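(* Let $\hat X$ be a formally smooth formal $V$-scheme such that $\Omega^1_{\hat X/\mathrm{Spf}(V)}$ has a basis $dx_1,\dots,dx_l$ with $x_1,\dots,x_l$ sections of $\mathcal{O}_{\hat X}$ (the local situation). A stratification $(E,\epsilon_n)\in\widehat{Str}(\hat X/\mathrm{Spf}(V))$ is special if and only if its radius of convergence $R((E,\epsilon_n),\hat X)$ is equal to $1$.
   Context: $V$ is a complete discrete valuation ring of mixed characteristic $(0,p)$ with fraction field $K$. A formal $V$-scheme is a $p$-adic Noetherian formal scheme topologically of finite type over $\mathrm{Spf}(V)$; one works locally on $\hat X$ (so $\hat X$ is affine), with trivial log structures. An isocoherent sheaf on $\hat X$ is a sheaf of $K\otimes_V\mathcal{O}_{\hat X}$-modules isomorphic to $K\otimes_V F$ with $F$ coherent. Let $\hat X^n$ be the $n$-th infinitesimal neighborhood of the diagonal of $\hat X\times_{\mathrm{Spf}(V)}\hat X$, with projections $p_{1,n},p_{2,n}:\hat X^n\to\hat X$; with $\xi_j=1\otimes x_j-x_j\otimes1$, $\mathcal{O}_{\hat X^n}$ is free over $\mathcal{O}_{\hat X}$ on the monomials $\boldsymbol\xi^{\boldsymbol\beta}$, $|\boldsymbol\beta|\le n$. An object of $\widehat{Str}(\hat X/\mathrm{Spf}(V))$ is an isocoherent sheaf $E$ on $\hat X$ with $\mathcal{O}_{\hat X^n}$-linear isomorphisms $\epsilon_n:p_{2,n}^*E\to p_{1,n}^*E$, compatible for varying $n$, with $\epsilon_0=\mathrm{id}$, satisfying the cocycle condition on the infinitesimal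 neighborhoods of the triple diagonal. **Special.** Let $\tilde E$ be a coherent $p$-torsion-free $\mathcal{O}_{\hat X}$-module with $K\otimes\tilde E=E$ (the notion does not depend on this choice). $(E,\epsilon_n)$ is special if there is a sequence of integers $k(n)$, $n\in\mathbb{N}$, such that (i) $k(n)=o(n)$ for $n\to\infty$; (ii) $p^{k(n)}\epsilon_n$ maps $p_{2,n}^*(\tilde E)$ into $p_{1,n}^*(\tilde E)$ and $p^{k(n)}\epsilon_n^{-1}$ maps $p_{1,n}^*(\tilde E)$ into $p_{2,n}^*(\tilde E)$. **Radius of convergence.** Taking the inverse limit of $E\to p_{2,n}^*E\xrightarrow{\epsilon_n}p_{1,n}^*E=\prod_{|\boldsymbol\beta|\le n}E\boldsymbol\xi^{\boldsymbol\beta}$ gives $\theta:E\to\prod_{\boldsymbol\beta}E\boldsymbol\xi^{\boldsymbol\beta}$. For $\eta<1$, a section $s\in\Gamma(\hat X,E)$ is $\eta$-convergent if $\theta(s)\in\Gamma(\hat X,E\otimes\mathcal{O}_{\hat X}\{\boldsymbol\xi/\eta\})$, i.e. writing $\theta(s)=\sum_{\boldsymbol\beta}s_{\boldsymbol\beta}\boldsymbol\xi^{\boldsymbol\beta}$ one has $\|s_{\boldsymbol\beta}\|\eta^{|\boldsymbol\beta|}\to0$ as $|\boldsymbol\beta|\to\infty$, where $\|\cdot\|$ is the $p$-adic Banach norm on $E$ with unit ball $\tilde E$. Put $R(s)=\sup\{\eta: s\text{ is }\eta\text{-convergent}\}$ and $R((E,\epsilon_n),\hat X)=\inf_{s\in\Gamma(\hat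 X,E)}R(s)$. *)

theory Defs
  imports
    "HOL-Algebra.Free_Abelian_Groups" "HOL-Algebra.Module" "HOL-Algebra.Ideal_Product"
    "HOL-Algebra.Ring_Divisibility" "HOL-Computational_Algebra.Primes"
    "HOL-Library.Landau_Symbols"
begin

section \<open>Modules\<close>

definition mod_hom ::
  "('r, 'x) ring_scheme \<Rightarrow> ('r, 'm, 'y) module_scheme \<Rightarrow> ('r, 'n, 'z) module_scheme \<Rightarrow> ('m \<Rightarrow> 'n) set"
where
  "mod_hom R M N = {f \<in> carrier M \<rightarrow> carrier N.
     (\<forall>x\<in>carrier M. \<forall>y\<in>carrier M. f (x \<oplus>\<^bsub>M\<^esub> y) = f x \<oplus>\<^bsub>N\<^esub> f y) \<and>
     (\<forall>r\<in>carrier R. \<forall>x\<in>carrier M. f (r \<odot>\<^bsub>M\<^esub> x) = r \<odot>\<^bsub>N\<^esub> f x)}"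

definition mod_iso ::
  "('r, 'x) ring_scheme \<Rightarrow> ('r, 'm, 'y) module_scheme \<Rightarrow> ('r, 'n, 'z) module_scheme \<Rightarrow> ('m \<Rightarrow> 'n) set"
where
  "mod_iso R M N = {f \<in> mod_hom R M N. bij_betw f (carrier M) (carrier N)}"

definition fin_gen_module :: "('r, 'x) ring_scheme \<Rightarrow> ('r, 'm, 'y) module_scheme \<Rightarrow> bool" where
  "fin_gen_module R M \<longleftrightarrow> module R M \<and>
     (\<exists>S. finite S \<and> S \<subseteq> carrier M \<and>
        (\<forall>e\<in>carrier M. \<exists>a\<in>S \<rightarrow> carrier R. e = (\<Oplus>\<^bsub>M\<^esub>s\<in>S. a s \<odot>\<^bsub>M\<^esub> s)))"

text \<open>Restriction of scalars along a ring homomorphism \<open>\<phi>\<close>.  The fields \<open>mult\<close> and \<open>one\<close> of a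
  module record play no role for modules.\<close>

definition restrict_scalars :: "('a \<Rightarrow> 'b) \<Rightarrow> ('b, 'm, 'y) module_scheme \<Rightarrow> ('a, 'm) module" where
  "restrict_scalars \<phi> M =
     \<lparr>carrier = carrier M, monoid.mult = monoid.mult M, one = one M,
      zero = zero M, add = add M,
      smult = (\<lambda>a m. \<phi> a \<odot>\<^bsub>M\<^esub> m)\<rparr>"

text \<open>The map on cosets \<open>x + I \<mapsto> f x + N\<close> induced by \<open>f\<close>, where \<open>f ` I \<subseteq> N\<close>.\<close>

definition coset_map :: "('s, 'y) ring_scheme \<Rightarrow> 's set \<Rightarrow> ('r \<Rightarrow> 's) \<Rightarrow> 'r set \<Rightarrow> 's set" where
  "coset_map S N f X = (\<Union>x\<in>X. N +>\<^bsub>S\<^esub> f x)"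

section \<open>Adic completion\<close>

primrec ideal_power :: "('r, 'x) ring_scheme \<Rightarrow> 'r set \<Rightarrow> nat \<Rightarrow> 'r set" where
  "ideal_power R I 0 = carrier R"
| "ideal_power R I (Suc n) = ideal_prod R I (ideal_power R I n)"

text \<open>The inverse limit of the rings \<open>R / I\<^sup>m\<close>.  A coset of \<open>I\<^sup>m\<^sup>+\<^sup>1\<close> is sent by the transition map
  to the coset of \<open>I\<^sup>m\<close> that contains it.\<close>

definition adic_completion :: "('r, 'x) ring_scheme \<Rightarrow> 'r set \<Rightarrow> (nat \<Rightarrow> 'r set) ring" where
  "adic_completion R I =
     \<lparr>carrier = {f. (\<forall>m. f m \<in> carrier (R Quot ideal_power R I m)) \<and> (\<forall>m. f (Suc m) \<subseteq> f m)},
      monoid.mult = (\<lambda>f g m. f m \<otimes>\<^bsub>R Quot ideal_power R I m\<^esub> g m),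
      one = (\<lambda>m. \<one>\<^bsub>R Quot ideal_power R I m\<^esub>),
      zero = (\<lambda>m. \<zero>\<^bsub>R Quot ideal_power R I m\<^esub>),
      add = (\<lambda>f g m. f m \<oplus>\<^bsub>R Quot ideal_power R I m\<^esub> g m)\<rparr>"

definition to_completion :: "('r, 'x) ring_scheme \<Rightarrow> 'r set \<Rightarrow> 'r \<Rightarrow> nat \<Rightarrow> 'r set" where
  "to_completion R I a = (\<lambda>m. ideal_power R I m +>\<^bsub>R\<^esub> a)"

definition completion_map ::
  "('s, 'y) ring_scheme \<Rightarrow> 's set \<Rightarrow> ('r \<Rightarrow> 's) \<Rightarrow> (nat \<Rightarrow> 'r set) \<Rightarrow> nat \<Rightarrow> 's set" where
  "completion_map S J f u = (\<lambda>m. coset_map S (ideal_power S J m) f (u m))"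

text \<open>Complete and separated.\<close>

definition adically_complete :: "('r, 'x) ring_scheme \<Rightarrow> 'r set \<Rightarrow> bool" where
  "adically_complete R I \<longleftrightarrow>
     bij_betw (to_completion R I) (carrier R) (carrier (adic_completion R I))"

definition p_elem :: "nat \<Rightarrow> ('r, 'x) ring_scheme \<Rightarrow> 'r" where
  "p_elem p R = [p] \<cdot>\<^bsub>R\<^esub> \<one>\<^bsub>R\<^esub>"

definition p_ideal :: "nat \<Rightarrow> ('r, 'x) ring_scheme \<Rightarrow> 'r set" where
  "p_ideal p R = PIdl\<^bsub>R\<^esub> (p_elem p R)"

definition p_completion :: "nat \<Rightarrow> ('r, 'x) ring_scheme \<Rightarrow> (nat \<Rightarrow> 'r set) ring" where
  "p_completion p R = adic_completion R (p_ideal p R)"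

section \<open>The base ring and its fraction field\<close>

definition max_ideal :: "('v, 'x) ring_scheme \<Rightarrow> 'v set" where
  "max_ideal V = (THE M. maximalideal M V)"

definition discrete_valuation_ring :: "('v, 'x) ring_scheme \<Rightarrow> bool" where
  "discrete_valuation_ring V \<longleftrightarrow>
     principal_domain V \<and> (\<exists>!M. maximalideal M V) \<and> \<not> field V"

definition complete_mixed_dvr :: "nat \<Rightarrow> ('v, 'x) ring_scheme \<Rightarrow> bool" where
  "complete_mixed_dvr p V \<longleftrightarrow>
     discrete_valuation_ring V \<and> adically_complete V (max_ideal V) \<and>
     Factorial_Ring.prime p \<and>
     (\<forall>n::nat. n > 0 \<longrightarrow> [n] \<cdot>\<^bsub>V\<^esub> \<one>\<^bsub>V\<^esub> \<noteq> \<zero>\<^bsub>V\<^esub>) \<and> p_elem p V \<in> max_ideal V"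

definition alg_map :: "('v, 'a, 'y) module_scheme \<Rightarrow> 'v \<Rightarrow> 'a" where
  "alg_map A v = v \<odot>\<^bsub>A\<^esub> \<one>\<^bsub>A\<^esub>"

definition fraction_field :: "('v, 'x) ring_scheme \<Rightarrow> ('v, 'k, 'y) module_scheme \<Rightarrow> bool" where
  "fraction_field V K \<longleftrightarrow>
     algebra V K \<and> field K \<and> inj_on (alg_map K) (carrier V) \<and>
     (\<forall>c\<in>carrier K. \<exists>a\<in>carrier V. \<exists>b\<in>carrier V - {\<zero>\<^bsub>V\<^esub>}.
        c = alg_map K a \<otimes>\<^bsub>K\<^esub> inv\<^bsub>K\<^esub> (alg_map K b))"

text \<open>The normalised discrete valuation of a nonzero element of the fraction field.\<close>

definition dvr_val :: "('v, 'x) ring_scheme \<Rightarrow> ('v, 'k, 'y) module_scheme \<Rightarrow> 'k \<Rightarrow> int" where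
  "dvr_val V K c = (THE k::int. \<exists>w\<in>carrier V. \<exists>u\<in>Units V.
     PIdl\<^bsub>V\<^esub> w = max_ideal V \<and> c = alg_map K u \<otimes>\<^bsub>K\<^esub> (alg_map K w [^]\<^bsub>K\<^esub> k))"

text \<open>The \<open>p\<close>-adic absolute value, normalised by \<open>\<bar>p\<bar> = 1/p\<close>.\<close>

definition p_abs :: "nat \<Rightarrow> ('v, 'x) ring_scheme \<Rightarrow> ('v, 'k, 'y) module_scheme \<Rightarrow> 'k \<Rightarrow> real" where
  "p_abs p V K c =
     (if c = \<zero>\<^bsub>K\<^esub> then 0
      else real p powr (- real_of_int (dvr_val V K c) / real_of_int (dvr_val V K (p_elem p K))))"

section \<open>Tensor products\<close>

text \<open>The ring \<open>\<int>[A \<times> B]\<close> on the multiplicative monoid \<open>A \<times> B\<close>.  Dividing it by the ideal generated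
  by the bilinearity relations gives the tensor product of two algebras; that ideal agrees with
  the subgroup generated by the relations.\<close>

definition pair_ring ::
  "('a, 'x) ring_scheme \<Rightarrow> ('b, 'y) ring_scheme \<Rightarrow> (('a \<times> 'b) \<Rightarrow>\<^sub>0 int) ring" where
  "pair_ring A B =
     \<lparr>carrier = {f. Poly_Mapping.keys f \<subseteq> carrier A \<times> carrier B},
      monoid.mult = (\<lambda>f g. frag_extend (\<lambda>(a, b). frag_extend (\<lambda>(c, d). frag_of (a \<otimes>\<^bsub>A\<^esub> c, b \<otimes>\<^bsub>B\<^esub> d)) g) f),
      one = frag_of (\<one>\<^bsub>A\<^esub>, \<one>\<^bsub>B\<^esub>), zero = 0, add = (+)\<rparr>"

definition tensor_ideal ::
  "('v, 'x) ring_scheme \<Rightarrow> ('v, 'a, 'y) module_scheme \<Rightarrow> ('v, 'b, 'z) module_scheme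
     \<Rightarrow> (('a \<times> 'b) \<Rightarrow>\<^sub>0 int) set" where
  "tensor_ideal V A B = Idl\<^bsub>pair_ring A B\<^esub>
     ({frag_of (a \<oplus>\<^bsub>A\<^esub> a', b) - frag_of (a, b) - frag_of (a', b) | a a' b.
         a \<in> carrier A \<and> a' \<in> carrier A \<and> b \<in> carrier B} \<union>
      {frag_of (a, b \<oplus>\<^bsub>B\<^esub> b') - frag_of (a, b) - frag_of (a, b') | a b b'.
         a \<in> carrier A \<and> b \<in> carrier B \<and> b' \<in> carrier B} \<union>
      {frag_of (v \<odot>\<^bsub>A\<^esub> a, b) - frag_of (a, v \<odot>\<^bsub>B\<^esub> b) | v a b.
         v \<in> carrier V \<and> a \<in> carrier A \<and> b \<in> carrier B})"

definition tens ::
  "('v, 'x) ring_scheme \<Rightarrow> ('v, 'a, 'y) module_scheme \<Rightarrow> ('v, 'b, 'z) module_scheme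
     \<Rightarrow> 'a \<Rightarrow> 'b \<Rightarrow> (('a \<times> 'b) \<Rightarrow>\<^sub>0 int) set" where
  "tens V A B a b = tensor_ideal V A B +>\<^bsub>pair_ring A B\<^esub> frag_of (a, b)"

definition tensor_algebra ::
  "('v, 'x) ring_scheme \<Rightarrow> ('v, 'a, 'y) module_scheme \<Rightarrow> ('v, 'b, 'z) module_scheme
     \<Rightarrow> ('v, (('a \<times> 'b) \<Rightarrow>\<^sub>0 int) set) module" where
  "tensor_algebra V A B = (let Q = pair_ring A B Quot tensor_ideal V A B in
     \<lparr>carrier = carrier Q, monoid.mult = monoid.mult Q, one = one Q, zero = zero Q,
      add = add Q,
      smult = (\<lambda>v X. tens V A B (v \<odot>\<^bsub>A\<^esub> \<one>\<^bsub>A\<^esub>) \<one>\<^bsub>B\<^esub> \<otimes>\<^bsub>Q\<^esub> X)\<rparr>)"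

definition frag_eval :: "('m, 'y) ring_scheme \<Rightarrow> ('s \<Rightarrow> 'm) \<Rightarrow> ('s \<Rightarrow>\<^sub>0 int) \<Rightarrow> 'm" where
  "frag_eval M h x = (\<Oplus>\<^bsub>M\<^esub>s\<in>Poly_Mapping.keys x. [Poly_Mapping.lookup x s] \<cdot>\<^bsub>M\<^esub> h s)"

text \<open>The ring homomorphism \<open>a \<otimes> b \<mapsto> f a * g b\<close>.  The evaluation is constant on each coset.\<close>

definition tensor_lift ::
  "('c, 'y) ring_scheme \<Rightarrow> ('a \<Rightarrow> 'c) \<Rightarrow> ('b \<Rightarrow> 'c) \<Rightarrow> (('a \<times> 'b) \<Rightarrow>\<^sub>0 int) set \<Rightarrow> 'c" where
  "tensor_lift C f g X = the_elem (frag_eval C (\<lambda>(a, b). f a \<otimes>\<^bsub>C\<^esub> g b) ` X)"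

text \<open>The \<open>B\<close>-module \<open>B \<otimes>\<^sub>A M\<close>, where \<open>B\<close> is an \<open>A\<close>-module through \<open>\<phi>\<close>.\<close>

definition bc_subgroup ::
  "('a, 'x) ring_scheme \<Rightarrow> ('b, 'y) ring_scheme \<Rightarrow> ('a \<Rightarrow> 'b) \<Rightarrow> ('a, 'm, 'z) module_scheme
     \<Rightarrow> (('b \<times> 'm) \<Rightarrow>\<^sub>0 int) set" where
  "bc_subgroup A B \<phi> M = generate (free_Abelian_group (carrier B \<times> carrier M))
     ({frag_of (b \<oplus>\<^bsub>B\<^esub> b', m) - frag_of (b, m) - frag_of (b', m) | b b' m.
         b \<in> carrier B \<and> b' \<in> carrier B \<and> m \<in> carrier M} \<union>
      {frag_of (b, m \<oplus>\<^bsub>M\<^esub> m') - frag_of (b, m) - frag_of (b, m') | b m m'.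
         b \<in> carrier B \<and> m \<in> carrier M \<and> m' \<in> carrier M} \<union>
      {frag_of (b \<otimes>\<^bsub>B\<^esub> \<phi> a, m) - frag_of (b, a \<odot>\<^bsub>M\<^esub> m) | b a m.
         b \<in> carrier B \<and> a \<in> carrier A \<and> m \<in> carrier M})"

definition bc_coset ::
  "('a, 'x) ring_scheme \<Rightarrow> ('b, 'y) ring_scheme \<Rightarrow> ('a \<Rightarrow> 'b) \<Rightarrow> ('a, 'm, 'z) module_scheme
     \<Rightarrow> (('b \<times> 'm) \<Rightarrow>\<^sub>0 int) \<Rightarrow> (('b \<times> 'm) \<Rightarrow>\<^sub>0 int) set" where
  "bc_coset A B \<phi> M x =
     bc_subgroup A B \<phi> M #>\<^bsub>free_Abelian_group (carrier B \<times> carrier M)\<^esub> x"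

definition bc_pure ::
  "('a, 'x) ring_scheme \<Rightarrow> ('b, 'y) ring_scheme \<Rightarrow> ('a \<Rightarrow> 'b) \<Rightarrow> ('a, 'm, 'z) module_scheme
     \<Rightarrow> 'b \<Rightarrow> 'm \<Rightarrow> (('b \<times> 'm) \<Rightarrow>\<^sub>0 int) set" where
  "bc_pure A B \<phi> M b m = bc_coset A B \<phi> M (frag_of (b, m))"

definition base_change ::
  "('a, 'x) ring_scheme \<Rightarrow> ('b, 'y) ring_scheme \<Rightarrow> ('a \<Rightarrow> 'b) \<Rightarrow> ('a, 'm, 'z) module_scheme
     \<Rightarrow> ('b, (('b \<times> 'm) \<Rightarrow>\<^sub>0 int) set) module" where
  "base_change A B \<phi> M =
     (let Q = free_Abelian_group (carrier B \<times> carrier M) Mod bc_subgroup A B \<phi> M in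
      \<lparr>carrier = carrier Q, monoid.mult = undefined, one = undefined,
       zero = one Q, add = monoid.mult Q,
       smult = (\<lambda>b X. \<Union>x\<in>X. bc_coset A B \<phi> M
                  (frag_extend (\<lambda>(c, m). frag_of (b \<otimes>\<^bsub>B\<^esub> c, m)) x))\<rparr>)"

text \<open>The map \<open>b \<otimes> m \<mapsto> h b \<otimes> f m\<close> into the base change described by the first four arguments.\<close>

definition bc_map ::
  "('a, 'x) ring_scheme \<Rightarrow> ('b, 'y) ring_scheme \<Rightarrow> ('a \<Rightarrow> 'b) \<Rightarrow> ('a, 'm, 'z) module_scheme
     \<Rightarrow> ('c \<Rightarrow> 'b) \<Rightarrow> ('n \<Rightarrow> 'm) \<Rightarrow> (('c \<times> 'n) \<Rightarrow>\<^sub>0 int) set \<Rightarrow> (('b \<times> 'm) \<Rightarrow>\<^sub>0 int) set" where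
  "bc_map A B \<phi> M h f X =
     (\<Union>x\<in>X. bc_coset A B \<phi> M (frag_extend (\<lambda>(c, n). frag_of (h c, f n)) x))"

text \<open>The map \<open>b \<otimes> m \<mapsto> b m\<close> into a \<open>B\<close>-module \<open>N\<close>, for elements \<open>m\<close> of \<open>N\<close>.\<close>

definition bc_counit :: "('b, 'n, 'z) module_scheme \<Rightarrow> (('b \<times> 'n) \<Rightarrow>\<^sub>0 int) set \<Rightarrow> 'n" where
  "bc_counit N X = the_elem (frag_eval N (\<lambda>(b, m). b \<odot>\<^bsub>N\<^esub> m) ` X)"

section \<open>Affine formal schemes\<close>

definition multi_indices :: "nat \<Rightarrow> (nat \<Rightarrow> nat) set" where
  "multi_indices l = {\<beta>. \<forall>i\<ge>l. \<beta> i = 0}"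

definition mdeg :: "nat \<Rightarrow> (nat \<Rightarrow> nat) \<Rightarrow> nat" where
  "mdeg l \<beta> = (\<Sum>i<l. \<beta> i)"

definition mpow :: "('a, 'y) ring_scheme \<Rightarrow> nat \<Rightarrow> (nat \<Rightarrow> 'a) \<Rightarrow> (nat \<Rightarrow> nat) \<Rightarrow> 'a" where
  "mpow A l t \<beta> = (\<Otimes>\<^bsub>A\<^esub>i\<in>{..<l}. t i [^]\<^bsub>A\<^esub> \<beta> i)"

text \<open>Surjectivity of the evaluation \<open>V{T\<^sub>1, \<dots>, T\<^sub>r} \<rightarrow> A\<close>, \<open>T\<^sub>i \<mapsto> t\<^sub>i\<close>, from some ring of restricted
  power series (with coefficients tending to \<open>0\<close>); the value of a series is its \<open>p\<close>-adic limit.\<close>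

definition topologically_finite_type ::
  "nat \<Rightarrow> ('v, 'x) ring_scheme \<Rightarrow> ('v, 'a, 'y) module_scheme \<Rightarrow> bool" where
  "topologically_finite_type p V A \<longleftrightarrow>
     (\<exists>r. \<exists>t\<in>{..<r} \<rightarrow> carrier A. \<forall>a\<in>carrier A. \<exists>c\<in>multi_indices r \<rightarrow> carrier V.
        \<forall>m. (let N = {\<alpha>\<in>multi_indices r. c \<alpha> \<notin> ideal_power V (p_ideal p V) m} in
          finite N \<and>
          a \<ominus>\<^bsub>A\<^esub> (\<Oplus>\<^bsub>A\<^esub>\<alpha>\<in>N. c \<alpha> \<odot>\<^bsub>A\<^esub> mpow A r t \<alpha>) \<in> ideal_power A (p_ideal p A) m))"

text \<open>The affine formal \<open>V\<close>-scheme \<open>Spf A\<close> is represented by its ring \<open>A\<close> of global sections.\<close>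

definition affine_formal_scheme ::
  "nat \<Rightarrow> ('v, 'x) ring_scheme \<Rightarrow> ('v, 'a, 'y) module_scheme \<Rightarrow> bool" where
  "affine_formal_scheme p V A \<longleftrightarrow>
     algebra V A \<and> noetherian_ring A \<and> adically_complete A (p_ideal p A) \<and>
     topologically_finite_type p V A"

text \<open>The infinitesimal lifting property for \<open>Spf A \<rightarrow> Spf V\<close>: a discrete test ring \<open>C\<close> over \<open>V\<close> is one
  in which \<open>p\<close> is nilpotent, and continuity of homomorphisms into it is then automatic.
  A definition cannot quantify over all types, so the test rings live on one fixed type.  This
  loses nothing: a lifting problem \<open>g : A \<rightarrow> C / J\<close> with \<open>p\<^sup>m = 0\<close> in \<open>C\<close> can be replaced by the
  nilpotent extension of \<open>A / p\<^sup>m\<close> generated over \<open>V\<close> by a set of preimages in the fibre product of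
  \<open>C\<close> and \<open>A / p\<^sup>m\<close> over \<open>C / J\<close>, and its cardinality is at most that of \<open>A\<close> or \<open>\<nat>\<close>.\<close>

definition formally_smooth ::
  "nat \<Rightarrow> ('v, 'x) ring_scheme \<Rightarrow> ('v, 'a, 'y) module_scheme \<Rightarrow> bool" where
  "formally_smooth p V A \<longleftrightarrow>
     (\<forall>(C :: ('v, ((nat \<Rightarrow> nat) \<Rightarrow> 'a) set) module) J g.
        algebra V C \<and> (\<exists>m::nat. p_elem p C [^]\<^bsub>C\<^esub> m = \<zero>\<^bsub>C\<^esub>) \<and>
        ideal J C \<and> (\<exists>k. ideal_power C J k = {\<zero>\<^bsub>C\<^esub>}) \<and>
        g \<in> ring_hom A (C Quot J) \<and>
        (\<forall>v\<in>carrier V. g (alg_map A v) = J +>\<^bsub>C\<^esub> alg_map C v)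
        \<longrightarrow> (\<exists>h\<in>ring_hom A C.
              (\<forall>v\<in>carrier V. h (alg_map A v) = alg_map C v) \<and>
              (\<forall>a\<in>carrier A. J +>\<^bsub>C\<^esub> h a = g a)))"

section \<open>Infinitesimal neighbourhoods of the diagonal\<close>

text \<open>Here \<open>T\<close> is \<open>A \<otimes> A\<close> or \<open>A \<otimes> A \<otimes> A\<close> and \<open>\<mu> : T \<rightarrow> A\<close> is multiplication.  The diagonal ideal is
  the kernel of the map from the \<open>p\<close>-adic completion of \<open>T\<close> to that of \<open>A\<close>, which is \<open>A\<close> itself.\<close>

definition diag_ideal ::
  "nat \<Rightarrow> ('t, 'x) ring_scheme \<Rightarrow> ('a, 'y) ring_scheme \<Rightarrow> ('t \<Rightarrow> 'a) \<Rightarrow> (nat \<Rightarrow> 't set) set" where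
  "diag_ideal p T A \<mu> =
     a_kernel (p_completion p T) (p_completion p A) (completion_map A (p_ideal p A) \<mu>)"

definition diag_power ::
  "nat \<Rightarrow> ('t, 'x) ring_scheme \<Rightarrow> ('a, 'y) ring_scheme \<Rightarrow> ('t \<Rightarrow> 'a) \<Rightarrow> nat \<Rightarrow> (nat \<Rightarrow> 't set) set" where
  "diag_power p T A \<mu> n = ideal_power (p_completion p T) (diag_ideal p T A \<mu>) n"

definition inf_nbhd ::
  "nat \<Rightarrow> ('t, 'x) ring_scheme \<Rightarrow> ('a, 'y) ring_scheme \<Rightarrow> ('t \<Rightarrow> 'a) \<Rightarrow> nat
     \<Rightarrow> (nat \<Rightarrow> 't set) set ring" where
  "inf_nbhd p T A \<mu> n = p_completion p T Quot diag_power p T A \<mu> (Suc n)"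

definition nbhd_class ::
  "nat \<Rightarrow> ('t, 'x) ring_scheme \<Rightarrow> ('a, 'y) ring_scheme \<Rightarrow> ('t \<Rightarrow> 'a) \<Rightarrow> nat \<Rightarrow> 't
     \<Rightarrow> (nat \<Rightarrow> 't set) set" where
  "nbhd_class p T A \<mu> n t =
     diag_power p T A \<mu> (Suc n) +>\<^bsub>p_completion p T\<^esub> to_completion T (p_ideal p T) t"

type_synonym 'a dbl = "(('a \<times> 'a) \<Rightarrow>\<^sub>0 int) set"
type_synonym 'a tpl = "(('a dbl \<times> 'a) \<Rightarrow>\<^sub>0 int) set"
type_synonym 'a nbhd2 = "(nat \<Rightarrow> 'a dbl set) set"
type_synonym 'a nbhd3 = "(nat \<Rightarrow> 'a tpl set) set"
type_synonym ('a, 'e) pull2 = "(('a nbhd2 \<times> 'e) \<Rightarrow>\<^sub>0 int) set"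
type_synonym ('a, 'e) pull3 = "(('a nbhd3 \<times> 'e) \<Rightarrow>\<^sub>0 int) set"

definition A2 :: "('v, 'x) ring_scheme \<Rightarrow> ('v, 'a) module \<Rightarrow> ('v, 'a dbl) module" where
  "A2 V A = tensor_algebra V A A"

definition A3 :: "('v, 'x) ring_scheme \<Rightarrow> ('v, 'a) module \<Rightarrow> ('v, 'a tpl) module" where
  "A3 V A = tensor_algebra V (A2 V A) A"

definition mu2 :: "('v, 'a) module \<Rightarrow> 'a dbl \<Rightarrow> 'a" where
  "mu2 A = tensor_lift A id id"

definition mu3 :: "('v, 'a) module \<Rightarrow> 'a tpl \<Rightarrow> 'a" where
  "mu3 A = tensor_lift A (mu2 A) id"

text \<open>With \<open>X = Spf A\<close>: the rings of \<open>X\<^sup>n\<close> and of the neighbourhood of the triple diagonal, with the homomorphisms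
  of the projections: \<open>pr1\<close>, \<open>pr2\<close> to \<open>X\<close>; \<open>tr1\<close>, \<open>tr2\<close>, \<open>tr3\<close> to \<open>X\<close>; \<open>q12\<close>, \<open>q23\<close>, \<open>q13\<close> to \<open>X\<^sup>n\<close>.\<close>

definition nb2 :: "nat \<Rightarrow> ('v, 'x) ring_scheme \<Rightarrow> ('v, 'a) module \<Rightarrow> nat \<Rightarrow> 'a nbhd2 ring" where
  "nb2 p V A n = inf_nbhd p (A2 V A) A (mu2 A) n"

definition nb3 :: "nat \<Rightarrow> ('v, 'x) ring_scheme \<Rightarrow> ('v, 'a) module \<Rightarrow> nat \<Rightarrow> 'a nbhd3 ring" where
  "nb3 p V A n = inf_nbhd p (A3 V A) A (mu3 A) n"

definition pr1 :: "nat \<Rightarrow> ('v, 'x) ring_scheme \<Rightarrow> ('v, 'a) module \<Rightarrow> nat \<Rightarrow> 'a \<Rightarrow> 'a nbhd2" where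
  "pr1 p V A n a = nbhd_class p (A2 V A) A (mu2 A) n (tens V A A a \<one>\<^bsub>A\<^esub>)"

definition pr2 :: "nat \<Rightarrow> ('v, 'x) ring_scheme \<Rightarrow> ('v, 'a) module \<Rightarrow> nat \<Rightarrow> 'a \<Rightarrow> 'a nbhd2" where
  "pr2 p V A n a = nbhd_class p (A2 V A) A (mu2 A) n (tens V A A \<one>\<^bsub>A\<^esub> a)"

definition tens3 :: "('v, 'x) ring_scheme \<Rightarrow> ('v, 'a) module \<Rightarrow> 'a \<Rightarrow> 'a \<Rightarrow> 'a \<Rightarrow> 'a tpl" where
  "tens3 V A a b c = tens V (A2 V A) A (tens V A A a b) c"

definition tr1 :: "nat \<Rightarrow> ('v, 'x) ring_scheme \<Rightarrow> ('v, 'a) module \<Rightarrow> nat \<Rightarrow> 'a \<Rightarrow> 'a nbhd3" where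
  "tr1 p V A n a = nbhd_class p (A3 V A) A (mu3 A) n (tens3 V A a \<one>\<^bsub>A\<^esub> \<one>\<^bsub>A\<^esub>)"

definition tr2 :: "nat \<Rightarrow> ('v, 'x) ring_scheme \<Rightarrow> ('v, 'a) module \<Rightarrow> nat \<Rightarrow> 'a \<Rightarrow> 'a nbhd3" where
  "tr2 p V A n a = nbhd_class p (A3 V A) A (mu3 A) n (tens3 V A \<one>\<^bsub>A\<^esub> a \<one>\<^bsub>A\<^esub>)"

definition tr3 :: "nat \<Rightarrow> ('v, 'x) ring_scheme \<Rightarrow> ('v, 'a) module \<Rightarrow> nat \<Rightarrow> 'a \<Rightarrow> 'a nbhd3" where
  "tr3 p V A n a = nbhd_class p (A3 V A) A (mu3 A) n (tens3 V A \<one>\<^bsub>A\<^esub> \<one>\<^bsub>A\<^esub> a)"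

definition nbhd_map ::
  "nat \<Rightarrow> ('v, 'x) ring_scheme \<Rightarrow> ('v, 'a) module \<Rightarrow> nat \<Rightarrow> ('a dbl \<Rightarrow> 'a tpl) \<Rightarrow> 'a nbhd2 \<Rightarrow> 'a nbhd3"
where
  "nbhd_map p V A n f =
     coset_map (p_completion p (A3 V A)) (diag_power p (A3 V A) A (mu3 A) (Suc n))
       (completion_map (A3 V A) (p_ideal p (A3 V A)) f)"

definition q12 :: "nat \<Rightarrow> ('v, 'x) ring_scheme \<Rightarrow> ('v, 'a) module \<Rightarrow> nat \<Rightarrow> 'a nbhd2 \<Rightarrow> 'a nbhd3" where
  "q12 p V A n = nbhd_map p V A n
     (tensor_lift (A3 V A) (\<lambda>a. tens3 V A a \<one>\<^bsub>A\<^esub> \<one>\<^bsub>A\<^esub>) (\<lambda>b. tens3 V A \<one>\<^bsub>A\<^esub> b \<one>\<^bsub>A\<^esub>))"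

definition q23 :: "nat \<Rightarrow> ('v, 'x) ring_scheme \<Rightarrow> ('v, 'a) module \<Rightarrow> nat \<Rightarrow> 'a nbhd2 \<Rightarrow> 'a nbhd3" where
  "q23 p V A n = nbhd_map p V A n
     (tensor_lift (A3 V A) (\<lambda>a. tens3 V A \<one>\<^bsub>A\<^esub> a \<one>\<^bsub>A\<^esub>) (\<lambda>b. tens3 V A \<one>\<^bsub>A\<^esub> \<one>\<^bsub>A\<^esub> b))"

definition q13 :: "nat \<Rightarrow> ('v, 'x) ring_scheme \<Rightarrow> ('v, 'a) module \<Rightarrow> nat \<Rightarrow> 'a nbhd2 \<Rightarrow> 'a nbhd3" where
  "q13 p V A n = nbhd_map p V A n
     (tensor_lift (A3 V A) (\<lambda>a. tens3 V A a \<one>\<^bsub>A\<^esub> \<one>\<^bsub>A\<^esub>) (\<lambda>b. tens3 V A \<one>\<^bsub>A\<^esub> \<one>\<^bsub>A\<^esub> b))"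

text \<open>The restriction from a larger neighbourhood to the \<open>n\<close>-th one.\<close>

definition nb_res :: "nat \<Rightarrow> ('v, 'x) ring_scheme \<Rightarrow> ('v, 'a) module \<Rightarrow> nat \<Rightarrow> 'a nbhd2 \<Rightarrow> 'a nbhd2" where
  "nb_res p V A n =
     coset_map (p_completion p (A2 V A)) (diag_power p (A2 V A) A (mu2 A) (Suc n)) id"

text \<open>The module of differentials \<open>\<Omega>\<^sup>1 = I / I\<^sup>2\<close>, where \<open>I\<close> is the diagonal ideal, as an ideal of
  the ring of \<open>X\<^sup>1\<close>, with \<open>d a = 1 \<otimes> a - a \<otimes> 1\<close>.\<close>

definition Omega :: "nat \<Rightarrow> ('v, 'x) ring_scheme \<Rightarrow> ('v, 'a) module \<Rightarrow> ('a, 'a nbhd2) module" where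
  "Omega p V A = (let N = nb2 p V A 1 in
     \<lparr>carrier = {diag_power p (A2 V A) A (mu2 A) 2 +>\<^bsub>p_completion p (A2 V A)\<^esub> t | t.
                   t \<in> diag_ideal p (A2 V A) A (mu2 A)},
      monoid.mult = monoid.mult N, one = one N, zero = zero N, add = add N,
      smult = (\<lambda>a w. pr1 p V A 1 a \<otimes>\<^bsub>N\<^esub> w)\<rparr>)"

definition xi :: "nat \<Rightarrow> ('v, 'x) ring_scheme \<Rightarrow> ('v, 'a) module \<Rightarrow> nat \<Rightarrow> 'a \<Rightarrow> 'a nbhd2" where
  "xi p V A n a = pr2 p V A n a \<ominus>\<^bsub>nb2 p V A n\<^esub> pr1 p V A n a"

abbreviation diff_form :: "nat \<Rightarrow> ('v, 'x) ring_scheme \<Rightarrow> ('v, 'a) module \<Rightarrow> 'a \<Rightarrow> 'a nbhd2" where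
  "diff_form p V A a \<equiv> xi p V A 1 a"

definition differential_basis ::
  "nat \<Rightarrow> ('v, 'x) ring_scheme \<Rightarrow> ('v, 'a) module \<Rightarrow> nat \<Rightarrow> (nat \<Rightarrow> 'a) \<Rightarrow> bool" where
  "differential_basis p V A l x \<longleftrightarrow>
     (\<forall>i<l. x i \<in> carrier A) \<and>
     (\<forall>w\<in>carrier (Omega p V A). \<exists>!a. a \<in> {..<l} \<rightarrow>\<^sub>E carrier A \<and>
        w = (\<Oplus>\<^bsub>Omega p V A\<^esub>i\<in>{..<l}. a i \<odot>\<^bsub>Omega p V A\<^esub> diff_form p V A (x i)))"

section \<open>Stratifications\<close>

type_synonym ('k, 'a) iso_ring = "(('k \<times> 'a) \<Rightarrow>\<^sub>0 int) set"

definition AK ::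
  "('v, 'x) ring_scheme \<Rightarrow> ('v, 'k) module \<Rightarrow> ('v, 'a) module \<Rightarrow> ('v, ('k, 'a) iso_ring) module" where
  "AK V K A = tensor_algebra V K A"

definition to_AK :: "('v, 'x) ring_scheme \<Rightarrow> ('v, 'k) module \<Rightarrow> ('v, 'a) module \<Rightarrow> 'a \<Rightarrow> ('k, 'a) iso_ring"
where
  "to_AK V K A a = tens V K A \<one>\<^bsub>K\<^esub> a"

text \<open>A coherent sheaf on \<open>Spf A\<close> is given by a finitely generated \<open>A\<close>-module \<open>F\<close>, and \<open>K \<otimes> F\<close> is
  \<open>(K \<otimes>\<^sub>V A) \<otimes>\<^sub>A F\<close>.  Every finitely generated \<open>A\<close>-module is a quotient of some \<open>A\<^sup>r\<close> and therefore
  lives, up to isomorphism, on the type used for \<open>F\<close>.\<close>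

definition isocoherent ::
  "('v, 'x) ring_scheme \<Rightarrow> ('v, 'k) module \<Rightarrow> ('v, 'a) module \<Rightarrow> (('k, 'a) iso_ring, 'e) module \<Rightarrow> bool"
where
  "isocoherent V K A E \<longleftrightarrow> module (AK V K A) E \<and>
     (\<exists>F :: ('a, (nat \<Rightarrow> 'a) set) module. fin_gen_module A F \<and>
        mod_iso (AK V K A) (base_change A (AK V K A) (to_AK V K A) F) E \<noteq> {})"

definition over_A ::
  "('v, 'x) ring_scheme \<Rightarrow> ('v, 'k) module \<Rightarrow> ('v, 'a) module \<Rightarrow> (('k, 'a) iso_ring, 'e) module
     \<Rightarrow> ('a, 'e) module" where
  "over_A V K A E = restrict_scalars (to_AK V K A) E"

text \<open>Multiplication by a scalar of \<open>K\<close>.\<close>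

definition K_scale ::
  "('v, 'x) ring_scheme \<Rightarrow> ('v, 'k) module \<Rightarrow> ('v, 'a) module \<Rightarrow> (('k, 'a) iso_ring, 'e) module
     \<Rightarrow> 'k \<Rightarrow> 'e \<Rightarrow> 'e" where
  "K_scale V K A E c e = tens V K A c \<one>\<^bsub>A\<^esub> \<odot>\<^bsub>E\<^esub> e"

text \<open>A coherent submodule \<open>L\<close> of \<open>E\<close> such that the canonical map \<open>K \<otimes> L \<rightarrow> E\<close> is bijective.  It is
  torsion-free because \<open>p\<close> is invertible on \<open>E\<close>; conversely a torsion-free module embeds in its
  tensor product with \<open>K\<close>.\<close>

definition lattice_mod ::
  "('v, 'x) ring_scheme \<Rightarrow> ('v, 'k) module \<Rightarrow> ('v, 'a) module \<Rightarrow> (('k, 'a) iso_ring, 'e) module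
     \<Rightarrow> 'e set \<Rightarrow> ('a, 'e) module" where
  "lattice_mod V K A E L = (over_A V K A E)\<lparr>carrier := L\<rparr>"

definition is_lattice ::
  "('v, 'x) ring_scheme \<Rightarrow> ('v, 'k) module \<Rightarrow> ('v, 'a) module \<Rightarrow> (('k, 'a) iso_ring, 'e) module
     \<Rightarrow> 'e set \<Rightarrow> bool" where
  "is_lattice V K A E L \<longleftrightarrow>
     submodule L A (over_A V K A E) \<and> fin_gen_module A (lattice_mod V K A E L) \<and>
     bij_betw (bc_counit E)
       (carrier (base_change A (AK V K A) (to_AK V K A) (lattice_mod V K A E L))) (carrier E)"

definition p1_pull ::
  "nat \<Rightarrow> ('v, 'x) ring_scheme \<Rightarrow> ('v, 'a) module \<Rightarrow> nat \<Rightarrow> ('a, 'e) module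
     \<Rightarrow> ('a nbhd2, ('a, 'e) pull2) module" where
  "p1_pull p V A n M = base_change A (nb2 p V A n) (pr1 p V A n) M"

definition p2_pull ::
  "nat \<Rightarrow> ('v, 'x) ring_scheme \<Rightarrow> ('v, 'a) module \<Rightarrow> nat \<Rightarrow> ('a, 'e) module
     \<Rightarrow> ('a nbhd2, ('a, 'e) pull2) module" where
  "p2_pull p V A n M = base_change A (nb2 p V A n) (pr2 p V A n) M"

definition p1_map ::
  "nat \<Rightarrow> ('v, 'x) ring_scheme \<Rightarrow> ('v, 'a) module \<Rightarrow> nat \<Rightarrow> ('a, 'e) module
     \<Rightarrow> ('a nbhd2 \<Rightarrow> 'a nbhd2) \<Rightarrow> ('e \<Rightarrow> 'e) \<Rightarrow> ('a, 'e) pull2 \<Rightarrow> ('a, 'e) pull2" where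
  "p1_map p V A n M = bc_map A (nb2 p V A n) (pr1 p V A n) M"

definition p2_map ::
  "nat \<Rightarrow> ('v, 'x) ring_scheme \<Rightarrow> ('v, 'a) module \<Rightarrow> nat \<Rightarrow> ('a, 'e) module
     \<Rightarrow> ('a nbhd2 \<Rightarrow> 'a nbhd2) \<Rightarrow> ('e \<Rightarrow> 'e) \<Rightarrow> ('a, 'e) pull2 \<Rightarrow> ('a, 'e) pull2" where
  "p2_map p V A n M = bc_map A (nb2 p V A n) (pr2 p V A n) M"

text \<open>\<open>g\<close> is the pullback along \<open>q\<close> of a homomorphism \<open>e\<close> from the second to the first pullback of
  \<open>M\<close>, where \<open>q\<close> carries \<open>pr1\<close> to \<open>r\<close> and \<open>pr2\<close> to \<open>r'\<close>: the unique linear map with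
  \<open>g (q\<^sup>* z) = q\<^sup>* (e z)\<close>.\<close>

definition is_pullback ::
  "nat \<Rightarrow> ('v, 'x) ring_scheme \<Rightarrow> ('v, 'a) module \<Rightarrow> nat \<Rightarrow> ('a, 'e) module
     \<Rightarrow> ('a nbhd2 \<Rightarrow> 'a nbhd3) \<Rightarrow> ('a \<Rightarrow> 'a nbhd3) \<Rightarrow> ('a \<Rightarrow> 'a nbhd3)
     \<Rightarrow> (('a, 'e) pull2 \<Rightarrow> ('a, 'e) pull2) \<Rightarrow> (('a, 'e) pull3 \<Rightarrow> ('a, 'e) pull3) \<Rightarrow> bool" where
  "is_pullback p V A n M q r r' e g \<longleftrightarrow>
     (let W = nb3 p V A n in
      g \<in> mod_hom W (base_change A W r' M) (base_change A W r M) \<and>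
      (\<forall>z\<in>carrier (p2_pull p V A n M).
         g (bc_map A W r' M q id z) = bc_map A W r M q id (e z)))"

definition stratification ::
  "nat \<Rightarrow> ('v, 'x) ring_scheme \<Rightarrow> ('v, 'k) module \<Rightarrow> ('v, 'a) module
     \<Rightarrow> (('k, 'a) iso_ring, 'e) module \<Rightarrow> (nat \<Rightarrow> ('a, 'e) pull2 \<Rightarrow> ('a, 'e) pull2) \<Rightarrow> bool" where
  "stratification p V K A E \<epsilon> \<longleftrightarrow>
     (let M = over_A V K A E in
      isocoherent V K A E \<and>
      (\<forall>n. \<epsilon> n \<in> mod_iso (nb2 p V A n) (p2_pull p V A n M) (p1_pull p V A n M)) \<and>
      (\<forall>n n'. n \<le> n' \<longrightarrow> (\<forall>z\<in>carrier (p2_pull p V A n' M).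
         \<epsilon> n (p2_map p V A n M (nb_res p V A n) id z) =
           p1_map p V A n M (nb_res p V A n) id (\<epsilon> n' z))) \<and>
      (\<forall>z\<in>carrier (p2_pull p V A 0 M). \<epsilon> 0 z = z) \<and>
      (\<forall>n. \<exists>g12 g23 g13.
         is_pullback p V A n M (q12 p V A n) (tr1 p V A n) (tr2 p V A n) (\<epsilon> n) g12 \<and>
         is_pullback p V A n M (q23 p V A n) (tr2 p V A n) (tr3 p V A n) (\<epsilon> n) g23 \<and>
         is_pullback p V A n M (q13 p V A n) (tr1 p V A n) (tr3 p V A n) (\<epsilon> n) g13 \<and>
         (\<forall>z\<in>carrier (base_change A (nb3 p V A n) (tr3 p V A n) M). g12 (g23 z) = g13 z)))"

section \<open>Special stratifications and the radius of convergence\<close>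

text \<open>The image of the pullback of the lattice \<open>L\<close> in the pullback of \<open>E\<close>.\<close>

definition p1_lattice ::
  "nat \<Rightarrow> ('v, 'x) ring_scheme \<Rightarrow> ('v, 'k) module \<Rightarrow> ('v, 'a) module
     \<Rightarrow> (('k, 'a) iso_ring, 'e) module \<Rightarrow> 'e set \<Rightarrow> nat \<Rightarrow> ('a, 'e) pull2 set" where
  "p1_lattice p V K A E L n =
     p1_map p V A n (over_A V K A E) id id ` carrier (p1_pull p V A n (lattice_mod V K A E L))"

definition p2_lattice ::
  "nat \<Rightarrow> ('v, 'x) ring_scheme \<Rightarrow> ('v, 'k) module \<Rightarrow> ('v, 'a) module
     \<Rightarrow> (('k, 'a) iso_ring, 'e) module \<Rightarrow> 'e set \<Rightarrow> nat \<Rightarrow> ('a, 'e) pull2 set" where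
  "p2_lattice p V K A E L n =
     p2_map p V A n (over_A V K A E) id id ` carrier (p2_pull p V A n (lattice_mod V K A E L))"

text \<open>The exponents \<open>k n\<close> may be negative; a scalar \<open>c\<close> of \<open>K\<close> acts on a pullback of \<open>E\<close> by
  \<open>b \<otimes> e \<mapsto> b \<otimes> c e\<close>.\<close>

definition special ::
  "nat \<Rightarrow> ('v, 'x) ring_scheme \<Rightarrow> ('v, 'k) module \<Rightarrow> ('v, 'a) module
     \<Rightarrow> (('k, 'a) iso_ring, 'e) module \<Rightarrow> 'e set
     \<Rightarrow> (nat \<Rightarrow> ('a, 'e) pull2 \<Rightarrow> ('a, 'e) pull2) \<Rightarrow> bool" where
  "special p V K A E L \<epsilon> \<longleftrightarrow>
     (let M = over_A V K A E in
      \<exists>k :: nat \<Rightarrow> int. (\<lambda>n. real_of_int (k n)) \<in> o(\<lambda>n. real n) \<and>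
        (\<forall>n. let pk = K_scale V K A E (p_elem p K [^]\<^bsub>K\<^esub> k n) in
           (\<forall>z\<in>p2_lattice p V K A E L n.
              p1_map p V A n M id pk (\<epsilon> n z) \<in> p1_lattice p V K A E L n) \<and>
           (\<forall>z\<in>p1_lattice p V K A E L n.
              p2_map p V A n M id pk (inv_into (carrier (p2_pull p V A n M)) (\<epsilon> n) z)
                \<in> p2_lattice p V K A E L n)))"

text \<open>The Banach norm over \<open>K\<close> with unit ball \<open>L\<close>.\<close>

definition lattice_norm ::
  "nat \<Rightarrow> ('v, 'x) ring_scheme \<Rightarrow> ('v, 'k) module \<Rightarrow> ('v, 'a) module
     \<Rightarrow> (('k, 'a) iso_ring, 'e) module \<Rightarrow> 'e set \<Rightarrow> 'e \<Rightarrow> real" where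
  "lattice_norm p V K A E L s =
     Inf {p_abs p V K c | c. c \<in> carrier K \<and> s \<in> K_scale V K A E c ` L}"

text \<open>\<open>c\<close> is the family of coefficients of \<open>\<theta> s\<close>: modulo the \<open>(n+1)\<close>-st power of the diagonal ideal,
  \<open>\<epsilon>\<^sub>n (1 \<otimes> s)\<close> is the sum of the \<open>\<xi>\<^sup>\<beta> \<otimes> c \<beta>\<close> with \<open>\<bar>\<beta>\<bar> \<le> n\<close>.\<close>

definition is_theta ::
  "nat \<Rightarrow> ('v, 'x) ring_scheme \<Rightarrow> ('v, 'k) module \<Rightarrow> ('v, 'a) module \<Rightarrow> nat \<Rightarrow> (nat \<Rightarrow> 'a)
     \<Rightarrow> (('k, 'a) iso_ring, 'e) module \<Rightarrow> (nat \<Rightarrow> ('a, 'e) pull2 \<Rightarrow> ('a, 'e) pull2)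
     \<Rightarrow> 'e \<Rightarrow> ((nat \<Rightarrow> nat) \<Rightarrow> 'e) \<Rightarrow> bool" where
  "is_theta p V K A l x E \<epsilon> s c \<longleftrightarrow>
     (let M = over_A V K A E in
      c \<in> multi_indices l \<rightarrow>\<^sub>E carrier E \<and>
      (\<forall>n. let N = nb2 p V A n in
         \<epsilon> n (bc_pure A N (pr2 p V A n) M \<one>\<^bsub>N\<^esub> s) =
           (\<Oplus>\<^bsub>p1_pull p V A n M\<^esub>\<beta>\<in>{\<beta>\<in>multi_indices l. mdeg l \<beta> \<le> n}.
              bc_pure A N (pr1 p V A n) M (mpow N l (\<lambda>j. xi p V A n (x j)) \<beta>) (c \<beta>))))"

definition theta ::
  "nat \<Rightarrow> ('v, 'x) ring_scheme \<Rightarrow> ('v, 'k) module \<Rightarrow> ('v, 'a) module \<Rightarrow> nat \<Rightarrow> (nat \<Rightarrow> 'a)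
     \<Rightarrow> (('k, 'a) iso_ring, 'e) module \<Rightarrow> (nat \<Rightarrow> ('a, 'e) pull2 \<Rightarrow> ('a, 'e) pull2)
     \<Rightarrow> 'e \<Rightarrow> (nat \<Rightarrow> nat) \<Rightarrow> 'e" where
  "theta p V K A l x E \<epsilon> s = (THE c. is_theta p V K A l x E \<epsilon> s c)"

definition eta_convergent ::
  "nat \<Rightarrow> ('v, 'x) ring_scheme \<Rightarrow> ('v, 'k) module \<Rightarrow> ('v, 'a) module \<Rightarrow> nat \<Rightarrow> (nat \<Rightarrow> 'a)
     \<Rightarrow> (('k, 'a) iso_ring, 'e) module \<Rightarrow> 'e set
     \<Rightarrow> (nat \<Rightarrow> ('a, 'e) pull2 \<Rightarrow> ('a, 'e) pull2) \<Rightarrow> real \<Rightarrow> 'e \<Rightarrow> bool" where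
  "eta_convergent p V K A l x E L \<epsilon> \<eta> s \<longleftrightarrow>
     (\<forall>\<delta>>0. \<exists>N. \<forall>\<beta>\<in>multi_indices l. mdeg l \<beta> \<ge> N \<longrightarrow>
        lattice_norm p V K A E L (theta p V K A l x E \<epsilon> s \<beta>) * \<eta> ^ mdeg l \<beta> < \<delta>)"

text \<open>The value \<open>\<eta> = 0\<close> is admitted so that the supremum is taken over a nonempty set.\<close>

definition section_radius ::
  "nat \<Rightarrow> ('v, 'x) ring_scheme \<Rightarrow> ('v, 'k) module \<Rightarrow> ('v, 'a) module \<Rightarrow> nat \<Rightarrow> (nat \<Rightarrow> 'a)
     \<Rightarrow> (('k, 'a) iso_ring, 'e) module \<Rightarrow> 'e set
     \<Rightarrow> (nat \<Rightarrow> ('a, 'e) pull2 \<Rightarrow> ('a, 'e) pull2) \<Rightarrow> 'e \<Rightarrow> real" where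
  "section_radius p V K A l x E L \<epsilon> s =
     Sup {\<eta>. 0 \<le> \<eta> \<and> \<eta> < 1 \<and> eta_convergent p V K A l x E L \<epsilon> \<eta> s}"

definition radius_of_convergence ::
  "nat \<Rightarrow> ('v, 'x) ring_scheme \<Rightarrow> ('v, 'k) module \<Rightarrow> ('v, 'a) module \<Rightarrow> nat \<Rightarrow> (nat \<Rightarrow> 'a)
     \<Rightarrow> (('k, 'a) iso_ring, 'e) module \<Rightarrow> 'e set
     \<Rightarrow> (nat \<Rightarrow> ('a, 'e) pull2 \<Rightarrow> ('a, 'e) pull2) \<Rightarrow> real" where
  "radius_of_convergence p V K A l x E L \<epsilon> =
     Inf (section_radius p V K A l x E L \<epsilon> ` carrier E)"

end

theory Submission
  imports Defs
begin

text \<open>The coefficients \<open>s\<^sub>\<beta>\<close> of \<open>\<theta> s\<close> are well defined because \<open>E\<close> is torsion-free: the derivations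
  \<open>\<partial>\<^sub>j\<close> dual to the \<open>dx\<^sub>j\<close> act on the right factor of \<open>A \<otimes> A\<close>, hence map the ring of \<open>X\<^sup>n\<^sup>+\<^sup>1\<close> to that
  of \<open>X\<^sup>n\<close>, and they lower \<open>\<xi>\<^sup>\<beta>\<close> at the cost of an integer factor only.  Pulling the cocycle condition
  back along \<open>(x, y) \<mapsto> (x, y, x)\<close> gives \<open>\<epsilon>\<^sub>n\<^sup>-\<^sup>1 (1 \<otimes> s) = \<Sum> (-\<xi>)\<^sup>\<beta> \<otimes> s\<^sub>\<beta>\<close>.  So \<open>p\<^sup>k\<close> times \<open>\<epsilon>\<^sub>n\<close> and its
  inverse preserve the pullbacks of the lattice \<open>L\<close> if and only if \<open>p\<^sup>k s\<^sub>\<beta> \<in> L\<close> for \<open>\<bar>\<beta>\<bar> \<le> n\<close> and \<open>s\<close> in a finite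
  set of generators of \<open>L\<close>.  If this holds with some \<open>k n = o(n)\<close>, then \<open>\<parallel>s\<^sub>\<beta>\<parallel> \<le> p\<^sup>c\<^sup>+\<^sup>k\<^sup>(\<^sup>|\<^sup>\<beta>\<^sup>|\<^sup>)\<close> for a constant
  \<open>c\<close>, which makes every section \<open>\<eta>\<close>-convergent for all \<open>\<eta> < 1\<close>.  Conversely, if the generators are
  \<open>p\<^sup>-\<^sup>d\<close>-convergent, then the least admissible \<open>k n\<close> is at most \<open>d n + O(1)\<close>, and \<open>d\<close> is arbitrary.\<close>

section \<open>Additive maps\<close>

text \<open>Existence and uniqueness of Taylor coefficients are kept apart. Existence holds over any
  A-module: the dx_j generate I/I^2 for the diagonal ideal I, hence monomials generate each I^k
  modulo I^(k+1), and I^(n+1) is zero on X^n. Uniqueness cancels the integers that differentiation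
  produces, so positive integers must act injectively. The lattice criterion combines both: an
  element of the pulled-back lattice expands with coefficients in L, and uniqueness in E identifies
  this expansion with the given one. The derivations have to live on a quotient of a p-adic
  completion. They extend to it because every additive map respects divisibility by powers of p, and
  they act on the pullback of E along the first projection because they kill the left copy of A.
  Condition (ii) bounds both \<epsilon>_n and its inverse, whereas the radius only sees
  \<epsilon>_n. The expansion of the inverse has the same coefficients, which is why one k serves
  both directions.\<close>

lemma abelian_group_homI':
  assumes "abelian_group G" "abelian_group H" "\<And>x. x \<in> carrier G \<Longrightarrow> f x \<in> carrier H"
    "\<And>x y. x \<in> carrier G \<Longrightarrow> y \<in> carrier G \<Longrightarrow> f (x \<oplus>\<^bsub>G\<^esub> y) = f x \<oplus>\<^bsub>H\<^esub> f y"
  shows "abelian_group_hom G H f"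
proof -
  interpret G: abelian_group G by fact
  interpret H: abelian_group H by fact
  show ?thesis
    by (rule abelian_group_homI)
       (use assms in \<open>auto intro!: group_hom.intro group_hom_axioms.intro homI G.a_group H.a_group\<close>)
qed

lemma ring_hom_additive:
  assumes "ring R" "ring S" "f \<in> ring_hom R S"
  shows "abelian_group_hom R S f"
  using assms by (intro abelian_group_homI') (auto simp: ring_hom_def ring.is_abelian_group)

lemma abelian_group_hom_comp:
  assumes "abelian_group_hom R S f" "abelian_group_hom S T g"
  shows "abelian_group_hom R T (\<lambda>x. g (f x))"
proof -
  interpret f: abelian_group_hom R S f by fact
  interpret g: abelian_group_hom S T g by fact
  show ?thesis
    by (rule abelian_group_homI') (use f.G.abelian_group_axioms g.H.abelian_group_axioms in auto)
qed

context abelian_group_hom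
begin

lemma hom_diff:
  assumes "x \<in> carrier G" "y \<in> carrier G"
  shows "h (x \<ominus>\<^bsub>G\<^esub> y) = h x \<ominus>\<^bsub>H\<^esub> h y"
  using assms by (simp add: a_minus_def)

lemma hom_finsum:
  assumes "f \<in> I \<rightarrow> carrier G"
  shows "h (\<Oplus>\<^bsub>G\<^esub>i\<in>I. f i) = (\<Oplus>\<^bsub>H\<^esub>i\<in>I. h (f i))"
  using assms
proof (induction I rule: infinite_finite_induct)
  case (insert i I)
  have "h (f i) \<in> carrier H" "(\<lambda>i. h (f i)) \<in> I \<rightarrow> carrier H"
    using insert.prems hom_closed by (auto simp: Pi_iff)
  then show ?case using insert by (simp add: Pi_iff)
qed auto

lemma hom_add_pow: "x \<in> carrier G \<Longrightarrow> h (add_pow G n x) = add_pow H (n::nat) (h x)"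
  by (induction n) (auto simp: G.add.nat_pow_Suc H.add.nat_pow_Suc)

end

subsection \<open>Evaluation on free abelian groups\<close>

context abelian_group
begin

lemma add_pow_int_0 [simp]: "add_pow G (0::int) y = \<zero>"
  by (simp add: add_pow_def)

text \<open>Evaluations of different elements run over different supports; over a common finite
  index set they can be added term by term.\<close>

lemma frag_eval_superset:
  assumes "finite I" "Poly_Mapping.keys x \<subseteq> I" "h \<in> I \<rightarrow> carrier G"
  shows "frag_eval G h x = (\<Oplus>s\<in>I. add_pow G (Poly_Mapping.lookup x s) (h s))"
  unfolding frag_eval_def
  by (rule add.finprod_mono_neutral_cong_left)
     (use assms in \<open>auto simp: Poly_Mapping.in_keys_iff Pi_iff intro!: add.int_pow_closed\<close>)

lemma frag_eval_closed:
  assumes "Poly_Mapping.keys x \<subseteq> S" "h \<in> S \<rightarrow> carrier G"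
  shows "frag_eval G h x \<in> carrier G"
  unfolding frag_eval_def using assms by (intro finsum_closed) (auto simp: Pi_iff subset_iff)

lemma frag_eval_add:
  assumes "Poly_Mapping.keys x \<subseteq> S" "Poly_Mapping.keys y \<subseteq> S" "h \<in> S \<rightarrow> carrier G"
  shows "frag_eval G h (x + y) = frag_eval G h x \<oplus> frag_eval G h y"
proof -
  define I where "I = Poly_Mapping.keys x \<union> Poly_Mapping.keys y"
  have I: "finite I" "Poly_Mapping.keys x \<subseteq> I" "Poly_Mapping.keys y \<subseteq> I"
    "Poly_Mapping.keys (x + y) \<subseteq> I"
    using Poly_Mapping.keys_add[of x y] by (auto simp: I_def)
  have h: "h \<in> I \<rightarrow> carrier G" using assms by (auto simp: I_def)
  have "frag_eval G h (x + y) = (\<Oplus>s\<in>I. add_pow G (Poly_Mapping.lookup x s) (h s) \<oplus> add_pow G (Poly_Mapping.lookup y s) (h s))"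
    unfolding frag_eval_superset[OF I(1,4) h]
    by (rule add.finprod_cong') (use h in \<open>auto simp: lookup_add Pi_iff add.int_pow_mult\<close>)
  also have "\<dots> = frag_eval G h x \<oplus> frag_eval G h y"
    unfolding frag_eval_superset[OF I(1,2) h] frag_eval_superset[OF I(1,3) h]
    by (rule finsum_addf) (use h in auto)
  finally show ?thesis .
qed

lemma frag_eval_zero [simp]: "frag_eval G h 0 = \<zero>"
  by (simp add: frag_eval_def)

lemma frag_eval_of:
  assumes "h s \<in> carrier G"
  shows "frag_eval G h (frag_of s) = h s"
  using assms by (subst frag_eval_superset[of "{s}"]) (auto simp: keys_frag_of)

lemma frag_eval_diff:
  assumes "Poly_Mapping.keys x \<subseteq> S" "Poly_Mapping.keys y \<subseteq> S" "h \<in> S \<rightarrow> carrier G"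
  shows "frag_eval G h (x - y) = frag_eval G h x \<ominus> frag_eval G h y"
proof -
  have k: "Poly_Mapping.keys (x - y) \<subseteq> S"
    using keys_diff[of x y] assms by auto
  have "frag_eval G h (x - y + y) = frag_eval G h (x - y) \<oplus> frag_eval G h y"
    by (rule frag_eval_add[OF k assms(2,3)])
  then show ?thesis
    using frag_eval_closed[OF k assms(3)] frag_eval_closed[OF assms(1,3)] frag_eval_closed[OF assms(2,3)]
    by (simp add: a_minus_def add.inv_solve_right)
qed

end

section \<open>Tensor products of algebras\<close>

locale ring_pair = A: cring A + B: cring B for A :: "('a, 'x) ring_scheme" and B :: "('b, 'y) ring_scheme"
begin

abbreviation "P \<equiv> pair_ring A B"
abbreviation "S \<equiv> carrier A \<times> carrier B"

lemma carrier_P: "x \<in> carrier P \<longleftrightarrow> Poly_Mapping.keys x \<subseteq> S"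
  by (simp add: pair_ring_def)

lemma frag_of_P [simp]: "frag_of (a, b) \<in> carrier P \<longleftrightarrow> a \<in> carrier A \<and> b \<in> carrier B"
  by (simp add: carrier_P keys_frag_of)

lemma ops_P [simp]: "x \<oplus>\<^bsub>P\<^esub> y = x + y" "\<zero>\<^bsub>P\<^esub> = 0" "\<one>\<^bsub>P\<^esub> = frag_of (\<one>\<^bsub>A\<^esub>, \<one>\<^bsub>B\<^esub>)"
  by (simp_all add: pair_ring_def)

lemma mult_of: "frag_of (a, b) \<otimes>\<^bsub>P\<^esub> frag_of (c, d) = frag_of (a \<otimes>\<^bsub>A\<^esub> c, b \<otimes>\<^bsub>B\<^esub> d)"
  by (simp add: pair_ring_def)

lemma mult_l: "(x + y) \<otimes>\<^bsub>P\<^esub> z = x \<otimes>\<^bsub>P\<^esub> z + y \<otimes>\<^bsub>P\<^esub> z" "(x - y) \<otimes>\<^bsub>P\<^esub> z = x \<otimes>\<^bsub>P\<^esub> z - y \<otimes>\<^bsub>P\<^esub> z"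
  "0 \<otimes>\<^bsub>P\<^esub> z = 0"
  by (simp_all add: pair_ring_def frag_extend_add frag_extend_diff)

text \<open>Multiplication in \<open>pair_ring\<close> is a \<open>frag_extend\<close> whose
  function argument is itself a \<open>frag_extend\<close> of the right factor, so additivity on the
  right is additivity of \<open>frag_extend\<close> in the function.\<close>

lemma frag_extend_fun_add:
  fixes f g :: "'d \<Rightarrow> 'c \<Rightarrow>\<^sub>0 int"
  shows "frag_extend (\<lambda>i. f i + g i) x = frag_extend f x + frag_extend g x"
  "frag_extend (\<lambda>i. f i - g i) x = frag_extend f x - frag_extend g x"
proof -
  have "frag_cmul c (a - b) = frag_cmul c a - frag_cmul c b" for c and a b :: "'c \<Rightarrow>\<^sub>0 int"
    by (rule poly_mapping_eqI) (simp add: lookup_minus right_diff_distrib)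
  then show "frag_extend (\<lambda>i. f i - g i) x = frag_extend f x - frag_extend g x"
    by (simp add: frag_extend_def sum_subtractf)
qed (simp add: frag_extend_def frag_cmul_distrib2 sum.distrib)

lemma mult_r: "z \<otimes>\<^bsub>P\<^esub> (x + y) = z \<otimes>\<^bsub>P\<^esub> x + z \<otimes>\<^bsub>P\<^esub> y" "z \<otimes>\<^bsub>P\<^esub> (x - y) = z \<otimes>\<^bsub>P\<^esub> x - z \<otimes>\<^bsub>P\<^esub> y"
  "z \<otimes>\<^bsub>P\<^esub> 0 = 0"
  by (simp_all add: pair_ring_def frag_extend_add frag_extend_diff split_def
     frag_extend_fun_add frag_extend_eq_0)

text \<open>\<open>frag_induction\<close> builds elements by differences, which settles sums and
  negatives in a single case; the later induction rules keep this form.\<close>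

lemma P_induct [consumes 1, case_names zero of diff]:
  assumes "x \<in> carrier P" "Q 0" "\<And>a b. a \<in> carrier A \<Longrightarrow> b \<in> carrier B \<Longrightarrow> Q (frag_of (a, b))"
    "\<And>x y. x \<in> carrier P \<Longrightarrow> y \<in> carrier P \<Longrightarrow> Q x \<Longrightarrow> Q y \<Longrightarrow> Q (x - y)"
  shows "Q x"
proof -
  have "Poly_Mapping.keys x \<subseteq> S" using assms(1) by (simp add: carrier_P)
  then have "Q x \<and> x \<in> carrier P"
  proof (induction x rule: frag_induction)
    case (diff a b)
    then show ?case using assms(4) keys_diff[of a b] by (auto simp: carrier_P)
  qed (use assms in \<open>auto simp: carrier_P keys_frag_of\<close>)
  then show ?thesis by simp
qed

lemma P_closed:
  assumes "x \<in> carrier P" "y \<in> carrier P"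
  shows "x + y \<in> carrier P" "x - y \<in> carrier P" "- x \<in> carrier P"
  using assms Poly_Mapping.keys_add[of x y] keys_diff[of x y] by (auto simp: carrier_P)

lemma mult_P_closed:
  assumes "x \<in> carrier P" "y \<in> carrier P"
  shows "x \<otimes>\<^bsub>P\<^esub> y \<in> carrier P"
  using assms(1)
proof (induction rule: P_induct)
  case (of a b)
  from assms(2) show ?case
    by (induction rule: P_induct) (use of in \<open>auto simp: mult_r mult_of P_closed carrier_P[of 0]\<close>)
qed (auto simp: mult_l P_closed carrier_P[of 0])

text \<open>Commutativity and associativity hold on basis elements and extend by additivity, one
  argument at a time.\<close>

lemma cring_P: "cring P"
proof (rule cringI)
  show "abelian_group P"
  proof (rule abelian_groupI)
    fix x assume "x \<in> carrier P"
    then show "\<exists>y\<in>carrier P. y \<oplus>\<^bsub>P\<^esub> x = \<zero>\<^bsub>P\<^esub>"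
      by (intro bexI[of _ "- x"]) (auto simp: P_closed)
  qed (auto simp: P_closed carrier_P[of 0] algebra_simps)
  have comm: "x \<otimes>\<^bsub>P\<^esub> y = y \<otimes>\<^bsub>P\<^esub> x" if x: "x \<in> carrier P" and y: "y \<in> carrier P" for x y
    using x
  proof (induction rule: P_induct)
    case (of a b)
    from y show ?case
      by (induction rule: P_induct) (use of in \<open>auto simp: mult_r mult_l mult_of A.m_comm B.m_comm\<close>)
  qed (auto simp: mult_l mult_r)
  show "comm_monoid P"
  proof (rule comm_monoidI)
    fix x y z assume x: "x \<in> carrier P" and y: "y \<in> carrier P" and z: "z \<in> carrier P"
    show "x \<otimes>\<^bsub>P\<^esub> y \<otimes>\<^bsub>P\<^esub> z = x \<otimes>\<^bsub>P\<^esub> (y \<otimes>\<^bsub>P\<^esub> z)"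
      using x
    proof (induction rule: P_induct)
      case ab: (of a b)
      from y show ?case
      proof (induction rule: P_induct)
        case cd: (of c d)
        from z show ?case
          by (induction rule: P_induct)
             (use ab cd in \<open>auto simp: mult_r mult_l mult_of A.m_assoc B.m_assoc\<close>)
      qed (auto simp: mult_l mult_r)
    qed (auto simp: mult_l mult_r)
  next
    fix x assume "x \<in> carrier P"
    then show "\<one>\<^bsub>P\<^esub> \<otimes>\<^bsub>P\<^esub> x = x"
      by (induction rule: P_induct) (auto simp: mult_r mult_of)
  qed (auto simp: mult_P_closed comm)
qed (auto simp: mult_l)

lemma a_inv_P: "x \<in> carrier P \<Longrightarrow> \<ominus>\<^bsub>P\<^esub> x = - x"
proof -
  interpret P: cring P by (rule cring_P)
  assume x: "x \<in> carrier P"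
  then have "\<ominus>\<^bsub>P\<^esub> x + x = 0" using P.l_neg by fastforce
  then show ?thesis by (simp add: eq_neg_iff_add_eq_0)
qed

end

lemma (in ring) coset_eq_iff:
  assumes "ideal I R" "a \<in> carrier R" "b \<in> carrier R"
  shows "I +> a = I +> b \<longleftrightarrow> a \<ominus> b \<in> I"
  using quotient_eq_iff_same_a_r_cos[OF assms] by simp

lemma (in ideal) carrier_Quot: "X \<in> carrier (R Quot I) \<longleftrightarrow> (\<exists>x\<in>carrier R. X = I +> x)"
  by (auto simp: FactRing_def A_RCOSETS_def RCOSETS_def a_r_coset_def)

text \<open>This is what gives \<open>the_elem\<close> of the image of a coset a meaning, for tensor
  products and for \<open>aug\<close> alike.\<close>

lemma (in ideal) coset_image:
  assumes f: "abelian_group_hom R H f" and I: "\<And>i. i \<in> I \<Longrightarrow> f i = \<zero>\<^bsub>H\<^esub>" and x: "x \<in> carrier R"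
  shows "f ` (I +> x) = {f x}"
proof -
  interpret f: abelian_group_hom R H f by fact
  have "f y = f x" if "y \<in> I +> x" for y
    using that I x by (auto simp: a_r_coset_def' a_Hcarr)
  moreover have "x \<in> I +> x" using x by (rule a_rcos_self)
  ultimately show ?thesis by blast
qed

text \<open>Balancedness is kept out, because the tensor product over V and base change along a ring
  homomorphism ask for it in different forms.\<close>

definition biadditive ::
  "('a, 'x) ring_scheme \<Rightarrow> ('b, 'y) ring_scheme \<Rightarrow> ('m, 'z) ring_scheme \<Rightarrow> ('a \<Rightarrow> 'b \<Rightarrow> 'm) \<Rightarrow> bool"
where
  "biadditive A B M h \<longleftrightarrow> abelian_group M \<and>
     (\<forall>a\<in>carrier A. \<forall>b\<in>carrier B. h a b \<in> carrier M) \<and>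
     (\<forall>a\<in>carrier A. \<forall>a'\<in>carrier A. \<forall>b\<in>carrier B. h (a \<oplus>\<^bsub>A\<^esub> a') b = h a b \<oplus>\<^bsub>M\<^esub> h a' b) \<and>
     (\<forall>a\<in>carrier A. \<forall>b\<in>carrier B. \<forall>b'\<in>carrier B. h a (b \<oplus>\<^bsub>B\<^esub> b') = h a b \<oplus>\<^bsub>M\<^esub> h a b')"

text \<open>Covers \<open>tensor_lift\<close>, where h multiplies the images of a and b, and
  \<open>bc_counit\<close>, where h is the scalar action; only the additive structure of the target
  enters.\<close>

definition tlift :: "('m, 'z) ring_scheme \<Rightarrow> ('a \<Rightarrow> 'b \<Rightarrow> 'm) \<Rightarrow> (('a \<times> 'b) \<Rightarrow>\<^sub>0 int) set \<Rightarrow> 'm" where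
  "tlift M h X = the_elem (frag_eval M (\<lambda>(a, b). h a b) ` X)"

section \<open>The tensor product of two V-algebras and its universal property\<close>

locale alg_pair = A: algebra V A + B: algebra V B
  for V :: "('v, 'w) ring_scheme" and A :: "('v, 'a, 'x) module_scheme" and B :: "('v, 'b, 'y) module_scheme"

sublocale alg_pair \<subseteq> ring_pair A B
  by unfold_locales

context alg_pair
begin

abbreviation "J \<equiv> tensor_ideal V A B"
abbreviation "T \<equiv> tensor_algebra V A B"
abbreviation "t \<equiv> tens V A B"

definition relators :: "(('a \<times> 'b) \<Rightarrow>\<^sub>0 int) set" where
  "relators = ({frag_of (a \<oplus>\<^bsub>A\<^esub> a', b) - frag_of (a, b) - frag_of (a', b) | a a' b.
         a \<in> carrier A \<and> a' \<in> carrier A \<and> b \<in> carrier B} \<union>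
      {frag_of (a, b \<oplus>\<^bsub>B\<^esub> b') - frag_of (a, b) - frag_of (a, b') | a b b'.
         a \<in> carrier A \<and> b \<in> carrier B \<and> b' \<in> carrier B} \<union>
      {frag_of (v \<odot>\<^bsub>A\<^esub> a, b) - frag_of (a, v \<odot>\<^bsub>B\<^esub> b) | v a b.
         v \<in> carrier V \<and> a \<in> carrier A \<and> b \<in> carrier B})"

lemma relatorsI:
  "a \<in> carrier A \<Longrightarrow> a' \<in> carrier A \<Longrightarrow> b \<in> carrier B \<Longrightarrow>
    frag_of (a \<oplus>\<^bsub>A\<^esub> a', b) - (frag_of (a, b) + frag_of (a', b)) \<in> relators"
  "a \<in> carrier A \<Longrightarrow> b \<in> carrier B \<Longrightarrow> b' \<in> carrier B \<Longrightarrow>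
    frag_of (a, b \<oplus>\<^bsub>B\<^esub> b') - (frag_of (a, b) + frag_of (a, b')) \<in> relators"
  unfolding diff_diff_eq[symmetric] relators_def by blast+

lemma J_eq: "J = Idl\<^bsub>P\<^esub> relators"
  by (simp add: tensor_ideal_def relators_def)

lemma relators_P: "relators \<subseteq> carrier P"
  by (auto simp: relators_def intro!: P_closed)

sublocale P: cring P by (rule cring_P)

sublocale J: ideal J P
  unfolding J_eq by (rule P.genideal_ideal) (rule relators_P)

lemma P_minus: "x \<in> carrier P \<Longrightarrow> y \<in> carrier P \<Longrightarrow> x \<ominus>\<^bsub>P\<^esub> y = x - y"
  using a_inv_P[of y] by (simp add: a_minus_def)

lemma relators_J: "r \<in> relators \<Longrightarrow> r \<in> J"
  unfolding J_eq using P.genideal_self[OF relators_P] by auto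

lemma ops_T: "carrier T = carrier (P Quot J)" "x \<oplus>\<^bsub>T\<^esub> y = x \<oplus>\<^bsub>P Quot J\<^esub> y"
  "x \<otimes>\<^bsub>T\<^esub> y = x \<otimes>\<^bsub>P Quot J\<^esub> y" "\<zero>\<^bsub>T\<^esub> = \<zero>\<^bsub>P Quot J\<^esub>" "\<one>\<^bsub>T\<^esub> = \<one>\<^bsub>P Quot J\<^esub>"
  by (simp_all add: tensor_algebra_def Let_def)

lemma cring_T: "cring T"
proof -
  interpret Q: cring "P Quot J" by (rule J.quotient_is_cring) (rule cring_P)
  have "abelian_group T"
  proof (rule abelian_groupI)
    fix x assume "x \<in> carrier T"
    then show "\<exists>y\<in>carrier T. y \<oplus>\<^bsub>T\<^esub> x = \<zero>\<^bsub>T\<^esub>"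
      by (intro bexI[of _ "\<ominus>\<^bsub>P Quot J\<^esub> x"]) (auto simp: ops_T Q.l_neg)
  qed (simp_all add: ops_T Q.a_assoc, rule Q.a_comm)
  moreover have "comm_monoid T"
    by (rule comm_monoidI) (simp_all add: ops_T Q.m_assoc, rule Q.m_comm)
  ultimately show ?thesis
    by (rule cringI) (simp add: ops_T Q.l_distr)
qed

sublocale T: cring T by (rule cring_T)

lemma rep_T: "X \<in> carrier T \<longleftrightarrow> (\<exists>x\<in>carrier P. X = J +>\<^bsub>P\<^esub> x)"
  by (simp add: ops_T J.carrier_Quot)

lemma coset_T: "abelian_group_hom P T ((+>\<^bsub>P\<^esub>) J)"
  by (rule abelian_group_homI')
     (auto simp: ops_T ring_hom_add[OF J.rcos_ring_hom] ring_hom_closed[OF J.rcos_ring_hom] P.abelian_group_axioms T.abelian_group_axioms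
       simp flip: ops_P)

lemma coset_T_minus: "x \<in> carrier P \<Longrightarrow> y \<in> carrier P \<Longrightarrow> J +>\<^bsub>P\<^esub> (x - y) = (J +>\<^bsub>P\<^esub> x) \<ominus>\<^bsub>T\<^esub> (J +>\<^bsub>P\<^esub> y)"
  using abelian_group_hom.hom_diff[OF coset_T, of x y] by (simp add: P_minus)

lemma tens_closed [simp]: "a \<in> carrier A \<Longrightarrow> b \<in> carrier B \<Longrightarrow> t a b \<in> carrier T"
  by (auto simp: rep_T tens_def)

lemma T_induct [consumes 1, case_names zero tens diff]:
  assumes "X \<in> carrier T" "Q \<zero>\<^bsub>T\<^esub>" "\<And>a b. a \<in> carrier A \<Longrightarrow> b \<in> carrier B \<Longrightarrow> Q (t a b)"
    "\<And>X Y. X \<in> carrier T \<Longrightarrow> Y \<in> carrier T \<Longrightarrow> Q X \<Longrightarrow> Q Y \<Longrightarrow> Q (X \<ominus>\<^bsub>T\<^esub> Y)"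
  shows "Q X"
proof -
  obtain x where x: "x \<in> carrier P" "X = J +>\<^bsub>P\<^esub> x" using assms(1) by (auto simp: rep_T)
  have "Q (J +>\<^bsub>P\<^esub> x)" using x(1)
  proof (induction rule: P_induct)
    case zero
    then show ?case using assms(2) abelian_group_hom.hom_zero[OF coset_T] by simp
  next
    case (of a b)
    then show ?case using assms(3) by (simp add: tens_def)
  next
    case (diff x y)
    then show ?case using assms(4) by (auto simp: coset_T_minus rep_T)
  qed
  then show ?thesis by (simp add: x)
qed

lemma T_ext:
  assumes "abelian_group_hom T M f" "abelian_group_hom T M g"
    "\<And>a b. a \<in> carrier A \<Longrightarrow> b \<in> carrier B \<Longrightarrow> f (t a b) = g (t a b)" "X \<in> carrier T"
  shows "f X = g X"
proof -
  interpret f: abelian_group_hom T M f by fact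
  interpret g: abelian_group_hom T M g by fact
  show ?thesis using assms(4) by (induction rule: T_induct) (auto simp: assms f.hom_diff g.hom_diff)
qed

lemma tens_mult:
  "a \<in> carrier A \<Longrightarrow> b \<in> carrier B \<Longrightarrow> c \<in> carrier A \<Longrightarrow> d \<in> carrier B \<Longrightarrow>
    t a b \<otimes>\<^bsub>T\<^esub> t c d = t (a \<otimes>\<^bsub>A\<^esub> c) (b \<otimes>\<^bsub>B\<^esub> d)"
  unfolding tens_def ops_T by (subst ring_hom_mult[OF J.rcos_ring_hom, symmetric]) (auto simp: mult_of)

lemma tens_one: "t \<one>\<^bsub>A\<^esub> \<one>\<^bsub>B\<^esub> = \<one>\<^bsub>T\<^esub>"
  by (simp add: tens_def ops_T FactRing_def)

lemma tens_eqI: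
  assumes "x \<in> carrier P" "y \<in> carrier P" "x - y \<in> relators"
  shows "J +>\<^bsub>P\<^esub> x = J +>\<^bsub>P\<^esub> y"
  using assms relators_J by (simp add: P.coset_eq_iff[OF J.ideal_axioms] P_minus)

lemma tens_add_l:
  assumes "a \<in> carrier A" "a' \<in> carrier A" "b \<in> carrier B"
  shows "t (a \<oplus>\<^bsub>A\<^esub> a') b = t a b \<oplus>\<^bsub>T\<^esub> t a' b"
proof -
  have "t (a \<oplus>\<^bsub>A\<^esub> a') b = J +>\<^bsub>P\<^esub> (frag_of (a, b) \<oplus>\<^bsub>P\<^esub> frag_of (a', b))"
    unfolding tens_def by (rule tens_eqI)
      (use assms in \<open>auto simp: relatorsI intro!: P_closed\<close>)
  then show ?thesis
    using assms abelian_group_hom.hom_add[OF coset_T, of "frag_of (a, b)" "frag_of (a', b)"]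
    by (simp add: tens_def)
qed

lemma tens_add_r:
  assumes "a \<in> carrier A" "b \<in> carrier B" "b' \<in> carrier B"
  shows "t a (b \<oplus>\<^bsub>B\<^esub> b') = t a b \<oplus>\<^bsub>T\<^esub> t a b'"
proof -
  have "t a (b \<oplus>\<^bsub>B\<^esub> b') = J +>\<^bsub>P\<^esub> (frag_of (a, b) \<oplus>\<^bsub>P\<^esub> frag_of (a, b'))"
    unfolding tens_def by (rule tens_eqI)
      (use assms in \<open>auto simp: relatorsI intro!: P_closed\<close>)
  then show ?thesis
    using assms abelian_group_hom.hom_add[OF coset_T, of "frag_of (a, b)" "frag_of (a, b')"]
    by (simp add: tens_def)
qed

lemma tens_smult:
  assumes "v \<in> carrier V" "a \<in> carrier A" "b \<in> carrier B"
  shows "t (v \<odot>\<^bsub>A\<^esub> a) b = t a (v \<odot>\<^bsub>B\<^esub> b)"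
  unfolding tens_def by (rule tens_eqI) (use assms in \<open>auto simp: relators_def\<close>)

lemma biadditive_tens: "biadditive A B T t"
  by (auto simp: biadditive_def tens_add_l tens_add_r T.abelian_group_axioms)

text \<open>The tensor product divides by an ideal, but h only provides an additive map \<phi> on
  \<open>pair_ring\<close>, whose kernel need not be an ideal. So \<phi> must be shown to kill all
  multiples of the relations, and not only the relations themselves.\<close>

lemma tlift:
  assumes h: "biadditive A B M h"
    and bal: "\<And>v a b. v \<in> carrier V \<Longrightarrow> a \<in> carrier A \<Longrightarrow> b \<in> carrier B \<Longrightarrow> h (v \<odot>\<^bsub>A\<^esub> a) b = h a (v \<odot>\<^bsub>B\<^esub> b)"
  shows tlift_hom: "abelian_group_hom T M (tlift M h)"
    and tlift_tens: "\<And>a b. a \<in> carrier A \<Longrightarrow> b \<in> carrier B \<Longrightarrow> tlift M h (t a b) = h a b"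
proof -
  interpret M: abelian_group M using h by (simp add: biadditive_def)
  define g where "g = (\<lambda>(a, b). h a b)"
  have g: "g \<in> carrier A \<times> carrier B \<rightarrow> carrier M"
    using h by (auto simp: g_def biadditive_def)
  define \<phi> where "\<phi> = frag_eval M g"
  have \<phi>: "abelian_group_hom P M \<phi>"
    by (rule abelian_group_homI')
       (auto simp: \<phi>_def carrier_P M.frag_eval_add[OF _ _ g] M.frag_eval_closed[OF _ g]
         P.abelian_group_axioms M.abelian_group_axioms)
  interpret \<phi>: abelian_group_hom P M \<phi> by fact
  have \<phi>_diff: "\<phi> (x - y) = \<phi> x \<ominus>\<^bsub>M\<^esub> \<phi> y" if "x \<in> carrier P" "y \<in> carrier P" for x y
    using \<phi>.hom_diff[OF that] by (simp add: P_minus that)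
  have \<phi>_of: "\<phi> (frag_of (a, b)) = h a b" if "a \<in> carrier A" "b \<in> carrier B" for a b
    using M.frag_eval_of[of g "(a, b)"] h that by (auto simp: \<phi>_def g_def biadditive_def)
  \<comment> \<open>The largest ideal inside the kernel of \<phi>; it remains to see that it
    contains the relators.\<close>
  define N where "N = {x \<in> carrier P. \<forall>r\<in>carrier P. \<phi> (r \<otimes>\<^bsub>P\<^esub> x) = \<zero>\<^bsub>M\<^esub>}"
  have idN: "ideal N P"
  proof (rule idealI)
    show "ring P" by (rule P.ring_axioms)
    show "subgroup N (add_monoid P)"
    proof (rule P.add.subgroupI)
      show "N \<noteq> {}" using \<phi>.hom_zero by (auto simp: N_def mult_r carrier_P intro!: exI[of _ 0])
    next
      fix a b assume ab: "a \<in> N" "b \<in> N"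
      then show "a \<oplus>\<^bsub>P\<^esub> b \<in> N"
        by (simp add: N_def P.r_distr del: ops_P)
      show "\<ominus>\<^bsub>P\<^esub> a \<in> N"
        using ab by (auto simp: N_def P.r_minus)
    qed (auto simp: N_def)
  next
    fix a x assume "a \<in> N" "x \<in> carrier P"
    then show "x \<otimes>\<^bsub>P\<^esub> a \<in> N" "a \<otimes>\<^bsub>P\<^esub> x \<in> N"
      by (auto simp: N_def P.m_comm[of a x] simp flip: P.m_assoc)
  qed
  \<comment> \<open>A relator times a basis element is again a relator of the same kind, so \<phi>
    kills it; other multiples r follow by additivity.\<close>
  have "\<phi> (r \<otimes>\<^bsub>P\<^esub> x) = \<zero>\<^bsub>M\<^esub>" if "r \<in> carrier P" and x: "x \<in> relators" for r x
    using that(1)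
  proof (induction rule: P_induct)
    case zero
    then show ?case using \<phi>.hom_zero by (simp add: mult_l)
  next
    case (diff r r')
    have "x \<in> carrier P" using relators_P x by auto
    then show ?case using diff by (simp add: mult_l mult_P_closed \<phi>_diff M.minus_eq)
  next
    case (of c d)
    have b: "\<And>a a' b. a \<in> carrier A \<Longrightarrow> a' \<in> carrier A \<Longrightarrow> b \<in> carrier B \<Longrightarrow> h (a \<oplus>\<^bsub>A\<^esub> a') b = h a b \<oplus>\<^bsub>M\<^esub> h a' b"
      "\<And>a b b'. a \<in> carrier A \<Longrightarrow> b \<in> carrier B \<Longrightarrow> b' \<in> carrier B \<Longrightarrow> h a (b \<oplus>\<^bsub>B\<^esub> b') = h a b \<oplus>\<^bsub>M\<^esub> h a b'"
      "\<And>a b. a \<in> carrier A \<Longrightarrow> b \<in> carrier B \<Longrightarrow> h a b \<in> carrier M"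
      using h by (auto simp: biadditive_def)
    have z: "u \<oplus>\<^bsub>M\<^esub> w \<ominus>\<^bsub>M\<^esub> u \<ominus>\<^bsub>M\<^esub> w = \<zero>\<^bsub>M\<^esub>" if "u \<in> carrier M" "w \<in> carrier M" for u w
      proof -
      have "u \<oplus>\<^bsub>M\<^esub> w \<ominus>\<^bsub>M\<^esub> u \<ominus>\<^bsub>M\<^esub> w = (u \<oplus>\<^bsub>M\<^esub> w) \<ominus>\<^bsub>M\<^esub> (u \<oplus>\<^bsub>M\<^esub> w)"
        using that by (simp add: M.minus_eq M.minus_add M.a_assoc)
      then show ?thesis using that by (simp add: M.minus_eq M.r_neg)
    qed
    have zz: "u \<ominus>\<^bsub>M\<^esub> u = \<zero>\<^bsub>M\<^esub>" if "u \<in> carrier M" for u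
      using that by (simp add: M.minus_eq M.r_neg)
    from x show ?case
      using of by (auto simp: relators_def mult_r mult_of \<phi>_diff \<phi>_of P_closed A.r_distr B.r_distr b z zz
          A.smult_assoc2 B.smult_assoc2 A.m_comm[of c] B.m_comm[of d] bal)
  qed
  then have "relators \<subseteq> N" using relators_P by (auto simp: N_def)
  then have "J \<subseteq> N" unfolding J_eq by (rule P.genideal_minimal[OF idN])
  then have \<phi>J: "\<phi> j = \<zero>\<^bsub>M\<^esub>" if "j \<in> J" for j
    proof -
    have "j \<in> carrier P" "\<phi> (\<one>\<^bsub>P\<^esub> \<otimes>\<^bsub>P\<^esub> j) = \<zero>\<^bsub>M\<^esub>"
      using that \<open>J \<subseteq> N\<close> P.one_closed unfolding N_def by blast+
    then show ?thesis using P.l_one by metis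
  qed
  have val: "tlift M h (J +>\<^bsub>P\<^esub> x) = \<phi> x" if "x \<in> carrier P" for x
    using J.coset_image[OF \<phi> \<phi>J that] by (simp add: tlift_def \<phi>_def g_def)
  show "abelian_group_hom T M (tlift M h)"
  proof (rule abelian_group_homI')
    fix X Y assume "X \<in> carrier T" "Y \<in> carrier T"
    then obtain x y where "x \<in> carrier P" "X = J +>\<^bsub>P\<^esub> x" "y \<in> carrier P" "Y = J +>\<^bsub>P\<^esub> y"
      by (auto simp: rep_T)
    then show "tlift M h (X \<oplus>\<^bsub>T\<^esub> Y) = tlift M h X \<oplus>\<^bsub>M\<^esub> tlift M h Y"
      using abelian_group_hom.hom_add[OF coset_T, of x y] \<phi>.hom_add[of x y] val[of "x + y"]
      by (simp add: val P_closed)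
  qed (auto simp: rep_T val T.abelian_group_axioms M.abelian_group_axioms)
  show "tlift M h (t a b) = h a b" if "a \<in> carrier A" "b \<in> carrier B" for a b
    using that by (simp add: tens_def val \<phi>_of)
qed

lemma tensor_lift:
  assumes C: "cring C" and f: "f \<in> ring_hom A C" and g: "g \<in> ring_hom B C"
    and bal: "\<And>v a b. v \<in> carrier V \<Longrightarrow> a \<in> carrier A \<Longrightarrow> b \<in> carrier B \<Longrightarrow>
      f (v \<odot>\<^bsub>A\<^esub> a) \<otimes>\<^bsub>C\<^esub> g b = f a \<otimes>\<^bsub>C\<^esub> g (v \<odot>\<^bsub>B\<^esub> b)"
  shows tensor_lift_hom: "tensor_lift C f g \<in> ring_hom T C"
    and tensor_lift_tens: "\<And>a b. a \<in> carrier A \<Longrightarrow> b \<in> carrier B \<Longrightarrow> tensor_lift C f g (t a b) = f a \<otimes>\<^bsub>C\<^esub> g b"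
proof -
  interpret C: cring C by fact
  interpret f: ring_hom_cring A C f using f by unfold_locales
  interpret g: ring_hom_cring B C g using g by unfold_locales
  define h where "h = (\<lambda>a b. f a \<otimes>\<^bsub>C\<^esub> g b)"
  have eq: "tensor_lift C f g = tlift C h"
    by (simp add: fun_eq_iff tensor_lift_def tlift_def h_def)
  have h: "biadditive A B C h"
    by (auto simp: biadditive_def h_def C.l_distr C.r_distr C.abelian_group_axioms)
  have l: "abelian_group_hom T C (tlift C h)"
    "\<And>a b. a \<in> carrier A \<Longrightarrow> b \<in> carrier B \<Longrightarrow> tlift C h (t a b) = h a b"
    using tlift[OF h] bal by (auto simp: h_def)
  interpret l: abelian_group_hom T C "tlift C h" by fact
  \<comment> \<open>Both sides are additive in X and in Y, so pure tensors suffice.\<close>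
  have mult: "tlift C h (X \<otimes>\<^bsub>T\<^esub> Y) = tlift C h X \<otimes>\<^bsub>C\<^esub> tlift C h Y" if X: "X \<in> carrier T" and Y: "Y \<in> carrier T" for X Y
    using X
  proof (induction rule: T_induct)
    case (tens a b)
    from Y show ?case
    proof (induction rule: T_induct)
      case (tens c d)
      then show ?case using \<open>a \<in> carrier A\<close> \<open>b \<in> carrier B\<close> by (simp add: tens_mult l(2)) (simp add: h_def C.m_ac)
    qed (use tens in \<open>auto simp: T.minus_eq C.minus_eq T.r_distr C.r_distr T.r_minus C.r_minus\<close>)
  qed (use Y in \<open>auto simp: T.minus_eq C.minus_eq T.l_distr C.l_distr T.l_minus C.l_minus\<close>)
  show "tensor_lift C f g \<in> ring_hom T C"
  proof -
    have "tlift C h \<one>\<^bsub>T\<^esub> = \<one>\<^bsub>C\<^esub>"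
      using l(2)[of "\<one>\<^bsub>A\<^esub>" "\<one>\<^bsub>B\<^esub>"] by (simp add: tens_one) (simp add: h_def)
    then show ?thesis
      unfolding eq by (intro ring_hom_memI) (auto simp: mult)
  qed
  show "tensor_lift C f g (t a b) = f a \<otimes>\<^bsub>C\<^esub> g b" if "a \<in> carrier A" "b \<in> carrier B" for a b
    using that l(2)[of a b] by (simp add: eq) (simp add: h_def)
qed

lemma ring_hom_l: "(\<lambda>a. t a \<one>\<^bsub>B\<^esub>) \<in> ring_hom A T"
  by (rule ring_hom_memI) (auto simp: tens_mult tens_add_l tens_one)

lemma ring_hom_r: "(\<lambda>b. t \<one>\<^bsub>A\<^esub> b) \<in> ring_hom B T"
  by (rule ring_hom_memI) (auto simp: tens_mult tens_add_r tens_one)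

lemma smult_T: "v \<odot>\<^bsub>T\<^esub> X = t (v \<odot>\<^bsub>A\<^esub> \<one>\<^bsub>A\<^esub>) \<one>\<^bsub>B\<^esub> \<otimes>\<^bsub>T\<^esub> X"
  by (simp add: tensor_algebra_def Let_def)

lemma smult_tens:
  "v \<in> carrier V \<Longrightarrow> a \<in> carrier A \<Longrightarrow> b \<in> carrier B \<Longrightarrow> v \<odot>\<^bsub>T\<^esub> t a b = t (v \<odot>\<^bsub>A\<^esub> a) b"
  by (simp add: smult_T tens_mult A.smult_assoc2)

lemma algebra_T: "algebra V T"
proof (rule algebraI)
  fix v w X assume v: "v \<in> carrier V" "w \<in> carrier V" "X \<in> carrier T"
  have "t (v \<otimes>\<^bsub>V\<^esub> w \<odot>\<^bsub>A\<^esub> \<one>\<^bsub>A\<^esub>) \<one>\<^bsub>B\<^esub> = t (v \<odot>\<^bsub>A\<^esub> \<one>\<^bsub>A\<^esub>) \<one>\<^bsub>B\<^esub> \<otimes>\<^bsub>T\<^esub> t (w \<odot>\<^bsub>A\<^esub> \<one>\<^bsub>A\<^esub>) \<one>\<^bsub>B\<^esub>"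
    using v by (simp add: tens_mult A.smult_assoc1 A.smult_assoc2)
  then show "v \<otimes>\<^bsub>V\<^esub> w \<odot>\<^bsub>T\<^esub> X = v \<odot>\<^bsub>T\<^esub> (w \<odot>\<^bsub>T\<^esub> X)"
    using v by (simp add: smult_T T.m_assoc)
  show "(v \<oplus>\<^bsub>V\<^esub> w) \<odot>\<^bsub>T\<^esub> X = v \<odot>\<^bsub>T\<^esub> X \<oplus>\<^bsub>T\<^esub> w \<odot>\<^bsub>T\<^esub> X"
    using v by (simp add: smult_T A.smult_l_distr tens_add_l T.l_distr)
qed (auto simp: smult_T T.r_distr T.m_assoc tens_one A.R_cring T.is_cring)

end

section \<open>Quotients and adic completions\<close>

lemma (in ideal) quot_ops:
  assumes "x \<in> carrier R" "y \<in> carrier R"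
  shows "(I +> x) \<oplus>\<^bsub>R Quot I\<^esub> (I +> y) = I +> (x \<oplus> y)"
    "(I +> x) \<otimes>\<^bsub>R Quot I\<^esub> (I +> y) = I +> (x \<otimes> y)"
  using assms ring_hom_add[OF rcos_ring_hom, of x y] ring_hom_mult[OF rcos_ring_hom, of x y] by auto

lemma (in ideal) quot_closed [simp]: "x \<in> carrier R \<Longrightarrow> I +> x \<in> carrier (R Quot I)"
  by (rule ring_hom_closed[OF rcos_ring_hom])

text \<open>f maps a whole coset of I into one coset of N, so the union in \<open>coset_map\<close>
  collapses.\<close>

lemma coset_map_coset:
  assumes I: "ideal I R" and N: "ideal N S" and f: "abelian_group_hom R S f"
    and sub: "\<And>i. i \<in> I \<Longrightarrow> f i \<in> N" and x: "x \<in> carrier R"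
  shows "coset_map S N f (I +>\<^bsub>R\<^esub> x) = N +>\<^bsub>S\<^esub> f x"
proof -
  interpret I: ideal I R by fact
  interpret N: ideal N S by fact
  interpret f: abelian_group_hom R S f by fact
  have "N +>\<^bsub>S\<^esub> f y = N +>\<^bsub>S\<^esub> f x" if "y \<in> I +>\<^bsub>R\<^esub> x" for y
  proof -
    obtain i where i: "i \<in> I" "y = i \<oplus>\<^bsub>R\<^esub> x" using \<open>y \<in> I +>\<^bsub>R\<^esub> x\<close> by (auto simp: a_r_coset_def')
    have c: "f i \<in> carrier S" "f x \<in> carrier S" using i x I.a_Hcarr by auto
    have "f y \<ominus>\<^bsub>S\<^esub> f x = f i"
      using c i x I.a_Hcarr by (simp add: N.minus_eq N.a_assoc N.r_neg)
    then show ?thesis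
      using i x sub I.a_Hcarr by (subst N.coset_eq_iff[OF N]) auto
  qed
  moreover have "x \<in> I +>\<^bsub>R\<^esub> x" using x by (rule I.a_rcos_self)
  ultimately show ?thesis unfolding coset_map_def by blast
qed

lemma coset_map_additive:
  assumes I: "ideal I R" and N: "ideal N S" and f: "abelian_group_hom R S f"
    and sub: "\<And>i. i \<in> I \<Longrightarrow> f i \<in> N"
  shows "abelian_group_hom (R Quot I) (S Quot N) (coset_map S N f)"
proof -
  interpret I: ideal I R by fact
  interpret N: ideal N S by fact
  interpret f: abelian_group_hom R S f by fact
  note c = coset_map_coset[OF assms]
  show ?thesis
    by (rule abelian_group_homI')
       (auto simp: I.carrier_Quot c I.quot_ops N.quot_ops intro: N.quot_ops
         ring.is_abelian_group[OF I.quotient_is_ring] ring.is_abelian_group[OF N.quotient_is_ring])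
qed

lemma coset_map_ring_hom:
  assumes I: "ideal I R" and N: "ideal N S" and f: "f \<in> ring_hom R S"
    and sub: "\<And>i. i \<in> I \<Longrightarrow> f i \<in> N"
  shows "coset_map S N f \<in> ring_hom (R Quot I) (S Quot N)"
proof -
  interpret I: ideal I R by fact
  interpret N: ideal N S by fact
  have fa: "abelian_group_hom R S f"
    by (rule ring_hom_additive) (use f I.ring_axioms N.ring_axioms in auto)
  note c = coset_map_coset[OF I N fa sub]
  interpret a: abelian_group_hom "R Quot I" "S Quot N" "coset_map S N f"
    by (rule coset_map_additive[OF I N fa sub])
  show ?thesis
  proof (rule ring_hom_memI)
    show "coset_map S N f \<one>\<^bsub>R Quot I\<^esub> = \<one>\<^bsub>S Quot N\<^esub>"
      using c[of "\<one>\<^bsub>R\<^esub>"] ring_hom_one[OF f] by (simp add: FactRing_def)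
  qed (use ring_hom_closed[OF f] ring_hom_mult[OF f] in \<open>auto simp: I.carrier_Quot c I.quot_ops N.quot_ops\<close>)
qed

context ring
begin

lemma ideal_power_ideal: "ideal I R \<Longrightarrow> ideal (ideal_power R I n) R"
  by (induction n) (auto intro: ideal_prod_is_ideal oneideal)

lemma ideal_power_Suc_subset: "ideal I R \<Longrightarrow> ideal_power R I (Suc n) \<subseteq> ideal_power R I n"
  using ideal_prod_inter[of I "ideal_power R I n"] ideal_power_ideal by auto

lemma ideal_power_antimono:
  assumes "ideal I R" "m \<le> n"
  shows "ideal_power R I n \<subseteq> ideal_power R I m"
  using assms(2)
proof (induction n rule: dec_induct)
  case (step n)
  then show ?case using ideal_power_Suc_subset[OF assms(1), of n] by blast
qed simp

lemma ideal_power_1: "ideal I R \<Longrightarrow> ideal_power R I (Suc 0) = I"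
  using ideal_prod_one by simp

end

lemma (in cring) ideal_power_mult:
  assumes I: "ideal I R" and x: "x \<in> ideal_power R I m" and y: "y \<in> ideal_power R I n"
  shows "x \<otimes> y \<in> ideal_power R I (m + n)"
  using x
proof (induction m arbitrary: x)
  case 0
  then show ?case using ideal.I_l_closed[OF ideal_power_ideal[OF I] y] by simp
next
  case (Suc m)
  have yc: "y \<in> carrier R" using ideal.Icarr[OF ideal_power_ideal[OF I] y] .
  from Suc.prems have "x \<in> I \<cdot> ideal_power R I m" by simp
  then have "x \<otimes> y \<in> I \<cdot> ideal_power R I (m + n) \<and> x \<in> carrier R"
  proof (induction rule: ideal_prod.induct)
    case (prod i j)
    then have c: "i \<in> carrier R" "j \<in> carrier R"
      using ideal.Icarr[OF I] ideal.Icarr[OF ideal_power_ideal[OF I]] by auto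
    show ?case using c yc ideal_prod.prod[of i I "j \<otimes> y" "ideal_power R I (m + n)" R] Suc.IH[OF prod(2)] prod(1)
      by (simp add: m_assoc)
  next
    case (sum a b)
    then show ?case using yc by (auto simp: l_distr intro: ideal_prod.sum)
  qed
  then show ?case by simp
qed

lemma ideal_power_hom:
  assumes R: "ring R" and S: "ring S" and f: "f \<in> ring_hom R S" and I: "ideal I R"
    and sub: "\<And>i. i \<in> I \<Longrightarrow> f i \<in> J" and x: "x \<in> ideal_power R I n"
  shows "f x \<in> ideal_power S J n"
  using x
proof (induction n arbitrary: x)
  case 0
  then show ?case using ring_hom_closed[OF f] by simp
next
  case (Suc n)
  from Suc.prems have "x \<in> I \<cdot>\<^bsub>R\<^esub> ideal_power R I n" by simp
  then have "f x \<in> J \<cdot>\<^bsub>S\<^esub> ideal_power S J n \<and> x \<in> carrier R"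
  proof (induction rule: ideal_prod.induct)
    case (prod i j)
    then have c: "i \<in> carrier R" "j \<in> carrier R"
      using ideal.Icarr[OF I] ideal.Icarr[OF ring.ideal_power_ideal[OF R I]] by auto
    show ?case
      using c ring_hom_mult[OF f c] ideal_prod.prod[of "f i" J "f j" "ideal_power S J n" S] sub Suc.IH prod
        ring.ring_simprules(5)[OF R c] by simp
  next
    case (sum a b)
    then show ?case
      using ring_hom_add[OF f, of a b] ring.ring_simprules(1)[OF R] by (auto intro: ideal_prod.sum)
  qed
  then show ?case by simp
qed

lemma (in cring) p_elem_mult: "x \<in> carrier R \<Longrightarrow> p_elem p R \<otimes> x = add_pow R p x"
  by (simp add: p_elem_def add_pow_ldistr)

lemma (in cring) p_elem_closed [simp]: "p_elem p R \<in> carrier R"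
  by (simp add: p_elem_def)

lemma (in cring) p_ideal_ideal: "ideal (p_ideal p R) R"
  by (simp add: p_ideal_def cgenideal_ideal)

lemma (in cring) p_ideal_iff: "x \<in> p_ideal p R \<longleftrightarrow> (\<exists>y\<in>carrier R. x = add_pow R p y)"
proof -
  have "y \<otimes> p_elem p R = add_pow R p y" if "y \<in> carrier R" for y
    using that by (simp add: p_elem_def add_pow_rdistr)
  then show ?thesis by (auto simp: p_ideal_def cgenideal_def) metis
qed

text \<open>An element p y is a sum of p copies of y, so an additive map carries multiples of p to
  multiples of p, and inductively for its powers. Hence derivations, and not only ring
  homomorphisms, pass to p-adic completions.\<close>

lemma p_power_additive:
  assumes R: "cring R" and S: "cring S" and f: "abelian_group_hom R S f"
    and x: "x \<in> ideal_power R (p_ideal p R) n"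
  shows "f x \<in> ideal_power S (p_ideal p S) n"
proof -
  interpret R: cring R by fact
  interpret S: cring S by fact
  interpret f: abelian_group_hom R S f by fact
  note I = R.p_ideal_ideal[of p]
  show ?thesis using x
  proof (induction n arbitrary: x)
    case (Suc n)
    from Suc.prems have "x \<in> p_ideal p R \<cdot>\<^bsub>R\<^esub> ideal_power R (p_ideal p R) n" by simp
    then have "f x \<in> p_ideal p S \<cdot>\<^bsub>S\<^esub> ideal_power S (p_ideal p S) n \<and> x \<in> carrier R"
    proof (induction rule: ideal_prod.induct)
      case (prod i j)
      then have j: "j \<in> carrier R" using ideal.Icarr[OF R.ideal_power_ideal[OF I]] by auto
      obtain y where y: "y \<in> carrier R" "i = p_elem p R \<otimes>\<^bsub>R\<^esub> y"
        using prod(1) by (auto simp: R.p_ideal_iff R.p_elem_mult)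
      have yj: "y \<otimes>\<^bsub>R\<^esub> j \<in> ideal_power R (p_ideal p R) n"
        using ideal.I_l_closed[OF R.ideal_power_ideal[OF I] prod(2) y(1)] .
      have "f (i \<otimes>\<^bsub>R\<^esub> j) = f (add_pow R p (y \<otimes>\<^bsub>R\<^esub> j))"
        using y j by (simp add: R.p_elem_mult R.add_pow_ldistr)
      also have "\<dots> = p_elem p S \<otimes>\<^bsub>S\<^esub> f (y \<otimes>\<^bsub>R\<^esub> j)"
        using y j by (simp add: f.hom_add_pow S.p_elem_mult)
      also have "\<dots> \<in> p_ideal p S \<cdot>\<^bsub>S\<^esub> ideal_power S (p_ideal p S) n"
        using Suc.IH[OF yj] by (intro ideal_prod.prod) (auto simp: p_ideal_def S.cgenideal_self)
      finally show ?case using y j by simp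
    next
      case (sum a b)
      then show ?case by (auto intro: ideal_prod.sum)
    qed
    then show ?case by simp
  qed simp
qed

declare ideal_power.simps(2) [simp del]

section \<open>The ring structure of an adic completion\<close>

locale adic = cring R + ideal I R for R :: "('r, 'x) ring_scheme" (structure) and I
begin

abbreviation "Ip m \<equiv> ideal_power R I m"
abbreviation "C \<equiv> adic_completion R I"

sublocale Ip: ideal "Ip m" R for m
  by (rule ideal_power_ideal) (rule ideal_axioms)

text \<open>For a family of ideals this rule loops: its premise leaves the index undetermined.\<close>

declare Ip.a_Hcarr [simp del]

sublocale Q: cring "R Quot Ip m" for m
  by (rule Ip.quotient_is_cring) (rule is_cring)

text \<open>\<open>adic_completion\<close> phrases compatibility as inclusion of cosets; on
  representatives it becomes a congruence modulo the lower power.\<close>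

lemma coset_subset_iff:
  assumes "x \<in> carrier R" "y \<in> carrier R"
  shows "Ip (Suc m) +> y \<subseteq> Ip m +> x \<longleftrightarrow> Ip m +> y = Ip m +> x"
proof
  assume "Ip (Suc m) +> y \<subseteq> Ip m +> x"
  then have "y \<in> Ip m +> x" using Ip.a_rcos_self[OF assms(2)] by blast
  then show "Ip m +> y = Ip m +> x" using Ip.a_repr_independence'[of y m x] assms by auto
next
  assume "Ip m +> y = Ip m +> x"
  moreover have "Ip (Suc m) +> y \<subseteq> Ip m +> y"
    using ideal_power_Suc_subset[OF ideal_axioms, of m] by (auto simp: a_r_coset_def')
  ultimately show "Ip (Suc m) +> y \<subseteq> Ip m +> x" by simp
qed

lemma C_ops: "(u \<oplus>\<^bsub>C\<^esub> v) m = u m \<oplus>\<^bsub>R Quot Ip m\<^esub> v m" "(u \<otimes>\<^bsub>C\<^esub> v) m = u m \<otimes>\<^bsub>R Quot Ip m\<^esub> v m"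
  "\<zero>\<^bsub>C\<^esub> m = \<zero>\<^bsub>R Quot Ip m\<^esub>" "\<one>\<^bsub>C\<^esub> m = \<one>\<^bsub>R Quot Ip m\<^esub>"
  by (simp_all add: adic_completion_def)

lemma C_closed: "u \<in> carrier C \<Longrightarrow> u m \<in> carrier (R Quot Ip m)"
  by (simp add: adic_completion_def)

lemma C_rep:
  assumes "u \<in> carrier C"
  obtains x where "\<And>m. x m \<in> carrier R" "\<And>m. u m = Ip m +> x m" "\<And>m. Ip m +> x (Suc m) = Ip m +> x m"
proof -
  have "\<forall>m. \<exists>x. x \<in> carrier R \<and> u m = Ip m +> x"
    using C_closed[OF assms] by (auto simp: Ip.carrier_Quot)
  then obtain x where x: "\<And>m. x m \<in> carrier R" "\<And>m. u m = Ip m +> x m" by metis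
  have "Ip (Suc m) +> x (Suc m) \<subseteq> Ip m +> x m" for m
    using assms by (simp add: adic_completion_def flip: x(2))
  then show ?thesis using x coset_subset_iff by (intro that[of x]) blast+
qed

lemma C_I:
  assumes "\<And>m. x m \<in> carrier R" "\<And>m. u m = Ip m +> x m" "\<And>m. Ip m +> x (Suc m) = Ip m +> x m"
  shows "u \<in> carrier C"
  using assms coset_subset_iff by (auto simp: adic_completion_def Ip.quot_ops)

lemma Q_zero: "\<zero>\<^bsub>R Quot Ip m\<^esub> = Ip m +> \<zero>" "\<one>\<^bsub>R Quot Ip m\<^esub> = Ip m +> \<one>"
  using Ip.a_subset[of m] by (simp_all add: FactRing_def)

lemma Q_inv: "x \<in> carrier R \<Longrightarrow> \<ominus>\<^bsub>R Quot Ip m\<^esub> (Ip m +> x) = Ip m +> (\<ominus> x)"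
  by (rule Q.minus_equality) (auto simp: Ip.quot_ops Q_zero l_neg)

lemma cring_C: "cring C"
proof (rule cringI)
  have cl: "u \<oplus>\<^bsub>C\<^esub> v \<in> carrier C \<and> u \<otimes>\<^bsub>C\<^esub> v \<in> carrier C" if u: "u \<in> carrier C" and v: "v \<in> carrier C" for u v
  proof -
    obtain x where x: "\<And>m. x m \<in> carrier R" "\<And>m. u m = Ip m +> x m" "\<And>m. Ip m +> x (Suc m) = Ip m +> x m"
      using C_rep[OF u] by blast
    obtain y where y: "\<And>m. y m \<in> carrier R" "\<And>m. v m = Ip m +> y m" "\<And>m. Ip m +> y (Suc m) = Ip m +> y m"
      using C_rep[OF v] by blast
    show ?thesis
      by (intro conjI C_I[of "\<lambda>m. x m \<oplus> y m"] C_I[of "\<lambda>m. x m \<otimes> y m"])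
         (auto simp: x y C_ops Ip.quot_ops simp flip: Ip.quot_ops(1,2))
  qed
  show "abelian_group C"
  proof (rule abelian_groupI)
    fix u assume u: "u \<in> carrier C"
    then obtain x where x: "\<And>m. x m \<in> carrier R" "\<And>m. u m = Ip m +> x m" "\<And>m. Ip m +> x (Suc m) = Ip m +> x m"
      using C_rep by blast
    have "(\<lambda>m. \<ominus>\<^bsub>R Quot Ip m\<^esub> u m) \<in> carrier C"
      by (intro C_I[of "\<lambda>m. \<ominus> x m"]) (auto simp: x Q_inv simp flip: Q_inv)
    then show "\<exists>v\<in>carrier C. v \<oplus>\<^bsub>C\<^esub> u = \<zero>\<^bsub>C\<^esub>"
      by (rule bexI[rotated]) (use u in \<open>simp add: fun_eq_iff C_ops C_closed Q.l_neg\<close>)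
  next
    show "\<zero>\<^bsub>C\<^esub> \<in> carrier C" by (rule C_I[of "\<lambda>_. \<zero>"]) (auto simp: C_ops Q_zero)
  next
    fix u v assume "u \<in> carrier C" "v \<in> carrier C"
    then show "u \<oplus>\<^bsub>C\<^esub> v = v \<oplus>\<^bsub>C\<^esub> u"
      by (intro ext) (simp add: C_ops C_closed Q.a_comm)
  qed (use cl in \<open>auto simp: C_ops C_closed Q.a_assoc intro!: ext\<close>)
  show "comm_monoid C"
  proof (rule comm_monoidI)
    show "\<one>\<^bsub>C\<^esub> \<in> carrier C" by (rule C_I[of "\<lambda>_. \<one>"]) (auto simp: C_ops Q_zero)
  next
    fix u v assume "u \<in> carrier C" "v \<in> carrier C"
    then show "u \<otimes>\<^bsub>C\<^esub> v = v \<otimes>\<^bsub>C\<^esub> u"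
      by (intro ext) (simp add: C_ops C_closed Q.m_comm)
  qed (use cl in \<open>auto simp: C_ops C_closed Q.m_assoc intro!: ext\<close>)
  fix u v w assume "u \<in> carrier C" "v \<in> carrier C" "w \<in> carrier C"
  then show "(u \<oplus>\<^bsub>C\<^esub> v) \<otimes>\<^bsub>C\<^esub> w = u \<otimes>\<^bsub>C\<^esub> w \<oplus>\<^bsub>C\<^esub> v \<otimes>\<^bsub>C\<^esub> w"
    by (intro ext) (simp add: C_ops C_closed Q.l_distr)
qed

sublocale C: cring C by (rule cring_C)

lemma to_completion_hom: "to_completion R I \<in> ring_hom R C"
proof (rule ring_hom_memI)
  fix x assume x: "x \<in> carrier R"
  show "to_completion R I x \<in> carrier C"
    by (rule C_I[of "\<lambda>_. x"]) (use x in \<open>auto simp: to_completion_def\<close>)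
  fix y assume y: "y \<in> carrier R"
  show "to_completion R I (x \<otimes> y) = to_completion R I x \<otimes>\<^bsub>C\<^esub> to_completion R I y"
    "to_completion R I (x \<oplus> y) = to_completion R I x \<oplus>\<^bsub>C\<^esub> to_completion R I y"
    using x y by (intro ext, simp add: C_ops to_completion_def Ip.quot_ops)+
qed (intro ext, simp add: C_ops to_completion_def Q_zero)

end

section \<open>Maps between completions induced by additive maps\<close>

locale adic_pair = R: adic R I + S: adic S J
  for R :: "('r, 'x) ring_scheme" and I and S :: "('s, 'y) ring_scheme" and J
begin

text \<open>Multiplicativity is left out so that derivations qualify as well as ring
  homomorphisms.\<close>

definition adic_map :: "('r \<Rightarrow> 's) \<Rightarrow> bool" where
  "adic_map f \<longleftrightarrow> abelian_group_hom R S f \<and> (\<forall>m. \<forall>x\<in>R.Ip m. f x \<in> S.Ip m)"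

abbreviation "cmap \<equiv> completion_map S J"

lemma cmap_coset:
  assumes "adic_map f" "x \<in> carrier R" "u m = R.Ip m +>\<^bsub>R\<^esub> x"
  shows "cmap f u m = S.Ip m +>\<^bsub>S\<^esub> f x"
  using assms coset_map_coset[OF R.Ip.ideal_axioms S.Ip.ideal_axioms, of f m m x]
  by (simp add: completion_map_def adic_map_def)

lemma cmap_additive:
  assumes f: "adic_map f"
  shows "abelian_group_hom R.C S.C (cmap f)"
proof (rule abelian_group_homI')
  interpret f: abelian_group_hom R S f using f by (simp add: adic_map_def)
  interpret q: abelian_group_hom "R Quot R.Ip m" "S Quot S.Ip m" "coset_map S (S.Ip m) f" for m
    by (rule coset_map_additive[OF R.Ip.ideal_axioms S.Ip.ideal_axioms]) (use f in \<open>auto simp: adic_map_def\<close>)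
  fix u assume u: "u \<in> carrier R.C"
  then obtain x where x: "\<And>m. x m \<in> carrier R" "\<And>m. u m = R.Ip m +>\<^bsub>R\<^esub> x m" "\<And>m. R.Ip m +>\<^bsub>R\<^esub> x (Suc m) = R.Ip m +>\<^bsub>R\<^esub> x m"
    using R.C_rep by blast
  have cm: "cmap f u m = S.Ip m +>\<^bsub>S\<^esub> f (x m)" for m
    by (rule cmap_coset[OF f x(1) x(2)])
  have "S.Ip m +>\<^bsub>S\<^esub> f (x (Suc m)) = S.Ip m +>\<^bsub>S\<^esub> f (x m)" for m
    using x(3)[of m] cmap_coset[OF f x(1), of "\<lambda>k. R.Ip k +>\<^bsub>R\<^esub> x m" m m]
      cmap_coset[OF f x(1), of "\<lambda>k. R.Ip k +>\<^bsub>R\<^esub> x (Suc m)" m "Suc m"]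
    by (simp add: completion_map_def)
  then show "cmap f u \<in> carrier S.C"
    using x cm by (intro S.C_I[of "\<lambda>m. f (x m)"]) auto
  show "cmap f (u \<oplus>\<^bsub>R.C\<^esub> v) = cmap f u \<oplus>\<^bsub>S.C\<^esub> cmap f v" if "v \<in> carrier R.C" for v
    using u that by (intro ext) (simp add: completion_map_def R.C_ops S.C_ops R.C_closed)
qed (auto simp: R.C.abelian_group_axioms S.C.abelian_group_axioms)

lemma cmap_ring_hom:
  assumes f: "adic_map f" "f \<in> ring_hom R S"
  shows "cmap f \<in> ring_hom R.C S.C"
proof (rule ring_hom_memI)
  interpret c: abelian_group_hom R.C S.C "cmap f" by (rule cmap_additive[OF f(1)])
  have q: "coset_map S (S.Ip m) f \<in> ring_hom (R Quot R.Ip m) (S Quot S.Ip m)" for m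
    by (rule coset_map_ring_hom[OF R.Ip.ideal_axioms S.Ip.ideal_axioms f(2)]) (use f in \<open>auto simp: adic_map_def\<close>)
  show "cmap f \<one>\<^bsub>R.C\<^esub> = \<one>\<^bsub>S.C\<^esub>"
    by (intro ext) (simp add: ring_hom_one[OF q] completion_map_def R.C_ops S.C_ops)
  fix u v assume "u \<in> carrier R.C" "v \<in> carrier R.C"
  then show "cmap f u \<in> carrier S.C" "cmap f (u \<oplus>\<^bsub>R.C\<^esub> v) = cmap f u \<oplus>\<^bsub>S.C\<^esub> cmap f v"
    by auto
  show "cmap f (u \<otimes>\<^bsub>R.C\<^esub> v) = cmap f u \<otimes>\<^bsub>S.C\<^esub> cmap f v"
    using \<open>u \<in> _\<close> \<open>v \<in> _\<close>
    by (intro ext) (simp add: ring_hom_mult[OF q] completion_map_def R.C_ops S.C_ops R.C_closed)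
qed

lemma cmap_to_completion:
  "adic_map f \<Longrightarrow> x \<in> carrier R \<Longrightarrow> cmap f (to_completion R I x) = to_completion S J (f x)"
  by (intro ext) (simp add: cmap_coset to_completion_def)

end

lemma cmap_comp:
  assumes "adic_pair R I S J" "adic_pair S J T K" "adic_pair.adic_map R I S J f" "adic_pair.adic_map S J T K g"
    "u \<in> carrier (adic_completion R I)"
  shows "completion_map T K g (completion_map S J f u) = completion_map T K (\<lambda>x. g (f x)) u"
proof -
  interpret f: adic_pair R I S J by fact
  interpret g: adic_pair S J T K by fact
  interpret h: adic_pair R I T K ..
  have h: "h.adic_map (\<lambda>x. g (f x))"
    using assms(3,4) abelian_group_hom_comp[of R S f T g]
    by (simp add: f.adic_map_def g.adic_map_def h.adic_map_def)
  interpret fh: abelian_group_hom R S f using assms(3) by (simp add: f.adic_map_def)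
  obtain x where x: "\<And>m. x m \<in> carrier R" "\<And>m. u m = f.R.Ip m +>\<^bsub>R\<^esub> x m"
      "\<And>m. f.R.Ip m +>\<^bsub>R\<^esub> x (Suc m) = f.R.Ip m +>\<^bsub>R\<^esub> x m"
    using f.R.C_rep[OF assms(5)] by blast
  show ?thesis
  proof
    fix m
    have "completion_map S J f u m = f.S.Ip m +>\<^bsub>S\<^esub> f (x m)"
      using f.cmap_coset[of f "x m" u m] assms(3) x(1,2) by simp
    then show "completion_map T K g (completion_map S J f u) m = completion_map T K (\<lambda>x. g (f x)) u m"
      using g.cmap_coset[OF assms(4), of "f (x m)" "completion_map S J f u" m] h.cmap_coset[of "\<lambda>x. g (f x)" "x m" u m] h x(1,2)
      by simp
  qed
qed

lemma cmap_cong: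
  assumes "adic_pair R I S J" "adic_pair.adic_map R I S J f" "adic_pair.adic_map R I S J g"
    "\<And>x. x \<in> carrier R \<Longrightarrow> f x = g x" "u \<in> carrier (adic_completion R I)"
  shows "completion_map S J f u = completion_map S J g u"
proof -
  interpret f: adic_pair R I S J by fact
  obtain x where x: "\<And>m. x m \<in> carrier R" "\<And>m. u m = f.R.Ip m +>\<^bsub>R\<^esub> x m"
      "\<And>m. f.R.Ip m +>\<^bsub>R\<^esub> x (Suc m) = f.R.Ip m +>\<^bsub>R\<^esub> x m"
    using f.R.C_rep[OF assms(5)] by blast
  show ?thesis
  proof
    fix m
    show "completion_map S J f u m = completion_map S J g u m"
      using f.cmap_coset[of f "x m" u m] f.cmap_coset[of g "x m" u m] assms x(1,2) by simp
  qed
qed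

section \<open>Infinitesimal neighbourhoods\<close>

lemma (in cring) p_adic: "adic R (p_ideal p R)"
  by (intro adic.intro p_ideal_ideal is_cring)

lemma p_adic_pair: "cring R \<Longrightarrow> cring S \<Longrightarrow> adic_pair R (p_ideal p R) S (p_ideal p S)"
  by (intro adic_pair.intro cring.p_adic)

lemma p_adic_map:
  assumes "cring R" "cring S" "abelian_group_hom R S f"
  shows "adic_pair.adic_map R (p_ideal p R) S (p_ideal p S) f"
  unfolding adic_pair.adic_map_def[OF p_adic_pair[OF assms(1,2)]]
  using assms by (auto intro: p_power_additive)

text \<open>T stands for A \<otimes> A or A \<otimes> A \<otimes> A, \<mu> for multiplication and s
  for the inclusion of the first factor. The section s and the completeness of A together split the
  augmentation of the completion of T.\<close>

locale augmented = T: cring T + A: cring A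
  for p :: nat and T :: "('t, 'x) ring_scheme" and A :: "('a, 'y) ring_scheme" and \<mu> and s +
  assumes mu_hom: "\<mu> \<in> ring_hom T A" and s_hom: "s \<in> ring_hom A T"
    and mu_s: "\<And>a. a \<in> carrier A \<Longrightarrow> \<mu> (s a) = a"
    and complete: "adically_complete A (p_ideal p A)"
begin

abbreviation "That \<equiv> p_completion p T"
abbreviation "Ahat \<equiv> p_completion p A"
abbreviation "emb \<equiv> to_completion T (p_ideal p T)"
abbreviation "mu_hat \<equiv> completion_map A (p_ideal p A) \<mu>"
abbreviation "I \<equiv> diag_ideal p T A \<mu>"
abbreviation "D \<equiv> diag_power p T A \<mu>"
abbreviation "N \<equiv> inf_nbhd p T A \<mu>"
abbreviation "cls \<equiv> nbhd_class p T A \<mu>"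

sublocale TA: adic_pair T "p_ideal p T" A "p_ideal p A"
  by (rule p_adic_pair) (rule T.is_cring A.is_cring)+

sublocale That: cring That
  unfolding p_completion_def by (rule TA.R.cring_C)

sublocale Ahat: cring Ahat
  unfolding p_completion_def by (rule TA.S.cring_C)

lemma mu_additive: "abelian_group_hom T A \<mu>"
  by (rule ring_hom_additive[OF T.ring_axioms A.ring_axioms mu_hom])

lemma mu_adic: "TA.adic_map \<mu>"
  by (rule p_adic_map[OF T.is_cring A.is_cring mu_additive])

lemma mu_hat_hom: "mu_hat \<in> ring_hom That Ahat"
  unfolding p_completion_def by (rule TA.cmap_ring_hom) (rule mu_adic mu_hom)+

sublocale mu_hat: ring_hom_ring That Ahat mu_hat
  by (rule ring_hom_ringI2[OF That.ring_axioms Ahat.ring_axioms mu_hat_hom])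

sublocale I: ideal I That
  unfolding diag_ideal_def by (rule mu_hat.kernel_is_ideal)

declare I.a_Hcarr [simp del]

lemma I_iff: "u \<in> I \<longleftrightarrow> u \<in> carrier That \<and> mu_hat u = \<zero>\<^bsub>Ahat\<^esub>"
  unfolding diag_ideal_def a_kernel_def kernel_def by simp

sublocale D: ideal "D n" That for n
  unfolding diag_power_def by (rule That.ideal_power_ideal) (rule I.ideal_axioms)

declare D.a_Hcarr [simp del]

lemma D_1: "D (Suc 0) = I"
  unfolding diag_power_def by (rule That.ideal_power_1) (rule I.ideal_axioms)

lemma D_antimono: "m \<le> n \<Longrightarrow> D n \<subseteq> D m"
  unfolding diag_power_def by (rule That.ideal_power_antimono) (rule I.ideal_axioms)

lemma D_mult: "u \<in> D m \<Longrightarrow> v \<in> D n \<Longrightarrow> u \<otimes>\<^bsub>That\<^esub> v \<in> D (m + n)"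
  unfolding diag_power_def by (rule That.ideal_power_mult) (rule I.ideal_axioms)

lemma N_eq: "N n = That Quot D (Suc n)"
  by (simp add: inf_nbhd_def)

sublocale N: cring "N n" for n
  unfolding N_eq by (rule D.quotient_is_cring) (rule That.is_cring)

lemma emb_hom: "emb \<in> ring_hom T That"
  unfolding p_completion_def by (rule TA.R.to_completion_hom)

lemma emb_closed [simp]: "t \<in> carrier T \<Longrightarrow> emb t \<in> carrier That"
  by (rule ring_hom_closed[OF emb_hom])

definition proj :: "nat \<Rightarrow> (nat \<Rightarrow> 't set) \<Rightarrow> (nat \<Rightarrow> 't set) set" where
  "proj n u = D (Suc n) +>\<^bsub>That\<^esub> u"

lemma proj_hom: "proj n \<in> ring_hom That (N n)"
  unfolding N_eq proj_def by (rule D.rcos_ring_hom)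

sublocale proj: ring_hom_cring That "N n" "proj n" for n
  by unfold_locales (rule proj_hom)

lemma N_cases:
  assumes "X \<in> carrier (N n)" obtains u where "u \<in> carrier That" "X = proj n u"
  using assms by (auto simp: N_eq D.carrier_Quot proj_def)

lemma proj_eq_iff: "u \<in> carrier That \<Longrightarrow> v \<in> carrier That \<Longrightarrow> proj n u = proj n v \<longleftrightarrow> u \<ominus>\<^bsub>That\<^esub> v \<in> D (Suc n)"
  unfolding proj_def by (rule That.coset_eq_iff) (rule D.ideal_axioms)

lemma proj_zero_iff: "u \<in> carrier That \<Longrightarrow> proj n u = \<zero>\<^bsub>N n\<^esub> \<longleftrightarrow> u \<in> D (Suc n)"
  using proj_eq_iff[of u "\<zero>\<^bsub>That\<^esub>" n] by (simp add: That.minus_eq)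

lemma cls_eq: "cls n t = proj n (emb t)"
  by (simp add: nbhd_class_def proj_def)

lemma cls_hom: "cls n \<in> ring_hom T (N n)"
proof -
  have "(\<lambda>t. proj n (emb t)) \<in> ring_hom T (N n)"
    using ring_hom_trans[OF emb_hom proj_hom] by (simp add: comp_def)
  then show ?thesis by (simp add: cls_eq[abs_def])
qed

sublocale cls: ring_hom_cring T "N n" "cls n" for n
  by unfold_locales (rule cls_hom)

lemma mu_hat_emb: "t \<in> carrier T \<Longrightarrow> mu_hat (emb t) = to_completion A (p_ideal p A) (\<mu> t)"
  by (rule TA.cmap_to_completion[OF mu_adic])

lemma emb_I: "t \<in> carrier T \<Longrightarrow> \<mu> t = \<zero>\<^bsub>A\<^esub> \<Longrightarrow> emb t \<in> I"
proof -
  have "to_completion A (p_ideal p A) \<zero>\<^bsub>A\<^esub> = \<zero>\<^bsub>Ahat\<^esub>"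
    using TA.S.to_completion_hom A.ring_axioms Ahat.ring_axioms
    unfolding p_completion_def by (rule ring_hom_zero)
  then show "t \<in> carrier T \<Longrightarrow> \<mu> t = \<zero>\<^bsub>A\<^esub> \<Longrightarrow> emb t \<in> I"
    by (simp add: I_iff mu_hat_emb)
qed

text \<open>By completeness the augmentation of u comes from some a in A; then u and s a have the
  same augmentation and differ by an element of its kernel.\<close>

lemma decomp:
  assumes "u \<in> carrier That"
  obtains a where "a \<in> carrier A" "u \<ominus>\<^bsub>That\<^esub> emb (s a) \<in> I"
proof -
  have "mu_hat u \<in> carrier Ahat" using assms by simp
  then have "mu_hat u \<in> to_completion A (p_ideal p A) ` carrier A"
    using complete by (simp add: adically_complete_def bij_betw_def p_completion_def)
  then obtain a where a: "a \<in> carrier A" "mu_hat u = to_completion A (p_ideal p A) a"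
    by (rule imageE)
  have s: "s a \<in> carrier T" using a s_hom by (auto simp: ring_hom_def)
  have "u \<ominus>\<^bsub>That\<^esub> emb (s a) \<in> I"
    using assms a s ring_hom_closed[OF mu_hat_hom assms] by (simp add: I_iff That.minus_eq mu_hat_emb mu_s Ahat.r_neg)
  then show ?thesis using a that by blast
qed

text \<open>The augmentation \<open>X\<^sup>n \<leftarrow> X\<close>: the retraction of \<open>s\<close> with kernel \<open>I\<close>.\<close>

definition aug :: "(nat \<Rightarrow> 't set) set \<Rightarrow> 'a" where
  "aug X = the_elem ((\<lambda>u. inv_into (carrier A) (to_completion A (p_ideal p A)) (mu_hat u)) ` X)"

lemma aug_proj_hom: "(\<lambda>u. inv_into (carrier A) (to_completion A (p_ideal p A)) (mu_hat u)) \<in> ring_hom That A"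
proof -
  define \<iota> where "\<iota> = to_completion A (p_ideal p A)"
  have b: "bij_betw \<iota> (carrier A) (carrier Ahat)"
    using complete by (simp add: adically_complete_def p_completion_def \<iota>_def)
  have h: "\<iota> \<in> ring_hom A Ahat"
    unfolding \<iota>_def p_completion_def by (rule TA.S.to_completion_hom)
  have "inv_into (carrier A) \<iota> \<in> ring_hom Ahat A"
  proof -
    have "\<iota> \<in> ring_iso A Ahat" using b h by (simp add: ring_iso_def)
    then show ?thesis using ring_iso_set_sym[OF A.ring_axioms] by (auto simp: ring_iso_def)
  qed
  from ring_hom_trans[OF mu_hat_hom this] show ?thesis by (simp add: comp_def \<iota>_def)
qed

text \<open>The power of the diagonal ideal that is divided out lies in the kernel of the completed
  augmentation, so the value is the same on the whole class.\<close>

lemma aug_proj: "u \<in> carrier That \<Longrightarrow>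
  aug (proj n u) = inv_into (carrier A) (to_completion A (p_ideal p A)) (mu_hat u)"
proof -
  assume u: "u \<in> carrier That"
  define g where "g = (\<lambda>u. inv_into (carrier A) (to_completion A (p_ideal p A)) (mu_hat u))"
  have g: "abelian_group_hom That A g"
    unfolding g_def by (rule ring_hom_additive[OF That.ring_axioms A.ring_axioms aug_proj_hom])
  have emb0: "to_completion A (p_ideal p A) \<zero>\<^bsub>A\<^esub> = \<zero>\<^bsub>Ahat\<^esub>"
    using TA.S.to_completion_hom A.ring_axioms Ahat.ring_axioms
    unfolding p_completion_def by (rule ring_hom_zero)
  have inj: "inj_on (to_completion A (p_ideal p A)) (carrier A)"
    using complete by (simp add: adically_complete_def bij_betw_def)
  have "g i = \<zero>\<^bsub>A\<^esub>" if "i \<in> D (Suc n)" for i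
  proof -
    have "i \<in> I" using that D_antimono[of "Suc 0" "Suc n"] by (auto simp: D_1)
    then show ?thesis using inv_into_f_f[OF inj, of "\<zero>\<^bsub>A\<^esub>"] by (simp add: I_iff g_def emb0)
  qed
  then have "g ` proj n u = {g u}" unfolding proj_def by (intro D.coset_image[OF g _ u])
  then show ?thesis by (simp add: aug_def g_def)
qed

lemma aug_hom: "aug \<in> ring_hom (N n) A"
proof (rule ring_hom_memI)
  fix X Y assume "X \<in> carrier (N n)" "Y \<in> carrier (N n)"
  then obtain u v where u: "u \<in> carrier That" "X = proj n u" and v: "v \<in> carrier That" "Y = proj n v"
    by (meson N_cases)
  show "aug X \<in> carrier A" using u ring_hom_closed[OF aug_proj_hom] by (simp add: aug_proj)
  show "aug (X \<otimes>\<^bsub>N n\<^esub> Y) = aug X \<otimes>\<^bsub>A\<^esub> aug Y" "aug (X \<oplus>\<^bsub>N n\<^esub> Y) = aug X \<oplus>\<^bsub>A\<^esub> aug Y"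
    using u v ring_hom_mult[OF aug_proj_hom, of u v] ring_hom_add[OF aug_proj_hom, of u v]
    by (simp_all add: aug_proj flip: proj.hom_mult proj.hom_add)
next
  show "aug \<one>\<^bsub>N n\<^esub> = \<one>\<^bsub>A\<^esub>"
    using ring_hom_one[OF aug_proj_hom] by (simp add: aug_proj flip: proj.hom_one)
qed

lemma aug_cls: "t \<in> carrier T \<Longrightarrow> aug (cls n t) = \<mu> t"
proof -
  assume t: "t \<in> carrier T"
  have inj: "inj_on (to_completion A (p_ideal p A)) (carrier A)"
    using complete by (simp add: adically_complete_def bij_betw_def)
  show ?thesis
    using t inv_into_f_f[OF inj] ring_hom_closed[OF mu_hom t] by (simp add: cls_eq aug_proj mu_hat_emb)
qed

end

section \<open>Functoriality of the neighbourhoods for maps compatible with the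
  augmentations\<close>

locale aug_map = X: augmented p T A \<mu> s + Y: augmented p T' A \<mu>' s'
  for p and T :: "('t, 'x) ring_scheme" and A :: "('a, 'y) ring_scheme" and \<mu> s
    and T' :: "('u, 'z) ring_scheme" and \<mu>' s' +
  fixes f
  assumes f_hom: "f \<in> ring_hom T T'" and mu_f: "\<And>t. t \<in> carrier T \<Longrightarrow> \<mu>' (f t) = \<mu> t"
begin

definition "f_hat = completion_map T' (p_ideal p T') f"
definition "nbm m = coset_map (p_completion p T') (diag_power p T' A \<mu>' (Suc m)) f_hat"

sublocale TT: adic_pair T "p_ideal p T" T' "p_ideal p T'"
  by (rule p_adic_pair) (rule X.T.is_cring Y.T.is_cring)+

lemma f_additive: "abelian_group_hom T T' f"
  by (rule ring_hom_additive[OF X.T.ring_axioms Y.T.ring_axioms f_hom])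

lemma f_adic: "TT.adic_map f"
  by (rule p_adic_map[OF X.T.is_cring Y.T.is_cring f_additive])

lemma f_hat_hom: "f_hat \<in> ring_hom X.That Y.That"
  unfolding p_completion_def f_hat_def by (rule TT.cmap_ring_hom) (rule f_adic f_hom)+

text \<open>The diagonal ideals are kernels of completed augmentations. As f commutes with the
  augmentations and completion respects composition, the completed map commutes with the completed
  ones.\<close>

lemma f_hat_I:
  assumes "u \<in> X.I" shows "f_hat u \<in> Y.I"
proof -
  have u: "u \<in> carrier X.That" "X.mu_hat u = \<zero>\<^bsub>X.Ahat\<^esub>" using assms by (auto simp: X.I_iff)
  have comp: "adic_pair.adic_map T (p_ideal p T) A (p_ideal p A) (\<lambda>x. \<mu>' (f x))"
    by (rule p_adic_map[OF X.T.is_cring X.A.is_cring abelian_group_hom_comp[OF f_additive Y.mu_additive]])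
  have "Y.mu_hat (f_hat u) = completion_map A (p_ideal p A) (\<lambda>x. \<mu>' (f x)) u"
    unfolding f_hat_def
    by (rule cmap_comp[OF TT.adic_pair_axioms Y.TA.adic_pair_axioms f_adic Y.mu_adic])
       (use u in \<open>simp add: p_completion_def\<close>)
  also have "\<dots> = X.mu_hat u"
    by (rule cmap_cong[OF X.TA.adic_pair_axioms comp X.mu_adic])
       (use u mu_f in \<open>simp_all add: p_completion_def\<close>)
  finally show ?thesis using u ring_hom_closed[OF f_hat_hom] by (simp add: Y.I_iff)
qed

lemma f_hat_D: "u \<in> X.D m \<Longrightarrow> f_hat u \<in> Y.D m"
  unfolding diag_power_def
  by (rule ideal_power_hom[OF X.That.ring_axioms Y.That.ring_axioms f_hat_hom X.I.ideal_axioms])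
     (auto simp: f_hat_I)

lemma nbm_hom: "nbm m \<in> ring_hom (X.N m) (Y.N m)"
  unfolding nbm_def X.N_eq Y.N_eq
  by (rule coset_map_ring_hom[OF X.D.ideal_axioms Y.D.ideal_axioms f_hat_hom f_hat_D])

lemma nbm_proj: "u \<in> carrier X.That \<Longrightarrow> nbm m (X.proj m u) = Y.proj m (f_hat u)"
  unfolding nbm_def X.proj_def Y.proj_def
  by (rule coset_map_coset)
     (rule X.D.ideal_axioms Y.D.ideal_axioms ring_hom_additive[OF X.That.ring_axioms Y.That.ring_axioms f_hat_hom]
       f_hat_D | assumption)+

lemma f_hat_emb: "t \<in> carrier T \<Longrightarrow> f_hat (X.emb t) = Y.emb (f t)"
  unfolding f_hat_def by (rule TT.cmap_to_completion[OF f_adic])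

lemma nbm_cls: "t \<in> carrier T \<Longrightarrow> nbm m (X.cls m t) = Y.cls m (f t)"
  by (simp add: X.cls_eq Y.cls_eq nbm_proj f_hat_emb)

end

section \<open>Restriction to smaller neighbourhoods\<close>

context augmented
begin

definition "res m = coset_map That (D (Suc m)) id"

lemma res_proj: "m \<le> n \<Longrightarrow> u \<in> carrier That \<Longrightarrow> res m (proj n u) = proj m u"
proof -
  assume mn: "m \<le> n" and u: "u \<in> carrier That"
  have "D (Suc n) \<subseteq> D (Suc m)" using mn by (intro D_antimono) simp
  then have "coset_map That (D (Suc m)) id (D (Suc n) +>\<^bsub>That\<^esub> u) = D (Suc m) +>\<^bsub>That\<^esub> id u"
    by (intro coset_map_coset[OF D.ideal_axioms D.ideal_axioms
          ring_hom_additive[OF That.ring_axioms That.ring_axioms id_ring_hom] _ u]) (metis id_apply subsetD)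
  then show ?thesis by (simp add: res_def proj_def)
qed

lemma res_hom: "m \<le> n \<Longrightarrow> res m \<in> ring_hom (N n) (N m)"
proof -
  assume mn: "m \<le> n"
  have "D (Suc n) \<subseteq> D (Suc m)" using mn by (intro D_antimono) simp
  then show ?thesis unfolding res_def N_eq
    by (intro coset_map_ring_hom[OF D.ideal_axioms D.ideal_axioms id_ring_hom]) (metis id_apply subsetD)
qed

lemma res_cls: "m \<le> n \<Longrightarrow> t \<in> carrier T \<Longrightarrow> res m (cls n t) = cls m t"
  by (simp add: cls_eq res_proj)

end

section \<open>Derivations on the neighbourhoods\<close>

locale aug_derivation = augmented +
  fixes \<delta>
  assumes d_additive: "abelian_group_hom T T \<delta>"
    and d_mult: "\<And>x y. x \<in> carrier T \<Longrightarrow> y \<in> carrier T \<Longrightarrow>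
      \<delta> (x \<otimes>\<^bsub>T\<^esub> y) = x \<otimes>\<^bsub>T\<^esub> \<delta> y \<oplus>\<^bsub>T\<^esub> \<delta> x \<otimes>\<^bsub>T\<^esub> y"
begin

definition "d_hat = completion_map T (p_ideal p T) \<delta>"
definition "nbd m = coset_map That (D (Suc m)) d_hat"

sublocale TT: adic_pair T "p_ideal p T" T "p_ideal p T"
  by (rule p_adic_pair) (rule T.is_cring)+

lemma d_adic: "TT.adic_map \<delta>"
  by (rule p_adic_map[OF T.is_cring T.is_cring d_additive])

lemma d_hat_additive: "abelian_group_hom That That d_hat"
  unfolding p_completion_def d_hat_def by (rule TT.cmap_additive) (rule d_adic)

sublocale d_hat: abelian_group_hom That That d_hat
  by (rule d_hat_additive)

text \<open>Equality in the completion is tested modulo each power of (p), where both factors have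
  representatives in T.\<close>

lemma d_hat_mult:
  assumes "u \<in> carrier That" "v \<in> carrier That"
  shows "d_hat (u \<otimes>\<^bsub>That\<^esub> v) = u \<otimes>\<^bsub>That\<^esub> d_hat v \<oplus>\<^bsub>That\<^esub> d_hat u \<otimes>\<^bsub>That\<^esub> v"
proof
  fix m
  interpret d: abelian_group_hom T T \<delta> by (rule d_additive)
  have uv: "u \<in> carrier TA.R.C" "v \<in> carrier TA.R.C" using assms by (simp_all add: p_completion_def)
  obtain x where x: "x \<in> carrier T" "u m = TA.R.Ip m +>\<^bsub>T\<^esub> x"
    using TA.R.C_closed[OF uv(1), of m] unfolding TA.R.Ip.carrier_Quot by blast
  obtain y where y: "y \<in> carrier T" "v m = TA.R.Ip m +>\<^bsub>T\<^esub> y"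
    using TA.R.C_closed[OF uv(2), of m] unfolding TA.R.Ip.carrier_Quot by blast
  have "(u \<otimes>\<^bsub>TA.R.C\<^esub> v) m = TA.R.Ip m +>\<^bsub>T\<^esub> (x \<otimes>\<^bsub>T\<^esub> y)"
    using x y by (simp add: TA.R.C_ops TA.R.Ip.quot_ops)
  then have "d_hat (u \<otimes>\<^bsub>TA.R.C\<^esub> v) m = TA.R.Ip m +>\<^bsub>T\<^esub> \<delta> (x \<otimes>\<^bsub>T\<^esub> y)"
    unfolding d_hat_def using x y by (intro TT.cmap_coset[OF d_adic]) simp_all
  moreover have "d_hat u m = TA.R.Ip m +>\<^bsub>T\<^esub> \<delta> x" "d_hat v m = TA.R.Ip m +>\<^bsub>T\<^esub> \<delta> y"
    unfolding d_hat_def by (rule TT.cmap_coset[OF d_adic], fact+)+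
  ultimately show "d_hat (u \<otimes>\<^bsub>That\<^esub> v) m = (u \<otimes>\<^bsub>That\<^esub> d_hat v \<oplus>\<^bsub>That\<^esub> d_hat u \<otimes>\<^bsub>That\<^esub> v) m"
    using x y by (simp add: p_completion_def TA.R.C_ops TA.R.Ip.quot_ops d_mult)
qed

text \<open>By the Leibniz rule a derivation lowers the order of vanishing along the diagonal by at
  most one, even when it is unrelated to \<mu>. Therefore it maps the ring of the (m+1)-st
  neighbourhood to that of the m-th, and one level is lost.\<close>

lemma d_hat_D: "u \<in> D (Suc k) \<Longrightarrow> d_hat u \<in> D k"
proof (induction k arbitrary: u)
  case 0
  then show ?case using D.Icarr[of u "Suc 0"] by (simp add: diag_power_def)
next
  case (Suc k)
  from Suc.prems have "u \<in> ideal_prod That I (D (Suc k))" by (simp add: diag_power_def ideal_power.simps(2)[of _ _ "Suc k"])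
  then have "d_hat u \<in> D (Suc k) \<and> u \<in> carrier That"
  proof (induction rule: ideal_prod.induct)
    case (prod i j)
    have c: "i \<in> carrier That" "j \<in> carrier That" using prod I.Icarr[of i] D.Icarr[of j "Suc k"] by simp_all
    have "i \<otimes>\<^bsub>That\<^esub> d_hat j \<in> D (Suc k)"
      using D_mult[of i 1 "d_hat j" k] prod Suc.IH by (simp add: D_1)
    moreover have "d_hat i \<otimes>\<^bsub>That\<^esub> j \<in> D (Suc k)"
      using prod c by (intro D.I_l_closed) simp_all
    ultimately show ?case using c by (simp add: d_hat_mult D.a_closed)
  next
    case (sum a b)
    then show ?case by (simp add: D.a_closed)
  qed
  then show ?case by simp
qed

lemma nbd_additive: "abelian_group_hom (N (Suc m)) (N m) (nbd m)"
  unfolding nbd_def N_eq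
  by (rule coset_map_additive[OF D.ideal_axioms D.ideal_axioms d_hat_additive d_hat_D])

lemma nbd_proj: "u \<in> carrier That \<Longrightarrow> nbd m (proj (Suc m) u) = proj m (d_hat u)"
  unfolding nbd_def proj_def
  by (rule coset_map_coset[OF D.ideal_axioms D.ideal_axioms d_hat_additive d_hat_D])

lemma nbd_mult:
  assumes "X \<in> carrier (N (Suc m))" "Y \<in> carrier (N (Suc m))"
  shows "nbd m (X \<otimes>\<^bsub>N (Suc m)\<^esub> Y) = res m X \<otimes>\<^bsub>N m\<^esub> nbd m Y \<oplus>\<^bsub>N m\<^esub> nbd m X \<otimes>\<^bsub>N m\<^esub> res m Y"
proof -
  obtain u v where u: "u \<in> carrier That" "X = proj (Suc m) u" and v: "v \<in> carrier That" "Y = proj (Suc m) v"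
    using assms by (meson N_cases)
  show ?thesis
    using u v by (simp add: nbd_proj res_proj d_hat_mult flip: proj.hom_mult)
qed

lemma nbd_cls: "t \<in> carrier T \<Longrightarrow> nbd m (cls (Suc m) t) = cls m (\<delta> t)"
  using TT.cmap_to_completion[OF d_adic, of t] by (simp add: cls_eq nbd_proj d_hat_def)

end

section \<open>Base change\<close>

text \<open>\<open>free_Abelian_group\<close> is a multiplicatively written group; this is the same
  group in additive form, so that the theory of additive maps applies to it.\<close>

definition frag_ring :: "'s set \<Rightarrow> ('s \<Rightarrow>\<^sub>0 int) ring" where
  "frag_ring S = \<lparr>carrier = {x. Poly_Mapping.keys x \<subseteq> S}, monoid.mult = undefined, one = undefined,
     zero = 0, add = (+)\<rparr>"

lemma frag_ring_simps [simp]: "x \<in> carrier (frag_ring S) \<longleftrightarrow> Poly_Mapping.keys x \<subseteq> S"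
  "\<zero>\<^bsub>frag_ring S\<^esub> = 0" "x \<oplus>\<^bsub>frag_ring S\<^esub> y = x + y"
  by (simp_all add: frag_ring_def)

lemma add_monoid_frag_ring: "add_monoid (frag_ring S) = free_Abelian_group S"
  by (simp add: frag_ring_def free_Abelian_group_def)

lemma frag_ring: "abelian_group (frag_ring S)"
  by (rule comm_group_abelian_groupI) (simp only: add_monoid_frag_ring abelian_free_Abelian_group)

lemma minus_frag_ring:
  "Poly_Mapping.keys x \<subseteq> S \<Longrightarrow> Poly_Mapping.keys y \<subseteq> S \<Longrightarrow> x \<ominus>\<^bsub>frag_ring S\<^esub> y = x - y"
  by (simp only: a_minus_def a_inv_def add_monoid_frag_ring) simp

locale base_extension = A: cring A + B: cring B + M: module A M
  for A :: "('a, 'x) ring_scheme" and B :: "('b, 'y) ring_scheme" and \<phi> and M :: "('a, 'm, 'z) module_scheme" +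
  assumes phi_hom: "\<phi> \<in> ring_hom A B"
begin

abbreviation "S \<equiv> carrier B \<times> carrier M"
abbreviation "F \<equiv> free_Abelian_group S"
abbreviation "H \<equiv> bc_subgroup A B \<phi> M"
abbreviation "BC \<equiv> base_change A B \<phi> M"
abbreviation "pure \<equiv> bc_pure A B \<phi> M"
abbreviation "\<kappa> \<equiv> bc_coset A B \<phi> M"

lemma phi_closed [simp]: "a \<in> carrier A \<Longrightarrow> \<phi> a \<in> carrier B"
  by (rule ring_hom_closed[OF phi_hom])

definition relators :: "(('b \<times> 'm) \<Rightarrow>\<^sub>0 int) set" where
  "relators = ({frag_of (b \<oplus>\<^bsub>B\<^esub> b', m) - frag_of (b, m) - frag_of (b', m) | b b' m.
         b \<in> carrier B \<and> b' \<in> carrier B \<and> m \<in> carrier M} \<union>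
      {frag_of (b, m \<oplus>\<^bsub>M\<^esub> m') - frag_of (b, m) - frag_of (b, m') | b m m'.
         b \<in> carrier B \<and> m \<in> carrier M \<and> m' \<in> carrier M} \<union>
      {frag_of (b \<otimes>\<^bsub>B\<^esub> \<phi> a, m) - frag_of (b, a \<odot>\<^bsub>M\<^esub> m) | b a m.
         b \<in> carrier B \<and> a \<in> carrier A \<and> m \<in> carrier M})"

lemma relatorsI:
  "b \<in> carrier B \<Longrightarrow> b' \<in> carrier B \<Longrightarrow> m \<in> carrier M \<Longrightarrow>
    frag_of (b \<oplus>\<^bsub>B\<^esub> b', m) - (frag_of (b, m) + frag_of (b', m)) \<in> relators"
  "b \<in> carrier B \<Longrightarrow> m \<in> carrier M \<Longrightarrow> m' \<in> carrier M \<Longrightarrow>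
    frag_of (b, m \<oplus>\<^bsub>M\<^esub> m') - (frag_of (b, m) + frag_of (b, m')) \<in> relators"
  "b \<in> carrier B \<Longrightarrow> a \<in> carrier A \<Longrightarrow> m \<in> carrier M \<Longrightarrow>
    frag_of (b \<otimes>\<^bsub>B\<^esub> \<phi> a, m) - frag_of (b, a \<odot>\<^bsub>M\<^esub> m) \<in> relators"
  unfolding diff_diff_eq[symmetric] relators_def by blast+

lemma H_eq: "H = generate F relators"
  by (simp add: bc_subgroup_def relators_def)

lemma keys_closed:
  assumes "Poly_Mapping.keys x \<subseteq> S" "Poly_Mapping.keys y \<subseteq> S"
  shows "Poly_Mapping.keys (x + y) \<subseteq> S" "Poly_Mapping.keys (x - y) \<subseteq> S"
  using assms Poly_Mapping.keys_add[of x y] keys_diff[of x y] by blast+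

lemma keys_of: "b \<in> carrier B \<Longrightarrow> m \<in> carrier M \<Longrightarrow> Poly_Mapping.keys (frag_of (b, m)) \<subseteq> S"
  by (simp add: keys_frag_of)

lemma keys_relators: "r \<in> relators \<Longrightarrow> Poly_Mapping.keys r \<subseteq> S"
  unfolding relators_def
  by (elim UnE CollectE exE conjE; hypsubst; intro keys_closed keys_of; simp)

lemma relators_F: "relators \<subseteq> carrier F"
  using keys_relators by auto

sublocale F: comm_group F
  by (rule abelian_free_Abelian_group)

lemma H_subgroup: "subgroup H F"
  unfolding H_eq by (rule F.generate_is_subgroup) (rule relators_F)

lemma H_normal: "H \<lhd> F"
  by (rule F.normal_iff_subgroup[THEN iffD2, OF H_subgroup])

lemma BC_ops: "carrier BC = carrier (F Mod H)" "X \<oplus>\<^bsub>BC\<^esub> Y = X \<otimes>\<^bsub>F Mod H\<^esub> Y" "\<zero>\<^bsub>BC\<^esub> = \<one>\<^bsub>F Mod H\<^esub>"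
  by (simp_all add: base_change_def Let_def)

lemma abelian_group_BC: "abelian_group BC"
proof (rule abelian_groupI)
  interpret Q: comm_group "F Mod H" by (rule F.abelian_FactGroup[OF H_subgroup])
  fix X assume X: "X \<in> carrier BC"
  then show "\<exists>Y\<in>carrier BC. Y \<oplus>\<^bsub>BC\<^esub> X = \<zero>\<^bsub>BC\<^esub>"
    unfolding BC_ops using Q.l_inv Q.inv_closed by blast
  fix Y assume Y: "Y \<in> carrier BC"
  show "X \<oplus>\<^bsub>BC\<^esub> Y \<in> carrier BC"
    using X Y unfolding BC_ops by (rule Q.m_closed)
  show "\<zero>\<^bsub>BC\<^esub> \<oplus>\<^bsub>BC\<^esub> X = X"
    using X unfolding BC_ops by (rule Q.l_one)
  show "X \<oplus>\<^bsub>BC\<^esub> Y = Y \<oplus>\<^bsub>BC\<^esub> X"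
    using X Y unfolding BC_ops by (rule Q.m_comm)
  show "X \<oplus>\<^bsub>BC\<^esub> Y \<oplus>\<^bsub>BC\<^esub> Z = X \<oplus>\<^bsub>BC\<^esub> (Y \<oplus>\<^bsub>BC\<^esub> Z)" if "Z \<in> carrier BC" for Z
    using X Y that unfolding BC_ops by (rule Q.m_assoc)
next
  interpret Q: comm_group "F Mod H" by (rule F.abelian_FactGroup[OF H_subgroup])
  show "\<zero>\<^bsub>BC\<^esub> \<in> carrier BC" unfolding BC_ops by (rule Q.one_closed)
qed

sublocale BC: abelian_group BC
  by (rule abelian_group_BC)

lemma kappa: "\<kappa> x = H #>\<^bsub>F\<^esub> x"
  by (simp add: bc_coset_def)

lemma carrier_BC: "X \<in> carrier BC \<longleftrightarrow> (\<exists>x. Poly_Mapping.keys x \<subseteq> S \<and> X = \<kappa> x)"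
proof -
  have "X \<in> carrier BC \<longleftrightarrow> X \<in> (\<Union>x\<in>carrier F. {H #>\<^bsub>F\<^esub> x})"
    by (simp only: BC_ops FactGroup_def RCOSETS_def partial_object.simps)
  then show ?thesis
    by (simp only: kappa UN_iff singleton_iff Bex_def carrier_free_Abelian_group_iff)
qed

lemma add_BC: "X \<oplus>\<^bsub>BC\<^esub> Y = X <#>\<^bsub>F\<^esub> Y"
  by (simp add: BC_ops FactGroup_def)

lemma kappa_additive: "abelian_group_hom (frag_ring S) BC \<kappa>"
proof (rule abelian_group_homI')
  fix x y assume "x \<in> carrier (frag_ring S)" "y \<in> carrier (frag_ring S)"
  then show "\<kappa> (x \<oplus>\<^bsub>frag_ring S\<^esub> y) = \<kappa> x \<oplus>\<^bsub>BC\<^esub> \<kappa> y"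
    using normal.rcos_sum[OF H_normal, of x y] by (simp add: add_BC kappa)
qed (use carrier_BC frag_ring abelian_group_BC in auto)

sublocale kappa: abelian_group_hom "frag_ring S" BC \<kappa>
  by (rule kappa_additive)

lemma kappa_diff:
  "Poly_Mapping.keys x \<subseteq> S \<Longrightarrow> Poly_Mapping.keys y \<subseteq> S \<Longrightarrow> \<kappa> (x - y) = \<kappa> x \<ominus>\<^bsub>BC\<^esub> \<kappa> y"
  using kappa.hom_diff[of x y] by (simp add: minus_frag_ring)

lemma kappa_eqI:
  assumes "x - y \<in> relators" "Poly_Mapping.keys x \<subseteq> S" "Poly_Mapping.keys y \<subseteq> S"
  shows "\<kappa> x = \<kappa> y"
proof -
  have "x - y \<in> H" unfolding H_eq using assms(1) by (rule generate.incl)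
  then have "x \<in> H #>\<^bsub>F\<^esub> y" by (force simp: r_coset_def)
  then show ?thesis
    unfolding kappa using F.repr_independence[OF _ _ H_subgroup, of x y] assms by simp
qed

lemma pure_closed [simp]: "b \<in> carrier B \<Longrightarrow> m \<in> carrier M \<Longrightarrow> pure b m \<in> carrier BC"
  by (auto simp: bc_pure_def carrier_BC keys_frag_of intro!: exI[of _ "frag_of (b, m)"])

lemma pure_add_l:
  assumes "b \<in> carrier B" "b' \<in> carrier B" "m \<in> carrier M"
  shows "pure (b \<oplus>\<^bsub>B\<^esub> b') m = pure b m \<oplus>\<^bsub>BC\<^esub> pure b' m"
proof -
  have "pure (b \<oplus>\<^bsub>B\<^esub> b') m = \<kappa> (frag_of (b, m) + frag_of (b', m))"
    unfolding bc_pure_def by (rule kappa_eqI) (use assms in \<open>simp_all add: relatorsI keys_of keys_closed\<close>)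
  then show ?thesis
    using assms kappa.hom_add[of "frag_of (b, m)" "frag_of (b', m)"] by (simp add: bc_pure_def keys_of)
qed

lemma pure_add_r:
  assumes "b \<in> carrier B" "m \<in> carrier M" "m' \<in> carrier M"
  shows "pure b (m \<oplus>\<^bsub>M\<^esub> m') = pure b m \<oplus>\<^bsub>BC\<^esub> pure b m'"
proof -
  have "pure b (m \<oplus>\<^bsub>M\<^esub> m') = \<kappa> (frag_of (b, m) + frag_of (b, m'))"
    unfolding bc_pure_def by (rule kappa_eqI) (use assms in \<open>simp_all add: relatorsI keys_of keys_closed\<close>)
  then show ?thesis
    using assms kappa.hom_add[of "frag_of (b, m)" "frag_of (b, m')"] by (simp add: bc_pure_def keys_of)
qed

lemma pure_smult:
  assumes "b \<in> carrier B" "a \<in> carrier A" "m \<in> carrier M"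
  shows "pure (b \<otimes>\<^bsub>B\<^esub> \<phi> a) m = pure b (a \<odot>\<^bsub>M\<^esub> m)"
  unfolding bc_pure_def by (rule kappa_eqI) (use assms in \<open>simp_all add: relatorsI keys_of\<close>)

lemma BC_induct [consumes 1, case_names zero pure diff]:
  assumes "X \<in> carrier BC" "Q \<zero>\<^bsub>BC\<^esub>" "\<And>b m. b \<in> carrier B \<Longrightarrow> m \<in> carrier M \<Longrightarrow> Q (pure b m)"
    "\<And>X Y. X \<in> carrier BC \<Longrightarrow> Y \<in> carrier BC \<Longrightarrow> Q X \<Longrightarrow> Q Y \<Longrightarrow> Q (X \<ominus>\<^bsub>BC\<^esub> Y)"
  shows "Q X"
proof -
  obtain x where x: "Poly_Mapping.keys x \<subseteq> S" "X = \<kappa> x" using assms(1) by (auto simp: carrier_BC)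
  have "Q (\<kappa> x) \<and> Poly_Mapping.keys x \<subseteq> S" using x(1)
  proof (induction x rule: frag_induction)
    case zero
    then show ?case using assms(2) kappa.hom_zero by simp
  next
    case (one z)
    then show ?case using assms(3) by (cases z) (auto simp: bc_pure_def keys_frag_of)
  next
    case (diff x y)
    then show ?case using assms(4) by (auto simp: kappa_diff keys_closed carrier_BC)
  qed
  then show ?thesis by (simp add: x)
qed

text \<open>Base change divides by a subgroup and not by an ideal, so vanishing on the relators
  themselves is enough here. The third part speaks of every representative of a class because
  \<open>bc_map\<close> is a union over all of them.\<close>

lemma bc_lift:
  assumes h: "biadditive B M G h"
    and bal: "\<And>b a m. b \<in> carrier B \<Longrightarrow> a \<in> carrier A \<Longrightarrow> m \<in> carrier M \<Longrightarrow>
      h (b \<otimes>\<^bsub>B\<^esub> \<phi> a) m = h b (a \<odot>\<^bsub>M\<^esub> m)"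
  shows bc_lift_hom: "abelian_group_hom BC G (tlift G h)"
    and bc_lift_pure: "\<And>b m. b \<in> carrier B \<Longrightarrow> m \<in> carrier M \<Longrightarrow> tlift G h (pure b m) = h b m"
    and bc_lift_kappa: "\<And>x y. Poly_Mapping.keys x \<subseteq> S \<Longrightarrow> y \<in> \<kappa> x \<Longrightarrow>
      Poly_Mapping.keys y \<subseteq> S \<and> frag_eval G (\<lambda>(b, m). h b m) y = tlift G h (\<kappa> x)"
proof -
  interpret G: abelian_group G using h by (simp add: biadditive_def)
  define g where "g = (\<lambda>(b, m). h b m)"
  have g: "g \<in> S \<rightarrow> carrier G"
    using h by (auto simp: g_def biadditive_def)
  define \<psi> where "\<psi> = frag_eval G g"
  have \<psi>: "abelian_group_hom (frag_ring S) G \<psi>"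
    by (rule abelian_group_homI')
       (auto simp: \<psi>_def G.frag_eval_add[OF _ _ g] G.frag_eval_closed[OF _ g] frag_ring G.abelian_group_axioms)
  interpret \<psi>: abelian_group_hom "frag_ring S" G \<psi> by fact
  have \<psi>_diff: "\<psi> (x - y) = \<psi> x \<ominus>\<^bsub>G\<^esub> \<psi> y" if "Poly_Mapping.keys x \<subseteq> S" "Poly_Mapping.keys y \<subseteq> S" for x y
    using \<psi>.hom_diff[of x y] that by (simp add: minus_frag_ring)
  have \<psi>_of: "\<psi> (frag_of (b, m)) = h b m" if "b \<in> carrier B" "m \<in> carrier M" for b m
    using G.frag_eval_of[of g "(b, m)"] h that by (auto simp: \<psi>_def g_def biadditive_def)
  have b: "\<And>b b' m. b \<in> carrier B \<Longrightarrow> b' \<in> carrier B \<Longrightarrow> m \<in> carrier M \<Longrightarrow> h (b \<oplus>\<^bsub>B\<^esub> b') m = h b m \<oplus>\<^bsub>G\<^esub> h b' m"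
    "\<And>b m m'. b \<in> carrier B \<Longrightarrow> m \<in> carrier M \<Longrightarrow> m' \<in> carrier M \<Longrightarrow> h b (m \<oplus>\<^bsub>M\<^esub> m') = h b m \<oplus>\<^bsub>G\<^esub> h b m'"
    "\<And>b m. b \<in> carrier B \<Longrightarrow> m \<in> carrier M \<Longrightarrow> h b m \<in> carrier G"
    using h by (auto simp: biadditive_def)
  have z: "u \<oplus>\<^bsub>G\<^esub> w \<ominus>\<^bsub>G\<^esub> u \<ominus>\<^bsub>G\<^esub> w = \<zero>\<^bsub>G\<^esub>" if "u \<in> carrier G" "w \<in> carrier G" for u w
  proof -
    have "u \<oplus>\<^bsub>G\<^esub> w \<ominus>\<^bsub>G\<^esub> u \<ominus>\<^bsub>G\<^esub> w = (u \<oplus>\<^bsub>G\<^esub> w) \<ominus>\<^bsub>G\<^esub> (u \<oplus>\<^bsub>G\<^esub> w)"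
      using that by (simp add: G.minus_eq G.minus_add G.a_assoc)
    then show ?thesis using that by (simp add: G.minus_eq G.r_neg)
  qed
  have zz: "u \<ominus>\<^bsub>G\<^esub> u = \<zero>\<^bsub>G\<^esub>" if "u \<in> carrier G" for u
    using that by (simp add: G.minus_eq G.r_neg)
  have rel: "\<psi> x = \<zero>\<^bsub>G\<^esub>" if "x \<in> relators" for x
    using that by (auto simp: relators_def \<psi>_diff \<psi>_of keys_of keys_closed b z zz bal)
  have H: "Poly_Mapping.keys x \<subseteq> S \<and> \<psi> x = \<zero>\<^bsub>G\<^esub>" if "x \<in> H" for x
    using that unfolding H_eq
  proof (induction rule: generate.induct)
    case one
    then show ?case using \<psi>.hom_zero by simp
  next
    case (incl x)
    then show ?case using rel keys_relators by simp
  next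
    case (inv x)
    then have x: "Poly_Mapping.keys x \<subseteq> S" using keys_relators by simp
    then show ?case using \<psi>_diff[of 0 x] rel[OF inv] \<psi>.hom_zero by (simp add: G.minus_eq)
  next
    case (eng x y)
    then show ?case using \<psi>.hom_add[of x y] by (simp add: keys_closed)
  qed
  have val: "Poly_Mapping.keys y \<subseteq> S \<and> \<psi> y = \<psi> x" if x: "Poly_Mapping.keys x \<subseteq> S" and y: "y \<in> \<kappa> x" for x y
  proof -
    obtain k where k: "k \<in> H" "y = k + x" using y by (auto simp: kappa r_coset_def)
    show ?thesis
      using H[OF k(1)] x k(2) \<psi>.hom_add[of k x] \<psi>.hom_closed[of x] by (simp add: keys_closed)
  qed
  have "x \<in> \<kappa> x" for x
    using subgroup.one_closed[OF H_subgroup] by (force simp: kappa r_coset_def)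
  then have img: "\<psi> ` \<kappa> x = {\<psi> x}" if "Poly_Mapping.keys x \<subseteq> S" for x
    using val[OF that] by blast
  have tl: "tlift G h (\<kappa> x) = \<psi> x" if "Poly_Mapping.keys x \<subseteq> S" for x
    using img[OF that] by (simp add: tlift_def \<psi>_def g_def)
  show "abelian_group_hom BC G (tlift G h)"
  proof (rule abelian_group_homI')
    fix X Y assume "X \<in> carrier BC" "Y \<in> carrier BC"
    then obtain x y where "Poly_Mapping.keys x \<subseteq> S" "X = \<kappa> x" "Poly_Mapping.keys y \<subseteq> S" "Y = \<kappa> y"
      by (auto simp: carrier_BC)
    then show "tlift G h (X \<oplus>\<^bsub>BC\<^esub> Y) = tlift G h X \<oplus>\<^bsub>G\<^esub> tlift G h Y"
      using kappa.hom_add[of x y] \<psi>.hom_add[of x y] tl[of "x + y"] by (simp add: tl keys_closed)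
  next
    fix X assume "X \<in> carrier BC"
    then show "tlift G h X \<in> carrier G" using \<psi>.hom_closed by (auto simp: carrier_BC tl)
  qed (auto simp: abelian_group_BC G.abelian_group_axioms)
  show "tlift G h (pure b m) = h b m" if "b \<in> carrier B" "m \<in> carrier M" for b m
    using that by (simp add: bc_pure_def tl keys_of \<psi>_of)
  show "Poly_Mapping.keys y \<subseteq> S \<and> frag_eval G (\<lambda>(b, m). h b m) y = tlift G h (\<kappa> x)"
    if "Poly_Mapping.keys x \<subseteq> S" "y \<in> \<kappa> x" for x y
    using val[OF that] tl[OF that(1)] by (simp add: \<psi>_def g_def)
qed

end

text \<open>The map h on the rings is only asked to be additive and compatible with the images of A.
  This covers restrictions, multiplication by a fixed ring element, and derivations that kill the
  image of A.\<close>

locale bc_morphism = X: base_extension A B \<phi> M + Y: base_extension A B' \<phi>' M'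
  for A :: "('a, 'x) ring_scheme" and B :: "('b, 'y) ring_scheme" and \<phi> and M :: "('a, 'm, 'z) module_scheme"
    and B' :: "('c, 'w) ring_scheme" and \<phi>' and M' :: "('a, 'n, 'v) module_scheme" +
  fixes h f
  assumes h: "abelian_group_hom B B' h" and f: "abelian_group_hom M M' f"
    and h_phi: "\<And>b a. b \<in> carrier B \<Longrightarrow> a \<in> carrier A \<Longrightarrow> h (b \<otimes>\<^bsub>B\<^esub> \<phi> a) = h b \<otimes>\<^bsub>B'\<^esub> \<phi>' a"
    and f_smult: "\<And>a m. a \<in> carrier A \<Longrightarrow> m \<in> carrier M \<Longrightarrow> f (a \<odot>\<^bsub>M\<^esub> m) = a \<odot>\<^bsub>M'\<^esub> f m"
begin

abbreviation "bm \<equiv> bc_map A B' \<phi>' M' h f"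
definition "\<beta> c n = Y.pure (h c) (f n)"

sublocale h: abelian_group_hom B B' h by (rule h)
sublocale f: abelian_group_hom M M' f by (rule f)

lemma beta: "biadditive B M Y.BC \<beta>"
  "\<And>b a m. b \<in> carrier B \<Longrightarrow> a \<in> carrier A \<Longrightarrow> m \<in> carrier M \<Longrightarrow> \<beta> (b \<otimes>\<^bsub>B\<^esub> \<phi> a) m = \<beta> b (a \<odot>\<^bsub>M\<^esub> m)"
  by (auto simp: biadditive_def \<beta>_def Y.abelian_group_BC Y.pure_add_l Y.pure_add_r h_phi f_smult Y.pure_smult)

lemma frag_map:
  assumes "Poly_Mapping.keys x \<subseteq> X.S"
  shows "Poly_Mapping.keys (frag_extend (\<lambda>(c, n). frag_of (h c, f n)) x) \<subseteq> Y.S \<and>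
    Y.\<kappa> (frag_extend (\<lambda>(c, n). frag_of (h c, f n)) x) = frag_eval Y.BC (\<lambda>(c, n). \<beta> c n) x \<and> Poly_Mapping.keys x \<subseteq> X.S"
  using assms
proof (induction x rule: frag_induction)
  case zero
  then show ?case using Y.kappa.hom_zero by (simp add: Y.BC.frag_eval_zero)
next
  case (one z)
  then show ?case
    using Y.BC.frag_eval_of[of "\<lambda>(c, n). \<beta> c n" z] by (cases z) (auto simp: keys_frag_of \<beta>_def bc_pure_def[symmetric])
next
  case (diff x y)
  have "(\<lambda>(c, n). \<beta> c n) \<in> X.S \<rightarrow> carrier Y.BC" by (auto simp: \<beta>_def)
  then show ?case using diff
    by (simp add: frag_extend_diff Y.keys_closed X.keys_closed Y.kappa_diff Y.BC.frag_eval_diff[of x X.S y])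
qed

text \<open>Every representative of the class produces the same coset, the value of the additive
  lift, so the union in \<open>bc_map\<close> is that coset.\<close>

lemma bm_eq:
  assumes "Z \<in> carrier X.BC" shows "bm Z = tlift Y.BC \<beta> Z"
proof -
  obtain x where x: "Poly_Mapping.keys x \<subseteq> X.S" "Z = X.\<kappa> x" using assms by (auto simp: X.carrier_BC)
  have "Y.\<kappa> (frag_extend (\<lambda>(c, n). frag_of (h c, f n)) y) = tlift Y.BC \<beta> Z" if "y \<in> Z" for y
    using X.bc_lift_kappa[OF beta x(1), of y] that x(2) frag_map[of y] by simp
  moreover have "x \<in> Z"
    using subgroup.one_closed[OF X.H_subgroup] x by (force simp: X.kappa r_coset_def)
  ultimately show ?thesis unfolding bc_map_def by blast
qed

lemma bm_additive: "abelian_group_hom X.BC Y.BC bm"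
proof -
  interpret l: abelian_group_hom X.BC Y.BC "tlift Y.BC \<beta>" by (rule X.bc_lift_hom[OF beta])
  show ?thesis
    by (rule abelian_group_homI') (auto simp: bm_eq X.abelian_group_BC Y.abelian_group_BC)
qed

lemma bm_pure: "b \<in> carrier B \<Longrightarrow> m \<in> carrier M \<Longrightarrow> bm (X.pure b m) = Y.pure (h b) (f m)"
  by (simp add: bm_eq X.bc_lift_pure[OF beta] \<beta>_def)

end

context base_extension
begin

text \<open>The action of b on a base change is by construction the map induced by multiplication
  with b on the ring; seen this way, its additivity and its values on pure tensors come for
  free.\<close>

lemma smult_morphism:
  assumes "b \<in> carrier B" shows "bc_morphism A B \<phi> M B \<phi> M ((\<otimes>\<^bsub>B\<^esub>) b) id"
  by unfold_locales (use assms in \<open>auto simp: B.r_distr B.m_assoc intro!: homI\<close>)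

lemma smult_BC: "b \<odot>\<^bsub>BC\<^esub> X = bc_map A B \<phi> M ((\<otimes>\<^bsub>B\<^esub>) b) id X"
  by (simp add: base_change_def Let_def bc_map_def)

lemma smult_additive: "b \<in> carrier B \<Longrightarrow> abelian_group_hom BC BC (\<lambda>X. b \<odot>\<^bsub>BC\<^esub> X)"
  using bc_morphism.bm_additive[OF smult_morphism] by (simp add: smult_BC)

lemma smult_pure: "b \<in> carrier B \<Longrightarrow> c \<in> carrier B \<Longrightarrow> m \<in> carrier M \<Longrightarrow> b \<odot>\<^bsub>BC\<^esub> pure c m = pure (b \<otimes>\<^bsub>B\<^esub> c) m"
  using bc_morphism.bm_pure[OF smult_morphism] by (simp add: smult_BC)

lemma pure_additive_r: "b \<in> carrier B \<Longrightarrow> abelian_group_hom M BC (pure b)"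
  by (rule abelian_group_homI') (auto simp: pure_add_r abelian_group_BC M.abelian_group_axioms)

lemma pure_additive_l: "m \<in> carrier M \<Longrightarrow> abelian_group_hom B BC (\<lambda>b. pure b m)"
  by (rule abelian_group_homI') (auto simp: pure_add_l abelian_group_BC B.is_abelian_group)

end

section \<open>The diagonal of an affine formal scheme\<close>

locale affine_diagonal = A: algebra V A
  for p :: nat and V :: "('v, 'x) ring_scheme" and A :: "('v, 'a) module" +
  assumes complete: "adically_complete A (p_ideal p A)"
begin

abbreviation "AA \<equiv> A2 V A"
abbreviation "AAA \<equiv> A3 V A"
abbreviation "t2 \<equiv> tens V A A"
abbreviation "t3 \<equiv> tens3 V A"

sublocale P2: alg_pair V A A ..

lemma AA_eq: "AA = P2.T"
  by (simp add: A2_def)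

lemma algebra_AA: "algebra V AA"
  unfolding AA_eq by (rule P2.algebra_T)

sublocale AA: algebra V AA by (rule algebra_AA)

sublocale P3: alg_pair V AA A ..

lemma AAA_eq: "AAA = P3.T"
  by (simp add: A3_def)

lemma algebra_AAA: "algebra V AAA"
  unfolding AAA_eq by (rule P3.algebra_T)

sublocale AAA: algebra V AAA by (rule algebra_AAA)

lemma t2_closed [simp]: "a \<in> carrier A \<Longrightarrow> b \<in> carrier A \<Longrightarrow> t2 a b \<in> carrier AA"
  by (simp add: AA_eq)

lemma t2_mult: "a \<in> carrier A \<Longrightarrow> b \<in> carrier A \<Longrightarrow> c \<in> carrier A \<Longrightarrow> d \<in> carrier A \<Longrightarrow>
    t2 a b \<otimes>\<^bsub>AA\<^esub> t2 c d = t2 (a \<otimes>\<^bsub>A\<^esub> c) (b \<otimes>\<^bsub>A\<^esub> d)"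
  by (simp add: AA_eq P2.tens_mult)

lemma t2_one: "t2 \<one>\<^bsub>A\<^esub> \<one>\<^bsub>A\<^esub> = \<one>\<^bsub>AA\<^esub>"
  by (simp add: AA_eq P2.tens_one)

lemma t2_smult: "v \<in> carrier V \<Longrightarrow> a \<in> carrier A \<Longrightarrow> b \<in> carrier A \<Longrightarrow> t2 (v \<odot>\<^bsub>A\<^esub> a) b = t2 a (v \<odot>\<^bsub>A\<^esub> b)"
  by (rule P2.tens_smult)

lemma smult_t2: "v \<in> carrier V \<Longrightarrow> a \<in> carrier A \<Longrightarrow> b \<in> carrier A \<Longrightarrow> v \<odot>\<^bsub>AA\<^esub> t2 a b = t2 (v \<odot>\<^bsub>A\<^esub> a) b"
  by (simp add: AA_eq P2.smult_tens)

lemma t3_closed [simp]: "a \<in> carrier A \<Longrightarrow> b \<in> carrier A \<Longrightarrow> c \<in> carrier A \<Longrightarrow> t3 a b c \<in> carrier AAA"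
  by (simp add: AAA_eq tens3_def)

lemma t3_mult: "a \<in> carrier A \<Longrightarrow> b \<in> carrier A \<Longrightarrow> c \<in> carrier A \<Longrightarrow>
   a' \<in> carrier A \<Longrightarrow> b' \<in> carrier A \<Longrightarrow> c' \<in> carrier A \<Longrightarrow>
    t3 a b c \<otimes>\<^bsub>AAA\<^esub> t3 a' b' c' = t3 (a \<otimes>\<^bsub>A\<^esub> a') (b \<otimes>\<^bsub>A\<^esub> b') (c \<otimes>\<^bsub>A\<^esub> c')"
  by (simp add: AAA_eq tens3_def P3.tens_mult t2_mult)

lemma t3_hom:
  "(\<lambda>a. t3 a \<one>\<^bsub>A\<^esub> \<one>\<^bsub>A\<^esub>) \<in> ring_hom A AAA" "(\<lambda>a. t3 \<one>\<^bsub>A\<^esub> a \<one>\<^bsub>A\<^esub>) \<in> ring_hom A AAA"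
  "(\<lambda>a. t3 \<one>\<^bsub>A\<^esub> \<one>\<^bsub>A\<^esub> a) \<in> ring_hom A AAA"
proof -
  have h: "(\<lambda>a. tens V AA A a \<one>\<^bsub>A\<^esub>) \<in> ring_hom AA AAA" "(\<lambda>a. tens V AA A \<one>\<^bsub>AA\<^esub> a) \<in> ring_hom A AAA"
    unfolding AAA_eq by (rule P3.ring_hom_l P3.ring_hom_r)+
  have "(\<lambda>a. t2 a \<one>\<^bsub>A\<^esub>) \<in> ring_hom A AA" "(\<lambda>a. t2 \<one>\<^bsub>A\<^esub> a) \<in> ring_hom A AA"
    unfolding AA_eq by (rule P2.ring_hom_l P2.ring_hom_r)+
  then show "(\<lambda>a. t3 a \<one>\<^bsub>A\<^esub> \<one>\<^bsub>A\<^esub>) \<in> ring_hom A AAA" "(\<lambda>a. t3 \<one>\<^bsub>A\<^esub> a \<one>\<^bsub>A\<^esub>) \<in> ring_hom A AAA"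
    using ring_hom_trans[OF _ h(1)] by (simp_all add: comp_def tens3_def[abs_def])
  show "(\<lambda>a. t3 \<one>\<^bsub>A\<^esub> \<one>\<^bsub>A\<^esub> a) \<in> ring_hom A AAA"
    using h(2) by (simp add: tens3_def t2_one)
qed

lemma t3_smult:
  "v \<in> carrier V \<Longrightarrow> a \<in> carrier A \<Longrightarrow> b \<in> carrier A \<Longrightarrow> c \<in> carrier A \<Longrightarrow>
    t3 (v \<odot>\<^bsub>A\<^esub> a) b c = t3 a (v \<odot>\<^bsub>A\<^esub> b) c \<and> t3 a (v \<odot>\<^bsub>A\<^esub> b) c = t3 a b (v \<odot>\<^bsub>A\<^esub> c)"
  by (simp add: tens3_def t2_smult flip: P3.tens_smult) (simp add: smult_t2 t2_smult)

lemma mu2: "mu2 A \<in> ring_hom AA A" "\<And>a b. a \<in> carrier A \<Longrightarrow> b \<in> carrier A \<Longrightarrow> mu2 A (t2 a b) = a \<otimes>\<^bsub>A\<^esub> b"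
proof -
  have bal: "id (v \<odot>\<^bsub>A\<^esub> a) \<otimes>\<^bsub>A\<^esub> id b = id a \<otimes>\<^bsub>A\<^esub> id (v \<odot>\<^bsub>A\<^esub> b)"
    if "v \<in> carrier V" "a \<in> carrier A" "b \<in> carrier A" for v a b
    using that by (simp add: A.smult_assoc2 A.m_comm[of a])
  note l = P2.tensor_lift[OF A.is_cring id_ring_hom id_ring_hom bal]
  show "mu2 A \<in> ring_hom AA A" "\<And>a b. a \<in> carrier A \<Longrightarrow> b \<in> carrier A \<Longrightarrow> mu2 A (t2 a b) = a \<otimes>\<^bsub>A\<^esub> b"
    unfolding mu2_def AA_eq using l by (simp_all add: id_def)
qed

lemma mu2_smult: "v \<in> carrier V \<Longrightarrow> X \<in> carrier AA \<Longrightarrow> mu2 A (v \<odot>\<^bsub>AA\<^esub> X) = v \<odot>\<^bsub>A\<^esub> mu2 A X"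
  using mu2 ring_hom_closed[OF mu2(1)] ring_hom_mult[OF mu2(1), of "t2 (v \<odot>\<^bsub>A\<^esub> \<one>\<^bsub>A\<^esub>) \<one>\<^bsub>A\<^esub>" X]
  by (simp add: AA_eq P2.smult_T A.smult_assoc2)

lemma mu3: "mu3 A \<in> ring_hom AAA A" "\<And>a b c. a \<in> carrier A \<Longrightarrow> b \<in> carrier A \<Longrightarrow> c \<in> carrier A \<Longrightarrow>
   mu3 A (t3 a b c) = a \<otimes>\<^bsub>A\<^esub> b \<otimes>\<^bsub>A\<^esub> c"
proof -
  have bal: "mu2 A (v \<odot>\<^bsub>AA\<^esub> a) \<otimes>\<^bsub>A\<^esub> id b = mu2 A a \<otimes>\<^bsub>A\<^esub> id (v \<odot>\<^bsub>A\<^esub> b)"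
    if "v \<in> carrier V" "a \<in> carrier AA" "b \<in> carrier A" for v a b
    using that ring_hom_closed[OF mu2(1)] by (simp add: mu2_smult A.smult_assoc2 A.m_comm[of "mu2 A a"])
  note l = P3.tensor_lift[OF A.is_cring mu2(1) id_ring_hom bal]
  show "mu3 A \<in> ring_hom AAA A" "\<And>a b c. a \<in> carrier A \<Longrightarrow> b \<in> carrier A \<Longrightarrow> c \<in> carrier A \<Longrightarrow>
   mu3 A (t3 a b c) = a \<otimes>\<^bsub>A\<^esub> b \<otimes>\<^bsub>A\<^esub> c"
    unfolding mu3_def AAA_eq tens3_def using l mu2(2) by (simp_all add: id_def)
qed

sublocale G2: augmented p AA A "mu2 A" "\<lambda>a. t2 a \<one>\<^bsub>A\<^esub>"
proof (unfold_locales)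
  show "(\<lambda>a. t2 a \<one>\<^bsub>A\<^esub>) \<in> ring_hom A AA" unfolding AA_eq by (rule P2.ring_hom_l)
qed (simp_all add: mu2 complete)

sublocale G3: augmented p AAA A "mu3 A" "\<lambda>a. t3 a \<one>\<^bsub>A\<^esub> \<one>\<^bsub>A\<^esub>"
  by unfold_locales (simp_all add: mu3 t3_hom complete)

lemma nb2_eq: "nb2 p V A = G2.N"
  by (simp add: nb2_def fun_eq_iff)

lemma nb3_eq: "nb3 p V A = G3.N"
  by (simp add: nb3_def fun_eq_iff)

abbreviation "N2 \<equiv> nb2 p V A"
abbreviation "N3 \<equiv> nb3 p V A"

sublocale N2: cring "N2 n" for n unfolding nb2_eq by (rule G2.N.is_cring)
sublocale N3: cring "N3 n" for n unfolding nb3_eq by (rule G3.N.is_cring)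

lemma pr_eq: "pr1 p V A n a = G2.cls n (t2 a \<one>\<^bsub>A\<^esub>)" "pr2 p V A n a = G2.cls n (t2 \<one>\<^bsub>A\<^esub> a)"
  by (simp_all add: pr1_def pr2_def)

lemma tr_eq: "tr1 p V A n a = G3.cls n (t3 a \<one>\<^bsub>A\<^esub> \<one>\<^bsub>A\<^esub>)" "tr2 p V A n a = G3.cls n (t3 \<one>\<^bsub>A\<^esub> a \<one>\<^bsub>A\<^esub>)"
  "tr3 p V A n a = G3.cls n (t3 \<one>\<^bsub>A\<^esub> \<one>\<^bsub>A\<^esub> a)"
  by (simp_all add: tr1_def tr2_def tr3_def)

lemma pr_hom: "pr1 p V A n \<in> ring_hom A (N2 n)" "pr2 p V A n \<in> ring_hom A (N2 n)"
proof -
  have "(\<lambda>a. t2 a \<one>\<^bsub>A\<^esub>) \<in> ring_hom A AA" "(\<lambda>a. t2 \<one>\<^bsub>A\<^esub> a) \<in> ring_hom A AA"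
    unfolding AA_eq by (rule P2.ring_hom_l P2.ring_hom_r)+
  from this[THEN ring_hom_trans[OF _ G2.cls_hom]]
  show "pr1 p V A n \<in> ring_hom A (N2 n)" "pr2 p V A n \<in> ring_hom A (N2 n)"
    by (simp_all add: comp_def nb2_eq pr_eq[abs_def])
qed

lemma tr_hom: "tr1 p V A n \<in> ring_hom A (N3 n)" "tr2 p V A n \<in> ring_hom A (N3 n)" "tr3 p V A n \<in> ring_hom A (N3 n)"
  using t3_hom[THEN ring_hom_trans[OF _ G3.cls_hom]]
  by (simp_all add: comp_def nb3_eq tr_eq[abs_def])

sublocale pr1: ring_hom_cring A "N2 n" "pr1 p V A n" for n by unfold_locales (rule pr_hom)
sublocale pr2: ring_hom_cring A "N2 n" "pr2 p V A n" for n by unfold_locales (rule pr_hom)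
sublocale tr1: ring_hom_cring A "N3 n" "tr1 p V A n" for n by unfold_locales (rule tr_hom)
sublocale tr2: ring_hom_cring A "N3 n" "tr2 p V A n" for n by unfold_locales (rule tr_hom)
sublocale tr3: ring_hom_cring A "N3 n" "tr3 p V A n" for n by unfold_locales (rule tr_hom)

abbreviation "\<xi> n \<equiv> xi p V A n"

lemma xi_closed [simp]: "a \<in> carrier A \<Longrightarrow> \<xi> n a \<in> carrier (N2 n)"
  by (simp add: xi_def)

text \<open>Each map from the double to the triple tensor product respects multiplication to A on
  pure tensors, hence everywhere; so it carries diagonal ideal to diagonal ideal and acts on the
  neighbourhoods.\<close>

lemma hom_AA_AAA:
  assumes f: "f \<in> ring_hom A AAA" and g: "g \<in> ring_hom A AAA"
    and bal: "\<And>v a b. v \<in> carrier V \<Longrightarrow> a \<in> carrier A \<Longrightarrow> b \<in> carrier A \<Longrightarrow>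
      f (v \<odot>\<^bsub>A\<^esub> a) \<otimes>\<^bsub>AAA\<^esub> g b = f a \<otimes>\<^bsub>AAA\<^esub> g (v \<odot>\<^bsub>A\<^esub> b)"
    and mu: "\<And>a. a \<in> carrier A \<Longrightarrow> mu3 A (f a) = a" "\<And>a. a \<in> carrier A \<Longrightarrow> mu3 A (g a) = a"
  shows "aug_map p AA A (mu2 A) (\<lambda>a. t2 a \<one>\<^bsub>A\<^esub>) AAA (mu3 A) (\<lambda>a. t3 a \<one>\<^bsub>A\<^esub> \<one>\<^bsub>A\<^esub>) (tensor_lift AAA f g)"
    and "\<And>a b. a \<in> carrier A \<Longrightarrow> b \<in> carrier A \<Longrightarrow> tensor_lift AAA f g (t2 a b) = f a \<otimes>\<^bsub>AAA\<^esub> g b"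
proof -
  note l = P2.tensor_lift[OF AAA.is_cring f g bal]
  have fc: "\<And>a. a \<in> carrier A \<Longrightarrow> f a \<in> carrier AAA" "\<And>a. a \<in> carrier A \<Longrightarrow> g a \<in> carrier AAA"
    using f g by (auto simp: ring_hom_def)
  have c: "mu3 A (tensor_lift AAA f g X) = mu2 A X" if X: "X \<in> carrier AA" for X
  proof (rule P2.T_ext)
    show "abelian_group_hom P2.T A (\<lambda>X. mu3 A (tensor_lift AAA f g X))"
      by (intro ring_hom_additive P2.T.ring_axioms A.ring_axioms)
         (use ring_hom_trans[OF l(1) mu3(1)] in \<open>simp add: comp_def\<close>)
    show "abelian_group_hom P2.T A (mu2 A)"
      using mu2(1) by (intro ring_hom_additive P2.T.ring_axioms A.ring_axioms) (simp add: AA_eq)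
    show "X \<in> carrier P2.T" using X by (simp add: AA_eq)
  qed (simp add: l ring_hom_mult[OF mu3(1)] fc mu mu2)
  show "aug_map p AA A (mu2 A) (\<lambda>a. t2 a \<one>\<^bsub>A\<^esub>) AAA (mu3 A) (\<lambda>a. t3 a \<one>\<^bsub>A\<^esub> \<one>\<^bsub>A\<^esub>) (tensor_lift AAA f g)"
    by (intro aug_map.intro aug_map_axioms.intro G2.augmented_axioms G3.augmented_axioms)
       (use l(1) c in \<open>simp_all add: AA_eq\<close>)
  show "\<And>a b. a \<in> carrier A \<Longrightarrow> b \<in> carrier A \<Longrightarrow> tensor_lift AAA f g (t2 a b) = f a \<otimes>\<^bsub>AAA\<^esub> g b"
    by (rule l(2))
qed

definition "f12 = tensor_lift AAA (\<lambda>a. t3 a \<one>\<^bsub>A\<^esub> \<one>\<^bsub>A\<^esub>) (\<lambda>b. t3 \<one>\<^bsub>A\<^esub> b \<one>\<^bsub>A\<^esub>)"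
definition "f23 = tensor_lift AAA (\<lambda>a. t3 \<one>\<^bsub>A\<^esub> a \<one>\<^bsub>A\<^esub>) (\<lambda>b. t3 \<one>\<^bsub>A\<^esub> \<one>\<^bsub>A\<^esub> b)"
definition "f13 = tensor_lift AAA (\<lambda>a. t3 a \<one>\<^bsub>A\<^esub> \<one>\<^bsub>A\<^esub>) (\<lambda>b. t3 \<one>\<^bsub>A\<^esub> \<one>\<^bsub>A\<^esub> b)"

sublocale F12: aug_map p AA A "mu2 A" "\<lambda>a. t2 a \<one>\<^bsub>A\<^esub>" AAA "mu3 A" "\<lambda>a. t3 a \<one>\<^bsub>A\<^esub> \<one>\<^bsub>A\<^esub>" f12
  unfolding f12_def by (rule hom_AA_AAA[OF t3_hom(1,2)]) (simp_all add: t3_mult t3_smult mu3 A.smult_assoc2)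
sublocale F23: aug_map p AA A "mu2 A" "\<lambda>a. t2 a \<one>\<^bsub>A\<^esub>" AAA "mu3 A" "\<lambda>a. t3 a \<one>\<^bsub>A\<^esub> \<one>\<^bsub>A\<^esub>" f23
  unfolding f23_def by (rule hom_AA_AAA[OF t3_hom(2,3)]) (simp_all add: t3_mult t3_smult mu3 A.smult_assoc2)
sublocale F13: aug_map p AA A "mu2 A" "\<lambda>a. t2 a \<one>\<^bsub>A\<^esub>" AAA "mu3 A" "\<lambda>a. t3 a \<one>\<^bsub>A\<^esub> \<one>\<^bsub>A\<^esub>" f13
  unfolding f13_def by (rule hom_AA_AAA[OF t3_hom(1,3)]) (simp_all add: t3_mult t3_smult mu3 A.smult_assoc2)

lemma f_t2:
  assumes "a \<in> carrier A" "b \<in> carrier A"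
  shows "f12 (t2 a b) = t3 a b \<one>\<^bsub>A\<^esub>" "f23 (t2 a b) = t3 \<one>\<^bsub>A\<^esub> a b" "f13 (t2 a b) = t3 a \<one>\<^bsub>A\<^esub> b"
  unfolding f12_def f23_def f13_def
  by (subst hom_AA_AAA(2), insert assms, simp_all add: t3_hom t3_mult t3_smult mu3 A.smult_assoc2)+

lemma q_eq: "q12 p V A n = F12.nbm n" "q23 p V A n = F23.nbm n" "q13 p V A n = F13.nbm n"
  unfolding q12_def q23_def q13_def nbhd_map_def F12.nbm_def F23.nbm_def F13.nbm_def
    F12.f_hat_def F23.f_hat_def F13.f_hat_def
  unfolding f12_def f23_def f13_def by (rule refl)+

lemma q_hom: "q12 p V A n \<in> ring_hom (N2 n) (N3 n)" "q23 p V A n \<in> ring_hom (N2 n) (N3 n)"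
  "q13 p V A n \<in> ring_hom (N2 n) (N3 n)"
  by (simp_all add: q_eq nb2_eq nb3_eq F12.nbm_hom F13.nbm_hom F23.nbm_hom)

lemma q_pr:
  assumes "a \<in> carrier A"
  shows "q12 p V A n (pr1 p V A n a) = tr1 p V A n a" "q12 p V A n (pr2 p V A n a) = tr2 p V A n a"
    "q23 p V A n (pr1 p V A n a) = tr2 p V A n a" "q23 p V A n (pr2 p V A n a) = tr3 p V A n a"
    "q13 p V A n (pr1 p V A n a) = tr1 p V A n a" "q13 p V A n (pr2 p V A n a) = tr3 p V A n a"
  using assms by (simp_all add: q_eq pr_eq tr_eq F12.nbm_cls F13.nbm_cls F23.nbm_cls f_t2)

text \<open>The map \<open>(x, y) \<mapsto> (x, y, x)\<close> between the neighbourhoods of the double and the triple diagonal.\<close>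

definition "fret = tensor_lift AA (tensor_lift AA (\<lambda>a. t2 a \<one>\<^bsub>A\<^esub>) (\<lambda>b. t2 \<one>\<^bsub>A\<^esub> b)) (\<lambda>c. t2 c \<one>\<^bsub>A\<^esub>)"

lemma fret: "fret \<in> ring_hom AAA AA"
  "\<And>a b c. a \<in> carrier A \<Longrightarrow> b \<in> carrier A \<Longrightarrow> c \<in> carrier A \<Longrightarrow> fret (t3 a b c) = t2 (a \<otimes>\<^bsub>A\<^esub> c) b"
proof -
  define g where "g = tensor_lift AA (\<lambda>a. t2 a \<one>\<^bsub>A\<^esub>) (\<lambda>b. t2 \<one>\<^bsub>A\<^esub> b)"
  have h: "(\<lambda>a. t2 a \<one>\<^bsub>A\<^esub>) \<in> ring_hom A AA" "(\<lambda>a. t2 \<one>\<^bsub>A\<^esub> a) \<in> ring_hom A AA"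
    unfolding AA_eq by (rule P2.ring_hom_l P2.ring_hom_r)+
  have g: "g \<in> ring_hom AA AA" "\<And>a b. a \<in> carrier A \<Longrightarrow> b \<in> carrier A \<Longrightarrow> g (t2 a b) = t2 a b"
    unfolding g_def using P2.tensor_lift[OF AA.is_cring h] by (simp_all add: t2_mult t2_smult A.smult_assoc2 flip: AA_eq)
  have bal: "g (v \<odot>\<^bsub>AA\<^esub> X) \<otimes>\<^bsub>AA\<^esub> t2 b \<one>\<^bsub>A\<^esub> = g X \<otimes>\<^bsub>AA\<^esub> t2 (v \<odot>\<^bsub>A\<^esub> b) \<one>\<^bsub>A\<^esub>"
    if "v \<in> carrier V" "X \<in> carrier AA" "b \<in> carrier A" for v X b
  proof -
    have gX: "g X \<in> carrier AA" using that ring_hom_closed[OF g(1)] by simp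
    have "g (v \<odot>\<^bsub>AA\<^esub> X) = g (t2 (v \<odot>\<^bsub>A\<^esub> \<one>\<^bsub>A\<^esub>) \<one>\<^bsub>A\<^esub> \<otimes>\<^bsub>AA\<^esub> X)"
      by (simp add: AA_eq P2.smult_T)
    also have "\<dots> = t2 (v \<odot>\<^bsub>A\<^esub> \<one>\<^bsub>A\<^esub>) \<one>\<^bsub>A\<^esub> \<otimes>\<^bsub>AA\<^esub> g X"
      using that by (simp add: ring_hom_mult[OF g(1)] g(2))
    finally have "g (v \<odot>\<^bsub>AA\<^esub> X) \<otimes>\<^bsub>AA\<^esub> t2 b \<one>\<^bsub>A\<^esub> = g X \<otimes>\<^bsub>AA\<^esub> (t2 (v \<odot>\<^bsub>A\<^esub> \<one>\<^bsub>A\<^esub>) \<one>\<^bsub>A\<^esub> \<otimes>\<^bsub>AA\<^esub> t2 b \<one>\<^bsub>A\<^esub>)"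
      using that gX by (simp add: AA.m_assoc[symmetric] AA.m_comm[of "g X"])
    then show ?thesis using that by (simp add: t2_mult A.smult_assoc2)
  qed
  note l = P3.tensor_lift[OF AA.is_cring g(1) h(1) bal]
  show "fret \<in> ring_hom AAA AA"
    unfolding fret_def AAA_eq using l(1) by (simp add: g_def)
  show "fret (t3 a b c) = t2 (a \<otimes>\<^bsub>A\<^esub> c) b" if "a \<in> carrier A" "b \<in> carrier A" "c \<in> carrier A" for a b c
    unfolding fret_def tens3_def using that l(2)[of "t2 a b" c] g(2) by (simp add: g_def t2_mult)
qed

text \<open>The map (x, y) \<mapsto> (x, y, x) sends the diagonal to the triple diagonal. Since A
  \<otimes> A \<otimes> A is an iterated tensor product, extension from pure tensors is applied
  twice.\<close>

sublocale FR: aug_map p AAA A "mu3 A" "\<lambda>a. t3 a \<one>\<^bsub>A\<^esub> \<one>\<^bsub>A\<^esub>" AA "mu2 A" "\<lambda>a. t2 a \<one>\<^bsub>A\<^esub>" fret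
proof (intro aug_map.intro aug_map_axioms.intro G2.augmented_axioms G3.augmented_axioms)
  show "fret \<in> ring_hom AAA AA" by (rule fret)
  fix X assume X: "X \<in> carrier AAA"
  show "mu2 A (fret X) = mu3 A X"
  proof (rule P3.T_ext)
    fix Y b assume Y: "Y \<in> carrier AA" and b: "b \<in> carrier A"
    have t: "\<And>Z. Z \<in> carrier AA \<Longrightarrow> tens V AA A Z b \<in> carrier AAA" using b by (simp add: AAA_eq)
    show "mu2 A (fret (tens V AA A Y b)) = mu3 A (tens V AA A Y b)"
    proof (rule P2.T_ext)
      have h: "abelian_group_hom P2.T AAA (\<lambda>Y. tens V AA A Y b)"
        unfolding AAA_eq by (rule abelian_group_homI'[OF P2.T.abelian_group_axioms P3.T.abelian_group_axioms])
          (simp_all add: b P3.tens_add_l flip: AA_eq)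
      show "abelian_group_hom P2.T A (\<lambda>Y. mu2 A (fret (tens V AA A Y b)))"
        using ring_hom_trans[OF fret(1) mu2(1)]
        by (intro abelian_group_hom_comp[OF h] ring_hom_additive AAA.ring_axioms A.ring_axioms) (simp add: comp_def)
      show "abelian_group_hom P2.T A (\<lambda>Y. mu3 A (tens V AA A Y b))"
        by (intro abelian_group_hom_comp[OF h] ring_hom_additive AAA.ring_axioms A.ring_axioms mu3)
      show "Y \<in> carrier P2.T" using Y by (simp add: AA_eq)
      fix c d assume "c \<in> carrier A" "d \<in> carrier A"
      then show "mu2 A (fret (tens V AA A (t2 c d) b)) = mu3 A (tens V AA A (t2 c d) b)"
        using fret(2)[of c d b] mu3(2)[of c d b] b by (simp add: tens3_def mu2 A.m_ac)
    qed
  next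
    show "abelian_group_hom P3.T A (\<lambda>X. mu2 A (fret X))"
      using ring_hom_trans[OF fret(1) mu2(1)]
      by (intro ring_hom_additive P3.T.ring_axioms A.ring_axioms) (simp add: comp_def AAA_eq)
    show "abelian_group_hom P3.T A (mu3 A)"
      using mu3 by (intro ring_hom_additive P3.T.ring_axioms A.ring_axioms) (simp add: AAA_eq)
    show "X \<in> carrier P3.T" using X by (simp add: AAA_eq)
  qed
qed

definition "ret n = FR.nbm n"

lemma ret_hom: "ret n \<in> ring_hom (N3 n) (N2 n)"
  by (simp add: ret_def FR.nbm_hom nb2_eq nb3_eq)

lemma ret_tr:
  assumes "a \<in> carrier A"
  shows "ret n (tr1 p V A n a) = pr1 p V A n a" "ret n (tr2 p V A n a) = pr2 p V A n a"
    "ret n (tr3 p V A n a) = pr1 p V A n a"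
  using assms by (simp_all add: ret_def tr_eq pr_eq FR.nbm_cls fret)

end

section \<open>Coordinates on the neighbourhoods of the diagonal\<close>

text \<open>The first form is the product rule with its second-order error term; the second is the
  telescoping form that compares a product with the product of two approximations.\<close>

lemma (in cring) prod_minus:
  assumes "a \<in> carrier R" "b \<in> carrier R" "c \<in> carrier R" "d \<in> carrier R"
  shows "a \<otimes> b \<ominus> c \<otimes> d = c \<otimes> (b \<ominus> d) \<oplus> d \<otimes> (a \<ominus> c) \<oplus> (a \<ominus> c) \<otimes> (b \<ominus> d)"
    "a \<otimes> b \<ominus> c \<otimes> d = (a \<ominus> c) \<otimes> b \<oplus> c \<otimes> (b \<ominus> d)"
  using assms by algebra+

locale smooth_diagonal = affine_diagonal p V A
  for p :: nat and V :: "('v, 'x) ring_scheme" and A :: "('v, 'a) module" +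
  fixes l :: nat and x :: "nat \<Rightarrow> 'a"
  assumes basis: "differential_basis p V A l x"
begin

abbreviation "W \<equiv> Omega p V A"
abbreviation "pr\<^sub>1 n \<equiv> pr1 p V A n"
abbreviation "pr\<^sub>2 n \<equiv> pr2 p V A n"

lemma x_closed [simp]: "i < l \<Longrightarrow> x i \<in> carrier A"
  using basis by (simp add: differential_basis_def)

definition dd :: "'a \<Rightarrow> nat \<Rightarrow> 'a dbl set" where
  "dd a = G2.emb (t2 \<one>\<^bsub>A\<^esub> a \<ominus>\<^bsub>AA\<^esub> t2 a \<one>\<^bsub>A\<^esub>)"

lemma dd_I: "a \<in> carrier A \<Longrightarrow> dd a \<in> G2.I"
proof -
  interpret mu: ring_hom_cring AA A "mu2 A" by unfold_locales (rule mu2)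
  assume "a \<in> carrier A"
  then show ?thesis unfolding dd_def
    by (intro G2.emb_I) (auto simp: AA.minus_eq mu2 A.r_neg)
qed

lemma dd_closed [simp]: "a \<in> carrier A \<Longrightarrow> dd a \<in> carrier G2.That"
  using dd_I G2.I.Icarr by blast

lemma xi_proj: "a \<in> carrier A \<Longrightarrow> \<xi> n a = G2.proj n (dd a)"
  by (simp add: xi_def pr_eq nb2_eq dd_def AA.minus_eq N2.minus_eq[unfolded nb2_eq] flip: G2.cls_eq)

lemma proj_closed [simp]: "u \<in> carrier G2.That \<Longrightarrow> G2.proj n u \<in> carrier (N2 n)"
  by (simp add: nb2_eq)

lemma N2_ops: "N2 n = G2.N n"
  by (simp add: nb2_eq)

lemma D_2: "diag_power p AA A (mu2 A) 2 = G2.D (Suc 1)"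
  by (simp add: numeral_2_eq_2)

lemma W_ops: "w \<oplus>\<^bsub>W\<^esub> w' = w \<oplus>\<^bsub>N2 1\<^esub> w'" "\<zero>\<^bsub>W\<^esub> = \<zero>\<^bsub>N2 1\<^esub>" "a \<odot>\<^bsub>W\<^esub> w = pr\<^sub>1 1 a \<otimes>\<^bsub>N2 1\<^esub> w"
  by (simp_all add: Omega_def Let_def)

lemma carrier_W: "w \<in> carrier W \<longleftrightarrow> (\<exists>u\<in>G2.I. w = G2.proj 1 u)"
  by (auto simp: Omega_def Let_def D_2 G2.proj_def)

lemma xi_W: "a \<in> carrier A \<Longrightarrow> \<xi> 1 a \<in> carrier W"
  using xi_proj[of a 1] dd_I by (auto simp: carrier_W)

text \<open>\<open>Omega\<close> carries the addition of the ring of X^1; through this inclusion,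
  sums of differentials can be computed in that ring.\<close>

lemma W_additive: "abelian_group_hom W (N2 1) (\<lambda>w. w)"
proof (rule abelian_group_homI')
  have sub: "w \<in> carrier (N2 1)" if "w \<in> carrier W" for w
    using that G2.I.Icarr by (auto simp: carrier_W)
  then show "\<And>w. w \<in> carrier W \<Longrightarrow> w \<in> carrier (N2 1)" .
  show "abelian_group W"
  proof (rule abelian_groupI)
    fix w w' assume w: "w \<in> carrier W" and w': "w' \<in> carrier W"
    then obtain u u' where u: "u \<in> G2.I" "w = G2.proj 1 u" and u': "u' \<in> G2.I" "w' = G2.proj 1 u'"
      unfolding carrier_W by blast
    have c: "u \<in> carrier G2.That" "u' \<in> carrier G2.That" using u u' G2.I.Icarr by blast+
    have "w \<oplus>\<^bsub>W\<^esub> w' = G2.proj 1 (u \<oplus>\<^bsub>G2.That\<^esub> u')"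
      using u u' c by (simp add: W_ops N2_ops)
    then show "w \<oplus>\<^bsub>W\<^esub> w' \<in> carrier W"
      unfolding carrier_W using G2.I.a_closed[OF u(1) u'(1)] by blast
    show "w \<oplus>\<^bsub>W\<^esub> w' = w' \<oplus>\<^bsub>W\<^esub> w"
      unfolding W_ops using sub[OF w] sub[OF w'] by (rule N2.a_comm)
    show "\<zero>\<^bsub>W\<^esub> \<oplus>\<^bsub>W\<^esub> w = w"
      unfolding W_ops using sub[OF w] by (rule N2.l_zero)
    show "w \<oplus>\<^bsub>W\<^esub> w' \<oplus>\<^bsub>W\<^esub> w'' = w \<oplus>\<^bsub>W\<^esub> (w' \<oplus>\<^bsub>W\<^esub> w'')" if "w'' \<in> carrier W" for w''
      unfolding W_ops using sub[OF w] sub[OF w'] sub[OF that] by (rule N2.a_assoc)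
    have "G2.proj 1 (\<ominus>\<^bsub>G2.That\<^esub> u) \<oplus>\<^bsub>W\<^esub> w = \<zero>\<^bsub>W\<^esub>"
      using u c by (simp add: W_ops N2_ops G2.N.l_neg)
    moreover have "G2.proj 1 (\<ominus>\<^bsub>G2.That\<^esub> u) \<in> carrier W"
      unfolding carrier_W using G2.I.a_inv_closed[OF u(1)] by blast
    ultimately show "\<exists>y\<in>carrier W. y \<oplus>\<^bsub>W\<^esub> w = \<zero>\<^bsub>W\<^esub>" by blast
  next
    have "\<zero>\<^bsub>W\<^esub> = G2.proj 1 \<zero>\<^bsub>G2.That\<^esub>" by (simp add: W_ops N2_ops)
    then show "\<zero>\<^bsub>W\<^esub> \<in> carrier W"
      unfolding carrier_W using G2.I.zero_closed by blast
  qed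
qed (simp_all add: W_ops N2.abelian_group_axioms)

text \<open>For n = 1 these are the linear combinations of the differentials; larger n occur because
  the coefficients found on X^1 are reused on higher neighbourhoods.\<close>

definition comb :: "nat \<Rightarrow> (nat \<Rightarrow> 'a) \<Rightarrow> 'a nbhd2" where
  "comb n a = (\<Oplus>\<^bsub>N2 n\<^esub>i\<in>{..<l}. pr\<^sub>1 n (a i) \<otimes>\<^bsub>N2 n\<^esub> \<xi> n (x i))"

lemma comb_eq:
  assumes "a \<in> {..<l} \<rightarrow> carrier A"
  shows "(\<Oplus>\<^bsub>W\<^esub>i\<in>{..<l}. a i \<odot>\<^bsub>W\<^esub> \<xi> 1 (x i)) = comb 1 a"
proof -
  interpret W: abelian_group_hom W "N2 1" "\<lambda>w. w" by (rule W_additive)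
  have "a i \<odot>\<^bsub>W\<^esub> \<xi> 1 (x i) \<in> carrier W" if "i < l" for i
  proof -
    have ai: "a i \<in> carrier A" using assms that by auto
    have "a i \<odot>\<^bsub>W\<^esub> \<xi> 1 (x i) = G2.proj 1 (G2.emb (t2 (a i) \<one>\<^bsub>A\<^esub>) \<otimes>\<^bsub>G2.That\<^esub> dd (x i))"
      using that ai by (simp add: W_ops N2_ops xi_proj pr_eq G2.cls_eq)
    moreover have "G2.emb (t2 (a i) \<one>\<^bsub>A\<^esub>) \<otimes>\<^bsub>G2.That\<^esub> dd (x i) \<in> G2.I"
      using that ai by (intro G2.I.I_l_closed dd_I) auto
    ultimately show ?thesis unfolding carrier_W by blast
  qed
  then have "(\<Oplus>\<^bsub>W\<^esub>i\<in>{..<l}. a i \<odot>\<^bsub>W\<^esub> \<xi> 1 (x i)) = (\<Oplus>\<^bsub>N2 1\<^esub>i\<in>{..<l}. a i \<odot>\<^bsub>W\<^esub> \<xi> 1 (x i))"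
    by (intro W.hom_finsum) auto
  then show ?thesis by (simp add: comb_def W_ops)
qed

section \<open>Partial derivatives with respect to the coordinates\<close>

definition dcoef :: "'a nbhd2 \<Rightarrow> nat \<Rightarrow> 'a" where
  "dcoef w = (THE a. a \<in> {..<l} \<rightarrow>\<^sub>E carrier A \<and> w = comb 1 a)"

lemma comb_ex1: "w \<in> carrier W \<Longrightarrow> \<exists>!a. a \<in> {..<l} \<rightarrow>\<^sub>E carrier A \<and> w = comb 1 a"
proof -
  assume "w \<in> carrier W"
  then have "\<exists>!a. a \<in> {..<l} \<rightarrow>\<^sub>E carrier A \<and> w = (\<Oplus>\<^bsub>W\<^esub>i\<in>{..<l}. a i \<odot>\<^bsub>W\<^esub> \<xi> 1 (x i))"
    using basis by (simp add: differential_basis_def)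
  moreover have "(a \<in> {..<l} \<rightarrow>\<^sub>E carrier A \<and> w = (\<Oplus>\<^bsub>W\<^esub>i\<in>{..<l}. a i \<odot>\<^bsub>W\<^esub> \<xi> 1 (x i))) \<longleftrightarrow>
      (a \<in> {..<l} \<rightarrow>\<^sub>E carrier A \<and> w = comb 1 a)" for a
    using comb_eq[of a] by (auto simp: PiE_def)
  ultimately show ?thesis by simp
qed

lemma dcoef: "w \<in> carrier W \<Longrightarrow> dcoef w \<in> {..<l} \<rightarrow>\<^sub>E carrier A \<and> w = comb 1 (dcoef w)"
  unfolding dcoef_def by (rule theI'[OF comb_ex1])

lemma dcoef_unique:
  assumes "w \<in> carrier W" "a \<in> {..<l} \<rightarrow> carrier A" "w = comb 1 a" "j < l"
  shows "dcoef w j = a j"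
proof -
  have "comb 1 (restrict a {..<l}) = comb 1 a"
    unfolding comb_def by (rule N2.finsum_cong') (use assms(2) in \<open>auto simp: Pi_iff\<close>)
  then have "dcoef w = restrict a {..<l}"
    unfolding dcoef_def by (intro the1_equality comb_ex1) (use assms in auto)
  then show ?thesis using assms(4) by simp
qed

text \<open>The coefficient of dx_j in da. The value zero for j outside the range makes every
  \<open>pd j\<close> a derivation, so that no condition on j has to be carried along.\<close>

definition pd :: "nat \<Rightarrow> 'a \<Rightarrow> 'a" where
  "pd j a = (if j < l then dcoef (\<xi> 1 a) j else \<zero>\<^bsub>A\<^esub>)"

lemma pd_closed [simp]: "a \<in> carrier A \<Longrightarrow> pd j a \<in> carrier A"
  using dcoef[OF xi_W, of a] by (auto simp: pd_def)

lemma xi_pd: "a \<in> carrier A \<Longrightarrow> \<xi> 1 a = comb 1 (\<lambda>j. pd j a)"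
proof -
  assume a: "a \<in> carrier A"
  have "comb 1 (\<lambda>j. pd j a) = comb 1 (dcoef (\<xi> 1 a))"
    unfolding comb_def by (rule N2.finsum_cong') (use dcoef[OF xi_W, of a] a in \<open>auto simp: pd_def PiE_iff\<close>)
  then show ?thesis using dcoef[OF xi_W, of a] a by simp
qed

lemma pd_unique:
  assumes "a \<in> carrier A" "c \<in> UNIV \<rightarrow> carrier A" "\<xi> 1 a = comb 1 c" "j < l"
  shows "pd j a = c j"
  using dcoef_unique[OF xi_W, of a c j] assms by (auto simp: pd_def)

lemma comb_add:
  assumes "a \<in> UNIV \<rightarrow> carrier A" "b \<in> UNIV \<rightarrow> carrier A"
  shows "comb n (\<lambda>i. a i \<oplus>\<^bsub>A\<^esub> b i) = comb n a \<oplus>\<^bsub>N2 n\<^esub> comb n b"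
proof -
  have "comb n (\<lambda>i. a i \<oplus>\<^bsub>A\<^esub> b i) = (\<Oplus>\<^bsub>N2 n\<^esub>i\<in>{..<l}. pr\<^sub>1 n (a i) \<otimes>\<^bsub>N2 n\<^esub> \<xi> n (x i) \<oplus>\<^bsub>N2 n\<^esub> pr\<^sub>1 n (b i) \<otimes>\<^bsub>N2 n\<^esub> \<xi> n (x i))"
    unfolding comb_def by (rule N2.finsum_cong') (use assms in \<open>auto simp: N2.l_distr Pi_iff\<close>)
  also have "\<dots> = comb n a \<oplus>\<^bsub>N2 n\<^esub> comb n b"
    unfolding comb_def by (rule N2.finsum_addf) (use assms in \<open>auto simp: Pi_iff\<close>)
  finally show ?thesis .
qed

lemma comb_mult:
  assumes "a \<in> UNIV \<rightarrow> carrier A" "b \<in> carrier A"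
  shows "comb n (\<lambda>i. b \<otimes>\<^bsub>A\<^esub> a i) = pr\<^sub>1 n b \<otimes>\<^bsub>N2 n\<^esub> comb n a"
proof -
  have "comb n (\<lambda>i. b \<otimes>\<^bsub>A\<^esub> a i) = (\<Oplus>\<^bsub>N2 n\<^esub>i\<in>{..<l}. pr\<^sub>1 n b \<otimes>\<^bsub>N2 n\<^esub> (pr\<^sub>1 n (a i) \<otimes>\<^bsub>N2 n\<^esub> \<xi> n (x i)))"
    unfolding comb_def by (rule N2.finsum_cong') (use assms in \<open>auto simp: N2.m_assoc Pi_iff\<close>)
  also have "\<dots> = pr\<^sub>1 n b \<otimes>\<^bsub>N2 n\<^esub> comb n a"
    unfolding comb_def by (rule N2.finsum_rdistr[symmetric]) (use assms in \<open>auto simp: Pi_iff\<close>)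
  finally show ?thesis .
qed

lemma xi_add:
  assumes "a \<in> carrier A" "b \<in> carrier A"
  shows "\<xi> n (a \<oplus>\<^bsub>A\<^esub> b) = \<xi> n a \<oplus>\<^bsub>N2 n\<^esub> \<xi> n b"
  using assms by (simp add: xi_def N2.minus_eq N2.minus_add N2.a_ac)

text \<open>\<open>dd a\<close> and \<open>dd b\<close> lie in the diagonal ideal, so the error term
  of the product rule lies in its square and vanishes on X^1.\<close>

lemma xi_mult:
  assumes "a \<in> carrier A" "b \<in> carrier A"
  shows "\<xi> 1 (a \<otimes>\<^bsub>A\<^esub> b) = pr\<^sub>1 1 a \<otimes>\<^bsub>N2 1\<^esub> \<xi> 1 b \<oplus>\<^bsub>N2 1\<^esub> pr\<^sub>1 1 b \<otimes>\<^bsub>N2 1\<^esub> \<xi> 1 a"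
proof -
  have "dd a \<otimes>\<^bsub>G2.That\<^esub> dd b \<in> G2.D (Suc 1)"
    using G2.D_mult[of "dd a" 1 "dd b" 1] dd_I assms by (simp add: G2.D_1)
  then have "\<xi> 1 a \<otimes>\<^bsub>N2 1\<^esub> \<xi> 1 b = \<zero>\<^bsub>N2 1\<^esub>"
    using assms G2.proj_zero_iff[of "dd a \<otimes>\<^bsub>G2.That\<^esub> dd b" 1] by (simp add: xi_proj N2_ops)
  then show ?thesis
    using assms N2.prod_minus(1)[of "pr\<^sub>2 1 a" 1 "pr\<^sub>2 1 b" "pr\<^sub>1 1 a" "pr\<^sub>1 1 b"] by (simp add: xi_def)
qed

text \<open>Elements of V pass across the tensor sign, so the two projections agree on them.\<close>

lemma xi_smult:
  assumes "v \<in> carrier V" "a \<in> carrier A"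
  shows "\<xi> n (v \<odot>\<^bsub>A\<^esub> a) = pr\<^sub>1 n (v \<odot>\<^bsub>A\<^esub> \<one>\<^bsub>A\<^esub>) \<otimes>\<^bsub>N2 n\<^esub> \<xi> n a"
proof -
  have v: "v \<odot>\<^bsub>A\<^esub> a = v \<odot>\<^bsub>A\<^esub> \<one>\<^bsub>A\<^esub> \<otimes>\<^bsub>A\<^esub> a" using assms by (simp add: A.smult_assoc2)
  have "pr\<^sub>2 n (v \<odot>\<^bsub>A\<^esub> \<one>\<^bsub>A\<^esub>) = pr\<^sub>1 n (v \<odot>\<^bsub>A\<^esub> \<one>\<^bsub>A\<^esub>)" using assms by (simp add: pr_eq t2_smult)
  then show ?thesis
    using assms unfolding v by (simp add: xi_def N2.minus_eq N2.r_distr N2.r_minus)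
qed

text \<open>Coordinates in a basis are unique; therefore each identity for \<open>pd\<close> follows
  from the corresponding identity for differentials.\<close>

lemma pd_add:
  assumes a: "a \<in> carrier A" and b: "b \<in> carrier A"
  shows "pd j (a \<oplus>\<^bsub>A\<^esub> b) = pd j a \<oplus>\<^bsub>A\<^esub> pd j b"
proof (cases "j < l")
  case True
  have "\<xi> 1 (a \<oplus>\<^bsub>A\<^esub> b) = comb 1 (\<lambda>j. pd j a) \<oplus>\<^bsub>N2 1\<^esub> comb 1 (\<lambda>j. pd j b)"
    unfolding xi_add[OF a b] xi_pd[OF a, symmetric] xi_pd[OF b, symmetric] by (rule refl)
  also have "\<dots> = comb 1 (\<lambda>j. pd j a \<oplus>\<^bsub>A\<^esub> pd j b)"
    by (rule comb_add[symmetric]) (use a b in auto)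
  finally show ?thesis using a b True by (intro pd_unique) auto
qed (simp add: pd_def)

lemma pd_mult:
  assumes a: "a \<in> carrier A" and b: "b \<in> carrier A"
  shows "pd j (a \<otimes>\<^bsub>A\<^esub> b) = a \<otimes>\<^bsub>A\<^esub> pd j b \<oplus>\<^bsub>A\<^esub> b \<otimes>\<^bsub>A\<^esub> pd j a"
proof (cases "j < l")
  case True
  have "\<xi> 1 (a \<otimes>\<^bsub>A\<^esub> b) = pr\<^sub>1 1 a \<otimes>\<^bsub>N2 1\<^esub> comb 1 (\<lambda>j. pd j b) \<oplus>\<^bsub>N2 1\<^esub> pr\<^sub>1 1 b \<otimes>\<^bsub>N2 1\<^esub> comb 1 (\<lambda>j. pd j a)"
    unfolding xi_mult[OF a b] xi_pd[OF a, symmetric] xi_pd[OF b, symmetric] by (rule refl)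
  also have "\<dots> = comb 1 (\<lambda>j. a \<otimes>\<^bsub>A\<^esub> pd j b) \<oplus>\<^bsub>N2 1\<^esub> comb 1 (\<lambda>j. b \<otimes>\<^bsub>A\<^esub> pd j a)"
    by (subst (1 2) comb_mult) (use a b in auto)
  also have "\<dots> = comb 1 (\<lambda>j. a \<otimes>\<^bsub>A\<^esub> pd j b \<oplus>\<^bsub>A\<^esub> b \<otimes>\<^bsub>A\<^esub> pd j a)"
    by (rule comb_add[symmetric]) (use a b in auto)
  finally show ?thesis using a b True by (intro pd_unique) auto
qed (use a b in \<open>simp add: pd_def\<close>)

lemma pd_smult:
  assumes v: "v \<in> carrier V" and a: "a \<in> carrier A"
  shows "pd j (v \<odot>\<^bsub>A\<^esub> a) = v \<odot>\<^bsub>A\<^esub> pd j a"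
proof (cases "j < l")
  case True
  have "\<xi> 1 (v \<odot>\<^bsub>A\<^esub> a) = pr\<^sub>1 1 (v \<odot>\<^bsub>A\<^esub> \<one>\<^bsub>A\<^esub>) \<otimes>\<^bsub>N2 1\<^esub> comb 1 (\<lambda>j. pd j a)"
    unfolding xi_smult[OF v a] xi_pd[OF a, symmetric] by (rule refl)
  also have "\<dots> = comb 1 (\<lambda>j. v \<odot>\<^bsub>A\<^esub> \<one>\<^bsub>A\<^esub> \<otimes>\<^bsub>A\<^esub> pd j a)"
    by (rule comb_mult[symmetric]) (use v a in auto)
  finally have "pd j (v \<odot>\<^bsub>A\<^esub> a) = v \<odot>\<^bsub>A\<^esub> \<one>\<^bsub>A\<^esub> \<otimes>\<^bsub>A\<^esub> pd j a"
    using v a True by (intro pd_unique) auto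
  then show ?thesis using v a by (simp add: A.smult_assoc2)
qed (use v in \<open>simp add: pd_def\<close>)

lemma pd_x: "i < l \<Longrightarrow> j < l \<Longrightarrow> pd j (x i) = (if i = j then \<one>\<^bsub>A\<^esub> else \<zero>\<^bsub>A\<^esub>)"
proof (rule pd_unique)
  assume i: "i < l"
  have "comb 1 (\<lambda>j. if i = j then \<one>\<^bsub>A\<^esub> else \<zero>\<^bsub>A\<^esub>) =
      (\<Oplus>\<^bsub>N2 1\<^esub>j\<in>{..<l}. if i = j then \<xi> 1 (x j) else \<zero>\<^bsub>N2 1\<^esub>)"
    unfolding comb_def by (rule N2.finsum_cong') auto
  also have "\<dots> = \<xi> 1 (x i)" using i by (intro N2.finsum_singleton) auto
  finally show "\<xi> 1 (x i) = comb 1 (\<lambda>j. if i = j then \<one>\<^bsub>A\<^esub> else \<zero>\<^bsub>A\<^esub>)" by simp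
qed auto

text \<open>The Leibniz rule for 1 times 1 says that the derivative of 1 equals twice
  itself.\<close>

lemma pd_one: "pd j \<one>\<^bsub>A\<^esub> = \<zero>\<^bsub>A\<^esub>"
proof -
  have "pd j \<one>\<^bsub>A\<^esub> = pd j \<one>\<^bsub>A\<^esub> \<oplus>\<^bsub>A\<^esub> pd j \<one>\<^bsub>A\<^esub>" using pd_mult[of "\<one>\<^bsub>A\<^esub>" "\<one>\<^bsub>A\<^esub>" j] by simp
  then show ?thesis using A.add.l_cancel_one[of "pd j \<one>\<^bsub>A\<^esub>" "pd j \<one>\<^bsub>A\<^esub>"] by simp
qed

text \<open>The derivation id \<otimes> \<partial>_j. It is well defined because \<partial>_j is
  V-linear, and it leaves the left factor alone, which makes it linear over the left copy of
  A.\<close>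

definition dAA :: "nat \<Rightarrow> 'a dbl \<Rightarrow> 'a dbl" where
  "dAA j = tlift AA (\<lambda>a b. t2 a (pd j b))"

lemma dAA: "abelian_group_hom AA AA (dAA j)"
  "a \<in> carrier A \<Longrightarrow> b \<in> carrier A \<Longrightarrow> dAA j (t2 a b) = t2 a (pd j b)"
proof -
  have h: "biadditive A A AA (\<lambda>a b. t2 a (pd j b))"
    using P2.biadditive_tens by (auto simp: biadditive_def AA_eq pd_add)
  have bal: "t2 (v \<odot>\<^bsub>A\<^esub> a) (pd j b) = t2 a (pd j (v \<odot>\<^bsub>A\<^esub> b))"
    if "v \<in> carrier V" "a \<in> carrier A" "b \<in> carrier A" for v a b
    using that by (simp add: t2_smult pd_smult)
  show "abelian_group_hom AA AA (dAA j)"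
    "a \<in> carrier A \<Longrightarrow> b \<in> carrier A \<Longrightarrow> dAA j (t2 a b) = t2 a (pd j b)"
    using P2.tlift[OF h bal] by (simp_all add: dAA_def flip: AA_eq)
qed

lemma t2_add_r: "a \<in> carrier A \<Longrightarrow> b \<in> carrier A \<Longrightarrow> c \<in> carrier A \<Longrightarrow>
    t2 a (b \<oplus>\<^bsub>A\<^esub> c) = t2 a b \<oplus>\<^bsub>AA\<^esub> t2 a c"
  unfolding AA_eq by (rule P2.tens_add_r)

lemma dAA_mult:
  assumes X: "X \<in> carrier AA" and Y: "Y \<in> carrier AA"
  shows "dAA j (X \<otimes>\<^bsub>AA\<^esub> Y) = X \<otimes>\<^bsub>AA\<^esub> dAA j Y \<oplus>\<^bsub>AA\<^esub> dAA j X \<otimes>\<^bsub>AA\<^esub> Y"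
proof -
  interpret d: abelian_group_hom AA AA "dAA j" by (rule dAA)
  have 1: "dAA j (t2 a b \<otimes>\<^bsub>AA\<^esub> t2 c d) = t2 a b \<otimes>\<^bsub>AA\<^esub> dAA j (t2 c d) \<oplus>\<^bsub>AA\<^esub> dAA j (t2 a b) \<otimes>\<^bsub>AA\<^esub> t2 c d"
    if "a \<in> carrier A" "b \<in> carrier A" "c \<in> carrier A" "d \<in> carrier A" for a b c d
    using that by (simp add: t2_mult dAA pd_mult t2_add_r A.m_comm[of d])
  have ext: "f Z = g Z" if "abelian_group_hom AA AA f" "abelian_group_hom AA AA g"
    "\<And>a b. a \<in> carrier A \<Longrightarrow> b \<in> carrier A \<Longrightarrow> f (t2 a b) = g (t2 a b)" "Z \<in> carrier AA" for f g Z
    by (rule P2.T_ext[of AA f g Z, folded AA_eq, OF that])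
  have 2: "dAA j (t2 a b \<otimes>\<^bsub>AA\<^esub> Z) = t2 a b \<otimes>\<^bsub>AA\<^esub> dAA j Z \<oplus>\<^bsub>AA\<^esub> dAA j (t2 a b) \<otimes>\<^bsub>AA\<^esub> Z"
    if ab: "a \<in> carrier A" "b \<in> carrier A" and Z: "Z \<in> carrier AA" for a b Z
  proof (rule ext[OF _ _ _ Z])
    show "abelian_group_hom AA AA (\<lambda>Z. dAA j (t2 a b \<otimes>\<^bsub>AA\<^esub> Z))"
      "abelian_group_hom AA AA (\<lambda>Z. t2 a b \<otimes>\<^bsub>AA\<^esub> dAA j Z \<oplus>\<^bsub>AA\<^esub> dAA j (t2 a b) \<otimes>\<^bsub>AA\<^esub> Z)"
      
      using ab by (intro abelian_group_homI' AA.abelian_group_axioms; simp add: AA.r_distr AA.a_ac)+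
  qed (use 1 ab in auto)
  show ?thesis
  proof (rule ext[OF _ _ _ X])
    show "abelian_group_hom AA AA (\<lambda>X. dAA j (X \<otimes>\<^bsub>AA\<^esub> Y))"
      "abelian_group_hom AA AA (\<lambda>X. X \<otimes>\<^bsub>AA\<^esub> dAA j Y \<oplus>\<^bsub>AA\<^esub> dAA j X \<otimes>\<^bsub>AA\<^esub> Y)"
      
      using Y by (intro abelian_group_homI' AA.abelian_group_axioms; simp add: AA.l_distr AA.a_ac)+
  qed (use 2 Y in auto)
qed

sublocale DD: aug_derivation p AA A "mu2 A" "\<lambda>a. t2 a \<one>\<^bsub>A\<^esub>" "dAA j" for j
  by (intro aug_derivation.intro aug_derivation_axioms.intro G2.augmented_axioms dAA(1) dAA_mult)

definition "nd j n = DD.nbd j n"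
abbreviation "rs n \<equiv> nb_res p V A n"

lemma rs_eq: "rs n = G2.res n"
  by (simp add: nb_res_def G2.res_def)

lemma rs_hom: "m \<le> n \<Longrightarrow> rs m \<in> ring_hom (N2 n) (N2 m)"
  by (simp add: rs_eq N2_ops G2.res_hom)

lemma rs_pr: "m \<le> n \<Longrightarrow> a \<in> carrier A \<Longrightarrow> rs m (pr\<^sub>1 n a) = pr\<^sub>1 m a"
  "m \<le> n \<Longrightarrow> a \<in> carrier A \<Longrightarrow> rs m (pr\<^sub>2 n a) = pr\<^sub>2 m a"
  by (simp_all add: rs_eq pr_eq G2.res_cls)

lemma rs_xi: "m \<le> n \<Longrightarrow> a \<in> carrier A \<Longrightarrow> rs m (\<xi> n a) = \<xi> m a"
  by (simp add: rs_eq xi_proj G2.res_proj)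

lemma nd_additive: "abelian_group_hom (N2 (Suc n)) (N2 n) (nd j n)"
  by (simp add: nd_def N2_ops DD.nbd_additive)

sublocale nd: abelian_group_hom "N2 (Suc n)" "N2 n" "nd j n" for j n
  by (rule nd_additive)

lemma nd_mult:
  "X \<in> carrier (N2 (Suc n)) \<Longrightarrow> Y \<in> carrier (N2 (Suc n)) \<Longrightarrow>
    nd j n (X \<otimes>\<^bsub>N2 (Suc n)\<^esub> Y) = rs n X \<otimes>\<^bsub>N2 n\<^esub> nd j n Y \<oplus>\<^bsub>N2 n\<^esub> nd j n X \<otimes>\<^bsub>N2 n\<^esub> rs n Y"
  by (simp add: nd_def rs_eq N2_ops DD.nbd_mult)

lemma nd_pr1: "a \<in> carrier A \<Longrightarrow> nd j n (pr\<^sub>1 (Suc n) a) = \<zero>\<^bsub>N2 n\<^esub>"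
proof -
  assume a: "a \<in> carrier A"
  have "t2 a \<zero>\<^bsub>A\<^esub> = \<zero>\<^bsub>AA\<^esub>"
    using a P2.tens_add_r[of a "\<zero>\<^bsub>A\<^esub>" "\<zero>\<^bsub>A\<^esub>"] AA.add.l_cancel_one[of "t2 a \<zero>\<^bsub>A\<^esub>" "t2 a \<zero>\<^bsub>A\<^esub>"] by (simp add: AA_eq)
  then show ?thesis
    using a by (simp add: nd_def pr_eq DD.nbd_cls dAA pd_one N2_ops)
qed

lemma nd_pr2: "a \<in> carrier A \<Longrightarrow> nd j n (pr\<^sub>2 (Suc n) a) = pr\<^sub>2 n (pd j a)"
  by (simp add: nd_def pr_eq DD.nbd_cls dAA)

lemma nd_xi: "i < l \<Longrightarrow> j < l \<Longrightarrow> nd j n (\<xi> (Suc n) (x i)) = (if i = j then \<one>\<^bsub>N2 n\<^esub> else \<zero>\<^bsub>N2 n\<^esub>)"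
  unfolding xi_def by (simp add: nd.hom_diff nd_pr1 nd_pr2 pd_x N2.minus_eq)

end

section \<open>Monomials\<close>

lemma mdeg_upd_Suc: "j < l \<Longrightarrow> mdeg l (\<beta>(j := Suc (\<beta> j))) = Suc (mdeg l \<beta>)"
  by (simp add: mdeg_def sum.remove[of _ j])

context cring
begin

context
  fixes l :: nat and t :: "nat \<Rightarrow> 'a"
  assumes t: "\<And>i. i < l \<Longrightarrow> t i \<in> carrier R"
begin

lemma mpow_closed: "mpow R l t \<beta> \<in> carrier R"
  unfolding mpow_def by (rule finprod_closed) (use t in auto)

lemma mpow_add: "mpow R l t (\<lambda>i. \<beta> i + \<gamma> i) = mpow R l t \<beta> \<otimes> mpow R l t \<gamma>"
proof -
  have "mpow R l t (\<lambda>i. \<beta> i + \<gamma> i) = (\<Otimes>i\<in>{..<l}. t i [^] \<beta> i \<otimes> t i [^] \<gamma> i)"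
    unfolding mpow_def by (rule finprod_cong') (use t in \<open>auto simp: nat_pow_mult\<close>)
  then show ?thesis
    unfolding mpow_def by (simp only:) (rule finprod_multf; use t in auto)
qed

lemma mpow_zero: "mpow R l t (\<lambda>_. 0) = \<one>"
  unfolding mpow_def by (simp add: finprod_one_eqI)

lemma mpow_split:
  assumes "j < l"
  shows "mpow R l t \<beta> = t j [^] \<beta> j \<otimes> (\<Otimes>i\<in>{..<l} - {j}. t i [^] \<beta> i)"
proof -
  have "{..<l} = insert j ({..<l} - {j})" using assms by auto
  then have "mpow R l t \<beta> = (\<Otimes>i\<in>insert j ({..<l} - {j}). t i [^] \<beta> i)" by (simp add: mpow_def)
  also have "\<dots> = t j [^] \<beta> j \<otimes> (\<Otimes>i\<in>{..<l} - {j}. t i [^] \<beta> i)"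
    by (rule finprod_insert) (use t assms in auto)
  finally show ?thesis .
qed

lemma mpow_unit:
  assumes "j < l"
  shows "mpow R l t (\<lambda>i. if i = j then 1 else 0) = t j"
proof -
  have "(\<Otimes>i\<in>{..<l} - {j}. t i [^] (if i = j then 1 else 0 :: nat)) = \<one>"
    by (rule finprod_one_eqI) auto
  then show ?thesis using mpow_split[OF assms, of "\<lambda>i. if i = j then 1 else 0"] t[OF assms] by simp
qed

end

end

lemma (in ring_hom_cring) hom_mpow:
  assumes "\<And>i. i < l \<Longrightarrow> t i \<in> carrier R"
  shows "h (mpow R l t \<beta>) = mpow S l (\<lambda>i. h (t i)) \<beta>"
proof -
  have "h (\<Otimes>\<^bsub>R\<^esub>i\<in>{..<l}. t i [^]\<^bsub>R\<^esub> \<beta> i) = (\<Otimes>\<^bsub>S\<^esub>i\<in>{..<l}. h (t i [^]\<^bsub>R\<^esub> \<beta> i))"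
    using assms by (subst hom_finprod) (auto simp: comp_def)
  also have "\<dots> = (\<Otimes>\<^bsub>S\<^esub>i\<in>{..<l}. h (t i) [^]\<^bsub>S\<^esub> \<beta> i)"
    by (rule S.finprod_cong') (use assms in auto)
  finally show ?thesis by (simp add: mpow_def)
qed

context augmented
begin

lemma D_pow: "u \<in> I \<Longrightarrow> u [^]\<^bsub>That\<^esub> k \<in> D k"
proof (induction k)
  case 0
  show ?case by (simp add: diag_power_def)
next
  case (Suc k)
  then show ?case using D_mult[of "u [^]\<^bsub>That\<^esub> k" k u 1] by (simp add: D_1)
qed

lemma D_finprod:
  assumes "finite F" "\<And>i. i \<in> F \<Longrightarrow> u i \<in> I"
  shows "(\<Otimes>\<^bsub>That\<^esub>i\<in>F. u i [^]\<^bsub>That\<^esub> \<beta> i) \<in> D (sum \<beta> F)"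
  using assms
proof (induction F rule: finite_induct)
  case empty
  then show ?case by (simp add: diag_power_def)
next
  case (insert i F)
  have c: "u k \<in> carrier That" if "k \<in> insert i F" for k
    using insert.prems[OF that] I.Icarr by blast
  have "(\<Otimes>\<^bsub>That\<^esub>k\<in>insert i F. u k [^]\<^bsub>That\<^esub> \<beta> k) = u i [^]\<^bsub>That\<^esub> \<beta> i \<otimes>\<^bsub>That\<^esub> (\<Otimes>\<^bsub>That\<^esub>k\<in>F. u k [^]\<^bsub>That\<^esub> \<beta> k)"
    using insert.hyps c by (intro That.finprod_insert) auto
  then show ?case using D_mult[OF D_pow[of "u i" "\<beta> i"] insert.IH] insert by simp
qed

lemma D_mpow: "(\<And>i. i < l \<Longrightarrow> u i \<in> I) \<Longrightarrow> mpow That l u \<beta> \<in> D (mdeg l \<beta>)"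
  unfolding mpow_def mdeg_def by (rule D_finprod) auto

lemma aug_I:
  assumes "u \<in> I" shows "aug (proj n u) = \<zero>\<^bsub>A\<^esub>"
proof -
  have inj: "inj_on (to_completion A (p_ideal p A)) (carrier A)"
    using complete by (simp add: adically_complete_def bij_betw_def)
  have "to_completion A (p_ideal p A) \<zero>\<^bsub>A\<^esub> = \<zero>\<^bsub>Ahat\<^esub>"
    using TA.S.to_completion_hom A.ring_axioms Ahat.ring_axioms
    unfolding p_completion_def by (rule ring_hom_zero)
  then show ?thesis
    using assms inv_into_f_f[OF inj, of "\<zero>\<^bsub>A\<^esub>"] by (simp add: aug_proj I_iff)
qed

end

section \<open>Monomials in the coordinate differences and their derivatives\<close>

context smooth_diagonal
begin

definition mon :: "nat \<Rightarrow> (nat \<Rightarrow> nat) \<Rightarrow> 'a nbhd2" where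
  "mon n \<beta> = mpow (N2 n) l (\<lambda>j. \<xi> n (x j)) \<beta>"

text \<open>The lift of \<open>mon\<close> to the completion, where membership in a power of the
  diagonal ideal can be stated.\<close>

definition Mon :: "(nat \<Rightarrow> nat) \<Rightarrow> nat \<Rightarrow> 'a dbl set" where
  "Mon \<beta> = mpow G2.That l (\<lambda>j. dd (x j)) \<beta>"

lemma Mon_D: "Mon \<beta> \<in> G2.D (mdeg l \<beta>)"
  unfolding Mon_def by (rule G2.D_mpow) (simp add: dd_I)

lemma Mon_closed: "Mon \<beta> \<in> carrier G2.That"
  unfolding Mon_def by (rule G2.That.mpow_closed) simp

lemma mpow_cong: "(\<And>i. i < l \<Longrightarrow> t i = t' i) \<Longrightarrow> (\<And>i. i < l \<Longrightarrow> t' i \<in> carrier (N2 n)) \<Longrightarrow>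
    mpow (N2 n) l t \<beta> = mpow (N2 n) l t' \<beta>"
  unfolding mpow_def by (rule N2.finprod_cong') auto

lemma mon_proj: "mon n \<beta> = G2.proj n (Mon \<beta>)"
proof -
  have "G2.proj n (Mon \<beta>) = mpow (G2.N n) l (\<lambda>i. G2.proj n (dd (x i))) \<beta>"
    unfolding Mon_def by (rule G2.proj.hom_mpow) simp
  also have "\<dots> = mon n \<beta>"
    unfolding mon_def N2_ops[symmetric] by (rule mpow_cong) (simp_all add: xi_proj)
  finally show ?thesis by simp
qed

lemma mon_closed [simp]: "mon n \<beta> \<in> carrier (N2 n)"
  by (simp add: mon_proj Mon_closed)

lemma mon_zero: "mon n (\<lambda>_. 0) = \<one>\<^bsub>N2 n\<^esub>"
  unfolding mon_def by (rule N2.mpow_zero) simp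

lemma mon_add: "mon n (\<lambda>i. \<beta> i + \<gamma> i) = mon n \<beta> \<otimes>\<^bsub>N2 n\<^esub> mon n \<gamma>"
  unfolding mon_def by (rule N2.mpow_add) simp

lemma mon_unit: "j < l \<Longrightarrow> mon n (\<lambda>i. if i = j then 1 else 0) = \<xi> n (x j)"
  unfolding mon_def by (rule N2.mpow_unit) simp

lemma mon_high: "n < mdeg l \<beta> \<Longrightarrow> mon n \<beta> = \<zero>\<^bsub>N2 n\<^esub>"
  unfolding mon_proj N2_ops using G2.D_antimono[of "Suc n" "mdeg l \<beta>"] Mon_D[of \<beta>]
  by (subst G2.proj_zero_iff[OF Mon_closed]) auto

lemma aug_mon: "0 < mdeg l \<beta> \<Longrightarrow> G2.aug (mon n \<beta>) = \<zero>\<^bsub>A\<^esub>"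
  unfolding mon_proj using G2.D_antimono[of "Suc 0" "mdeg l \<beta>"] Mon_D[of \<beta>]
  by (intro G2.aug_I) (auto simp: G2.D_1)

lemma aug_pr1: "a \<in> carrier A \<Longrightarrow> G2.aug (pr\<^sub>1 n a) = a"
  by (simp add: pr_eq G2.aug_cls mu2)

lemma rs_mon: "m \<le> n \<Longrightarrow> rs m (mon n \<beta>) = mon m \<beta>"
  by (simp add: mon_proj rs_eq G2.res_proj Mon_closed)

lemma nd_pow:
  fixes k :: nat
  assumes "i < l" "j < l"
  shows "nd j n (\<xi> (Suc n) (x i) [^]\<^bsub>N2 (Suc n)\<^esub> k) =
    (if i = j \<and> k > 0 then add_pow (N2 n) k (\<xi> n (x i) [^]\<^bsub>N2 n\<^esub> (k - 1)) else \<zero>\<^bsub>N2 n\<^esub>)"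
proof (induction k)
  case 0
  have "nd j n (pr\<^sub>1 (Suc n) \<one>\<^bsub>A\<^esub>) = \<zero>\<^bsub>N2 n\<^esub>" by (rule nd_pr1) simp
  then show ?case by simp
next
  case (Suc k)
  interpret rs: ring_hom_cring "N2 (Suc n)" "N2 n" "rs n"
    by unfold_locales (rule rs_hom, simp)
  have x: "\<xi> n (x i) \<in> carrier (N2 n)" "\<xi> (Suc n) (x i) \<in> carrier (N2 (Suc n))" using assms by auto
  have r: "rs n (\<xi> (Suc n) (x i)) = \<xi> n (x i)" using assms by (simp add: rs_xi)
  have *: "nd j n (\<xi> (Suc n) (x i) [^]\<^bsub>N2 (Suc n)\<^esub> Suc k) =
    \<xi> n (x i) [^]\<^bsub>N2 n\<^esub> k \<otimes>\<^bsub>N2 n\<^esub> (if i = j then \<one>\<^bsub>N2 n\<^esub> else \<zero>\<^bsub>N2 n\<^esub>) \<oplus>\<^bsub>N2 n\<^esub>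
    nd j n (\<xi> (Suc n) (x i) [^]\<^bsub>N2 (Suc n)\<^esub> k) \<otimes>\<^bsub>N2 n\<^esub> \<xi> n (x i)"
    using x assms by (simp add: nd_mult nd_xi r)
  show ?case
  proof (cases "i = j")
    case True
    show ?thesis
    proof (cases k)
      case 0
      then show ?thesis using * Suc.IH True x by simp
    next
      case (Suc m)
      then show ?thesis using * Suc.IH True x
        by (simp add: N2.add_pow_ldistr N2.add.nat_pow_Suc N2.a_comm N2.l_distr)
    qed
  next
    case False
    then show ?thesis using * Suc.IH x by simp
  qed
qed

lemma nd_finprod_zero:
  fixes \<beta> :: "nat \<Rightarrow> nat"
  assumes "finite F" "F \<subseteq> {..<l}" "j < l" "j \<notin> F"
  shows "nd j n (\<Otimes>\<^bsub>N2 (Suc n)\<^esub>i\<in>F. \<xi> (Suc n) (x i) [^]\<^bsub>N2 (Suc n)\<^esub> \<beta> i) = \<zero>\<^bsub>N2 n\<^esub>"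
  using assms
proof (induction F rule: finite_induct)
  case empty
  then show ?case using nd_pr1[of "\<one>\<^bsub>A\<^esub>" j n] by simp
next
  case (insert i F)
  interpret rs: ring_hom_cring "N2 (Suc n)" "N2 n" "rs n"
    by unfold_locales (rule rs_hom, simp)
  have c: "\<xi> (Suc n) (x k) \<in> carrier (N2 (Suc n))" if "k \<in> insert i F" for k
    using insert.prems that by auto
  have pw: "\<xi> (Suc n) (x k) [^]\<^bsub>N2 (Suc n)\<^esub> \<beta> k \<in> carrier (N2 (Suc n))" if "k \<in> insert i F" for k
    by (rule N2.nat_pow_closed[OF c[OF that]])
  have p: "(\<Otimes>\<^bsub>N2 (Suc n)\<^esub>k\<in>F. \<xi> (Suc n) (x k) [^]\<^bsub>N2 (Suc n)\<^esub> \<beta> k) \<in> carrier (N2 (Suc n))"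
    by (rule N2.finprod_closed) (use pw in auto)
  have "(\<Otimes>\<^bsub>N2 (Suc n)\<^esub>k\<in>insert i F. \<xi> (Suc n) (x k) [^]\<^bsub>N2 (Suc n)\<^esub> \<beta> k) =
      \<xi> (Suc n) (x i) [^]\<^bsub>N2 (Suc n)\<^esub> \<beta> i \<otimes>\<^bsub>N2 (Suc n)\<^esub> (\<Otimes>\<^bsub>N2 (Suc n)\<^esub>k\<in>F. \<xi> (Suc n) (x k) [^]\<^bsub>N2 (Suc n)\<^esub> \<beta> k)"
    by (rule N2.finprod_insert) (use insert.hyps pw in auto)
  then show ?case using insert c p by (simp add: nd_mult nd_pow)
qed

text \<open>The power of the j-th variable is split off: it obeys the power rule, while the product
  of the other powers is killed by the derivation.\<close>

lemma nd_mon: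
  assumes j: "j < l"
  shows "nd j n (mon (Suc n) \<beta>) =
    (if \<beta> j = 0 then \<zero>\<^bsub>N2 n\<^esub> else add_pow (N2 n) (\<beta> j) (mon n (\<beta>(j := \<beta> j - 1))))"
proof -
  interpret rs: ring_hom_cring "N2 (Suc n)" "N2 n" "rs n"
    by unfold_locales (rule rs_hom, simp)
  define F where "F = {..<l} - {j}"
  define r where "r m = (\<Otimes>\<^bsub>N2 m\<^esub>i\<in>F. \<xi> m (x i) [^]\<^bsub>N2 m\<^esub> \<beta> i)" for m
  have rc: "r m \<in> carrier (N2 m)" for m
    unfolding r_def by (intro N2.finprod_closed) (auto simp: F_def)
  have s: "mon m \<gamma> = \<xi> m (x j) [^]\<^bsub>N2 m\<^esub> \<gamma> j \<otimes>\<^bsub>N2 m\<^esub> (\<Otimes>\<^bsub>N2 m\<^esub>i\<in>F. \<xi> m (x i) [^]\<^bsub>N2 m\<^esub> \<gamma> i)" for m \<gamma>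
    unfolding mon_def F_def by (rule N2.mpow_split) (use j in auto)
  have rsr: "rs n (r (Suc n)) = r n"
  proof -
    have "rs n (r (Suc n)) = (\<Otimes>\<^bsub>N2 n\<^esub>i\<in>F. rs n (\<xi> (Suc n) (x i) [^]\<^bsub>N2 (Suc n)\<^esub> \<beta> i))"
      unfolding r_def by (subst rs.hom_finprod) (auto simp: F_def comp_def)
    also have "\<dots> = r n"
      unfolding r_def by (rule N2.finprod_cong') (auto simp: F_def rs_xi)
    finally show ?thesis .
  qed
  have nr: "nd j n (r (Suc n)) = \<zero>\<^bsub>N2 n\<^esub>"
    unfolding r_def by (rule nd_finprod_zero) (use j in \<open>auto simp: F_def\<close>)
  have r': "(\<Otimes>\<^bsub>N2 n\<^esub>i\<in>F. \<xi> n (x i) [^]\<^bsub>N2 n\<^esub> (\<beta>(j := \<beta> j - 1)) i) = r n"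
    unfolding r_def by (rule N2.finprod_cong') (auto simp: F_def)
  have "mon (Suc n) \<beta> = \<xi> (Suc n) (x j) [^]\<^bsub>N2 (Suc n)\<^esub> \<beta> j \<otimes>\<^bsub>N2 (Suc n)\<^esub> r (Suc n)"
    unfolding s[of "Suc n" \<beta>] r_def by simp
  then have "nd j n (mon (Suc n) \<beta>) = nd j n (\<xi> (Suc n) (x j) [^]\<^bsub>N2 (Suc n)\<^esub> \<beta> j) \<otimes>\<^bsub>N2 n\<^esub> r n"
    using j rc by (simp add: nd_mult nr rsr)
  moreover have "mon n (\<beta>(j := \<beta> j - 1)) = \<xi> n (x j) [^]\<^bsub>N2 n\<^esub> (\<beta> j - 1) \<otimes>\<^bsub>N2 n\<^esub> r n"
    unfolding s r' by simp
  ultimately show ?thesis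
    using j rc by (simp add: nd_pow N2.add_pow_ldistr)
qed

subsection \<open>The monomials generate\<close>

text \<open>The exponent \<beta> is unrestricted, which makes closure under products immediate.
  Monomials of degree above n vanish, and \<open>mon\<close> depends only on the exponents at
  positions below l.\<close>

inductive_set span :: "nat \<Rightarrow> 'a nbhd2 set" for n where
  base: "a \<in> carrier A \<Longrightarrow> pr\<^sub>1 n a \<otimes>\<^bsub>N2 n\<^esub> mon n \<beta> \<in> span n"
| add: "X \<in> span n \<Longrightarrow> Y \<in> span n \<Longrightarrow> X \<oplus>\<^bsub>N2 n\<^esub> Y \<in> span n"

lemma span_closed: "X \<in> span n \<Longrightarrow> X \<in> carrier (N2 n)"
  by (induction rule: span.induct) auto

lemma span_zero: "\<zero>\<^bsub>N2 n\<^esub> \<in> span n"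
  using span.base[of "\<zero>\<^bsub>A\<^esub>" n] by simp

lemma span_mult:
  assumes X: "X \<in> span n" and Y: "Y \<in> span n"
  shows "X \<otimes>\<^bsub>N2 n\<^esub> Y \<in> span n"
  using X
proof (induction rule: span.induct)
  case (base a \<beta>)
  from Y show ?case
  proof (induction rule: span.induct)
    case (base b \<gamma>)
    have eq: "(pr\<^sub>1 n a \<otimes>\<^bsub>N2 n\<^esub> mon n \<beta>) \<otimes>\<^bsub>N2 n\<^esub> (pr\<^sub>1 n b \<otimes>\<^bsub>N2 n\<^esub> mon n \<gamma>) =
        pr\<^sub>1 n (a \<otimes>\<^bsub>A\<^esub> b) \<otimes>\<^bsub>N2 n\<^esub> mon n (\<lambda>i. \<beta> i + \<gamma> i)"
      using \<open>a \<in> _\<close> base by (simp add: mon_add N2.m_ac)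
    show ?case unfolding eq by (rule span.base) (use \<open>a \<in> _\<close> base in auto)
  next
    case (add Z W)
    then show ?case using base span_closed by (simp add: N2.r_distr span.add)
  qed
next
  case (add Z W)
  then show ?case using span_closed Y by (simp add: N2.l_distr span.add)
qed

lemma comb_span: "(\<And>i. i < l \<Longrightarrow> a i \<in> carrier A) \<Longrightarrow> comb n a \<in> span n"
proof -
  assume a: "\<And>i. i < l \<Longrightarrow> a i \<in> carrier A"
  have "(\<Oplus>\<^bsub>N2 n\<^esub>i\<in>F. pr\<^sub>1 n (a i) \<otimes>\<^bsub>N2 n\<^esub> \<xi> n (x i)) \<in> span n" if "finite F" "F \<subseteq> {..<l}" for F
    using that
  proof (induction F rule: finite_induct)
    case empty
    then show ?case by (simp add: span_zero)
  next
    case (insert i F)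
    have i: "i < l" using insert by auto
    have "pr\<^sub>1 n (a i) \<otimes>\<^bsub>N2 n\<^esub> \<xi> n (x i) \<in> span n"
      using span.base[OF a[OF i], of n "\<lambda>k. if k = i then 1 else 0"] mon_unit[OF i] by simp
    moreover have "(\<Oplus>\<^bsub>N2 n\<^esub>k\<in>insert i F. pr\<^sub>1 n (a k) \<otimes>\<^bsub>N2 n\<^esub> \<xi> n (x k)) =
        pr\<^sub>1 n (a i) \<otimes>\<^bsub>N2 n\<^esub> \<xi> n (x i) \<oplus>\<^bsub>N2 n\<^esub> (\<Oplus>\<^bsub>N2 n\<^esub>k\<in>F. pr\<^sub>1 n (a k) \<otimes>\<^bsub>N2 n\<^esub> \<xi> n (x k))"
      using insert a by (intro N2.finsum_insert) auto
    ultimately show ?case using insert by (simp add: span.add)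
  qed
  then show ?thesis unfolding comb_def by simp
qed

text \<open>An equation with \<open>comb 1\<close> determines an element only modulo the square of
  the diagonal ideal. This lift is a definite element of the ideal, and its class on every
  neighbourhood is a combination of the coordinate differences.\<close>

definition Comb :: "(nat \<Rightarrow> 'a) \<Rightarrow> nat \<Rightarrow> 'a dbl set" where
  "Comb a = (\<Oplus>\<^bsub>G2.That\<^esub>i\<in>{..<l}. G2.emb (t2 (a i) \<one>\<^bsub>A\<^esub>) \<otimes>\<^bsub>G2.That\<^esub> dd (x i))"

lemma Comb:
  assumes a: "\<And>i. i < l \<Longrightarrow> a i \<in> carrier A"
  shows "Comb a \<in> G2.I" "G2.proj n (Comb a) = comb n a"
proof -
  have "(\<Oplus>\<^bsub>G2.That\<^esub>i\<in>F. G2.emb (t2 (a i) \<one>\<^bsub>A\<^esub>) \<otimes>\<^bsub>G2.That\<^esub> dd (x i)) \<in> G2.I" if "finite F" "F \<subseteq> {..<l}" for F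
    using that
  proof (induction F rule: finite_induct)
    case empty
    then show ?case using G2.I.zero_closed by simp
  next
    case (insert i F)
    have i: "i < l" using insert by auto
    have "G2.emb (t2 (a i) \<one>\<^bsub>A\<^esub>) \<otimes>\<^bsub>G2.That\<^esub> dd (x i) \<in> G2.I"
      using i a by (intro G2.I.I_l_closed dd_I) auto
    moreover have "(\<Oplus>\<^bsub>G2.That\<^esub>i\<in>insert i F. G2.emb (t2 (a i) \<one>\<^bsub>A\<^esub>) \<otimes>\<^bsub>G2.That\<^esub> dd (x i)) =
        G2.emb (t2 (a i) \<one>\<^bsub>A\<^esub>) \<otimes>\<^bsub>G2.That\<^esub> dd (x i) \<oplus>\<^bsub>G2.That\<^esub>
        (\<Oplus>\<^bsub>G2.That\<^esub>i\<in>F. G2.emb (t2 (a i) \<one>\<^bsub>A\<^esub>) \<otimes>\<^bsub>G2.That\<^esub> dd (x i))"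
      using insert a by (intro G2.That.finsum_insert) auto
    ultimately show ?case using insert G2.I.a_closed by simp
  qed
  then show "Comb a \<in> G2.I" unfolding Comb_def by simp
  interpret pj: abelian_group_hom G2.That "N2 n" "G2.proj n"
    unfolding N2_ops by (rule ring_hom_additive[OF G2.That.ring_axioms G2.N.ring_axioms G2.proj_hom])
  have "G2.proj n (Comb a) = (\<Oplus>\<^bsub>N2 n\<^esub>i\<in>{..<l}. G2.proj n (G2.emb (t2 (a i) \<one>\<^bsub>A\<^esub>) \<otimes>\<^bsub>G2.That\<^esub> dd (x i)))"
    unfolding Comb_def by (rule pj.hom_finsum) (use a in auto)
  also have "\<dots> = comb n a"
    unfolding comb_def
    by (rule N2.finsum_cong') (use a in \<open>auto simp: N2_ops xi_proj pr_eq G2.cls_eq\<close>)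
  finally show "G2.proj n (Comb a) = comb n a" .
qed

text \<open>The differentials generate the diagonal ideal modulo its square, and products of
  approximations approximate products: in i j - g h = (i - g) j + g (j - h) both summands vanish to
  one order more. The level n of the span is unrelated to k.\<close>

lemma D_approx:
  assumes "u \<in> G2.D (Suc k)"
  shows "\<exists>g\<in>G2.D (Suc k). G2.proj n g \<in> span n \<and> u \<ominus>\<^bsub>G2.That\<^esub> g \<in> G2.D (Suc (Suc k))"
  using assms
proof (induction k arbitrary: u)
  case 0
  then have u: "u \<in> G2.I" by (simp add: G2.D_1)
  then have w: "G2.proj 1 u \<in> carrier W" unfolding carrier_W by blast
  define a where "a = dcoef (G2.proj 1 u)"
  have a: "\<And>i. i < l \<Longrightarrow> a i \<in> carrier A" and e: "G2.proj 1 u = comb 1 a"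
    using dcoef[OF w] by (auto simp: a_def)
  have "G2.proj 1 u = G2.proj 1 (Comb a)" using e Comb(2)[OF a] by simp
  then have "u \<ominus>\<^bsub>G2.That\<^esub> Comb a \<in> G2.D (Suc 1)"
    using G2.proj_eq_iff[of u "Comb a" 1] G2.I.Icarr[OF u] G2.I.Icarr[OF Comb(1)[OF a]] by simp
  then show ?case
    using Comb[OF a] comb_span[of a n] a by (intro bexI[of _ "Comb a"]) (auto simp: G2.D_1)
next
  case (Suc k)
  from Suc.prems have "u \<in> ideal_prod G2.That G2.I (G2.D (Suc k))"
    by (simp add: diag_power_def ideal_power.simps(2)[of _ _ "Suc k"])
  then show ?case
  proof (induction rule: ideal_prod.induct)
    case (prod i j)
    have i: "i \<in> G2.D (Suc 0)" using prod by (simp add: G2.D_1)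
    \<comment> \<open>The argument of the base case, for the factor i in the diagonal ideal
      itself.\<close>
    have "\<exists>g\<in>G2.D (Suc 0). G2.proj n g \<in> span n \<and> i \<ominus>\<^bsub>G2.That\<^esub> g \<in> G2.D (Suc (Suc 0))"
    proof -
      have u: "i \<in> G2.I" by (rule prod)
      then have w: "G2.proj 1 i \<in> carrier W" unfolding carrier_W by blast
      define a where "a = dcoef (G2.proj 1 i)"
      have a: "\<And>i. i < l \<Longrightarrow> a i \<in> carrier A" and e: "G2.proj 1 i = comb 1 a"
        using dcoef[OF w] by (auto simp: a_def)
      have "G2.proj 1 i = G2.proj 1 (Comb a)" using e Comb(2)[OF a] by simp
      then have "i \<ominus>\<^bsub>G2.That\<^esub> Comb a \<in> G2.D (Suc 1)"
        using G2.proj_eq_iff[of i "Comb a" 1] G2.I.Icarr[OF u] G2.I.Icarr[OF Comb(1)[OF a]] by simp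
      then show ?thesis
        using Comb[OF a] comb_span[of a n] a by (intro bexI[of _ "Comb a"]) (auto simp: G2.D_1)
    qed
    then obtain g where g: "g \<in> G2.D (Suc 0)" "G2.proj n g \<in> span n" "i \<ominus>\<^bsub>G2.That\<^esub> g \<in> G2.D (Suc (Suc 0))"
      by blast
    obtain h where h: "h \<in> G2.D (Suc k)" "G2.proj n h \<in> span n" "j \<ominus>\<^bsub>G2.That\<^esub> h \<in> G2.D (Suc (Suc k))"
      using Suc.IH[OF prod(2)] by blast
    have c: "i \<in> carrier G2.That" "j \<in> carrier G2.That" "g \<in> carrier G2.That" "h \<in> carrier G2.That"
      using G2.D.Icarr[OF i] G2.D.Icarr[OF prod(2)] G2.D.Icarr[OF g(1)] G2.D.Icarr[OF h(1)] by blast+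
    have "(i \<ominus>\<^bsub>G2.That\<^esub> g) \<otimes>\<^bsub>G2.That\<^esub> j \<in> G2.D (Suc (Suc (Suc k)))"
      using G2.D_mult[OF g(3) prod(2)] by simp
    moreover have "g \<otimes>\<^bsub>G2.That\<^esub> (j \<ominus>\<^bsub>G2.That\<^esub> h) \<in> G2.D (Suc (Suc (Suc k)))"
      using G2.D_mult[OF g(1) h(3)] by simp
    ultimately have "i \<otimes>\<^bsub>G2.That\<^esub> j \<ominus>\<^bsub>G2.That\<^esub> g \<otimes>\<^bsub>G2.That\<^esub> h \<in> G2.D (Suc (Suc (Suc k)))"
      unfolding G2.That.prod_minus(2)[OF c(1,2,3,4)] by (rule G2.D.a_closed)
    moreover have "g \<otimes>\<^bsub>G2.That\<^esub> h \<in> G2.D (Suc (Suc k))" using G2.D_mult[OF g(1) h(1)] by simp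
    moreover have "G2.proj n (g \<otimes>\<^bsub>G2.That\<^esub> h) \<in> span n"
      using span_mult[OF g(2) h(2)] c by (simp add: N2_ops)
    ultimately show ?case by blast
  next
    case (sum u v)
    obtain g where g: "g \<in> G2.D (Suc (Suc k))" "G2.proj n g \<in> span n" "u \<ominus>\<^bsub>G2.That\<^esub> g \<in> G2.D (Suc (Suc (Suc k)))"
      using sum.IH(1) by blast
    obtain h where h: "h \<in> G2.D (Suc (Suc k))" "G2.proj n h \<in> span n" "v \<ominus>\<^bsub>G2.That\<^esub> h \<in> G2.D (Suc (Suc (Suc k)))"
      using sum.IH(2) by blast
    have uv: "u \<in> G2.D (Suc (Suc k))" "v \<in> G2.D (Suc (Suc k))"
      using sum.hyps by (simp_all add: diag_power_def ideal_power.simps(2)[of _ _ "Suc k"])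
    have c: "u \<in> carrier G2.That" "v \<in> carrier G2.That" "g \<in> carrier G2.That" "h \<in> carrier G2.That"
      using G2.D.Icarr[OF uv(1)] G2.D.Icarr[OF uv(2)] G2.D.Icarr[OF g(1)] G2.D.Icarr[OF h(1)] by blast+
    have e: "(u \<oplus>\<^bsub>G2.That\<^esub> v) \<ominus>\<^bsub>G2.That\<^esub> (g \<oplus>\<^bsub>G2.That\<^esub> h) = (u \<ominus>\<^bsub>G2.That\<^esub> g) \<oplus>\<^bsub>G2.That\<^esub> (v \<ominus>\<^bsub>G2.That\<^esub> h)"
      using c by (simp add: G2.That.minus_eq G2.That.minus_add G2.That.a_ac)
    show ?case
    proof (intro bexI[of _ "g \<oplus>\<^bsub>G2.That\<^esub> h"] conjI)
      show "(u \<oplus>\<^bsub>G2.That\<^esub> v) \<ominus>\<^bsub>G2.That\<^esub> (g \<oplus>\<^bsub>G2.That\<^esub> h) \<in> G2.D (Suc (Suc (Suc k)))"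
        unfolding e by (rule G2.D.a_closed[OF g(3) h(3)])
      show "G2.proj n (g \<oplus>\<^bsub>G2.That\<^esub> h) \<in> span n"
        using span.add[OF g(2) h(2)] c by (simp add: N2_ops)
      show "g \<oplus>\<^bsub>G2.That\<^esub> h \<in> G2.D (Suc (Suc k))" by (rule G2.D.a_closed[OF g(1) h(1)])
    qed
  qed
qed

text \<open>Each approximation raises the order of the remainder by one, and a remainder of order n
  + 1 is zero on the n-th neighbourhood; hence the induction on n - k.\<close>

lemma proj_D_span: "k \<le> n \<Longrightarrow> u \<in> G2.D (Suc k) \<Longrightarrow> G2.proj n u \<in> span n"
proof (induction "n - k" arbitrary: k u)
  case 0
  then have "u \<in> G2.D (Suc n)" by simp
  then have "G2.proj n u = \<zero>\<^bsub>N2 n\<^esub>"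
    unfolding N2_ops using G2.proj_zero_iff[OF G2.D.Icarr] by blast
  then show ?case by (simp add: span_zero)
next
  case (Suc d)
  obtain g where g: "g \<in> G2.D (Suc k)" "G2.proj n g \<in> span n" "u \<ominus>\<^bsub>G2.That\<^esub> g \<in> G2.D (Suc (Suc k))"
    using D_approx[OF Suc.prems(2)] by blast
  have c: "u \<in> carrier G2.That" "g \<in> carrier G2.That"
    using G2.D.Icarr[OF Suc.prems(2)] G2.D.Icarr[OF g(1)] by blast+
  have "G2.proj n (u \<ominus>\<^bsub>G2.That\<^esub> g) \<in> span n"
    using Suc.hyps(1)[of "Suc k"] Suc.hyps(2) g(3) by simp
  moreover have "G2.proj n u = G2.proj n (u \<ominus>\<^bsub>G2.That\<^esub> g) \<oplus>\<^bsub>N2 n\<^esub> G2.proj n g"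
    using c by (simp add: N2_ops G2.That.minus_eq G2.N.a_assoc G2.N.l_neg)
  ultimately show ?case using span.add g(2) by simp
qed

text \<open>\<open>decomp\<close> splits off the part that comes from A, a multiple of the trivial
  monomial; the rest lies in the diagonal ideal.\<close>

lemma N2_span: "X \<in> carrier (N2 n) \<Longrightarrow> X \<in> span n"
proof -
  assume "X \<in> carrier (N2 n)"
  then obtain u where u: "u \<in> carrier G2.That" "X = G2.proj n u"
    unfolding N2_ops by (rule G2.N_cases)
  obtain a where a: "a \<in> carrier A" "u \<ominus>\<^bsub>G2.That\<^esub> G2.emb (t2 a \<one>\<^bsub>A\<^esub>) \<in> G2.I"
    using G2.decomp[OF u(1)] by blast
  have "G2.proj n (u \<ominus>\<^bsub>G2.That\<^esub> G2.emb (t2 a \<one>\<^bsub>A\<^esub>)) \<in> span n"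
    using proj_D_span[of 0 n] a(2) by (simp add: G2.D_1)
  moreover have "G2.proj n (G2.emb (t2 a \<one>\<^bsub>A\<^esub>)) \<in> span n"
    using span.base[OF a(1), of n "\<lambda>_. 0"] a by (simp add: mon_zero pr_eq G2.cls_eq)
  moreover have "X = G2.proj n (u \<ominus>\<^bsub>G2.That\<^esub> G2.emb (t2 a \<one>\<^bsub>A\<^esub>)) \<oplus>\<^bsub>N2 n\<^esub> G2.proj n (G2.emb (t2 a \<one>\<^bsub>A\<^esub>))"
    using u a(1) by (simp add: N2_ops G2.That.minus_eq G2.N.a_assoc G2.N.l_neg)
  ultimately show ?thesis using span.add by simp
qed

end

section \<open>Expansions along the diagonal\<close>

definition indices :: "nat \<Rightarrow> nat \<Rightarrow> (nat \<Rightarrow> nat) set" where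
  "indices l n = {\<beta> \<in> multi_indices l. mdeg l \<beta> \<le> n}"

lemma finite_indices: "finite (indices l n)"
proof (rule finite_subset)
  have "\<beta> i \<le> n" if "i < l" "mdeg l \<beta> \<le> n" for \<beta> i
    using member_le_sum[of i "{..<l}" \<beta>] that by (simp add: mdeg_def)
  then show "indices l n \<subseteq> {\<beta>. \<forall>i. (i \<in> {..<l} \<longrightarrow> \<beta> i \<in> {..n}) \<and> (i \<notin> {..<l} \<longrightarrow> \<beta> i = 0)}"
    by (auto simp: indices_def multi_indices_def)
  show "finite {\<beta> :: nat \<Rightarrow> nat. \<forall>i. (i \<in> {..<l} \<longrightarrow> \<beta> i \<in> {..n}) \<and> (i \<notin> {..<l} \<longrightarrow> \<beta> i = 0)}"
    by (rule finite_set_of_finite_funs) auto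
qed

lemma zero_indices: "(\<lambda>_. 0) \<in> indices l n"
  by (simp add: indices_def multi_indices_def mdeg_def)

lemma mdeg_pos:
  assumes "\<beta> \<in> indices l n" "\<beta> \<noteq> (\<lambda>_. 0)"
  obtains j where "j < l" "\<beta> j > 0"
proof -
  obtain j where "\<beta> j \<noteq> 0" using assms(2) by auto
  moreover have "j < l"
    using \<open>\<beta> j \<noteq> 0\<close> assms(1) by (auto simp: indices_def multi_indices_def intro: ccontr)
  ultimately show ?thesis using that by blast
qed

text \<open>For reindexing the derivative of an expansion: the terms that survive in direction j are
  those with positive j-th exponent.\<close>

lemma indices_shift:
  assumes "j < l"
  shows "(\<lambda>\<gamma>. \<gamma>(j := Suc (\<gamma> j))) ` indices l n = {\<beta> \<in> indices l (Suc n). \<beta> j > 0}"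
    "inj_on (\<lambda>\<gamma>. \<gamma>(j := Suc (\<gamma> j))) (indices l n)"
proof -
  have "\<beta> \<in> (\<lambda>\<gamma>. \<gamma>(j := Suc (\<gamma> j))) ` indices l n" if "\<beta> \<in> indices l (Suc n)" "\<beta> j > 0" for \<beta>
  proof (rule image_eqI[of _ _ "\<beta>(j := \<beta> j - 1)"])
    show eq: "\<beta> = (\<lambda>\<gamma>. \<gamma>(j := Suc (\<gamma> j))) (\<beta>(j := \<beta> j - 1))" using that by auto
    show "\<beta>(j := \<beta> j - 1) \<in> indices l n"
      using mdeg_upd_Suc[OF assms, of "\<beta>(j := \<beta> j - 1)"] that assms
      by (auto simp: indices_def multi_indices_def)
  qed
  then show "(\<lambda>\<gamma>. \<gamma>(j := Suc (\<gamma> j))) ` indices l n = {\<beta> \<in> indices l (Suc n). \<beta> j > 0}"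
    using assms by (auto simp: indices_def multi_indices_def mdeg_upd_Suc)
  show "inj_on (\<lambda>\<gamma>. \<gamma>(j := Suc (\<gamma> j))) (indices l n)"
  proof (rule inj_onI)
    fix \<beta> \<gamma> :: "nat \<Rightarrow> nat" assume eq: "\<beta>(j := Suc (\<beta> j)) = \<gamma>(j := Suc (\<gamma> j))"
    show "\<beta> = \<gamma>"
    proof
      fix i show "\<beta> i = \<gamma> i" using fun_cong[OF eq, of i] by (cases "i = j") auto
    qed
  qed
qed

locale module_diagonal = smooth_diagonal p V A l x + M: module A M
  for p :: nat and V :: "('v, 'x) ring_scheme" and A :: "('v, 'a) module" and l x
    and M :: "('a, 'e, 'y) module_scheme"
begin

sublocale X1: base_extension A "N2 n" "pr1 p V A n" M for n
  by unfold_locales (rule pr_hom)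

sublocale X2: base_extension A "N2 n" "pr2 p V A n" M for n
  by unfold_locales (rule pr_hom)

abbreviation "E1 n \<equiv> base_change A (nb2 p V A n) (pr1 p V A n) M"
abbreviation "E2 n \<equiv> base_change A (nb2 p V A n) (pr2 p V A n) M"
abbreviation "pure1 n \<equiv> bc_pure A (nb2 p V A n) (pr1 p V A n) M"
abbreviation "pure2 n \<equiv> bc_pure A (nb2 p V A n) (pr2 p V A n) M"

lemma pure1_zero: "b \<in> carrier (N2 n) \<Longrightarrow> pure1 n b \<zero>\<^bsub>M\<^esub> = \<zero>\<^bsub>E1 n\<^esub>"
  using abelian_group_hom.hom_zero[OF X1.pure_additive_r] .

lemma pure1_zero_l: "m \<in> carrier M \<Longrightarrow> pure1 n \<zero>\<^bsub>N2 n\<^esub> m = \<zero>\<^bsub>E1 n\<^esub>"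
  using abelian_group_hom.hom_zero[OF X1.pure_additive_l] .

text \<open>The truncated Taylor series with coefficients c in the module; coefficients from A are
  absorbed into c through the tensor relation.\<close>

definition ex :: "nat \<Rightarrow> ((nat \<Rightarrow> nat) \<Rightarrow> 'e) \<Rightarrow> ('a nbhd2 \<times> 'e \<Rightarrow>\<^sub>0 int) set" where
  "ex n c = (\<Oplus>\<^bsub>E1 n\<^esub>\<beta>\<in>indices l n. pure1 n (mon n \<beta>) (c \<beta>))"

lemma ex_closed: "(\<And>\<beta>. \<beta> \<in> indices l n \<Longrightarrow> c \<beta> \<in> carrier M) \<Longrightarrow> ex n c \<in> carrier (E1 n)"
  unfolding ex_def by (rule X1.BC.finsum_closed) auto

lemma ex_cong:
  "(\<And>\<beta>. \<beta> \<in> indices l n \<Longrightarrow> c \<beta> = c' \<beta>) \<Longrightarrow> (\<And>\<beta>. \<beta> \<in> indices l n \<Longrightarrow> c' \<beta> \<in> carrier M) \<Longrightarrow> ex n c = ex n c'"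
  unfolding ex_def by (rule X1.BC.finsum_cong') auto

lemma ex_hom:
  assumes h: "abelian_group_hom (E1 n) G h" and c: "\<And>\<beta>. \<beta> \<in> indices l n \<Longrightarrow> c \<beta> \<in> carrier M"
  shows "h (ex n c) = (\<Oplus>\<^bsub>G\<^esub>\<beta>\<in>indices l n. h (pure1 n (mon n \<beta>) (c \<beta>)))"
  unfolding ex_def by (rule abelian_group_hom.hom_finsum[OF h]) (use c in auto)

lemma ex_diff:
  assumes c: "\<And>\<beta>. c \<beta> \<in> carrier M" and c': "\<And>\<beta>. c' \<beta> \<in> carrier M"
  shows "ex n (\<lambda>\<beta>. c \<beta> \<ominus>\<^bsub>M\<^esub> c' \<beta>) = ex n c \<ominus>\<^bsub>E1 n\<^esub> ex n c'"
proof -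
  have add: "ex n (\<lambda>\<beta>. c \<beta> \<oplus>\<^bsub>M\<^esub> c' \<beta>) = ex n c \<oplus>\<^bsub>E1 n\<^esub> ex n c'"
    if c: "\<And>\<beta>. c \<beta> \<in> carrier M" and c': "\<And>\<beta>. c' \<beta> \<in> carrier M" for c c'
  proof -
    have "ex n (\<lambda>\<beta>. c \<beta> \<oplus>\<^bsub>M\<^esub> c' \<beta>) =
        (\<Oplus>\<^bsub>E1 n\<^esub>\<beta>\<in>indices l n. pure1 n (mon n \<beta>) (c \<beta>) \<oplus>\<^bsub>E1 n\<^esub> pure1 n (mon n \<beta>) (c' \<beta>))"
      unfolding ex_def by (rule X1.BC.finsum_cong') (use that in \<open>auto simp: X1.pure_add_r\<close>)
    also have "\<dots> = ex n c \<oplus>\<^bsub>E1 n\<^esub> ex n c'"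
      unfolding ex_def by (rule X1.BC.finsum_addf) (use that in auto)
    finally show ?thesis .
  qed
  have d: "ex n (\<lambda>\<beta>. c \<beta> \<ominus>\<^bsub>M\<^esub> c' \<beta>) \<in> carrier (E1 n)" "ex n c' \<in> carrier (E1 n)" "ex n c \<in> carrier (E1 n)"
    using c c' by (auto intro!: ex_closed)
  have "ex n (\<lambda>\<beta>. c \<beta> \<ominus>\<^bsub>M\<^esub> c' \<beta>) \<oplus>\<^bsub>E1 n\<^esub> ex n c' = ex n (\<lambda>\<beta>. c \<beta> \<ominus>\<^bsub>M\<^esub> c' \<beta> \<oplus>\<^bsub>M\<^esub> c' \<beta>)"
    using c c' by (intro add[symmetric]) auto
  also have "\<dots> = ex n c"
    using c c' by (intro ex_cong) (auto simp: M.M.minus_eq M.M.a_assoc M.M.l_neg)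
  finally have e: "ex n c = ex n (\<lambda>\<beta>. c \<beta> \<ominus>\<^bsub>M\<^esub> c' \<beta>) \<oplus>\<^bsub>E1 n\<^esub> ex n c'" by (rule sym)
  show ?thesis
    unfolding X1.BC.minus_eq using e by (subst X1.BC.add.inv_solve_right[OF d(1,3,2)])
qed

lemma ex_zero: "ex n (\<lambda>_. \<zero>\<^bsub>M\<^esub>) = \<zero>\<^bsub>E1 n\<^esub>"
  unfolding ex_def by (rule X1.BC.add.finprod_one_eqI) (simp add: pure1_zero)

lemma ex_single:
  assumes "\<beta> \<in> indices l n" "m \<in> carrier M"
  shows "ex n (\<lambda>\<gamma>. if \<beta> = \<gamma> then m else \<zero>\<^bsub>M\<^esub>) = pure1 n (mon n \<beta>) m"
proof -
  have "ex n (\<lambda>\<gamma>. if \<beta> = \<gamma> then m else \<zero>\<^bsub>M\<^esub>) =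
      (\<Oplus>\<^bsub>E1 n\<^esub>\<gamma>\<in>indices l n. if \<beta> = \<gamma> then pure1 n (mon n \<gamma>) m else \<zero>\<^bsub>E1 n\<^esub>)"
    unfolding ex_def by (rule X1.BC.finsum_cong') (use assms in \<open>auto simp: pure1_zero\<close>)
  also have "\<dots> = pure1 n (mon n \<beta>) m"
    using assms by (intro X1.BC.finsum_singleton finite_indices) auto
  finally show ?thesis .
qed

lemma mon_cut: "mon n (\<lambda>i. if i < l then \<beta> i else 0) = mon n \<beta>"
  unfolding mon_def mpow_def by (rule N2.finprod_cong') auto

text \<open>The coefficient a is moved across the tensor sign onto m. A monomial of degree above n
  vanishes and is represented by the zero family.\<close>

lemma pure1_expand:
  assumes X: "X \<in> span n" and m: "m \<in> carrier M"
  shows "\<exists>c. (\<forall>\<beta>. c \<beta> \<in> carrier M) \<and> pure1 n X m = ex n c"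
  using X
proof (induction rule: span.induct)
  case (base a \<beta>)
  define \<gamma> where "\<gamma> = (\<lambda>i. if i < l then \<beta> i else 0)"
  have "pure1 n (pr1 p V A n a \<otimes>\<^bsub>N2 n\<^esub> mon n \<beta>) m = pure1 n (mon n \<gamma> \<otimes>\<^bsub>N2 n\<^esub> pr1 p V A n a) m"
    using base by (simp add: \<gamma>_def mon_cut N2.m_comm)
  also have "\<dots> = pure1 n (mon n \<gamma>) (a \<odot>\<^bsub>M\<^esub> m)"
    using base m by (simp add: X1.pure_smult)
  finally have eq: "pure1 n (pr1 p V A n a \<otimes>\<^bsub>N2 n\<^esub> mon n \<beta>) m = pure1 n (mon n \<gamma>) (a \<odot>\<^bsub>M\<^esub> m)" .
  show ?case
  proof (cases "mdeg l \<gamma> \<le> n")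
    case True
    then have "\<gamma> \<in> indices l n" by (simp add: indices_def multi_indices_def \<gamma>_def)
    then show ?thesis
      unfolding eq using base m ex_single[of \<gamma> n "a \<odot>\<^bsub>M\<^esub> m"]
      by (intro exI[of _ "\<lambda>\<delta>. if \<gamma> = \<delta> then a \<odot>\<^bsub>M\<^esub> m else \<zero>\<^bsub>M\<^esub>"]) auto
  next
    case False
    then show ?thesis
      unfolding eq using base m by (intro exI[of _ "\<lambda>_. \<zero>\<^bsub>M\<^esub>"]) (simp add: mon_high pure1_zero_l ex_zero)
  qed
next
  case (add Y Z)
  obtain c where c: "\<And>\<beta>. c \<beta> \<in> carrier M" "pure1 n Y m = ex n c" using add.IH(1) by blast
  obtain d where d: "\<And>\<beta>. d \<beta> \<in> carrier M" "pure1 n Z m = ex n d" using add.IH(2) by blast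
  have YZ: "Y \<in> carrier (N2 n)" "Z \<in> carrier (N2 n)" using add.hyps span_closed by auto
  have dc: "ex n d \<in> carrier (E1 n)" "ex n c \<in> carrier (E1 n)" using c d by (auto intro!: ex_closed)
  \<comment> \<open>The sum is written as c - (0 - d), so that \<open>ex_diff\<close> alone
    suffices.\<close>
  have "ex n (\<lambda>\<beta>. c \<beta> \<ominus>\<^bsub>M\<^esub> (\<zero>\<^bsub>M\<^esub> \<ominus>\<^bsub>M\<^esub> d \<beta>)) = ex n c \<ominus>\<^bsub>E1 n\<^esub> (\<zero>\<^bsub>E1 n\<^esub> \<ominus>\<^bsub>E1 n\<^esub> ex n d)"
    using c d by (simp add: ex_diff ex_zero)
  then have "ex n (\<lambda>\<beta>. c \<beta> \<ominus>\<^bsub>M\<^esub> (\<zero>\<^bsub>M\<^esub> \<ominus>\<^bsub>M\<^esub> d \<beta>)) = pure1 n (Y \<oplus>\<^bsub>N2 n\<^esub> Z) m"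
    using dc YZ m by (simp add: X1.pure_add_l c d X1.BC.minus_eq)
  then show ?case using c(1) d(1) by (intro exI[of _ "\<lambda>\<beta>. c \<beta> \<ominus>\<^bsub>M\<^esub> (\<zero>\<^bsub>M\<^esub> \<ominus>\<^bsub>M\<^esub> d \<beta>)"]) auto
qed

lemma expand:
  assumes "z \<in> carrier (E1 n)"
  shows "\<exists>c. (\<forall>\<beta>. c \<beta> \<in> carrier M) \<and> z = ex n c"
  using assms
proof (induction rule: X1.BC_induct)
  case zero
  then show ?case using ex_zero by (intro exI[of _ "\<lambda>_. \<zero>\<^bsub>M\<^esub>"]) auto
next
  case (pure b m)
  then show ?case using pure1_expand[OF N2_span] by blast
next
  case (diff Y Z)
  obtain c where c: "\<And>\<beta>. c \<beta> \<in> carrier M" "Y = ex n c" using diff.IH(1) by blast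
  obtain d where d: "\<And>\<beta>. d \<beta> \<in> carrier M" "Z = ex n d" using diff.IH(2) by blast
  show ?case
    using c d by (intro exI[of _ "\<lambda>\<beta>. c \<beta> \<ominus>\<^bsub>M\<^esub> d \<beta>"]) (simp add: ex_diff)
qed

section \<open>Uniqueness of the coefficients\<close>

lemma aug_lift:
  "abelian_group_hom (E1 n) M (tlift M (\<lambda>b m. G2.aug b \<odot>\<^bsub>M\<^esub> m))"
  "b \<in> carrier (N2 n) \<Longrightarrow> m \<in> carrier M \<Longrightarrow> tlift M (\<lambda>b m. G2.aug b \<odot>\<^bsub>M\<^esub> m) (pure1 n b m) = G2.aug b \<odot>\<^bsub>M\<^esub> m"
proof -
  have aug: "G2.aug \<in> ring_hom (N2 n) A" unfolding N2_ops by (rule G2.aug_hom)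
  have h: "biadditive (N2 n) M M (\<lambda>b m. G2.aug b \<odot>\<^bsub>M\<^esub> m)"
    using ring_hom_closed[OF aug] ring_hom_add[OF aug]
    by (auto simp: biadditive_def M.M.abelian_group_axioms M.smult_l_distr M.smult_r_distr)
  have bal: "G2.aug (b \<otimes>\<^bsub>N2 n\<^esub> pr1 p V A n a) \<odot>\<^bsub>M\<^esub> m = G2.aug b \<odot>\<^bsub>M\<^esub> (a \<odot>\<^bsub>M\<^esub> m)"
    if "b \<in> carrier (N2 n)" "a \<in> carrier A" "m \<in> carrier M" for b a m
    using that ring_hom_closed[OF aug] ring_hom_mult[OF aug] by (simp add: aug_pr1 M.smult_assoc1)
  show "abelian_group_hom (E1 n) M (tlift M (\<lambda>b m. G2.aug b \<odot>\<^bsub>M\<^esub> m))"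
    "b \<in> carrier (N2 n) \<Longrightarrow> m \<in> carrier M \<Longrightarrow> tlift M (\<lambda>b m. G2.aug b \<odot>\<^bsub>M\<^esub> m) (pure1 n b m) = G2.aug b \<odot>\<^bsub>M\<^esub> m"
    using X1.bc_lift[OF h bal] by simp_all
qed

text \<open>Restriction to the diagonal kills every monomial of positive degree and so reads off the
  constant coefficient.\<close>

lemma aug_ex:
  assumes c: "\<And>\<beta>. c \<beta> \<in> carrier M"
  shows "tlift M (\<lambda>b m. G2.aug b \<odot>\<^bsub>M\<^esub> m) (ex n c) = c (\<lambda>_. 0)"
proof -
  have aug: "G2.aug \<in> ring_hom (N2 n) A" unfolding N2_ops by (rule G2.aug_hom)
  have z: "G2.aug (mon n \<beta>) \<odot>\<^bsub>M\<^esub> c \<beta> = (if (\<lambda>_. 0) = \<beta> then c \<beta> else \<zero>\<^bsub>M\<^esub>)" if ind: "\<beta> \<in> indices l n" for \<beta>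
  proof (cases "\<beta> = (\<lambda>_. 0)")
    case True
    then show ?thesis using c ring_hom_one[OF aug] by (simp add: mon_zero)
  next
    case False
    then obtain j where "j < l" "\<beta> j > 0" using mdeg_pos[OF ind] by blast
    then have "0 < mdeg l \<beta>" by (auto simp: mdeg_def intro!: sum_pos2[of _ j])
    then show ?thesis using False c by (simp add: aug_mon)
  qed
  have "tlift M (\<lambda>b m. G2.aug b \<odot>\<^bsub>M\<^esub> m) (ex n c) =
      (\<Oplus>\<^bsub>M\<^esub>\<beta>\<in>indices l n. if (\<lambda>_. 0) = \<beta> then c \<beta> else \<zero>\<^bsub>M\<^esub>)"
    unfolding ex_hom[OF aug_lift(1) c]
    by (rule M.M.finsum_cong') (use c z in \<open>auto simp: aug_lift(2)\<close>)
  also have "\<dots> = c (\<lambda>_. 0)"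
    using c by (intro M.M.finsum_singleton finite_indices zero_indices) auto
  finally show ?thesis .
qed

text \<open>The derivation kills the left copy of A, so its tensor product with the identity of M
  respects the relations of the base change.\<close>

sublocale ND: bc_morphism A "N2 (Suc n)" "pr1 p V A (Suc n)" M "N2 n" "pr1 p V A n" M "nd j n" id for j n
proof (intro bc_morphism.intro bc_morphism_axioms.intro X1.base_extension_axioms nd_additive)
  show "abelian_group_hom M M id" by (rule abelian_group_homI') (auto simp: M.M.abelian_group_axioms)
  fix b a assume "b \<in> carrier (N2 (Suc n))" "a \<in> carrier A"
  then show "nd j n (b \<otimes>\<^bsub>N2 (Suc n)\<^esub> pr1 p V A (Suc n) a) = nd j n b \<otimes>\<^bsub>N2 n\<^esub> pr1 p V A n a"
    using ring_hom_closed[OF rs_hom[of n "Suc n"], of b] by (simp add: nd_mult nd_pr1 rs_pr)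
qed auto

abbreviation "ndm j n \<equiv> bc_map A (nb2 p V A n) (pr1 p V A n) M (nd j n) id"

lemma add_pow_closed [simp]: "m \<in> carrier M \<Longrightarrow> add_pow M (k::nat) m \<in> carrier M"
  by (rule M.M.add.nat_pow_closed)

lemma pure1_add_pow:
  assumes "b \<in> carrier (N2 n)" "m \<in> carrier M"
  shows "pure1 n (add_pow (N2 n) (k::nat) b) m = pure1 n b (add_pow M k m)"
  using abelian_group_hom.hom_add_pow[OF X1.pure_additive_l[OF assms(2)] assms(1), of k]
    abelian_group_hom.hom_add_pow[OF X1.pure_additive_r[OF assms(1)] assms(2), of k] by simp

text \<open>Differentiation multiplies each term by its j-th exponent and lowers that exponent;
  expressed in the lowered index \<gamma>, the factor is one more than the j-th entry of
  \<gamma>.\<close>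

lemma nd_ex:
  assumes j: "j < l" and c: "\<And>\<beta>. c \<beta> \<in> carrier M"
  shows "ndm j n (ex (Suc n) c) = ex n (\<lambda>\<gamma>. add_pow M (Suc (\<gamma> j)) (c (\<gamma>(j := Suc (\<gamma> j)))))"
proof -
  define sh where "sh = (\<lambda>\<gamma> :: nat \<Rightarrow> nat. \<gamma>(j := Suc (\<gamma> j)))"
  define f where "f \<beta> = pure1 n (mon n (\<beta>(j := \<beta> j - 1))) (add_pow M (\<beta> j) (c \<beta>))" for \<beta>
  have v: "ndm j n (pure1 (Suc n) (mon (Suc n) \<beta>) (c \<beta>)) = (if \<beta> j = 0 then \<zero>\<^bsub>E1 n\<^esub> else f \<beta>)" for \<beta>
  proof -
    have "ndm j n (pure1 (Suc n) (mon (Suc n) \<beta>) (c \<beta>)) = pure1 n (nd j n (mon (Suc n) \<beta>)) (c \<beta>)"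
      using ND.bm_pure[of "mon (Suc n) \<beta>" n "c \<beta>" j] c by simp
    then show ?thesis using c j by (simp add: nd_mon pure1_zero_l pure1_add_pow f_def)
  qed
  have fc: "f \<beta> \<in> carrier (E1 n)" for \<beta> using c by (simp add: f_def)
  have fsh: "f (sh \<gamma>) = pure1 n (mon n \<gamma>) (add_pow M (Suc (\<gamma> j)) (c (sh \<gamma>)))" for \<gamma>
  proof -
    have "(sh \<gamma>)(j := sh \<gamma> j - 1) = \<gamma>" "sh \<gamma> j = Suc (\<gamma> j)" by (auto simp: sh_def)
    then show ?thesis unfolding f_def by (simp only:)
  qed
  have "ndm j n (ex (Suc n) c) = (\<Oplus>\<^bsub>E1 n\<^esub>\<beta>\<in>indices l (Suc n). if \<beta> j = 0 then \<zero>\<^bsub>E1 n\<^esub> else f \<beta>)"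
    unfolding ex_hom[OF ND.bm_additive c] by (rule X1.BC.finsum_cong') (use fc v in auto)
  also have "\<dots> = (\<Oplus>\<^bsub>E1 n\<^esub>\<beta>\<in>{\<beta> \<in> indices l (Suc n). \<beta> j > 0}. f \<beta>)"
    by (rule X1.BC.add.finprod_mono_neutral_cong_right) (use fc finite_indices in auto)
  also have "\<dots> = (\<Oplus>\<^bsub>E1 n\<^esub>\<gamma>\<in>indices l n. f (sh \<gamma>))"
    unfolding indices_shift(1)[OF j, of n, symmetric] sh_def[symmetric]
    by (rule X1.BC.finsum_reindex) (use fc indices_shift(2)[OF j, of n] in \<open>auto simp: sh_def\<close>)
  also have "\<dots> = ex n (\<lambda>\<gamma>. add_pow M (Suc (\<gamma> j)) (c (sh \<gamma>)))"
    unfolding ex_def fsh by (rule refl)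
  finally show ?thesis by (simp add: sh_def)
qed

lemma ex_unique_0:
  assumes c: "\<And>\<beta>. c \<beta> \<in> carrier M" and z: "ex n c = \<zero>\<^bsub>E1 n\<^esub>"
  shows "c (\<lambda>_. 0) = \<zero>\<^bsub>M\<^esub>"
proof -
  have "c (\<lambda>_. 0) = tlift M (\<lambda>b m. G2.aug b \<odot>\<^bsub>M\<^esub> m) \<zero>\<^bsub>E1 n\<^esub>"
    unfolding z[symmetric] by (rule aug_ex[OF c, symmetric])
  also have "\<dots> = \<zero>\<^bsub>M\<^esub>" by (rule abelian_group_hom.hom_zero[OF aug_lift(1)])
  finally show ?thesis .
qed

text \<open>Induction on n. A coefficient of positive degree reappears, times a positive integer, in
  some derivative of the expansion, which lives one level lower; torsion-freeness removes the
  integer. The constant coefficient is read off on the diagonal.\<close>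

lemma ex_unique:
  assumes tf: "\<And>k m. 0 < (k::nat) \<Longrightarrow> m \<in> carrier M \<Longrightarrow> add_pow M k m = \<zero>\<^bsub>M\<^esub> \<Longrightarrow> m = \<zero>\<^bsub>M\<^esub>"
    and c: "\<And>\<beta>. c \<beta> \<in> carrier M" and z: "ex n c = \<zero>\<^bsub>E1 n\<^esub>" and \<beta>: "\<beta> \<in> indices l n"
  shows "c \<beta> = \<zero>\<^bsub>M\<^esub>"
  using c z \<beta>
proof (induction n arbitrary: c \<beta>)
  case (0 c \<beta>)
  have "mdeg l \<beta> = 0" "\<beta> \<in> multi_indices l" using 0 by (auto simp: indices_def)
  then have "\<beta> = (\<lambda>_. 0)" 
  proof (intro ext)
    fix i
    show "\<beta> i = 0"
      using member_le_sum[of i "{..<l}" \<beta>] \<open>mdeg l \<beta> = 0\<close> \<open>\<beta> \<in> multi_indices l\<close>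
      by (cases "i < l") (auto simp: mdeg_def multi_indices_def)
  qed
  then show ?case using ex_unique_0[OF 0(1,2)] by (simp only:)
next
  case (Suc n c \<beta>)
  show ?case
  proof (cases "\<beta> = (\<lambda>_. 0)")
    case True
    then show ?thesis using ex_unique_0[OF Suc.prems(1,2)] by (simp only:)
  next
    case False
    then obtain j where j: "j < l" "\<beta> j > 0" using mdeg_pos[OF Suc.prems(3)] by blast
    then have "\<beta> \<in> (\<lambda>\<gamma>. \<gamma>(j := Suc (\<gamma> j))) ` indices l n"
      using Suc.prems(3) indices_shift(1)[OF j(1), of n] by auto
    then obtain \<gamma> where \<gamma>: "\<gamma> \<in> indices l n" "\<beta> = \<gamma>(j := Suc (\<gamma> j))" by blast
    have "ndm j n (ex (Suc n) c) = \<zero>\<^bsub>E1 n\<^esub>"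
      using abelian_group_hom.hom_zero[OF ND.bm_additive, of n j] by (simp only: Suc.prems(2))
    then have "ex n (\<lambda>\<gamma>. add_pow M (Suc (\<gamma> j)) (c (\<gamma>(j := Suc (\<gamma> j))))) = \<zero>\<^bsub>E1 n\<^esub>"
      using nd_ex[OF j(1), of c n] Suc.prems(1) by (simp only:)
    then have "add_pow M (Suc (\<gamma> j)) (c (\<gamma>(j := Suc (\<gamma> j)))) = \<zero>\<^bsub>M\<^esub>"
      by (rule Suc.IH[rotated, OF _ \<gamma>(1)]) (rule add_pow_closed, rule Suc.prems(1))
    then show ?thesis unfolding \<gamma>(2) by (rule tf[OF zero_less_Suc Suc.prems(1)])
  qed
qed

lemma ex_inj:
  assumes tf: "\<And>k m. 0 < (k::nat) \<Longrightarrow> m \<in> carrier M \<Longrightarrow> add_pow M k m = \<zero>\<^bsub>M\<^esub> \<Longrightarrow> m = \<zero>\<^bsub>M\<^esub>"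
    and c: "\<And>\<beta>. c \<beta> \<in> carrier M" "\<And>\<beta>. d \<beta> \<in> carrier M" and z: "ex n c = ex n d" and \<beta>: "\<beta> \<in> indices l n"
  shows "c \<beta> = d \<beta>"
proof -
  have "ex n d \<in> carrier (E1 n)" using c by (auto intro!: ex_closed)
  then have "ex n (\<lambda>\<beta>. c \<beta> \<ominus>\<^bsub>M\<^esub> d \<beta>) = \<zero>\<^bsub>E1 n\<^esub>"
    using ex_diff[OF c, of n] z by (simp add: X1.BC.minus_eq X1.BC.r_neg)
  then have "c \<beta> \<ominus>\<^bsub>M\<^esub> d \<beta> = \<zero>\<^bsub>M\<^esub>"
  proof (rule ex_unique[where c = "\<lambda>\<beta>. c \<beta> \<ominus>\<^bsub>M\<^esub> d \<beta>" and n = n and \<beta> = \<beta>, rotated 2])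
    show "\<beta> \<in> indices l n" by (rule \<beta>)
    show "m = \<zero>\<^bsub>M\<^esub>" if "0 < (k::nat)" "m \<in> carrier M" "add_pow M k m = \<zero>\<^bsub>M\<^esub>" for k m
      by (rule tf[OF that])
    show "c \<gamma> \<ominus>\<^bsub>M\<^esub> d \<gamma> \<in> carrier M" for \<gamma>
      by (rule M.M.minus_closed[OF c])
  qed
  then show ?thesis
    using M.M.add.inv_solve_right[of "\<zero>\<^bsub>M\<^esub>" "c \<beta>" "d \<beta>"] c by (simp add: M.M.minus_eq)
qed

lemma res_morphism: "m \<le> n \<Longrightarrow> bc_morphism A (N2 n) (pr1 p V A n) M (N2 m) (pr1 p V A m) M (rs m) id"
  "m \<le> n \<Longrightarrow> bc_morphism A (N2 n) (pr2 p V A n) M (N2 m) (pr2 p V A m) M (rs m) id"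
proof -
  assume mn: "m \<le> n"
  have id: "abelian_group_hom M M id" by (rule abelian_group_homI') (auto simp: M.M.abelian_group_axioms)
  have r: "abelian_group_hom (N2 n) (N2 m) (rs m)"
    by (rule ring_hom_additive[OF N2.ring_axioms N2.ring_axioms rs_hom[OF mn]])
  show "bc_morphism A (N2 n) (pr1 p V A n) M (N2 m) (pr1 p V A m) M (rs m) id"
    by (intro bc_morphism.intro bc_morphism_axioms.intro X1.base_extension_axioms r id)
       (use mn in \<open>auto simp: ring_hom_mult[OF rs_hom[OF mn]] rs_pr\<close>)
  show "bc_morphism A (N2 n) (pr2 p V A n) M (N2 m) (pr2 p V A m) M (rs m) id"
    by (intro bc_morphism.intro bc_morphism_axioms.intro X2.base_extension_axioms r id)
       (use mn in \<open>auto simp: ring_hom_mult[OF rs_hom[OF mn]] rs_pr\<close>)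
qed

text \<open>Restriction maps monomials to monomials, and those of degree above m become zero, so an
  expansion is merely truncated.\<close>

lemma res_ex:
  assumes mn: "m \<le> n" and c: "\<And>\<beta>. c \<beta> \<in> carrier M"
  shows "bc_map A (N2 m) (pr1 p V A m) M (rs m) id (ex n c) = ex m c"
proof -
  interpret r: bc_morphism A "N2 n" "pr1 p V A n" M "N2 m" "pr1 p V A m" M "rs m" id
    by (rule res_morphism[OF mn])
  have "r.bm (ex n c) = (\<Oplus>\<^bsub>E1 m\<^esub>\<beta>\<in>indices l n. pure1 m (mon m \<beta>) (c \<beta>))"
    unfolding ex_hom[OF r.bm_additive c]
    by (rule X1.BC.finsum_cong') (use c mn in \<open>auto simp: r.bm_pure rs_mon\<close>)
  also have "\<dots> = ex m c"
    unfolding ex_def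
    by (rule X1.BC.add.finprod_mono_neutral_cong_right)
       (use c mn finite_indices in \<open>auto simp: indices_def mon_high pure1_zero_l\<close>)
  finally show ?thesis .
qed

end

section \<open>Taylor coefficients of a stratification\<close>

text \<open>The conditions of \<open>stratification\<close> on the maps \<epsilon>_n, with
  torsion-freeness of the module in the place of isocoherence.\<close>

locale strat_diagonal = module_diagonal p V A l x M
  for p :: nat and V :: "('v, 'x) ring_scheme" and A :: "('v, 'a) module" and l x
    and M :: "('a, 'e) module" +
  fixes \<epsilon> :: "nat \<Rightarrow> ('a, 'e) pull2 \<Rightarrow> ('a, 'e) pull2"
  assumes tf: "\<And>k m. 0 < (k::nat) \<Longrightarrow> m \<in> carrier M \<Longrightarrow> add_pow M k m = \<zero>\<^bsub>M\<^esub> \<Longrightarrow> m = \<zero>\<^bsub>M\<^esub>"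
    and eps_iso: "\<And>n. \<epsilon> n \<in> mod_iso (N2 n) (E2 n) (E1 n)"
    and eps_res: "\<And>m n z. m \<le> n \<Longrightarrow> z \<in> carrier (E2 n) \<Longrightarrow>
      \<epsilon> m (p2_map p V A m M (nb_res p V A m) id z) = p1_map p V A m M (nb_res p V A m) id (\<epsilon> n z)"
    and eps_0: "\<And>z. z \<in> carrier (E2 0) \<Longrightarrow> \<epsilon> 0 z = z"
    and eps_cocycle: "\<And>n. \<exists>g12 g23 g13.
         is_pullback p V A n M (q12 p V A n) (tr1 p V A n) (tr2 p V A n) (\<epsilon> n) g12 \<and>
         is_pullback p V A n M (q23 p V A n) (tr2 p V A n) (tr3 p V A n) (\<epsilon> n) g23 \<and>
         is_pullback p V A n M (q13 p V A n) (tr1 p V A n) (tr3 p V A n) (\<epsilon> n) g13 \<and>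
         (\<forall>z\<in>carrier (base_change A (N3 n) (tr3 p V A n) M). g12 (g23 z) = g13 z)"
begin

lemma eps_additive: "abelian_group_hom (E2 n) (E1 n) (\<epsilon> n)"
  using eps_iso[of n]
  by (intro abelian_group_homI' X1.abelian_group_BC X2.abelian_group_BC) (auto simp: mod_iso_def mod_hom_def)

lemma eps_smult: "b \<in> carrier (N2 n) \<Longrightarrow> z \<in> carrier (E2 n) \<Longrightarrow> \<epsilon> n (b \<odot>\<^bsub>E2 n\<^esub> z) = b \<odot>\<^bsub>E1 n\<^esub> \<epsilon> n z"
  using eps_iso[of n] by (auto simp: mod_iso_def mod_hom_def)

lemma eps_bij: "bij_betw (\<epsilon> n) (carrier (E2 n)) (carrier (E1 n))"
  using eps_iso[of n] by (auto simp: mod_iso_def)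

definition u2 :: "nat \<Rightarrow> 'e \<Rightarrow> ('a, 'e) pull2" where
  "u2 n s = pure2 n \<one>\<^bsub>N2 n\<^esub> s"

lemma u2_closed [simp]: "s \<in> carrier M \<Longrightarrow> u2 n s \<in> carrier (E2 n)"
  by (simp add: u2_def)

lemma eps_closed: "z \<in> carrier (E2 n) \<Longrightarrow> \<epsilon> n z \<in> carrier (E1 n)"
  using eps_bij by (auto simp: bij_betw_def)

definition is_coef :: "'e \<Rightarrow> ((nat \<Rightarrow> nat) \<Rightarrow> 'e) \<Rightarrow> bool" where
  "is_coef s c \<longleftrightarrow> c \<in> multi_indices l \<rightarrow>\<^sub>E carrier M \<and> (\<forall>n. \<epsilon> n (u2 n s) = ex n c)"

lemma res_u2: "m \<le> n \<Longrightarrow> s \<in> carrier M \<Longrightarrow> p2_map p V A m M (nb_res p V A m) id (u2 n s) = u2 m s"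
  using bc_morphism.bm_pure[OF res_morphism(2), of m n "\<one>\<^bsub>N2 n\<^esub>" s] ring_hom_one[OF rs_hom[of m n]]
  by (simp add: u2_def p2_map_def)

lemma indices_multi: "\<beta> \<in> indices l n \<Longrightarrow> \<beta> \<in> multi_indices l"
  by (simp add: indices_def)

text \<open>Each level is expanded separately; compatibility of the \<epsilon>_n with restriction
  and uniqueness of coefficients make the choices agree.\<close>

lemma coef_ex:
  assumes s: "s \<in> carrier M"
  shows "\<exists>c. is_coef s c"
proof -
  have "\<exists>c. (\<forall>\<beta>. c \<beta> \<in> carrier M) \<and> \<epsilon> n (u2 n s) = ex n c" for n
    by (rule expand) (use s in \<open>auto intro!: eps_closed\<close>)
  then obtain c where c: "\<And>n \<beta>. c n \<beta> \<in> carrier M" "\<And>n. \<epsilon> n (u2 n s) = ex n (c n)" by metis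
  have comp: "c n \<beta> = c m \<beta>" if mn: "m \<le> n" and b: "\<beta> \<in> indices l m" for m n \<beta>
  proof -
    have "ex m (c n) = p1_map p V A m M (nb_res p V A m) id (ex n (c n))"
      unfolding p1_map_def by (rule res_ex[OF mn c(1), symmetric])
    also have "\<dots> = \<epsilon> m (p2_map p V A m M (nb_res p V A m) id (u2 n s))"
      unfolding c(2)[symmetric] by (rule eps_res[OF mn u2_closed[OF s], symmetric])
    also have "\<dots> = ex m (c m)" unfolding res_u2[OF mn s] by (rule c(2))
    finally have e: "ex m (c n) = ex m (c m)" .
    show ?thesis by (rule ex_inj[where c = "c n" and d = "c m" and n = m and \<beta> = \<beta>, OF tf c(1) c(1) e b])
  qed
  \<comment> \<open>The coefficient at \<beta> is taken from the lowest level at which \<beta>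
    occurs.\<close>
  define d where "d = restrict (\<lambda>\<beta>. c (mdeg l \<beta>) \<beta>) (multi_indices l)"
  have "ex n (c n) = ex n d" for n
  proof (rule ex_cong)
    fix \<beta> assume b: "\<beta> \<in> indices l n"
    then have "\<beta> \<in> indices l (mdeg l \<beta>)" "mdeg l \<beta> \<le> n" by (auto simp: indices_def)
    then show "c n \<beta> = d \<beta>" using comp[of "mdeg l \<beta>" n \<beta>] indices_multi[OF b] by (simp add: d_def)
    show "d \<beta> \<in> carrier M" using indices_multi[OF b] c(1) by (simp add: d_def)
  qed
  then have "is_coef s d" using c by (auto simp: is_coef_def d_def)
  then show ?thesis by (intro exI[of _ d])
qed

text \<open>A family in an extensional function space is \<open>undefined\<close> outside the
  multi-indices, so membership in the module can only be asked for on \<open>indices\<close>.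
  Extension by zero reduces this to \<open>ex_inj\<close>.\<close>

lemma ex_inj':
  assumes c: "\<And>\<beta>. \<beta> \<in> indices l n \<Longrightarrow> c \<beta> \<in> carrier M" "\<And>\<beta>. \<beta> \<in> indices l n \<Longrightarrow> d \<beta> \<in> carrier M"
    and z: "ex n c = ex n d" and \<beta>: "\<beta> \<in> indices l n"
  shows "c \<beta> = d \<beta>"
proof -
  define c' where "c' = (\<lambda>\<beta>. if \<beta> \<in> indices l n then c \<beta> else \<zero>\<^bsub>M\<^esub>)"
  define d' where "d' = (\<lambda>\<beta>. if \<beta> \<in> indices l n then d \<beta> else \<zero>\<^bsub>M\<^esub>)"
  have "ex n c = ex n c'" "ex n d = ex n d'"
    by (rule ex_cong; use c in \<open>simp add: c'_def d'_def\<close>)+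
  then have e: "ex n c' = ex n d'" using z by (simp only:)
  have cc: "c' \<beta> \<in> carrier M" "d' \<beta> \<in> carrier M" for \<beta> using c by (auto simp: c'_def d'_def)
  have "c' \<beta> = d' \<beta>" by (rule ex_inj[OF tf cc e \<beta>])
  then show ?thesis using \<beta> by (simp add: c'_def d'_def)
qed

lemma coef_unique:
  assumes "is_coef s c" "is_coef s d"
  shows "c = d"
proof
  fix \<beta>
  show "c \<beta> = d \<beta>"
  proof (cases "\<beta> \<in> multi_indices l")
    case True
    then have b: "\<beta> \<in> indices l (mdeg l \<beta>)" by (simp add: indices_def)
    have "ex (mdeg l \<beta>) c = ex (mdeg l \<beta>) d" using assms by (simp add: is_coef_def)
    then show ?thesis
      by (intro ex_inj'[OF _ _ _ b]) (use assms indices_multi in \<open>auto simp: is_coef_def PiE_iff\<close>)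
  next
    case False
    then show ?thesis using assms by (auto simp: is_coef_def PiE_iff extensional_def)
  qed
qed

definition coef :: "'e \<Rightarrow> (nat \<Rightarrow> nat) \<Rightarrow> 'e" where
  "coef s = (THE c. is_coef s c)"

lemma is_coef: "s \<in> carrier M \<Longrightarrow> is_coef s (coef s)"
  unfolding coef_def using coef_ex coef_unique by (metis theI)

lemma coef_closed: "s \<in> carrier M \<Longrightarrow> \<beta> \<in> indices l n \<Longrightarrow> coef s \<beta> \<in> carrier M"
  using is_coef[of s] indices_multi by (auto simp: is_coef_def PiE_iff)

lemma eps_u2: "s \<in> carrier M \<Longrightarrow> \<epsilon> n (u2 n s) = ex n (coef s)"
  using is_coef[of s] by (simp add: is_coef_def)

lemma xi_0: "a \<in> carrier A \<Longrightarrow> \<xi> 0 a = \<zero>\<^bsub>N2 0\<^esub>"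
  using G2.proj_zero_iff[of "dd a" 0] dd_I by (simp add: xi_proj N2_ops G2.D_1)

lemma pr_0: "a \<in> carrier A \<Longrightarrow> pr2 p V A 0 a = pr1 p V A 0 a"
  using xi_0[of a] N2.add.inv_solve_right[of "\<zero>\<^bsub>N2 0\<^esub>" 0 "pr2 p V A 0 a" "pr1 p V A 0 a"]
  by (simp add: xi_def N2.minus_eq)

text \<open>On X^0 the two projections coincide, so both pullbacks are built from the same
  relations. This allows the normalisation of \<epsilon>_0 to be read inside the first pullback,
  where expansions live.\<close>

lemma pure2_0: "pure2 0 = pure1 0"
proof -
  have "bc_subgroup A (N2 0) (pr2 p V A 0) M = bc_subgroup A (N2 0) (pr1 p V A 0) M"
  proof -
    have "{frag_of (b \<otimes>\<^bsub>N2 0\<^esub> pr2 p V A 0 a, m) - frag_of (b, a \<odot>\<^bsub>M\<^esub> m) | b a m.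
         b \<in> carrier (N2 0) \<and> a \<in> carrier A \<and> m \<in> carrier M} =
      {frag_of (b \<otimes>\<^bsub>N2 0\<^esub> pr1 p V A 0 a, m) - frag_of (b, a \<odot>\<^bsub>M\<^esub> m) | b a m.
         b \<in> carrier (N2 0) \<and> a \<in> carrier A \<and> m \<in> carrier M}"
      by (intro Collect_cong iff_exI) (metis pr_0)
    then show ?thesis unfolding bc_subgroup_def by (simp only:)
  qed
  then show ?thesis by (intro ext) (simp add: bc_pure_def bc_coset_def)
qed

lemma coef_0:
  assumes s: "s \<in> carrier M"
  shows "coef s (\<lambda>_. 0) = s"
proof -
  have aug: "G2.aug \<in> ring_hom (N2 0) A" unfolding N2_ops by (rule G2.aug_hom)
  \<comment> \<open>\<open>aug_ex\<close> asks for coefficients in the module at every index, hence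
    the extension by zero.\<close>
  define c where "c = (\<lambda>\<beta>. if \<beta> \<in> indices l 0 then coef s \<beta> else \<zero>\<^bsub>M\<^esub>)"
  have c: "c \<beta> \<in> carrier M" for \<beta> using coef_closed[OF s] by (simp add: c_def)
  have e: "ex 0 (coef s) = ex 0 c"
    by (rule ex_cong) (use coef_closed[OF s] in \<open>auto simp: c_def\<close>)
  have "ex 0 c = pure1 0 \<one>\<^bsub>N2 0\<^esub> s"
    using eps_0[OF u2_closed[OF s]] eps_u2[OF s, of 0] e by (simp add: u2_def pure2_0)
  then have "tlift M (\<lambda>b m. G2.aug b \<odot>\<^bsub>M\<^esub> m) (ex 0 c) = G2.aug \<one>\<^bsub>N2 0\<^esub> \<odot>\<^bsub>M\<^esub> s"
    using aug_lift(2)[of "\<one>\<^bsub>N2 0\<^esub>" 0 s] s by simp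
  then show ?thesis
    using aug_ex[OF c, of 0] s ring_hom_one[OF aug] by (simp add: c_def zero_indices)
qed

definition nmon :: "nat \<Rightarrow> (nat \<Rightarrow> nat) \<Rightarrow> 'a nbhd2" where
  "nmon n \<beta> = mpow (N2 n) l (\<lambda>j. \<ominus>\<^bsub>N2 n\<^esub> \<xi> n (x j)) \<beta>"

lemma nmon_closed [simp]: "nmon n \<beta> \<in> carrier (N2 n)"
  unfolding nmon_def by (rule N2.mpow_closed) simp

sublocale ret: ring_hom_cring "N3 n" "N2 n" "ret n" for n by unfold_locales (rule ret_hom)
sublocale q12: ring_hom_cring "N2 n" "N3 n" "q12 p V A n" for n by unfold_locales (rule q_hom)
sublocale q23: ring_hom_cring "N2 n" "N3 n" "q23 p V A n" for n by unfold_locales (rule q_hom)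
sublocale q13: ring_hom_cring "N2 n" "N3 n" "q13 p V A n" for n by unfold_locales (rule q_hom)

text \<open>At a point (x, y, x) the coordinate differences are y - x for the first two places, x -
  y for the last two and 0 for the outer two.\<close>

lemma ret_q:
  "ret n (q12 p V A n (mon n \<beta>)) = mon n \<beta>" "ret n (q23 p V A n (mon n \<beta>)) = nmon n \<beta>"
  "ret n (q13 p V A n (mon n \<beta>)) = mpow (N2 n) l (\<lambda>_. \<zero>\<^bsub>N2 n\<^esub>) \<beta>"
proof -
  have c: "\<And>i. i < l \<Longrightarrow> \<xi> n (x i) \<in> carrier (N2 n)" by simp
  have 1: "ret n (q12 p V A n (\<xi> n (x i))) = \<xi> n (x i)" if "i < l" for i
    using that by (simp add: xi_def N2.minus_eq q_pr ret_tr)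
  have 2: "ret n (q23 p V A n (\<xi> n (x i))) = \<ominus>\<^bsub>N2 n\<^esub> \<xi> n (x i)" if "i < l" for i
    using that by (simp add: xi_def N2.minus_eq q_pr ret_tr N2.minus_add N2.a_comm)
  have 3: "ret n (q13 p V A n (\<xi> n (x i))) = \<zero>\<^bsub>N2 n\<^esub>" if "i < l" for i
    using that by (simp add: xi_def N2.minus_eq q_pr ret_tr N2.r_neg)
  have h: "(\<lambda>b. ret n (q12 p V A n b)) \<in> ring_hom (N2 n) (N2 n)" "(\<lambda>b. ret n (q23 p V A n b)) \<in> ring_hom (N2 n) (N2 n)"
    "(\<lambda>b. ret n (q13 p V A n b)) \<in> ring_hom (N2 n) (N2 n)"
    using ring_hom_trans[OF q_hom(1) ret_hom] ring_hom_trans[OF q_hom(2) ret_hom] ring_hom_trans[OF q_hom(3) ret_hom]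
    by (simp_all add: comp_def)
  interpret h1: ring_hom_cring "N2 n" "N2 n" "\<lambda>b. ret n (q12 p V A n b)" by unfold_locales (rule h)
  interpret h2: ring_hom_cring "N2 n" "N2 n" "\<lambda>b. ret n (q23 p V A n b)" by unfold_locales (rule h)
  interpret h3: ring_hom_cring "N2 n" "N2 n" "\<lambda>b. ret n (q13 p V A n b)" by unfold_locales (rule h)
  show "ret n (q12 p V A n (mon n \<beta>)) = mon n \<beta>"
    unfolding mon_def by (rule trans[OF h1.hom_mpow[of l "\<lambda>j. \<xi> n (x j)" \<beta>, OF c]], simp, rule mpow_cong) (simp_all add: 1)
  show "ret n (q23 p V A n (mon n \<beta>)) = nmon n \<beta>"
    unfolding mon_def nmon_def by (rule trans[OF h2.hom_mpow[of l "\<lambda>j. \<xi> n (x j)" \<beta>, OF c]], simp, rule mpow_cong) (simp_all add: 2)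
  show "ret n (q13 p V A n (mon n \<beta>)) = mpow (N2 n) l (\<lambda>_. \<zero>\<^bsub>N2 n\<^esub>) \<beta>"
    unfolding mon_def by (rule trans[OF h3.hom_mpow[of l "\<lambda>j. \<xi> n (x j)" \<beta>, OF c]], simp, rule mpow_cong) (simp_all add: 3)
qed

lemma mpow_zeros:
  assumes "\<beta> \<in> indices l n" "\<beta> \<noteq> (\<lambda>_. 0)"
  shows "mpow (N2 m) l (\<lambda>_. \<zero>\<^bsub>N2 m\<^esub>) \<beta> = \<zero>\<^bsub>N2 m\<^esub>"
proof -
  obtain j where j: "j < l" "\<beta> j > 0" using mdeg_pos[OF assms] by blast
  have "(\<Otimes>\<^bsub>N2 m\<^esub>i\<in>{..<l} - {j}. \<zero>\<^bsub>N2 m\<^esub> [^]\<^bsub>N2 m\<^esub> \<beta> i) \<in> carrier (N2 m)"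
    by (rule N2.finprod_closed) auto
  then show ?thesis
    using N2.mpow_split[of l "\<lambda>_. \<zero>\<^bsub>N2 m\<^esub>" m j \<beta>] j by (simp add: N2.nat_pow_zero)
qed

lemma id_additive: "abelian_group_hom M M id"
  by (rule abelian_group_homI') (auto simp: M.M.abelian_group_axioms)

sublocale T1: base_extension A "N3 n" "tr1 p V A n" M for n by unfold_locales (rule tr_hom)
sublocale T2: base_extension A "N3 n" "tr2 p V A n" M for n by unfold_locales (rule tr_hom)
sublocale T3: base_extension A "N3 n" "tr3 p V A n" M for n by unfold_locales (rule tr_hom)

abbreviation "tp1 n \<equiv> bc_pure A (nb3 p V A n) (tr1 p V A n) M"
abbreviation "tp2 n \<equiv> bc_pure A (nb3 p V A n) (tr2 p V A n) M"
abbreviation "tp3 n \<equiv> bc_pure A (nb3 p V A n) (tr3 p V A n) M"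
abbreviation "TB1 n \<equiv> base_change A (nb3 p V A n) (tr1 p V A n) M"
abbreviation "TB2 n \<equiv> base_change A (nb3 p V A n) (tr2 p V A n) M"
abbreviation "TB3 n \<equiv> base_change A (nb3 p V A n) (tr3 p V A n) M"

lemma morphismI:
  assumes "base_extension A B \<phi> M" "base_extension A B' \<phi>' M" "h \<in> ring_hom B B'"
    "\<And>a. a \<in> carrier A \<Longrightarrow> h (\<phi> a) = \<phi>' a"
  shows "bc_morphism A B \<phi> M B' \<phi>' M h id"
proof -
  interpret B: base_extension A B \<phi> M by fact
  interpret B': base_extension A B' \<phi>' M by fact
  show ?thesis
    by (intro bc_morphism.intro bc_morphism_axioms.intro assms(1,2) id_additive
        ring_hom_additive[OF B.B.ring_axioms B'.B.ring_axioms assms(3)])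
       (simp_all add: ring_hom_mult[OF assms(3)] assms(4))
qed

lemma pull_ex:
  assumes "base_extension A (N3 n) \<phi> M" "h \<in> ring_hom (N2 n) (N3 n)"
    "\<And>a. a \<in> carrier A \<Longrightarrow> h (pr1 p V A n a) = \<phi> a" and c: "\<And>\<beta>. \<beta> \<in> indices l n \<Longrightarrow> c \<beta> \<in> carrier M"
  shows "bc_map A (N3 n) \<phi> M h id (ex n c) =
    (\<Oplus>\<^bsub>base_change A (N3 n) \<phi> M\<^esub>\<beta>\<in>indices l n. bc_pure A (N3 n) \<phi> M (h (mon n \<beta>)) (c \<beta>))"
proof -
  interpret m: bc_morphism A "N2 n" "pr1 p V A n" M "N3 n" \<phi> M h id
    by (rule morphismI[OF X1.base_extension_axioms assms(1,2,3)])
  show ?thesis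
    by (rule trans[OF ex_hom[where c = c and n = n, OF m.bm_additive c]], assumption, rule m.Y.BC.finsum_cong')
       (use c ring_hom_closed[OF assms(2)] in \<open>auto simp: m.bm_pure\<close>)
qed

lemma pull_u2:
  assumes "base_extension A (N3 n) \<phi> M" "h \<in> ring_hom (N2 n) (N3 n)"
    "\<And>a. a \<in> carrier A \<Longrightarrow> h (pr2 p V A n a) = \<phi> a" and s: "s \<in> carrier M"
  shows "bc_map A (N3 n) \<phi> M h id (u2 n s) = bc_pure A (N3 n) \<phi> M \<one>\<^bsub>N3 n\<^esub> s"
proof -
  interpret m: bc_morphism A "N2 n" "pr2 p V A n" M "N3 n" \<phi> M h id
    by (rule morphismI[OF X2.base_extension_axioms assms(1,2,3)])
  show ?thesis
    using s ring_hom_one[OF assms(2)] by (simp add: u2_def m.bm_pure)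
qed

text \<open>The cocycle condition, pulled back along \<open>(x, y) \<mapsto> (x, y, x)\<close>.\<close>

lemma coef_cocycle:
  assumes s: "s \<in> carrier M"
  shows "(\<Oplus>\<^bsub>E1 n\<^esub>\<beta>\<in>indices l n. \<Oplus>\<^bsub>E1 n\<^esub>\<gamma>\<in>indices l n.
      pure1 n (nmon n \<beta> \<otimes>\<^bsub>N2 n\<^esub> mon n \<gamma>) (coef (coef s \<beta>) \<gamma>)) = pure1 n \<one>\<^bsub>N2 n\<^esub> s"
proof -
  obtain g12 g23 g13 where
    g12: "g12 \<in> mod_hom (N3 n) (TB2 n) (TB1 n)"
      "\<And>z. z \<in> carrier (E2 n) \<Longrightarrow> g12 (bc_map A (N3 n) (tr2 p V A n) M (q12 p V A n) id z) =
        bc_map A (N3 n) (tr1 p V A n) M (q12 p V A n) id (\<epsilon> n z)" and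
    g23: "g23 \<in> mod_hom (N3 n) (TB3 n) (TB2 n)"
      "\<And>z. z \<in> carrier (E2 n) \<Longrightarrow> g23 (bc_map A (N3 n) (tr3 p V A n) M (q23 p V A n) id z) =
        bc_map A (N3 n) (tr2 p V A n) M (q23 p V A n) id (\<epsilon> n z)" and
    g13: "g13 \<in> mod_hom (N3 n) (TB3 n) (TB1 n)"
      "\<And>z. z \<in> carrier (E2 n) \<Longrightarrow> g13 (bc_map A (N3 n) (tr3 p V A n) M (q13 p V A n) id z) =
        bc_map A (N3 n) (tr1 p V A n) M (q13 p V A n) id (\<epsilon> n z)" and
    co: "\<And>z. z \<in> carrier (TB3 n) \<Longrightarrow> g12 (g23 z) = g13 z"
    using eps_cocycle[of n] unfolding is_pullback_def Let_def p2_pull_def by blast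
  have cs: "coef m \<beta> \<in> carrier M" if "m \<in> carrier M" "\<beta> \<in> indices l n" for m \<beta>
    using that by (rule coef_closed)
  have v12: "g12 (tp2 n \<one>\<^bsub>N3 n\<^esub> m) = (\<Oplus>\<^bsub>TB1 n\<^esub>\<gamma>\<in>indices l n. tp1 n (q12 p V A n (mon n \<gamma>)) (coef m \<gamma>))"
    if m: "m \<in> carrier M" for m
    using g12(2)[OF u2_closed[OF m]]
      pull_u2[OF T2.base_extension_axioms q_hom(1) q_pr(2) m]
      pull_ex[OF T1.base_extension_axioms q_hom(1) q_pr(1), of n "coef m"] cs[OF m] eps_u2[OF m, of n] by simp
  have v23: "g23 (tp3 n \<one>\<^bsub>N3 n\<^esub> s) = (\<Oplus>\<^bsub>TB2 n\<^esub>\<beta>\<in>indices l n. tp2 n (q23 p V A n (mon n \<beta>)) (coef s \<beta>))"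
    using g23(2)[OF u2_closed[OF s]]
      pull_u2[OF T3.base_extension_axioms q_hom(2) q_pr(4) s]
      pull_ex[OF T2.base_extension_axioms q_hom(2) q_pr(3), of n "coef s"] cs[OF s] eps_u2[OF s, of n] by simp
  have v13: "g13 (tp3 n \<one>\<^bsub>N3 n\<^esub> s) = (\<Oplus>\<^bsub>TB1 n\<^esub>\<beta>\<in>indices l n. tp1 n (q13 p V A n (mon n \<beta>)) (coef s \<beta>))"
    using g13(2)[OF u2_closed[OF s]]
      pull_u2[OF T3.base_extension_axioms q_hom(3) q_pr(6) s]
      pull_ex[OF T1.base_extension_axioms q_hom(3) q_pr(5), of n "coef s"] cs[OF s] eps_u2[OF s, of n] by simp
  have a12: "abelian_group_hom (TB2 n) (TB1 n) g12"
    using g12(1) by (intro abelian_group_homI' T1.abelian_group_BC T2.abelian_group_BC) (auto simp: mod_hom_def)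
  \<comment> \<open>\<open>g12\<close> is known on 1 \<otimes> m only; linearity over the ring of
    the triple neighbourhood extends this to b \<otimes> m.\<close>
  have w12: "g12 (tp2 n b m) = (\<Oplus>\<^bsub>TB1 n\<^esub>\<gamma>\<in>indices l n. tp1 n (b \<otimes>\<^bsub>N3 n\<^esub> q12 p V A n (mon n \<gamma>)) (coef m \<gamma>))"
    if b: "b \<in> carrier (N3 n)" and m: "m \<in> carrier M" for b m
  proof -
    have "g12 (tp2 n b m) = g12 (b \<odot>\<^bsub>TB2 n\<^esub> tp2 n \<one>\<^bsub>N3 n\<^esub> m)"
      using T2.smult_pure[OF b N3.one_closed m] b by simp
    also have "\<dots> = b \<odot>\<^bsub>TB1 n\<^esub> g12 (tp2 n \<one>\<^bsub>N3 n\<^esub> m)"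
      using g12(1) b m by (simp add: mod_hom_def)
    also have "\<dots> = (\<Oplus>\<^bsub>TB1 n\<^esub>\<gamma>\<in>indices l n. b \<odot>\<^bsub>TB1 n\<^esub> tp1 n (q12 p V A n (mon n \<gamma>)) (coef m \<gamma>))"
      unfolding v12[OF m]
      by (rule abelian_group_hom.hom_finsum[OF T1.smult_additive[OF b]]) (use cs[OF m] in auto)
    also have "\<dots> = (\<Oplus>\<^bsub>TB1 n\<^esub>\<gamma>\<in>indices l n. tp1 n (b \<otimes>\<^bsub>N3 n\<^esub> q12 p V A n (mon n \<gamma>)) (coef m \<gamma>))"
      by (rule T1.BC.finsum_cong') (use cs[OF m] b in \<open>auto simp: T1.smult_pure\<close>)
    finally show ?thesis .
  qed
  define S where "S = (\<Oplus>\<^bsub>TB1 n\<^esub>\<beta>\<in>indices l n. \<Oplus>\<^bsub>TB1 n\<^esub>\<gamma>\<in>indices l n.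
      tp1 n (q23 p V A n (mon n \<beta>) \<otimes>\<^bsub>N3 n\<^esub> q12 p V A n (mon n \<gamma>)) (coef (coef s \<beta>) \<gamma>))"
  have in1: "(\<Oplus>\<^bsub>TB1 n\<^esub>\<gamma>\<in>indices l n.
      tp1 n (q23 p V A n (mon n \<beta>) \<otimes>\<^bsub>N3 n\<^esub> q12 p V A n (mon n \<gamma>)) (coef (coef s \<beta>) \<gamma>)) \<in> carrier (TB1 n)"
    if "\<beta> \<in> indices l n" for \<beta>
    by (rule T1.BC.finsum_closed) (use cs[OF cs[OF s that]] in auto)
  have "g12 (g23 (tp3 n \<one>\<^bsub>N3 n\<^esub> s)) = (\<Oplus>\<^bsub>TB1 n\<^esub>\<beta>\<in>indices l n. g12 (tp2 n (q23 p V A n (mon n \<beta>)) (coef s \<beta>)))"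
    unfolding v23 by (rule abelian_group_hom.hom_finsum[OF a12]) (use cs[OF s] in auto)
  also have "\<dots> = S"
    unfolding S_def by (rule T1.BC.finsum_cong') (use in1 w12 cs[OF s] in auto)
  \<comment> \<open>The cocycle condition as an identity between a double and a single expansion on
    the triple neighbourhood; what remains is to apply \<open>ret\<close> to both sides.\<close>
  finally have eq: "S = (\<Oplus>\<^bsub>TB1 n\<^esub>\<beta>\<in>indices l n. tp1 n (q13 p V A n (mon n \<beta>)) (coef s \<beta>))"
    using co[of "tp3 n \<one>\<^bsub>N3 n\<^esub> s"] s v13 by simp
  interpret r: bc_morphism A "N3 n" "tr1 p V A n" M "N2 n" "pr1 p V A n" M "ret n" id
    by (rule morphismI[OF T1.base_extension_axioms X1.base_extension_axioms ret_hom ret_tr(1)])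
  interpret ra: abelian_group_hom "TB1 n" "E1 n" r.bm by (rule r.bm_additive)
  have in2: "(\<Oplus>\<^bsub>E1 n\<^esub>\<gamma>\<in>indices l n. pure1 n (nmon n \<beta> \<otimes>\<^bsub>N2 n\<^esub> mon n \<gamma>) (coef (coef s \<beta>) \<gamma>)) \<in> carrier (E1 n)"
    if "\<beta> \<in> indices l n" for \<beta>
    by (rule X1.BC.finsum_closed) (use cs[OF cs[OF s that]] in auto)
  have "r.bm S = (\<Oplus>\<^bsub>E1 n\<^esub>\<beta>\<in>indices l n. r.bm (\<Oplus>\<^bsub>TB1 n\<^esub>\<gamma>\<in>indices l n.
      tp1 n (q23 p V A n (mon n \<beta>) \<otimes>\<^bsub>N3 n\<^esub> q12 p V A n (mon n \<gamma>)) (coef (coef s \<beta>) \<gamma>)))"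
    unfolding S_def by (rule ra.hom_finsum) (use in1 in auto)
  also have "\<dots> = (\<Oplus>\<^bsub>E1 n\<^esub>\<beta>\<in>indices l n. \<Oplus>\<^bsub>E1 n\<^esub>\<gamma>\<in>indices l n.
      pure1 n (nmon n \<beta> \<otimes>\<^bsub>N2 n\<^esub> mon n \<gamma>) (coef (coef s \<beta>) \<gamma>))"
  proof (rule X1.BC.finsum_cong')
    fix \<beta> assume b: "\<beta> \<in> indices l n"
    have "r.bm (\<Oplus>\<^bsub>TB1 n\<^esub>\<gamma>\<in>indices l n.
      tp1 n (q23 p V A n (mon n \<beta>) \<otimes>\<^bsub>N3 n\<^esub> q12 p V A n (mon n \<gamma>)) (coef (coef s \<beta>) \<gamma>)) =
      (\<Oplus>\<^bsub>E1 n\<^esub>\<gamma>\<in>indices l n. r.bm (tp1 n (q23 p V A n (mon n \<beta>) \<otimes>\<^bsub>N3 n\<^esub> q12 p V A n (mon n \<gamma>)) (coef (coef s \<beta>) \<gamma>)))"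
      by (rule ra.hom_finsum) (use cs[OF cs[OF s b]] in auto)
    also have "\<dots> = (\<Oplus>\<^bsub>E1 n\<^esub>\<gamma>\<in>indices l n. pure1 n (nmon n \<beta> \<otimes>\<^bsub>N2 n\<^esub> mon n \<gamma>) (coef (coef s \<beta>) \<gamma>))"
      by (rule X1.BC.finsum_cong') (use cs[OF cs[OF s b]] in \<open>auto simp: r.bm_pure ret_q\<close>)
    finally show "r.bm (\<Oplus>\<^bsub>TB1 n\<^esub>\<gamma>\<in>indices l n.
      tp1 n (q23 p V A n (mon n \<beta>) \<otimes>\<^bsub>N3 n\<^esub> q12 p V A n (mon n \<gamma>)) (coef (coef s \<beta>) \<gamma>)) =
      (\<Oplus>\<^bsub>E1 n\<^esub>\<gamma>\<in>indices l n. pure1 n (nmon n \<beta> \<otimes>\<^bsub>N2 n\<^esub> mon n \<gamma>) (coef (coef s \<beta>) \<gamma>))" .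
  qed (use in2 in auto)
  finally have lhs: "r.bm S = (\<Oplus>\<^bsub>E1 n\<^esub>\<beta>\<in>indices l n. \<Oplus>\<^bsub>E1 n\<^esub>\<gamma>\<in>indices l n.
      pure1 n (nmon n \<beta> \<otimes>\<^bsub>N2 n\<^esub> mon n \<gamma>) (coef (coef s \<beta>) \<gamma>))" .
  have "r.bm S = (\<Oplus>\<^bsub>E1 n\<^esub>\<beta>\<in>indices l n. r.bm (tp1 n (q13 p V A n (mon n \<beta>)) (coef s \<beta>)))"
    unfolding eq by (rule ra.hom_finsum) (use cs[OF s] in auto)
  \<comment> \<open>The monomials have become powers of zero: they vanish except for the trivial
    exponent, where the empty product is 1 and the coefficient is s itself.\<close>
  also have "\<dots> = (\<Oplus>\<^bsub>E1 n\<^esub>\<beta>\<in>indices l n. if (\<lambda>_. 0) = \<beta> then pure1 n \<one>\<^bsub>N2 n\<^esub> s else \<zero>\<^bsub>E1 n\<^esub>)"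
  proof (rule X1.BC.finsum_cong')
    fix \<beta> assume b: "\<beta> \<in> indices l n"
    have "r.bm (tp1 n (q13 p V A n (mon n \<beta>)) (coef s \<beta>)) = pure1 n (mpow (N2 n) l (\<lambda>_. \<zero>\<^bsub>N2 n\<^esub>) \<beta>) (coef s \<beta>)"
      using cs[OF s b] by (simp add: r.bm_pure ret_q)
    also have "\<dots> = (if (\<lambda>_. 0) = \<beta> then pure1 n \<one>\<^bsub>N2 n\<^esub> s else \<zero>\<^bsub>E1 n\<^esub>)"
    proof (cases "\<beta> = (\<lambda>_. 0)")
      case True
      then show ?thesis by (simp add: coef_0[OF s] N2.mpow_zero)
    next
      case False
      then show ?thesis using cs[OF s b] by (simp add: mpow_zeros[OF b] pure1_zero_l)
    qed
    finally show "r.bm (tp1 n (q13 p V A n (mon n \<beta>)) (coef s \<beta>)) =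
      (if (\<lambda>_. 0) = \<beta> then pure1 n \<one>\<^bsub>N2 n\<^esub> s else \<zero>\<^bsub>E1 n\<^esub>)" .
  qed (use s in auto)
  also have "\<dots> = pure1 n \<one>\<^bsub>N2 n\<^esub> s"
    using s by (intro X1.BC.finsum_singleton finite_indices zero_indices) auto
  finally show ?thesis using lhs by simp
qed

lemma pure2_u2: "b \<in> carrier (N2 n) \<Longrightarrow> m \<in> carrier M \<Longrightarrow> pure2 n b m = b \<odot>\<^bsub>E2 n\<^esub> u2 n m"
  by (simp add: u2_def X2.smult_pure)

lemma eps_pure2:
  assumes b: "b \<in> carrier (N2 n)" and m: "m \<in> carrier M"
  shows "\<epsilon> n (pure2 n b m) = (\<Oplus>\<^bsub>E1 n\<^esub>\<gamma>\<in>indices l n. pure1 n (b \<otimes>\<^bsub>N2 n\<^esub> mon n \<gamma>) (coef m \<gamma>))"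
proof -
  have cs: "coef m \<beta> \<in> carrier M" if "\<beta> \<in> indices l n" for \<beta>
    by (rule coef_closed[OF m that])
  have "\<epsilon> n (pure2 n b m) = b \<odot>\<^bsub>E1 n\<^esub> ex n (coef m)"
    using b m by (simp add: pure2_u2 eps_smult eps_u2)
  also have "\<dots> = (\<Oplus>\<^bsub>E1 n\<^esub>\<gamma>\<in>indices l n. b \<odot>\<^bsub>E1 n\<^esub> pure1 n (mon n \<gamma>) (coef m \<gamma>))"
    by (rule ex_hom[OF X1.smult_additive[OF b] cs])
  also have "\<dots> = (\<Oplus>\<^bsub>E1 n\<^esub>\<gamma>\<in>indices l n. pure1 n (b \<otimes>\<^bsub>N2 n\<^esub> mon n \<gamma>) (coef m \<gamma>))"
    by (rule X1.BC.finsum_cong') (use cs b in \<open>auto simp: X1.smult_pure\<close>)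
  finally show ?thesis .
qed

text \<open>\<open>coef_cocycle\<close> says that \<epsilon>_n maps the expansion with the monomials
  (-\<xi>)^\<beta> to 1 \<otimes> s; linearity and injectivity of \<epsilon>_n give the
  rest.\<close>

lemma eps_inverse:
  assumes b: "b \<in> carrier (N2 n)" and s: "s \<in> carrier M"
  shows "inv_into (carrier (E2 n)) (\<epsilon> n) (pure1 n b s) =
    (\<Oplus>\<^bsub>E2 n\<^esub>\<beta>\<in>indices l n. pure2 n (b \<otimes>\<^bsub>N2 n\<^esub> nmon n \<beta>) (coef s \<beta>))"
proof -
  have cs: "coef m \<beta> \<in> carrier M" if "m \<in> carrier M" "\<beta> \<in> indices l n" for m \<beta>
    using that by (rule coef_closed)
  define z where "z = (\<Oplus>\<^bsub>E2 n\<^esub>\<beta>\<in>indices l n. pure2 n (nmon n \<beta>) (coef s \<beta>))"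
  have z: "z \<in> carrier (E2 n)"
    unfolding z_def by (rule X2.BC.finsum_closed) (use cs[OF s] in auto)
  have in2: "(\<Oplus>\<^bsub>E1 n\<^esub>\<gamma>\<in>indices l n. pure1 n (nmon n \<beta> \<otimes>\<^bsub>N2 n\<^esub> mon n \<gamma>) (coef (coef s \<beta>) \<gamma>)) \<in> carrier (E1 n)"
    if "\<beta> \<in> indices l n" for \<beta>
    by (rule X1.BC.finsum_closed) (use cs[OF cs[OF s that]] in auto)
  have "\<epsilon> n z = (\<Oplus>\<^bsub>E1 n\<^esub>\<beta>\<in>indices l n. \<epsilon> n (pure2 n (nmon n \<beta>) (coef s \<beta>)))"
    unfolding z_def by (rule abelian_group_hom.hom_finsum[OF eps_additive]) (use cs[OF s] in auto)
  also have "\<dots> = (\<Oplus>\<^bsub>E1 n\<^esub>\<beta>\<in>indices l n. \<Oplus>\<^bsub>E1 n\<^esub>\<gamma>\<in>indices l n.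
      pure1 n (nmon n \<beta> \<otimes>\<^bsub>N2 n\<^esub> mon n \<gamma>) (coef (coef s \<beta>) \<gamma>))"
    by (rule X1.BC.finsum_cong') (use in2 cs[OF s] eps_pure2 in auto)
  also have "\<dots> = pure1 n \<one>\<^bsub>N2 n\<^esub> s" by (rule coef_cocycle[OF s])
  finally have ez: "\<epsilon> n z = pure1 n \<one>\<^bsub>N2 n\<^esub> s" .
  have bz: "b \<odot>\<^bsub>E2 n\<^esub> z = (\<Oplus>\<^bsub>E2 n\<^esub>\<beta>\<in>indices l n. pure2 n (b \<otimes>\<^bsub>N2 n\<^esub> nmon n \<beta>) (coef s \<beta>))"
  proof -
    have "b \<odot>\<^bsub>E2 n\<^esub> z = (\<Oplus>\<^bsub>E2 n\<^esub>\<beta>\<in>indices l n. b \<odot>\<^bsub>E2 n\<^esub> pure2 n (nmon n \<beta>) (coef s \<beta>))"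
      unfolding z_def by (rule abelian_group_hom.hom_finsum[OF X2.smult_additive[OF b]]) (use cs[OF s] in auto)
    also have "\<dots> = (\<Oplus>\<^bsub>E2 n\<^esub>\<beta>\<in>indices l n. pure2 n (b \<otimes>\<^bsub>N2 n\<^esub> nmon n \<beta>) (coef s \<beta>))"
      by (rule X2.BC.finsum_cong') (use cs[OF s] b in \<open>auto simp: X2.smult_pure\<close>)
    finally show ?thesis .
  qed
  have "\<epsilon> n (b \<odot>\<^bsub>E2 n\<^esub> z) = pure1 n b s"
    using eps_smult[OF b z] X1.smult_pure[OF b N2.one_closed s] b by (simp add: ez)
  moreover have "b \<odot>\<^bsub>E2 n\<^esub> z \<in> carrier (E2 n)"
    by (rule abelian_group_hom.hom_closed[OF X2.smult_additive[OF b] z])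
  ultimately have "inv_into (carrier (E2 n)) (\<epsilon> n) (pure1 n b s) = b \<odot>\<^bsub>E2 n\<^esub> z"
    using eps_bij[of n] by (metis bij_betw_inv_into_left)
  then show ?thesis by (simp only: bz)
qed

end

section \<open>The valuation of the fraction field\<close>

locale mixed_dvr =
  fixes p :: nat and V :: "('v, 'x) ring_scheme" and K :: "('v, 'k, 'y) module_scheme"
  assumes mixed: "complete_mixed_dvr p V" and frac: "fraction_field V K"
begin

sublocale V: principal_domain V
  using mixed by (simp add: complete_mixed_dvr_def discrete_valuation_ring_def)

sublocale K: field K
  using frac by (simp add: fraction_field_def)

sublocale VK: algebra V K
  using frac by (simp add: fraction_field_def)

sublocale \<phi>: ring_hom_cring V K "alg_map K"
proof (unfold_locales, rule ring_hom_memI)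
  fix a b assume "a \<in> carrier V" "b \<in> carrier V"
  then show "alg_map K (a \<otimes>\<^bsub>V\<^esub> b) = alg_map K a \<otimes>\<^bsub>K\<^esub> alg_map K b"
    by (simp add: alg_map_def VK.smult_assoc1 VK.smult_assoc2)
qed (auto simp: alg_map_def VK.smult_l_distr)

lemma alg_map_inj: "a \<in> carrier V \<Longrightarrow> b \<in> carrier V \<Longrightarrow> alg_map K a = alg_map K b \<longleftrightarrow> a = b"
  using frac by (auto simp: fraction_field_def inj_on_def)

lemma alg_map_eq_zero_iff: "a \<in> carrier V \<Longrightarrow> alg_map K a = \<zero>\<^bsub>K\<^esub> \<longleftrightarrow> a = \<zero>\<^bsub>V\<^esub>"
  using alg_map_inj[of a "\<zero>\<^bsub>V\<^esub>"] by simp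

lemma alg_map_pow: "a \<in> carrier V \<Longrightarrow> alg_map K (a [^]\<^bsub>V\<^esub> (n::nat)) = alg_map K a [^]\<^bsub>K\<^esub> n"
  by (induction n) auto

lemma maximal_ex1: "\<exists>!I. maximalideal I V"
  using mixed unfolding complete_mixed_dvr_def discrete_valuation_ring_def by (elim conjE)

lemma maximal: "maximalideal (max_ideal V) V"
  unfolding max_ideal_def by (rule theI'[OF maximal_ex1])

lemma maximal_unique: "maximalideal I V \<Longrightarrow> I = max_ideal V"
  by (rule ex1E[OF maximal_ex1]) (use maximal in blast)

lemma uniformizer_ex: "\<exists>w\<in>carrier V. PIdl\<^bsub>V\<^esub> w = max_ideal V"
  using V.exists_gen[OF maximalideal.axioms(1)[OF maximal]] by metis

definition unif :: 'v where
  "unif = (SOME w. w \<in> carrier V \<and> PIdl\<^bsub>V\<^esub> w = max_ideal V)"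

lemma unif: "unif \<in> carrier V" "PIdl\<^bsub>V\<^esub> unif = max_ideal V"
  unfolding unif_def using someI_ex[of "\<lambda>w. w \<in> carrier V \<and> PIdl\<^bsub>V\<^esub> w = max_ideal V"] uniformizer_ex
  by blast+

declare unif(1) [simp]

lemma unit_not_in_max:
  assumes "u \<in> Units V" shows "u \<notin> max_ideal V"
proof
  assume "u \<in> max_ideal V"
  then have "max_ideal V = carrier V"
    using ideal.I_l_closed[OF maximalideal.axioms(1)[OF maximal], of u "inv\<^bsub>V\<^esub> u"] assms
      ideal.one_imp_carrier[OF maximalideal.axioms(1)[OF maximal]] by simp
  then show False using maximalideal.I_notcarr[OF maximal] by simp
qed

lemma p_elem_in_max: "p_elem p V \<in> max_ideal V"
  using mixed by (simp add: complete_mixed_dvr_def)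

lemma char_zero: "n > 0 \<Longrightarrow> add_pow V (n::nat) \<one>\<^bsub>V\<^esub> \<noteq> \<zero>\<^bsub>V\<^esub>"
  using mixed by (simp add: complete_mixed_dvr_def)

lemma p_prime: "Factorial_Ring.prime p"
  using mixed by (simp add: complete_mixed_dvr_def)

lemma p_gt_1: "p > 1"
  using p_prime prime_gt_1_nat by blast

lemma unif_nonzero: "unif \<noteq> \<zero>\<^bsub>V\<^esub>"
proof
  assume "unif = \<zero>\<^bsub>V\<^esub>"
  then have "PIdl\<^bsub>V\<^esub> unif \<subseteq> {\<zero>\<^bsub>V\<^esub>}" by (auto simp: cgenideal_def)
  then have "p_elem p V = \<zero>\<^bsub>V\<^esub>" using p_elem_in_max unif(2) by blast
  then show False using char_zero[of p] p_gt_1 by (simp add: p_elem_def)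
qed

text \<open>In a principal ideal domain an irreducible element generates a maximal ideal, and here
  there is only one.\<close>

lemma irreducible_unif:
  assumes "q \<in> carrier V" "ring_irreducible\<^bsub>V\<^esub> q"
  shows "\<exists>u\<in>Units V. q = u \<otimes>\<^bsub>V\<^esub> unif"
proof -
  have "PIdl\<^bsub>V\<^esub> q = PIdl\<^bsub>V\<^esub> unif"
    using maximal_unique[OF V.irreducible_imp_maximalideal[OF assms]] unif by simp
  then have "q \<sim>\<^bsub>V\<^esub> unif" using V.associated_iff_same_ideal assms by simp
  then show ?thesis using V.ring_associated_iff assms by simp
qed

text \<open>A nonunit is a product of irreducibles, each of which is a unit times the uniformizer;
  the number of factors is the exponent.\<close>

lemma unif_factorization:
  assumes a: "a \<in> carrier V" "a \<noteq> \<zero>\<^bsub>V\<^esub>"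
  shows "\<exists>u\<in>Units V. \<exists>n::nat. a = u \<otimes>\<^bsub>V\<^esub> (unif [^]\<^bsub>V\<^esub> n)"
proof (cases "a \<in> Units V")
  case True
  then show ?thesis by (intro bexI[of _ a] exI[of _ 0]) auto
next
  case False
  then obtain fs where fs: "set fs \<subseteq> carrier (mult_of V)" "wfactors (mult_of V) fs a"
    using V.factorization_property[of a] a by auto
  have q: "\<exists>u\<in>Units V. q = u \<otimes>\<^bsub>V\<^esub> unif" if "q \<in> set fs" for q
    using that fs V.ring_irreducibleI'[of q] irreducible_unif[of q] by (auto simp: wfactors_def)
  have "\<exists>u\<in>Units V. \<exists>n::nat. foldr (\<otimes>\<^bsub>V\<^esub>) fs \<one>\<^bsub>V\<^esub> = u \<otimes>\<^bsub>V\<^esub> (unif [^]\<^bsub>V\<^esub> n)"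
    using q
  proof (induction fs)
    case Nil
    show ?case by (intro bexI[of _ "\<one>\<^bsub>V\<^esub>"] exI[of _ 0]) auto
  next
    case (Cons q fs)
    obtain u n where u: "u \<in> Units V" "foldr (\<otimes>\<^bsub>V\<^esub>) fs \<one>\<^bsub>V\<^esub> = u \<otimes>\<^bsub>V\<^esub> (unif [^]\<^bsub>V\<^esub> (n::nat))"
      using Cons by auto
    obtain v where v: "v \<in> Units V" "q = v \<otimes>\<^bsub>V\<^esub> unif" using Cons.prems[of q] by auto
    have "foldr (\<otimes>\<^bsub>V\<^esub>) (q # fs) \<one>\<^bsub>V\<^esub> = (v \<otimes>\<^bsub>V\<^esub> u) \<otimes>\<^bsub>V\<^esub> (unif [^]\<^bsub>V\<^esub> Suc n)"
      using u v V.Units_closed[of u] V.Units_closed[of v] by (simp add: V.m_ac)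
    moreover have "v \<otimes>\<^bsub>V\<^esub> u \<in> Units V" using u v by simp
    ultimately show ?case by blast
  qed
  then obtain u n where u: "u \<in> Units V" "foldr (\<otimes>\<^bsub>V\<^esub>) fs \<one>\<^bsub>V\<^esub> = u \<otimes>\<^bsub>V\<^esub> (unif [^]\<^bsub>V\<^esub> (n::nat))"
    by blast
  have uc: "u \<otimes>\<^bsub>V\<^esub> (unif [^]\<^bsub>V\<^esub> n) \<in> carrier V" using u V.Units_closed[of u] by simp
  have "u \<otimes>\<^bsub>V\<^esub> (unif [^]\<^bsub>V\<^esub> n) \<sim>\<^bsub>mult_of V\<^esub> a" using fs(2) u(2) by (simp add: wfactors_def)
  then have "a \<sim>\<^bsub>V\<^esub> (u \<otimes>\<^bsub>V\<^esub> (unif [^]\<^bsub>V\<^esub> n))"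
    using V.assoc_iff_assoc_mult[OF uc a(1)] by (auto simp: associated_def)
  then obtain v where v: "v \<in> Units V" "a = v \<otimes>\<^bsub>V\<^esub> (u \<otimes>\<^bsub>V\<^esub> (unif [^]\<^bsub>V\<^esub> n))"
    using V.ring_associated_iff[OF a(1) uc] by blast
  have "a = (v \<otimes>\<^bsub>V\<^esub> u) \<otimes>\<^bsub>V\<^esub> (unif [^]\<^bsub>V\<^esub> n)"
    using u v V.Units_closed[of u] V.Units_closed[of v] by (simp add: V.m_ac)
  moreover have "v \<otimes>\<^bsub>V\<^esub> u \<in> Units V" using u v by simp
  ultimately show ?thesis by blast
qed

section \<open>The valuation as a homomorphism on the unit group of K\<close>

abbreviation "G \<equiv> units_of K"

sublocale G: comm_group G
  by (rule K.units_comm_group)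

lemma carrier_G: "carrier G = carrier K - {\<zero>\<^bsub>K\<^esub>}"
  by (simp add: units_of_carrier K.field_Units)

lemma G_nat_pow: "c \<in> carrier G \<Longrightarrow> c [^]\<^bsub>K\<^esub> (k::nat) = c [^]\<^bsub>G\<^esub> k"
  by (rule K.units_of_pow[symmetric]) (simp only: units_of_carrier)

lemma G_inv: "c \<in> carrier G \<Longrightarrow> inv\<^bsub>K\<^esub> c = inv\<^bsub>G\<^esub> c"
  by (rule K.units_of_inv[symmetric]) (simp only: units_of_carrier)

lemma G_int_pow: "c \<in> carrier G \<Longrightarrow> c [^]\<^bsub>K\<^esub> (k::int) = c [^]\<^bsub>G\<^esub> k"
  unfolding int_pow_def2 by (simp only: G_nat_pow G_inv G.nat_pow_closed)

lemma alg_map_pow_G: "alg_map K a \<in> carrier G \<Longrightarrow> a \<in> carrier V \<Longrightarrow>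
    alg_map K (a [^]\<^bsub>V\<^esub> n) = alg_map K a [^]\<^bsub>G\<^esub> int n"
  by (simp only: alg_map_pow G_nat_pow int_pow_int)

abbreviation "W \<equiv> alg_map K unif"

lemma W_G: "W \<in> carrier G"
  using unif_nonzero by (simp add: carrier_G alg_map_eq_zero_iff)

text \<open>The units of V inside K; the valuation identifies G modulo H with the integers.\<close>

definition H :: "'k set" where
  "H = alg_map K ` Units V"

lemma alg_map_H [simp]: "u \<in> Units V \<Longrightarrow> alg_map K u \<in> H"
  by (simp add: H_def)

lemma H_E: "h \<in> H \<Longrightarrow> (\<And>u. u \<in> Units V \<Longrightarrow> h = alg_map K u \<Longrightarrow> thesis) \<Longrightarrow> thesis"
  by (auto simp: H_def)

lemma unit_G: "u \<in> Units V \<Longrightarrow> alg_map K u \<in> carrier G"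
proof -
  assume u: "u \<in> Units V"
  have "u \<noteq> \<zero>\<^bsub>V\<^esub>" using V.Units_r_inv[OF u] V.Units_inv_closed[OF u] V.zero_not_one by auto
  then show ?thesis using V.Units_closed[OF u] by (simp add: carrier_G alg_map_eq_zero_iff)
qed

lemma subgroup_H: "subgroup H G"
proof (rule G.subgroupI)
  show "H \<subseteq> carrier G" using unit_G by (auto elim: H_E)
  show "H \<noteq> {}" using alg_map_H[OF V.Units_one_closed] by blast
  fix c assume "c \<in> H"
  then obtain u where u: "u \<in> Units V" "c = alg_map K u" by (rule H_E)
  have "alg_map K u \<otimes>\<^bsub>G\<^esub> alg_map K (inv\<^bsub>V\<^esub> u) = \<one>\<^bsub>G\<^esub>"
    using u V.Units_closed[of u] by (simp add: units_of_mult units_of_one \<phi>.hom_mult[symmetric])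
  then have "inv\<^bsub>G\<^esub> c = alg_map K (inv\<^bsub>V\<^esub> u)"
    unfolding u(2) using unit_G u by (intro G.inv_equality) (auto simp: G.m_comm)
  then show "inv\<^bsub>G\<^esub> c \<in> H" using u by simp
  fix d assume "d \<in> H"
  then obtain v where v: "v \<in> Units V" "d = alg_map K v" by (rule H_E)
  have "c \<otimes>\<^bsub>G\<^esub> d = alg_map K (u \<otimes>\<^bsub>V\<^esub> v)" using u v V.Units_closed by (simp add: units_of_mult)
  then show "c \<otimes>\<^bsub>G\<^esub> d \<in> H" using u v by simp
qed

lemma H_G: "h \<in> H \<Longrightarrow> h \<in> carrier G"
  by (rule subgroup.mem_carrier[OF subgroup_H])

lemma alg_map_factorization:
  assumes "a \<in> carrier V" "a \<noteq> \<zero>\<^bsub>V\<^esub>"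
  shows "\<exists>h\<in>H. \<exists>n::nat. alg_map K a = h \<otimes>\<^bsub>G\<^esub> (W [^]\<^bsub>G\<^esub> int n)"
proof -
  obtain u and n :: nat where u: "u \<in> Units V" and a: "a = u \<otimes>\<^bsub>V\<^esub> (unif [^]\<^bsub>V\<^esub> n)"
    using unif_factorization[OF assms] by blast
  have "alg_map K a = alg_map K u \<otimes>\<^bsub>G\<^esub> (W [^]\<^bsub>G\<^esub> int n)"
    unfolding a using V.Units_closed[OF u] by (simp add: units_of_mult alg_map_pow_G[OF W_G, symmetric])
  then show ?thesis by (rule bexI[OF exI alg_map_H[OF u]])
qed

text \<open>An element is a fraction; numerator and denominator are factored in V and the exponents
  subtracted.\<close>

lemma G_factorization:
  assumes "c \<in> carrier G"
  obtains h k where "h \<in> H" "c = h \<otimes>\<^bsub>G\<^esub> (W [^]\<^bsub>G\<^esub> (k::int))"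
proof -
  have c: "c \<in> carrier K" "c \<noteq> \<zero>\<^bsub>K\<^esub>" using assms by (auto simp: carrier_G)
  obtain a b where ab: "a \<in> carrier V" "b \<in> carrier V" "b \<noteq> \<zero>\<^bsub>V\<^esub>" "c = alg_map K a \<otimes>\<^bsub>K\<^esub> inv\<^bsub>K\<^esub> (alg_map K b)"
    using frac c(1) unfolding fraction_field_def by blast
  have bG: "alg_map K b \<in> carrier G" using ab by (simp add: carrier_G alg_map_eq_zero_iff)
  have ib: "inv\<^bsub>K\<^esub> (alg_map K b) = inv\<^bsub>G\<^esub> (alg_map K b)"
    by (rule G_inv[OF bG])
  have "a \<noteq> \<zero>\<^bsub>V\<^esub>" using c ab ib G.inv_closed[OF bG] by (auto simp: carrier_G)
  then obtain h n where h: "h \<in> H" "alg_map K a = h \<otimes>\<^bsub>G\<^esub> (W [^]\<^bsub>G\<^esub> int n)"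
    using alg_map_factorization[OF ab(1)] by blast
  obtain h' n' where h': "h' \<in> H" "alg_map K b = h' \<otimes>\<^bsub>G\<^esub> (W [^]\<^bsub>G\<^esub> int n')"
    using alg_map_factorization[OF ab(2,3)] by blast
  have hG: "h \<in> carrier G" "h' \<in> carrier G" using h h' H_G by blast+
  have "c = alg_map K a \<otimes>\<^bsub>G\<^esub> inv\<^bsub>G\<^esub> (alg_map K b)" unfolding ab(4) ib units_of_mult by (rule refl)
  also have "\<dots> = (h \<otimes>\<^bsub>G\<^esub> inv\<^bsub>G\<^esub> h') \<otimes>\<^bsub>G\<^esub> (W [^]\<^bsub>G\<^esub> (int n - int n'))"
    unfolding h(2) h'(2) using hG W_G by (simp add: G.inv_mult G.int_pow_diff G.m_ac)
  finally have "c = (h \<otimes>\<^bsub>G\<^esub> inv\<^bsub>G\<^esub> h') \<otimes>\<^bsub>G\<^esub> (W [^]\<^bsub>G\<^esub> (int n - int n'))" .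
  moreover have "h \<otimes>\<^bsub>G\<^esub> inv\<^bsub>G\<^esub> h' \<in> H"
    using subgroup_H h(1) h'(1) by (simp add: subgroup.m_closed subgroup.m_inv_closed)
  ultimately show thesis by (rule that[rotated])
qed

text \<open>A positive power of the uniformizer lies in the maximal ideal and is no unit; a negative
  exponent reduces to this by inversion.\<close>

lemma W_pow_H: "W [^]\<^bsub>G\<^esub> (k::int) \<in> H \<Longrightarrow> k = 0"
proof -
  have nat: "n = 0" if n: "W [^]\<^bsub>G\<^esub> int n \<in> H" for n
  proof (rule ccontr)
    assume "n \<noteq> 0"
    then obtain m where m: "n = Suc m" by (cases n) auto
    have "alg_map K (unif [^]\<^bsub>V\<^esub> n) = W [^]\<^bsub>G\<^esub> int n"
      by (rule alg_map_pow_G[OF W_G unif(1)])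
    then obtain u where u: "u \<in> Units V" "alg_map K (unif [^]\<^bsub>V\<^esub> n) = alg_map K u" using n by (auto elim: H_E)
    then have "u = (unif [^]\<^bsub>V\<^esub> m) \<otimes>\<^bsub>V\<^esub> unif"
      using m alg_map_inj[of "unif [^]\<^bsub>V\<^esub> n" u] V.Units_closed[of u] by simp
    then have "u \<in> PIdl\<^bsub>V\<^esub> unif" by (auto simp: cgenideal_def)
    then show False using unit_not_in_max[OF u(1)] unif(2) by simp
  qed
  assume k: "W [^]\<^bsub>G\<^esub> k \<in> H"
  show "k = 0"
  proof (cases "k \<ge> 0")
    case True
    then show ?thesis using nat[of "nat k"] k by simp
  next
    case False
    have "inv\<^bsub>G\<^esub> (W [^]\<^bsub>G\<^esub> k) \<in> H" using subgroup_H k by (rule subgroup.m_inv_closed)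
    then show ?thesis using nat[of "nat (- k)"] False G.int_pow_neg[OF W_G, of k] by simp
  qed
qed

text \<open>\<open>dvr_val\<close> allows any uniformizer w. Each of them is a unit times
  \<open>unif\<close>, and the j-th power of that unit is absorbed into H, so the exponent does not
  depend on w.\<close>

lemma dvr_val_eq:
  assumes h: "h \<in> H"
  shows "dvr_val V K (h \<otimes>\<^bsub>G\<^esub> (W [^]\<^bsub>G\<^esub> (k::int))) = k"
  unfolding dvr_val_def
proof (rule the_equality)
  obtain u where u: "u \<in> Units V" "h = alg_map K u" by (rule H_E) (rule h)
  have "h \<otimes>\<^bsub>G\<^esub> (W [^]\<^bsub>G\<^esub> k) = alg_map K u \<otimes>\<^bsub>K\<^esub> (W [^]\<^bsub>K\<^esub> k)"
    using u W_G by (simp add: G_int_pow units_of_mult)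
  then show "\<exists>w\<in>carrier V. \<exists>u\<in>Units V. PIdl\<^bsub>V\<^esub> w = max_ideal V \<and>
      h \<otimes>\<^bsub>G\<^esub> (W [^]\<^bsub>G\<^esub> k) = alg_map K u \<otimes>\<^bsub>K\<^esub> (alg_map K w [^]\<^bsub>K\<^esub> k)"
    using u unif by blast
next
  fix j :: int assume "\<exists>w\<in>carrier V. \<exists>u\<in>Units V. PIdl\<^bsub>V\<^esub> w = max_ideal V \<and>
      h \<otimes>\<^bsub>G\<^esub> (W [^]\<^bsub>G\<^esub> k) = alg_map K u \<otimes>\<^bsub>K\<^esub> (alg_map K w [^]\<^bsub>K\<^esub> j)"
  then obtain w u where w: "w \<in> carrier V" "u \<in> Units V" "PIdl\<^bsub>V\<^esub> w = max_ideal V"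
    "h \<otimes>\<^bsub>G\<^esub> (W [^]\<^bsub>G\<^esub> k) = alg_map K u \<otimes>\<^bsub>K\<^esub> (alg_map K w [^]\<^bsub>K\<^esub> j)" by blast
  have "w \<sim>\<^bsub>V\<^esub> unif" using V.associated_iff_same_ideal w unif by simp
  then obtain v where v: "v \<in> Units V" "w = v \<otimes>\<^bsub>V\<^esub> unif" using V.ring_associated_iff w by auto
  have aw: "alg_map K w = alg_map K v \<otimes>\<^bsub>G\<^esub> W" using v V.Units_closed[of v] by (simp add: units_of_mult)
  have vH: "alg_map K v \<in> H" "alg_map K u \<in> H" using v w by simp_all
  define g where "g = alg_map K u \<otimes>\<^bsub>G\<^esub> (alg_map K v [^]\<^bsub>G\<^esub> j)"
  have g: "g \<in> H" unfolding g_def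
    using subgroup.m_closed[OF subgroup_H vH(2)] G.subgroup_int_pow_closed[OF subgroup_H vH(1)] by blast
  have e: "h \<otimes>\<^bsub>G\<^esub> (W [^]\<^bsub>G\<^esub> k) = g \<otimes>\<^bsub>G\<^esub> (W [^]\<^bsub>G\<^esub> j)"
  proof -
    have "alg_map K w \<in> carrier G" unfolding aw using H_G[OF vH(1)] W_G by (rule G.m_closed)
    then have "h \<otimes>\<^bsub>G\<^esub> (W [^]\<^bsub>G\<^esub> k) = alg_map K u \<otimes>\<^bsub>G\<^esub> ((alg_map K v \<otimes>\<^bsub>G\<^esub> W) [^]\<^bsub>G\<^esub> j)"
      using w(4) unfolding aw[symmetric] by (simp add: G_int_pow) (simp add: units_of_mult)
    also have "\<dots> = g \<otimes>\<^bsub>G\<^esub> (W [^]\<^bsub>G\<^esub> j)"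
      using H_G[OF vH(1)] H_G[OF vH(2)] W_G by (simp add: G.int_pow_mult_distrib[OF G.m_comm] g_def G.m_ac)
    finally show ?thesis .
  qed
  have "W [^]\<^bsub>G\<^esub> (j - k) = inv\<^bsub>G\<^esub> g \<otimes>\<^bsub>G\<^esub> h"
  proof -
    have c: "g \<in> carrier G" "h \<in> carrier G" "W [^]\<^bsub>G\<^esub> j \<in> carrier G" "W [^]\<^bsub>G\<^esub> k \<in> carrier G"
      using H_G[OF g] H_G[OF h] W_G by simp_all
    have "inv\<^bsub>G\<^esub> g \<otimes>\<^bsub>G\<^esub> h = inv\<^bsub>G\<^esub> g \<otimes>\<^bsub>G\<^esub> (h \<otimes>\<^bsub>G\<^esub> (W [^]\<^bsub>G\<^esub> k)) \<otimes>\<^bsub>G\<^esub> inv\<^bsub>G\<^esub> (W [^]\<^bsub>G\<^esub> k)"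
      using c by (simp add: G.m_assoc)
    also have "\<dots> = W [^]\<^bsub>G\<^esub> j \<otimes>\<^bsub>G\<^esub> inv\<^bsub>G\<^esub> (W [^]\<^bsub>G\<^esub> k)"
      unfolding e using c by (simp add: G.m_assoc[symmetric])
    finally show ?thesis using W_G by (simp add: G.int_pow_diff)
  qed
  also have "\<dots> \<in> H" using subgroup_H g h by (simp add: subgroup.m_closed subgroup.m_inv_closed)
  finally have "j - k = 0" by (rule W_pow_H)
  then show "j = k" by simp
qed

lemma dvr_val_mult:
  assumes "c \<in> carrier G" "d \<in> carrier G"
  shows "dvr_val V K (c \<otimes>\<^bsub>G\<^esub> d) = dvr_val V K c + dvr_val V K d"
proof -
  obtain h k where h: "h \<in> H" "c = h \<otimes>\<^bsub>G\<^esub> (W [^]\<^bsub>G\<^esub> (k::int))" using G_factorization[OF assms(1)] .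
  obtain h' k' where h': "h' \<in> H" "d = h' \<otimes>\<^bsub>G\<^esub> (W [^]\<^bsub>G\<^esub> (k'::int))" using G_factorization[OF assms(2)] .
  have "c \<otimes>\<^bsub>G\<^esub> d = (h \<otimes>\<^bsub>G\<^esub> h') \<otimes>\<^bsub>G\<^esub> (W [^]\<^bsub>G\<^esub> (k + k'))"
    using h(2) h'(2) H_G[OF h(1)] H_G[OF h'(1)] W_G by (simp add: G.int_pow_mult G.m_ac)
  moreover have "h \<otimes>\<^bsub>G\<^esub> h' \<in> H" using subgroup_H h(1) h'(1) by (rule subgroup.m_closed)
  ultimately show ?thesis using h h' by (simp add: dvr_val_eq)
qed

lemma dvr_val_int_pow:
  assumes "c \<in> carrier G"
  shows "dvr_val V K (c [^]\<^bsub>G\<^esub> (j::int)) = j * dvr_val V K c"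
proof -
  obtain h k where h: "h \<in> H" "c = h \<otimes>\<^bsub>G\<^esub> (W [^]\<^bsub>G\<^esub> (k::int))" using G_factorization[OF assms(1)] .
  have "c [^]\<^bsub>G\<^esub> j = (h [^]\<^bsub>G\<^esub> j) \<otimes>\<^bsub>G\<^esub> (W [^]\<^bsub>G\<^esub> (j * k))"
    using h H_G[OF h(1)] W_G by (simp add: G.int_pow_mult_distrib[OF G.m_comm] G.int_pow_pow mult.commute)
  moreover have "h [^]\<^bsub>G\<^esub> j \<in> H" using G.subgroup_int_pow_closed[OF subgroup_H h(1)] .
  ultimately show ?thesis using h by (simp add: dvr_val_eq)
qed

lemma dvr_val_nonneg_imp:
  assumes "c \<in> carrier G" "dvr_val V K c \<ge> 0"
  shows "c \<in> alg_map K ` carrier V"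
proof -
  obtain h k where h: "h \<in> H" "c = h \<otimes>\<^bsub>G\<^esub> (W [^]\<^bsub>G\<^esub> (k::int))" using G_factorization[OF assms(1)] .
  obtain u where u: "u \<in> Units V" "h = alg_map K u" by (rule H_E) (rule h(1))
  have "k = int (nat k)" using assms(2) h by (simp add: dvr_val_eq)
  then have "W [^]\<^bsub>G\<^esub> k = alg_map K (unif [^]\<^bsub>V\<^esub> nat k)"
    using alg_map_pow_G[OF W_G unif(1), of "nat k"] by simp
  then have "c = alg_map K (u \<otimes>\<^bsub>V\<^esub> (unif [^]\<^bsub>V\<^esub> nat k))"
    using h u V.Units_closed[of u] by (simp add: units_of_mult)
  moreover have "u \<otimes>\<^bsub>V\<^esub> (unif [^]\<^bsub>V\<^esub> nat k) \<in> carrier V" using V.Units_closed[OF u(1)] by simp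
  ultimately show ?thesis by (rule image_eqI)
qed

lemma alg_map_add_pow: "alg_map K (add_pow V (n::nat) \<one>\<^bsub>V\<^esub>) = add_pow K n \<one>\<^bsub>K\<^esub>"
  by (induction n) (auto simp: V.add.nat_pow_Suc K.add.nat_pow_Suc)

lemma add_pow_one_nonzero: "n > 0 \<Longrightarrow> add_pow K (n::nat) \<one>\<^bsub>K\<^esub> \<in> carrier G"
  using char_zero[of n] alg_map_add_pow[of n] alg_map_eq_zero_iff[of "add_pow V n \<one>\<^bsub>V\<^esub>"]
  by (simp add: carrier_G)

lemma p_elem_G: "p_elem p K \<in> carrier G"
  using add_pow_one_nonzero[of p] p_gt_1 by (simp add: p_elem_def)

text \<open>p lies in the maximal ideal, so the uniformizer occurs in it. Positivity allows
  inequalities to be multiplied by the denominator in \<open>p_abs\<close>.\<close>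

lemma dvr_val_p_elem: "dvr_val V K (p_elem p K) > 0"
proof -
  have pV: "p_elem p V \<in> carrier V" "p_elem p V \<noteq> \<zero>\<^bsub>V\<^esub>"
    using char_zero[of p] p_gt_1 by (auto simp: p_elem_def)
  obtain u n where u: "u \<in> Units V" "p_elem p V = u \<otimes>\<^bsub>V\<^esub> (unif [^]\<^bsub>V\<^esub> (n::nat))"
    using unif_factorization[OF pV] by blast
  have "n \<noteq> 0"
  proof
    assume "n = 0"
    then have "p_elem p V = u" using u V.Units_closed[of u] by simp
    then show False using unit_not_in_max[OF u(1)] p_elem_in_max by simp
  qed
  have "p_elem p K = alg_map K (p_elem p V)" by (simp add: p_elem_def alg_map_add_pow)
  also have "\<dots> = alg_map K u \<otimes>\<^bsub>G\<^esub> (W [^]\<^bsub>G\<^esub> int n)"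
    using u V.Units_closed[of u] by (simp add: units_of_mult alg_map_pow_G[OF W_G, symmetric])
  finally show ?thesis using u(1) \<open>n \<noteq> 0\<close> dvr_val_eq[of "alg_map K u" "int n"] by simp
qed

section \<open>Powers of p and the absolute value\<close>

definition pw :: "int \<Rightarrow> 'k" where
  "pw j = p_elem p K [^]\<^bsub>K\<^esub> j"

lemma pw_eq: "pw j = p_elem p K [^]\<^bsub>G\<^esub> j"
  unfolding pw_def by (rule G_int_pow[OF p_elem_G])

lemma pw_G: "pw j \<in> carrier G"
  unfolding pw_eq by (rule G.int_pow_closed[OF p_elem_G])

lemma pw_closed [simp]: "pw j \<in> carrier K"
  using pw_G[of j] by (simp add: carrier_G)

lemma pw_0 [simp]: "pw 0 = \<one>\<^bsub>K\<^esub>"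
  unfolding pw_eq by (simp add: units_of_one)

lemma pw_add: "pw i \<otimes>\<^bsub>K\<^esub> pw j = pw (i + j)"
  using G.int_pow_mult[OF p_elem_G, of i j] by (simp add: pw_eq units_of_mult)

text \<open>Nonnegative powers of p are integers, so they act on a module by repeated addition,
  which every additive map respects.\<close>

lemma pw_of_nat: "pw (int n) = add_pow K (p ^ n) \<one>\<^bsub>K\<^esub>"
proof (induction n)
  case (Suc n)
  have "pw (int (Suc n)) = pw 1 \<otimes>\<^bsub>K\<^esub> pw (int n)" by (simp add: pw_add)
  also have "pw 1 = add_pow K p \<one>\<^bsub>K\<^esub>"
    unfolding pw_eq by (simp add: p_elem_G) (simp add: p_elem_def)
  also have "add_pow K p \<one>\<^bsub>K\<^esub> \<otimes>\<^bsub>K\<^esub> pw (int n) = add_pow K p (pw (int n))"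
    by (simp add: K.add_pow_ldistr)
  also have "\<dots> = add_pow K (p ^ Suc n) \<one>\<^bsub>K\<^esub>"
    unfolding Suc by (simp add: K.add.nat_pow_pow mult.commute)
  finally show ?case .
qed simp

lemma dvr_val_pw: "dvr_val V K (pw j) = j * dvr_val V K (p_elem p K)"
  unfolding pw_eq by (rule dvr_val_int_pow[OF p_elem_G])

lemma p_abs_pw: "p_abs p V K (pw j) = p powr - j"
proof -
  have nz: "pw j \<noteq> \<zero>\<^bsub>K\<^esub>" using pw_G[of j] unfolding carrier_G by blast
  have e: "- real_of_int (j * d) / real_of_int d = - real_of_int j" if "d > 0" for d :: int
    using that by (simp add: field_simps)
  show ?thesis unfolding p_abs_def dvr_val_pw if_not_P[OF nz] e[OF dvr_val_p_elem] by (rule refl)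
qed

lemma p_abs_nonneg: "0 \<le> p_abs p V K c"
  by (simp add: p_abs_def)

text \<open>The inequality says that the product of p^j and c has nonnegative valuation.\<close>

lemma p_abs_le_imp:
  assumes c: "c \<in> carrier K" and le: "p_abs p V K c \<le> p powr (j::int)"
  shows "pw j \<otimes>\<^bsub>K\<^esub> c \<in> alg_map K ` carrier V"
proof (cases "c = \<zero>\<^bsub>K\<^esub>")
  case True
  then have "pw j \<otimes>\<^bsub>K\<^esub> c = alg_map K \<zero>\<^bsub>V\<^esub>" by simp
  then show ?thesis by blast
next
  case False
  then have cG: "c \<in> carrier G" using c by (simp add: carrier_G)
  let ?e = "dvr_val V K (p_elem p K)"
  have "real p powr (- real_of_int (dvr_val V K c) / real_of_int ?e) \<le> p powr j"
    using le unfolding p_abs_def if_not_P[OF False] .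
  then have "- real_of_int (dvr_val V K c) / real_of_int ?e \<le> j"
    using p_gt_1 by (subst (asm) powr_le_cancel_iff) simp_all
  then have "- real_of_int (dvr_val V K c) \<le> j * real_of_int ?e"
    using dvr_val_p_elem by (subst (asm) pos_divide_le_eq) simp_all
  then have "real_of_int 0 \<le> real_of_int (j * ?e + dvr_val V K c)" by simp
  then have "0 \<le> j * ?e + dvr_val V K c" by (simp only: of_int_le_iff)
  then have "pw j \<otimes>\<^bsub>G\<^esub> c \<in> alg_map K ` carrier V"
    using cG pw_G by (intro dvr_val_nonneg_imp) (simp_all add: dvr_val_mult dvr_val_pw)
  then show ?thesis by (simp add: units_of_mult)
qed

end

section \<open>Lattices in isocoherent modules\<close>

locale iso_module = D: mixed_dvr p V K + KA: alg_pair V K A + E: module "AK V K A" E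
  for p :: nat and V :: "('v, 'x) ring_scheme" and K :: "('v, 'k) module" and A :: "('v, 'a) module"
    and E :: "(('k, 'a) iso_ring, 'e) module"
begin

abbreviation "M \<equiv> over_A V K A E"
abbreviation "scale \<equiv> K_scale V K A E"

lemma R_eq: "AK V K A = KA.T"
  by (simp add: AK_def)

lemma M_ops: "carrier M = carrier E" "x \<oplus>\<^bsub>M\<^esub> y = x \<oplus>\<^bsub>E\<^esub> y" "\<zero>\<^bsub>M\<^esub> = \<zero>\<^bsub>E\<^esub>"
  "a \<odot>\<^bsub>M\<^esub> m = KA.t \<one>\<^bsub>K\<^esub> a \<odot>\<^bsub>E\<^esub> m"
  by (simp_all add: over_A_def restrict_scalars_def to_AK_def)

lemma tens_R [simp]: "c \<in> carrier K \<Longrightarrow> a \<in> carrier A \<Longrightarrow> KA.t c a \<in> carrier (AK V K A)"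
  unfolding R_eq by (rule KA.tens_closed)

lemma module_M: "module A M"
proof (rule moduleI)
  show "cring A" by (rule KA.B.cring_axioms)
  show "abelian_group M"
  proof (rule abelian_groupI)
    fix x assume "x \<in> carrier M"
    then show "\<exists>y\<in>carrier M. y \<oplus>\<^bsub>M\<^esub> x = \<zero>\<^bsub>M\<^esub>"
      by (intro bexI[of _ "\<ominus>\<^bsub>E\<^esub> x"]) (simp_all add: M_ops E.l_neg)
  qed (simp_all add: M_ops E.a_ac)
qed (auto simp: M_ops KA.tens_add_r E.smult_l_distr[unfolded R_eq] E.smult_r_distr KA.tens_mult
  E.smult_assoc1[unfolded R_eq, symmetric] KA.tens_one E.smult_one[unfolded R_eq])

sublocale M: module A M by (rule module_M)

lemma scale_closed [simp]: "c \<in> carrier K \<Longrightarrow> m \<in> carrier M \<Longrightarrow> scale c m \<in> carrier M"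
  by (simp add: K_scale_def M_ops)

lemma scale_additive: "c \<in> carrier K \<Longrightarrow> abelian_group_hom M M (scale c)"
  by (rule abelian_group_homI') (auto simp: M.abelian_group_axioms M_ops K_scale_def E.smult_r_distr)

text \<open>K and A act through the two factors of K \<otimes> A, which commute.\<close>

lemma scale_smult:
  assumes "c \<in> carrier K" "a \<in> carrier A" "m \<in> carrier M"
  shows "scale c (a \<odot>\<^bsub>M\<^esub> m) = a \<odot>\<^bsub>M\<^esub> scale c m"
    and scale_tens: "KA.t c a \<odot>\<^bsub>E\<^esub> m = scale c (a \<odot>\<^bsub>M\<^esub> m)"
proof -
  have m: "m \<in> carrier E" using assms by (simp add: M_ops)
  have "KA.t c \<one>\<^bsub>A\<^esub> \<otimes>\<^bsub>AK V K A\<^esub> KA.t \<one>\<^bsub>K\<^esub> a = KA.t c a"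
    "KA.t \<one>\<^bsub>K\<^esub> a \<otimes>\<^bsub>AK V K A\<^esub> KA.t c \<one>\<^bsub>A\<^esub> = KA.t c a"
    using assms by (simp_all add: R_eq KA.tens_mult)
  then have "KA.t c \<one>\<^bsub>A\<^esub> \<odot>\<^bsub>E\<^esub> (KA.t \<one>\<^bsub>K\<^esub> a \<odot>\<^bsub>E\<^esub> m) = KA.t c a \<odot>\<^bsub>E\<^esub> m"
    "KA.t \<one>\<^bsub>K\<^esub> a \<odot>\<^bsub>E\<^esub> (KA.t c \<one>\<^bsub>A\<^esub> \<odot>\<^bsub>E\<^esub> m) = KA.t c a \<odot>\<^bsub>E\<^esub> m"
    using assms m by (simp_all add: E.smult_assoc1[symmetric])
  then show "scale c (a \<odot>\<^bsub>M\<^esub> m) = a \<odot>\<^bsub>M\<^esub> scale c m" "KA.t c a \<odot>\<^bsub>E\<^esub> m = scale c (a \<odot>\<^bsub>M\<^esub> m)"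
    by (simp_all add: M_ops K_scale_def)
qed

lemma scale_mult:
  assumes "c \<in> carrier K" "d \<in> carrier K" "m \<in> carrier M"
  shows "scale c (scale d m) = scale (c \<otimes>\<^bsub>K\<^esub> d) m"
proof -
  have "KA.t c \<one>\<^bsub>A\<^esub> \<otimes>\<^bsub>AK V K A\<^esub> KA.t d \<one>\<^bsub>A\<^esub> = KA.t (c \<otimes>\<^bsub>K\<^esub> d) \<one>\<^bsub>A\<^esub>"
    using assms by (simp add: R_eq KA.tens_mult)
  then show ?thesis using assms by (simp add: K_scale_def M_ops E.smult_assoc1[symmetric])
qed

lemma scale_one: "m \<in> carrier M \<Longrightarrow> scale \<one>\<^bsub>K\<^esub> m = m"
  using E.smult_one[unfolded R_eq] by (simp add: K_scale_def M_ops KA.tens_one)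

lemma scale_add:
  assumes "c \<in> carrier K" "d \<in> carrier K" "m \<in> carrier M"
  shows "scale (c \<oplus>\<^bsub>K\<^esub> d) m = scale c m \<oplus>\<^bsub>M\<^esub> scale d m"
  using E.smult_l_distr[of "KA.t c \<one>\<^bsub>A\<^esub>" "KA.t d \<one>\<^bsub>A\<^esub>" m] assms
  by (simp add: K_scale_def M_ops KA.tens_add_l R_eq)

lemma scale_zero:
  assumes m: "m \<in> carrier M" shows "scale \<zero>\<^bsub>K\<^esub> m = \<zero>\<^bsub>M\<^esub>"
proof -
  interpret h: abelian_group_hom K M "\<lambda>c. scale c m"
    by (rule abelian_group_homI')
       (use m in \<open>auto simp: scale_add M.abelian_group_axioms D.K.abelian_group_axioms\<close>)
  show ?thesis by (rule h.hom_zero)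
qed

lemma scale_alg_map:
  assumes "v \<in> carrier V" "m \<in> carrier M"
  shows "scale (alg_map K v) m = alg_map A v \<odot>\<^bsub>M\<^esub> m"
  using assms by (simp add: K_scale_def M_ops alg_map_def KA.tens_smult)

lemma scale_add_pow: "m \<in> carrier M \<Longrightarrow> scale (add_pow K (n::nat) \<one>\<^bsub>K\<^esub>) m = add_pow M n m"
proof (induction n)
  case 0
  then show ?case by (simp add: scale_zero)
next
  case (Suc n)
  then show ?case
    by (simp add: D.K.add.nat_pow_Suc M.add.nat_pow_Suc scale_add scale_one D.K.add.nat_pow_closed)
qed

text \<open>A positive integer is invertible in K, and K acts on the module.\<close>

lemma torsion_free:
  assumes n: "0 < (n::nat)" and m: "m \<in> carrier M" and z: "add_pow M n m = \<zero>\<^bsub>M\<^esub>"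
  shows "m = \<zero>\<^bsub>M\<^esub>"
proof -
  let ?c = "add_pow K n \<one>\<^bsub>K\<^esub>"
  have c: "?c \<in> Units K" using D.add_pow_one_nonzero[OF n] by (simp only: units_of_carrier)
  have ci: "inv\<^bsub>K\<^esub> ?c \<in> carrier K" using c by (rule D.K.Units_inv_closed)
  have "m = scale (inv\<^bsub>K\<^esub> ?c \<otimes>\<^bsub>K\<^esub> ?c) m"
    using c m by (simp add: D.K.Units_l_inv scale_one)
  also have "\<dots> = scale (inv\<^bsub>K\<^esub> ?c) (add_pow M n m)"
    using ci m D.K.Units_closed[OF c] by (simp add: scale_mult[symmetric] scale_add_pow)
  also have "\<dots> = \<zero>\<^bsub>M\<^esub>"
    unfolding z by (rule abelian_group_hom.hom_zero[OF scale_additive[OF ci]])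
  finally show ?thesis .
qed

abbreviation "P j \<equiv> scale (D.pw j)"

lemma P_P: "m \<in> carrier M \<Longrightarrow> P i (P j m) = P (i + j) m"
  by (simp add: scale_mult D.pw_add)

lemma P_0: "m \<in> carrier M \<Longrightarrow> P 0 m = m"
  by (simp add: scale_one)

lemma P_nat: "m \<in> carrier M \<Longrightarrow> P (int n) m = add_pow M (p ^ n) m"
  by (simp add: D.pw_of_nat scale_add_pow)

end

section \<open>Lattices and their norm\<close>

locale iso_lattice = iso_module p V K A E
  for p :: nat and V :: "('v, 'x) ring_scheme" and K :: "('v, 'k) module" and A :: "('v, 'a) module"
    and E :: "(('k, 'a) iso_ring, 'e) module" +
  fixes L :: "'e set"
  assumes lattice: "is_lattice V K A E L"
begin

lemma submodule_L: "submodule L A M"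
  using lattice by (simp add: is_lattice_def)

lemma module_L: "module A (lattice_mod V K A E L)"
  unfolding lattice_mod_def by (rule submodule.submodule_is_module[OF submodule_L module_M])

lemma L_closed: "m \<in> L \<Longrightarrow> m \<in> carrier M"
  using subgroup.subset[OF submodule.axioms(1)[OF submodule_L]] by auto

lemma L_smult: "a \<in> carrier A \<Longrightarrow> m \<in> L \<Longrightarrow> a \<odot>\<^bsub>M\<^esub> m \<in> L"
  by (rule submodule.smult_closed[OF submodule_L])

lemma L_diff: "m \<in> L \<Longrightarrow> m' \<in> L \<Longrightarrow> m \<ominus>\<^bsub>M\<^esub> m' \<in> L"
  using subgroup.m_closed[OF submodule.axioms(1)[OF submodule_L]]
    subgroup.m_inv_closed[OF submodule.axioms(1)[OF submodule_L]]
  by (simp add: a_minus_def a_inv_def)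

lemma L_zero: "\<zero>\<^bsub>M\<^esub> \<in> L"
  using subgroup.one_closed[OF submodule.axioms(1)[OF submodule_L]] by simp

text \<open>The bound on c puts the product of p^j and c into V, and L is stable under V.\<close>

lemma scale_L:
  assumes c: "c \<in> carrier K" "p_abs p V K c \<le> p powr (j::int)" and m: "m \<in> L"
  shows "P j (scale c m) \<in> L"
proof -
  obtain v where v: "v \<in> carrier V" "D.pw j \<otimes>\<^bsub>K\<^esub> c = alg_map K v" using D.p_abs_le_imp[OF c] by blast
  have "P j (scale c m) = alg_map A v \<odot>\<^bsub>M\<^esub> m"
    using c L_closed[OF m] v by (simp add: scale_mult scale_alg_map)
  also have "\<dots> \<in> L" using v(1) m by (intro L_smult) (simp_all add: alg_map_def)
  finally show ?thesis .
qed

lemma P_L: "0 \<le> j \<Longrightarrow> m \<in> L \<Longrightarrow> P j m \<in> L"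
proof -
  assume j: "0 \<le> j" and m: "m \<in> L"
  have "p_abs p V K (D.pw 0) \<le> p powr j"
    unfolding D.p_abs_pw using j D.p_gt_1 by (intro powr_mono) auto
  then have "P j (P 0 m) \<in> L" using m by (intro scale_L D.pw_closed)
  then show ?thesis by (simp only: P_0[OF L_closed[OF m]])
qed

text \<open>Absolute values can be fractional powers of p when p is not a uniformizer, so an
  integral exponent above is chosen.\<close>

lemma p_abs_bound: "\<exists>j\<ge>0. p_abs p V K c \<le> p powr real_of_int j"
proof -
  obtain n where "p_abs p V K c < real p ^ n" using real_arch_pow[of "real p"] D.p_gt_1 by auto
  then have "p_abs p V K c \<le> p powr real_of_int (int n)" using D.p_gt_1 by (simp add: powr_realpow)
  then show ?thesis by (intro exI[of _ "int n"]) simp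
qed

lemma absorb_diff:
  assumes "\<exists>j\<ge>0. P j m \<in> L" "\<exists>j\<ge>0. P j m' \<in> L" "m \<in> carrier M" "m' \<in> carrier M"
  shows "\<exists>j\<ge>0. P j (m \<ominus>\<^bsub>M\<^esub> m') \<in> L"
proof -
  obtain i j where i: "i \<ge> 0" "P i m \<in> L" "j \<ge> 0" "P j m' \<in> L" using assms by blast
  have "P (j + i) m \<in> L" using P_L[OF i(3,2)] assms(3) by (simp only: P_P)
  moreover have "P (i + j) m' \<in> L" using P_L[OF i(1,4)] assms(4) by (simp only: P_P)
  ultimately have "P (i + j) m \<ominus>\<^bsub>M\<^esub> P (i + j) m' \<in> L" by (intro L_diff) (simp_all add: add.commute)
  then have "P (i + j) (m \<ominus>\<^bsub>M\<^esub> m') \<in> L"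
    using abelian_group_hom.hom_diff[OF scale_additive[OF D.pw_closed[of "i + j"]]] assms(3,4) by simp
  then show ?thesis using i by (intro exI[of _ "i + j"]) simp
qed

text \<open>The map from K \<otimes> L to E is onto, and its source is generated under differences
  by elements b \<otimes> x with x in L. Here b is in turn built from tensors c \<otimes> a, and a
  power of p that compensates c brings the corresponding product into L.\<close>

lemma absorb:
  assumes m: "m \<in> carrier M"
  shows "\<exists>j\<ge>0. P j m \<in> L"
proof -
  let ?Lm = "lattice_mod V K A E L"
  have Lc: "carrier ?Lm = L" "x \<oplus>\<^bsub>?Lm\<^esub> y = x \<oplus>\<^bsub>M\<^esub> y" "a \<odot>\<^bsub>?Lm\<^esub> x = a \<odot>\<^bsub>M\<^esub> x" for x y a
    by (simp_all add: lattice_mod_def)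
  have ring: "cring (AK V K A)" unfolding R_eq by (rule KA.cring_T)
  have hom: "to_AK V K A \<in> ring_hom A (AK V K A)"
    using KA.ring_hom_r unfolding R_eq to_AK_def .
  interpret B: base_extension A "AK V K A" "to_AK V K A" ?Lm
    by (intro base_extension.intro base_extension_axioms.intro KA.B.cring_axioms ring module_L hom)
  have LE: "x \<in> carrier E" if "x \<in> L" for x using L_closed[OF that] by (simp only: M_ops)
  have h: "biadditive (AK V K A) ?Lm E (\<lambda>b m. b \<odot>\<^bsub>E\<^esub> m)"
    using LE by (auto simp: biadditive_def Lc M_ops E.smult_l_distr E.smult_r_distr E.abelian_group_axioms)
  have bal: "(b \<otimes>\<^bsub>AK V K A\<^esub> to_AK V K A a) \<odot>\<^bsub>E\<^esub> x = b \<odot>\<^bsub>E\<^esub> (a \<odot>\<^bsub>?Lm\<^esub> x)"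
    if "b \<in> carrier (AK V K A)" "a \<in> carrier A" "x \<in> carrier ?Lm" for b a x
    using that LE by (simp add: Lc M_ops to_AK_def E.smult_assoc1)
  have cu: "bc_counit E = tlift E (\<lambda>b m. b \<odot>\<^bsub>E\<^esub> m)"
    by (intro ext) (simp add: bc_counit_def tlift_def)
  have lift: "abelian_group_hom B.BC M (tlift E (\<lambda>b m. b \<odot>\<^bsub>E\<^esub> m))"
    using B.bc_lift_hom[OF h bal]
    by (intro abelian_group_homI' B.abelian_group_BC M.abelian_group_axioms)
       (auto simp: M_ops abelian_group_hom_def abelian_group_hom_axioms_def intro: abelian_group_hom.hom_closed abelian_group_hom.hom_add)
  have z: "\<exists>j\<ge>0. P j \<zero>\<^bsub>M\<^esub> \<in> L"
    using P_L[OF order_refl L_zero] by (intro exI[of _ 0]) simp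
  have absorb_smult: "\<exists>j\<ge>0. P j (b \<odot>\<^bsub>E\<^esub> x) \<in> L" if x: "x \<in> L" and b: "b \<in> carrier KA.T" for b x
    using b
  proof (induction rule: KA.T_induct)
    case zero
    have "\<zero>\<^bsub>KA.T\<^esub> \<odot>\<^bsub>E\<^esub> x = \<zero>\<^bsub>M\<^esub>" using E.smult_l_null[OF LE[OF x]] by (simp add: R_eq M_ops)
    then show ?case using z by simp
  next
    case (tens c a)
    obtain j where j: "j \<ge> 0" "p_abs p V K c \<le> p powr real_of_int j" using p_abs_bound by blast
    have "P j (scale c (a \<odot>\<^bsub>M\<^esub> x)) \<in> L" by (rule scale_L[OF tens(1) j(2) L_smult[OF tens(2) x]])
    then show ?case using j(1) unfolding scale_tens[OF tens L_closed[OF x]] by blast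
  next
    case (diff X Y)
    have "(X \<ominus>\<^bsub>KA.T\<^esub> Y) \<odot>\<^bsub>E\<^esub> x = (X \<odot>\<^bsub>E\<^esub> x) \<ominus>\<^bsub>M\<^esub> (Y \<odot>\<^bsub>E\<^esub> x)"
    proof -
      have "abelian_group_hom KA.T M (\<lambda>b. b \<odot>\<^bsub>E\<^esub> x)"
        using LE[OF x] E.smult_l_distr[unfolded R_eq] E.smult_closed[unfolded R_eq]
        by (intro abelian_group_homI' M.abelian_group_axioms KA.T.abelian_group_axioms) (auto simp: M_ops)
      then show ?thesis by (rule abelian_group_hom.hom_diff[OF _ diff(1,2)])
    qed
    then show ?case
      using absorb_diff[OF diff(3,4)] LE[OF x] diff(1,2) E.smult_closed[unfolded R_eq] by (simp add: M_ops)
  qed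
  have all: "\<exists>j\<ge>0. P j (tlift E (\<lambda>b m. b \<odot>\<^bsub>E\<^esub> m) X) \<in> L" if "X \<in> carrier B.BC" for X
    using that
  proof (induction rule: B.BC_induct)
    case zero
    show ?case unfolding abelian_group_hom.hom_zero[OF lift] by (rule z)
  next
    case (pure b x)
    have "x \<in> L" "b \<in> carrier KA.T" using pure by (simp_all add: Lc R_eq)
    then have "\<exists>j\<ge>0. P j (b \<odot>\<^bsub>E\<^esub> x) \<in> L" by (rule absorb_smult)
    moreover have "tlift E (\<lambda>b m. b \<odot>\<^bsub>E\<^esub> m) (B.pure b x) = b \<odot>\<^bsub>E\<^esub> x"
      by (rule B.bc_lift_pure[OF h bal pure])
    ultimately show ?case by (simp only:)
  next
    case (diff X Y)
    show ?case unfolding abelian_group_hom.hom_diff[OF lift diff(1,2)]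
      by (rule absorb_diff[OF diff(3,4)]) (rule abelian_group_hom.hom_closed[OF lift], rule diff)+
  qed
  obtain X where "X \<in> carrier B.BC" "m = bc_counit E X"
    using lattice m unfolding is_lattice_def bij_betw_def by (auto simp: M_ops)
  then show ?thesis using all unfolding cu by blast
qed

abbreviation "nm \<equiv> lattice_norm p V K A E L"

text \<open>The norm is an infimum that is not claimed to be attained, hence the strict inequality
  in the last part: it provides a scalar of absolute value below p^j that carries an element of L to
  m.\<close>

lemma nm_nonneg:
  assumes m: "m \<in> carrier M" shows "0 \<le> nm m"
    and nm_le: "P j m \<in> L \<Longrightarrow> nm m \<le> p powr j"
    and nm_less_imp: "nm m < p powr j \<Longrightarrow> P j m \<in> L"
proof -
  let ?N = "{p_abs p V K c | c. c \<in> carrier K \<and> m \<in> scale c ` L}"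
  have mem: "p powr j \<in> ?N" if "P j m \<in> L" for j
  proof -
    have "m = P (- j) (P j m)" using m by (simp only: P_P) (simp only: P_0 left_minus)
    then have "m \<in> P (- j) ` L" using that by (rule image_eqI)
    moreover have "p_abs p V K (D.pw (- j)) = p powr j" by (simp add: D.p_abs_pw)
    ultimately show ?thesis by (intro CollectI exI[of _ "D.pw (- j)"]) simp
  qed
  have ne: "?N \<noteq> {}" using absorb[OF m] mem by blast
  have bdd: "bdd_below ?N" by (rule bdd_belowI[of _ 0]) (auto simp: D.p_abs_nonneg)
  show "0 \<le> nm m" unfolding lattice_norm_def by (rule cInf_greatest[OF ne]) (auto simp: D.p_abs_nonneg)
  show "P j m \<in> L \<Longrightarrow> nm m \<le> p powr j" unfolding lattice_norm_def by (rule cInf_lower[OF mem bdd])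
  assume "nm m < p powr j"
  then have "\<exists>x\<in>?N. x < p powr j" unfolding lattice_norm_def by (subst (asm) cInf_less_iff[OF ne bdd])
  then obtain c y where c: "c \<in> carrier K" "y \<in> L" "m = scale c y" "p_abs p V K c < p powr j" by blast
  show "P j m \<in> L" unfolding c(3) by (rule scale_L[OF c(1) less_imp_le[OF c(4)] c(2)])
qed

lemma lattice_generators:
  "\<exists>S. finite S \<and> S \<subseteq> L \<and> (\<forall>m\<in>L. \<exists>a\<in>S \<rightarrow> carrier A. m = (\<Oplus>\<^bsub>M\<^esub>s\<in>S. a s \<odot>\<^bsub>M\<^esub> s))"
proof -
  let ?Lm = "lattice_mod V K A E L"
  interpret Lm: module A ?Lm by (rule module_L)
  have Lc: "carrier ?Lm = L" "x \<oplus>\<^bsub>?Lm\<^esub> y = x \<oplus>\<^bsub>M\<^esub> y" "a \<odot>\<^bsub>?Lm\<^esub> x = a \<odot>\<^bsub>M\<^esub> x" for x y a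
    by (simp_all add: lattice_mod_def)
  obtain S where S: "finite S" "S \<subseteq> L"
    "\<And>m. m \<in> L \<Longrightarrow> \<exists>a\<in>S \<rightarrow> carrier A. m = (\<Oplus>\<^bsub>?Lm\<^esub>s\<in>S. a s \<odot>\<^bsub>?Lm\<^esub> s)"
    using lattice unfolding is_lattice_def fin_gen_module_def Lc(1) by blast
  have id: "abelian_group_hom ?Lm M id"
    by (rule abelian_group_homI') (auto simp: M.abelian_group_axioms Lm.abelian_group_axioms Lc L_closed)
  have eq: "(\<Oplus>\<^bsub>?Lm\<^esub>s\<in>S. a s \<odot>\<^bsub>?Lm\<^esub> s) = (\<Oplus>\<^bsub>M\<^esub>s\<in>S. a s \<odot>\<^bsub>M\<^esub> s)" if "a \<in> S \<rightarrow> carrier A" for a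
  proof -
    have "(\<lambda>s. a s \<odot>\<^bsub>?Lm\<^esub> s) \<in> S \<rightarrow> carrier ?Lm"
      using that S(2) L_smult by (auto simp: Lc Pi_iff)
    from abelian_group_hom.hom_finsum[OF id this] show ?thesis by (simp add: Lc)
  qed
  show ?thesis
  proof (intro exI[of _ S] conjI ballI S(1,2))
    fix m assume "m \<in> L"
    then obtain a where a: "a \<in> S \<rightarrow> carrier A" "m = (\<Oplus>\<^bsub>?Lm\<^esub>s\<in>S. a s \<odot>\<^bsub>?Lm\<^esub> s)"
      by (rule bexE[OF S(3)])
    show "\<exists>a\<in>S \<rightarrow> carrier A. m = (\<Oplus>\<^bsub>M\<^esub>s\<in>S. a s \<odot>\<^bsub>M\<^esub> s)"
      by (rule bexI[OF _ a(1)]) (unfold eq[OF a(1), symmetric], rule a(2))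
  qed
qed

end

section \<open>Bounds on the Taylor coefficients\<close>

text \<open>Multiplication by p^j is kept as an abstract family P with the properties used below, so
  the field K no longer appears.\<close>

locale lattice_strat = strat_diagonal p V A l x M \<epsilon>
  for p :: nat and V :: "('v, 'x) ring_scheme" and A :: "('v, 'a) module" and l x
    and M :: "('a, 'e) module" and \<epsilon> :: "nat \<Rightarrow> ('a, 'e) pull2 \<Rightarrow> ('a, 'e) pull2" +
  fixes L :: "'e set" and S :: "'e set" and P :: "int \<Rightarrow> 'e \<Rightarrow> 'e"
  assumes L: "submodule L A M"
    and S: "finite S" "S \<subseteq> L"
    and span_S: "\<And>m. m \<in> L \<Longrightarrow> \<exists>a\<in>S \<rightarrow> carrier A. m = (\<Oplus>\<^bsub>M\<^esub>s\<in>S. a s \<odot>\<^bsub>M\<^esub> s)"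
    and P_additive: "\<And>j. abelian_group_hom M M (P j)"
    and P_smult: "\<And>j a m. a \<in> carrier A \<Longrightarrow> m \<in> carrier M \<Longrightarrow> P j (a \<odot>\<^bsub>M\<^esub> m) = a \<odot>\<^bsub>M\<^esub> P j m"
    and P_P: "\<And>i j m. m \<in> carrier M \<Longrightarrow> P i (P j m) = P (i + j) m"
    and P_nat: "\<And>n m. m \<in> carrier M \<Longrightarrow> P (int n) m = add_pow M (p ^ n) m"
    and P_L: "\<And>j m. 0 \<le> j \<Longrightarrow> m \<in> L \<Longrightarrow> P j m \<in> L"
    and absorb: "\<And>m. m \<in> carrier M \<Longrightarrow> \<exists>j\<ge>0. P j m \<in> L"
begin

abbreviation "Lm \<equiv> M\<lparr>carrier := L\<rparr>"

lemma L_M: "m \<in> L \<Longrightarrow> m \<in> carrier M"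
  using subgroup.subset[OF submodule.axioms(1)[OF L]] by auto

lemma module_Lm: "module A Lm"
  by (rule submodule.submodule_is_module[OF L M.module_axioms])

lemma P_closed [simp]: "m \<in> carrier M \<Longrightarrow> P j m \<in> carrier M"
  by (rule abelian_group_hom.hom_closed[OF P_additive])

lemma incl_morphism:
  assumes "base_extension A B \<phi> M"
  shows "bc_morphism A B \<phi> Lm B \<phi> M id id"
proof -
  interpret B: base_extension A B \<phi> M by fact
  interpret Lm: module A Lm by (rule module_Lm)
  have "base_extension A B \<phi> Lm"
    by (intro base_extension.intro base_extension_axioms.intro A.cring_axioms B.B.cring_axioms module_Lm B.phi_hom)
  moreover have "abelian_group_hom Lm M id"
    by (rule abelian_group_homI') (auto simp: M.M.abelian_group_axioms Lm.abelian_group_axioms L_M)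
  moreover have "abelian_group_hom B B id"
    by (rule abelian_group_homI') (auto simp: B.B.abelian_group_axioms)
  ultimately show ?thesis
    by (intro bc_morphism.intro bc_morphism_axioms.intro assms) (auto simp: L_M)
qed

lemma P_morphism:
  assumes "base_extension A B \<phi> M"
  shows "bc_morphism A B \<phi> M B \<phi> M id (P j)"
proof -
  interpret B: base_extension A B \<phi> M by fact
  have "abelian_group_hom B B id"
    by (rule abelian_group_homI') (auto simp: B.B.abelian_group_axioms)
  then show ?thesis
    by (intro bc_morphism.intro bc_morphism_axioms.intro assms P_additive) (auto simp: P_smult)
qed

text \<open>The image, and not the pullback of L itself, as in \<open>p1_lattice\<close> and
  \<open>p2_lattice\<close>; leaving the ring and its structure map open treats both projections at
  once.\<close>

definition lat :: "('b, 'y) ring_scheme \<Rightarrow> ('a \<Rightarrow> 'b) \<Rightarrow> (('b \<times> 'e) \<Rightarrow>\<^sub>0 int) set set" where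
  "lat B \<phi> = bc_map A B \<phi> M id id ` carrier (base_change A B \<phi> Lm)"

lemma lat_subgroup:
  assumes "base_extension A B \<phi> M"
  shows "\<And>z. z \<in> lat B \<phi> \<Longrightarrow> z \<in> carrier (base_change A B \<phi> M)"
    "\<zero>\<^bsub>base_change A B \<phi> M\<^esub> \<in> lat B \<phi>"
    "\<And>z z'. z \<in> lat B \<phi> \<Longrightarrow> z' \<in> lat B \<phi> \<Longrightarrow> z \<ominus>\<^bsub>base_change A B \<phi> M\<^esub> z' \<in> lat B \<phi>"
    "\<And>b m. b \<in> carrier B \<Longrightarrow> m \<in> L \<Longrightarrow> bc_pure A B \<phi> M b m \<in> lat B \<phi>"
proof -
  interpret i: bc_morphism A B \<phi> Lm B \<phi> M id id by (rule incl_morphism[OF assms])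
  interpret h: abelian_group_hom i.X.BC i.Y.BC i.bm by (rule i.bm_additive)
  show "z \<in> lat B \<phi> \<Longrightarrow> z \<in> carrier i.Y.BC" for z unfolding lat_def by (elim imageE) (simp only: h.hom_closed)
  show "\<zero>\<^bsub>i.Y.BC\<^esub> \<in> lat B \<phi>" unfolding lat_def
    by (rule image_eqI[where x = "\<zero>\<^bsub>i.X.BC\<^esub>"]) (rule h.hom_zero[symmetric], rule i.X.BC.zero_closed)
  show "z \<ominus>\<^bsub>i.Y.BC\<^esub> z' \<in> lat B \<phi>" if zz: "z \<in> lat B \<phi>" "z' \<in> lat B \<phi>" for z z'
  proof -
    obtain y where y: "z = i.bm y" "y \<in> carrier i.X.BC" by (rule imageE[OF zz(1)[unfolded lat_def]])
    obtain y' where y': "z' = i.bm y'" "y' \<in> carrier i.X.BC" by (rule imageE[OF zz(2)[unfolded lat_def]])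
    show ?thesis unfolding y(1) y'(1) lat_def
      by (rule image_eqI[where x = "y \<ominus>\<^bsub>i.X.BC\<^esub> y'"])
         (rule h.hom_diff[OF y(2) y'(2), symmetric], rule i.X.BC.minus_closed[OF y(2) y'(2)])
  qed
  show "bc_pure A B \<phi> M b m \<in> lat B \<phi>" if b: "b \<in> carrier B" and m: "m \<in> L" for b m
  proof -
    have m': "m \<in> carrier Lm" using m by simp
    have "bc_pure A B \<phi> M b m = i.bm (i.X.pure b m)" unfolding i.bm_pure[OF b m'] id_apply by (rule refl)
    then show ?thesis unfolding lat_def by (rule image_eqI) (rule i.X.pure_closed[OF b m'])
  qed
qed

text \<open>Lattices are shown to be closed under differences; a sum is recovered as z - (0 -
  z').\<close>

lemma finsum_in:
  assumes "abelian_group G" "T \<subseteq> carrier G" "\<zero>\<^bsub>G\<^esub> \<in> T"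
    "\<And>z z'. z \<in> T \<Longrightarrow> z' \<in> T \<Longrightarrow> z \<ominus>\<^bsub>G\<^esub> z' \<in> T" "\<And>i. i \<in> I \<Longrightarrow> f i \<in> T"
  shows "(\<Oplus>\<^bsub>G\<^esub>i\<in>I. f i) \<in> T"
proof -
  interpret G: abelian_group G by fact
  have add: "z \<oplus>\<^bsub>G\<^esub> z' \<in> T" if "z \<in> T" "z' \<in> T" for z z'
  proof -
    have "z \<oplus>\<^bsub>G\<^esub> z' = z \<ominus>\<^bsub>G\<^esub> (\<zero>\<^bsub>G\<^esub> \<ominus>\<^bsub>G\<^esub> z')"
      using that assms(2) by (simp add: subset_iff G.minus_eq)
    then show ?thesis using assms(4)[OF that(1) assms(4)[OF assms(3) that(2)]] by (simp only:)
  qed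
  show ?thesis using assms(5)
  proof (induction I rule: infinite_finite_induct)
    case (insert i I)
    have "f \<in> I \<rightarrow> carrier G" "f i \<in> carrier G" using insert.prems assms(2) by blast+
    then have "(\<Oplus>\<^bsub>G\<^esub>i\<in>insert i I. f i) = f i \<oplus>\<^bsub>G\<^esub> (\<Oplus>\<^bsub>G\<^esub>i\<in>I. f i)"
      by (rule G.finsum_insert[OF insert.hyps])
    then show ?case using add insert by simp
  qed (use assms(3) in \<open>auto simp: G.finsum_infinite\<close>)
qed

text \<open>If m is a combination of the generators s with coefficients a_s, then b \<otimes> m is
  the sum of the b \<phi>(a_s) \<otimes> s, because the coefficients pass to the left
  factor.\<close>

lemma lat_generated:
  assumes B: "base_extension A B \<phi> M" and g: "abelian_group_hom (base_change A B \<phi> M) G g"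
    and T: "T \<subseteq> carrier G" "\<zero>\<^bsub>G\<^esub> \<in> T" "\<And>z z'. z \<in> T \<Longrightarrow> z' \<in> T \<Longrightarrow> z \<ominus>\<^bsub>G\<^esub> z' \<in> T"
    and gen: "\<And>b s. b \<in> carrier B \<Longrightarrow> s \<in> S \<Longrightarrow> g (bc_pure A B \<phi> M b s) \<in> T"
    and z: "z \<in> lat B \<phi>"
  shows "g z \<in> T"
proof -
  interpret i: bc_morphism A B \<phi> Lm B \<phi> M id id by (rule incl_morphism[OF B])
  interpret h: abelian_group_hom i.X.BC i.Y.BC i.bm by (rule i.bm_additive)
  interpret g: abelian_group_hom i.Y.BC G g by (rule g)
  have "g (i.bm y) \<in> T" if "y \<in> carrier i.X.BC" for y
    using that
  proof (induction rule: i.X.BC_induct)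
    case zero
    show ?case unfolding h.hom_zero g.hom_zero by (rule T(2))
  next
    case (pure b m)
    have b: "b \<in> carrier B" and m: "m \<in> L" using pure by simp_all
    obtain a where a: "a \<in> S \<rightarrow> carrier A" "m = (\<Oplus>\<^bsub>M\<^esub>s\<in>S. a s \<odot>\<^bsub>M\<^esub> s)" using span_S[OF m] by blast
    have sM: "s \<in> carrier M" if "s \<in> S" for s using that S(2) L_M by blast
    have asM: "(\<lambda>s. a s \<odot>\<^bsub>M\<^esub> s) \<in> S \<rightarrow> carrier M" using a(1) sM by (auto simp: Pi_iff)
    have "i.bm (i.X.pure b m) = i.Y.pure b m" unfolding i.bm_pure[OF pure] id_apply by (rule refl)
    also have "\<dots> = (\<Oplus>\<^bsub>i.Y.BC\<^esub>s\<in>S. i.Y.pure b (a s \<odot>\<^bsub>M\<^esub> s))"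
      unfolding a(2) by (rule abelian_group_hom.hom_finsum[OF i.Y.pure_additive_r[OF b] asM])
    finally have "g (i.bm (i.X.pure b m)) = g (\<Oplus>\<^bsub>i.Y.BC\<^esub>s\<in>S. i.Y.pure b (a s \<odot>\<^bsub>M\<^esub> s))"
      by (simp only:)
    also have "\<dots> = (\<Oplus>\<^bsub>G\<^esub>s\<in>S. g (i.Y.pure b (a s \<odot>\<^bsub>M\<^esub> s)))"
      by (rule g.hom_finsum) (use b asM in \<open>auto simp: Pi_iff\<close>)
    also have "\<dots> \<in> T"
    proof (rule finsum_in[OF g.H.abelian_group_axioms T])
      fix s assume s: "s \<in> S"
      have as: "a s \<in> carrier A" using a(1) s by auto
      have "i.Y.pure b (a s \<odot>\<^bsub>M\<^esub> s) = i.Y.pure (b \<otimes>\<^bsub>B\<^esub> \<phi> (a s)) s"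
        by (rule i.Y.pure_smult[OF b as sM[OF s], symmetric])
      then show "g (i.Y.pure b (a s \<odot>\<^bsub>M\<^esub> s)) \<in> T"
        using gen[OF i.X.B.m_closed[OF b i.Y.phi_closed[OF as]] s] by (simp only:)
    qed
    finally show ?case .
  next
    case (diff X Y)
    have "g (i.bm (X \<ominus>\<^bsub>i.X.BC\<^esub> Y)) = g (i.bm X) \<ominus>\<^bsub>G\<^esub> g (i.bm Y)"
      unfolding h.hom_diff[OF diff(1,2)]
      by (rule g.hom_diff[OF h.hom_closed[OF diff(1)] h.hom_closed[OF diff(2)]])
    then show ?case using T(3)[OF diff(3,4)] by (simp only:)
  qed
  then show ?thesis using z unfolding lat_def by blast
qed

text \<open>\<open>expand\<close> applies to L as to any module. Mapped into the pullback of M, the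
  expansion of a preimage gives an expansion of the same element with coefficients in L, and
  coefficients in M are unique.\<close>

lemma lat_ex:
  assumes c: "\<And>\<beta>. \<beta> \<in> indices l n \<Longrightarrow> c \<beta> \<in> carrier M" and z: "ex n c \<in> lat (N2 n) (pr1 p V A n)"
    and \<beta>: "\<beta> \<in> indices l n"
  shows "c \<beta> \<in> L"
proof -
  interpret LD: module_diagonal p V A l x Lm
    by (intro module_diagonal.intro smooth_diagonal_axioms module_Lm)
  interpret i: bc_morphism A "N2 n" "pr1 p V A n" Lm "N2 n" "pr1 p V A n" M id id
    by (rule incl_morphism[OF X1.base_extension_axioms])
  obtain y where y: "y \<in> carrier (LD.E1 n)" "ex n c = i.bm y" using z unfolding lat_def by (elim imageE)
  obtain d where d: "\<And>\<beta>. d \<beta> \<in> carrier Lm" "y = LD.ex n d" using LD.expand[OF y(1)] by blast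
  have dM: "d \<beta> \<in> carrier M" for \<beta> using d(1)[of \<beta>] by (simp add: L_M)
  have "ex n c = (\<Oplus>\<^bsub>E1 n\<^esub>\<beta>\<in>indices l n. i.bm (LD.pure1 n (mon n \<beta>) (d \<beta>)))"
    unfolding y(2) d(2) by (rule LD.ex_hom[OF i.bm_additive d(1)])
  also have "\<dots> = ex n d"
    unfolding ex_def by (rule X1.BC.finsum_cong') (use dM in \<open>auto simp: i.bm_pure[OF mon_closed d(1)]\<close>)
  finally have e: "ex n c = ex n d" .
  have "c \<beta> = d \<beta>" by (rule ex_inj'[OF c dM e \<beta>])
  then show ?thesis using d(1)[of \<beta>] by simp
qed

text \<open>Condition (ii) in the notion of a special stratification, for a single n and a single
  exponent.\<close>

definition bounded :: "nat \<Rightarrow> int \<Rightarrow> bool" where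
  "bounded n k \<longleftrightarrow>
    (\<forall>z\<in>lat (N2 n) (pr2 p V A n). p1_map p V A n M id (P k) (\<epsilon> n z) \<in> lat (N2 n) (pr1 p V A n)) \<and>
    (\<forall>z\<in>lat (N2 n) (pr1 p V A n).
      p2_map p V A n M id (P k) (inv_into (carrier (E2 n)) (\<epsilon> n) z) \<in> lat (N2 n) (pr2 p V A n))"

text \<open>The first half of \<open>bounded\<close> is applied to 1 \<otimes> s, whose image under
  \<epsilon>_n has exactly the coefficients of s.\<close>

lemma bounded_imp:
  assumes "bounded n k" and s: "s \<in> L" and \<beta>: "\<beta> \<in> indices l n"
  shows "P k (coef s \<beta>) \<in> L"
proof -
  interpret m: bc_morphism A "N2 n" "pr1 p V A n" M "N2 n" "pr1 p V A n" M id "P k"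
    by (rule P_morphism[OF X1.base_extension_axioms])
  have sM: "s \<in> carrier M" by (rule L_M[OF s])
  have cM: "coef s \<gamma> \<in> carrier M" if "\<gamma> \<in> indices l n" for \<gamma> by (rule coef_closed[OF sM that])
  have "u2 n s \<in> lat (N2 n) (pr2 p V A n)"
    unfolding u2_def by (rule lat_subgroup(4)[OF X2.base_extension_axioms _ s]) simp
  then have z: "m.bm (\<epsilon> n (u2 n s)) \<in> lat (N2 n) (pr1 p V A n)"
    using assms(1) unfolding bounded_def p1_map_def by blast
  have "m.bm (ex n (coef s)) = (\<Oplus>\<^bsub>E1 n\<^esub>\<gamma>\<in>indices l n. m.bm (pure1 n (mon n \<gamma>) (coef s \<gamma>)))"
    by (rule ex_hom[OF m.bm_additive cM])
  also have "\<dots> = ex n (\<lambda>\<gamma>. P k (coef s \<gamma>))"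
    unfolding ex_def by (rule X1.BC.finsum_cong') (use cM in \<open>auto simp: m.bm_pure\<close>)
  finally have "ex n (\<lambda>\<gamma>. P k (coef s \<gamma>)) \<in> lat (N2 n) (pr1 p V A n)"
    using z unfolding eps_u2[OF sM] by (simp only:)
  from lat_ex[OF _ this \<beta>] show ?thesis using cM by simp
qed

text \<open>The expansions of \<epsilon>_n and of its inverse have the same coefficients and differ
  only in the signs of the variables, so one condition on the generators gives both halves.\<close>

lemma boundedI:
  assumes P: "\<And>s \<beta>. s \<in> S \<Longrightarrow> \<beta> \<in> indices l n \<Longrightarrow> P k (coef s \<beta>) \<in> L"
  shows "bounded n k"
proof -
  interpret m1: bc_morphism A "N2 n" "pr1 p V A n" M "N2 n" "pr1 p V A n" M id "P k"
    by (rule P_morphism[OF X1.base_extension_axioms])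
  interpret m2: bc_morphism A "N2 n" "pr2 p V A n" M "N2 n" "pr2 p V A n" M id "P k"
    by (rule P_morphism[OF X2.base_extension_axioms])
  note L1 = lat_subgroup[OF X1.base_extension_axioms] and L2 = lat_subgroup[OF X2.base_extension_axioms]
  have sM: "s \<in> carrier M" if "s \<in> S" for s using that S(2) L_M by blast
  have cM: "coef s \<gamma> \<in> carrier M" if "s \<in> S" "\<gamma> \<in> indices l n" for s \<gamma>
    by (rule coef_closed[OF sM[OF that(1)] that(2)])
  let ?i = "inv_into (carrier (E2 n)) (\<epsilon> n)"
  have inv: "abelian_group_hom (E1 n) (E2 n) ?i"
  proof (rule abelian_group_homI'[OF X1.abelian_group_BC X2.abelian_group_BC])
    have im: "\<epsilon> n ` carrier (E2 n) = carrier (E1 n)" using eps_bij[of n] by (simp add: bij_betw_def)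
    show cl: "?i z \<in> carrier (E2 n)" if "z \<in> carrier (E1 n)" for z
      using that unfolding im[symmetric] by (rule inv_into_into)
    fix z y assume z: "z \<in> carrier (E1 n)" "y \<in> carrier (E1 n)"
    have r: "\<epsilon> n (?i z) = z" if "z \<in> carrier (E1 n)" for z
      using that unfolding im[symmetric] by (rule f_inv_into_f)
    have "\<epsilon> n (?i z \<oplus>\<^bsub>E2 n\<^esub> ?i y) = z \<oplus>\<^bsub>E1 n\<^esub> y"
      using abelian_group_hom.hom_add[OF eps_additive cl[OF z(1)] cl[OF z(2)]] r[OF z(1)] r[OF z(2)] by (simp only:)
    then show "?i (z \<oplus>\<^bsub>E1 n\<^esub> y) = ?i z \<oplus>\<^bsub>E2 n\<^esub> ?i y"
      using inv_into_f_eq[OF bij_betw_imp_inj_on[OF eps_bij] X2.BC.a_closed[OF cl[OF z(1)] cl[OF z(2)]]] by blast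
  qed
  have "p1_map p V A n M id (P k) (\<epsilon> n z) \<in> lat (N2 n) (pr1 p V A n)" if z: "z \<in> lat (N2 n) (pr2 p V A n)" for z
    unfolding p1_map_def
  proof (rule lat_generated[OF X2.base_extension_axioms _ _ L1(2,3) _ z, where g = "\<lambda>z. m1.bm (\<epsilon> n z)"])
    show "abelian_group_hom (E2 n) (E1 n) (\<lambda>z. m1.bm (\<epsilon> n z))"
      by (rule abelian_group_hom_comp[OF eps_additive m1.bm_additive])
    show "lat (N2 n) (pr1 p V A n) \<subseteq> carrier (E1 n)" using L1(1) by blast
    fix b s assume b: "b \<in> carrier (N2 n)" and s: "s \<in> S"
    have "m1.bm (\<epsilon> n (pure2 n b s)) =
        (\<Oplus>\<^bsub>E1 n\<^esub>\<gamma>\<in>indices l n. m1.bm (pure1 n (b \<otimes>\<^bsub>N2 n\<^esub> mon n \<gamma>) (coef s \<gamma>)))"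
      unfolding eps_pure2[OF b sM[OF s]]
      by (rule abelian_group_hom.hom_finsum[OF m1.bm_additive]) (use b cM[OF s] in auto)
    also have "\<dots> \<in> lat (N2 n) (pr1 p V A n)"
    proof (rule finsum_in[OF X1.abelian_group_BC _ L1(2,3)])
      show "lat (N2 n) (pr1 p V A n) \<subseteq> carrier (E1 n)" using L1(1) by blast
      fix \<gamma> assume g: "\<gamma> \<in> indices l n"
      have "m1.bm (pure1 n (b \<otimes>\<^bsub>N2 n\<^esub> mon n \<gamma>) (coef s \<gamma>)) = pure1 n (b \<otimes>\<^bsub>N2 n\<^esub> mon n \<gamma>) (P k (coef s \<gamma>))"
        using m1.bm_pure[of "b \<otimes>\<^bsub>N2 n\<^esub> mon n \<gamma>" "coef s \<gamma>"] b cM[OF s g] by simp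
      then show "m1.bm (pure1 n (b \<otimes>\<^bsub>N2 n\<^esub> mon n \<gamma>) (coef s \<gamma>)) \<in> lat (N2 n) (pr1 p V A n)"
        using L1(4)[where b = "b \<otimes>\<^bsub>N2 n\<^esub> mon n \<gamma>", OF _ P[OF s g]] b by simp
    qed
    finally show "m1.bm (\<epsilon> n (pure2 n b s)) \<in> lat (N2 n) (pr1 p V A n)" .
  qed
  moreover have "p2_map p V A n M id (P k) (?i z) \<in> lat (N2 n) (pr2 p V A n)" if z: "z \<in> lat (N2 n) (pr1 p V A n)" for z
    unfolding p2_map_def
  proof (rule lat_generated[OF X1.base_extension_axioms _ _ L2(2,3) _ z, where g = "\<lambda>z. m2.bm (?i z)"])
    show "abelian_group_hom (E1 n) (E2 n) (\<lambda>z. m2.bm (?i z))"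
      by (rule abelian_group_hom_comp[OF inv m2.bm_additive])
    show "lat (N2 n) (pr2 p V A n) \<subseteq> carrier (E2 n)" using L2(1) by blast
    fix b s assume b: "b \<in> carrier (N2 n)" and s: "s \<in> S"
    have "m2.bm (?i (pure1 n b s)) =
        (\<Oplus>\<^bsub>E2 n\<^esub>\<gamma>\<in>indices l n. m2.bm (pure2 n (b \<otimes>\<^bsub>N2 n\<^esub> nmon n \<gamma>) (coef s \<gamma>)))"
      unfolding eps_inverse[OF b sM[OF s]]
      by (rule abelian_group_hom.hom_finsum[OF m2.bm_additive]) (use b cM[OF s] in auto)
    also have "\<dots> \<in> lat (N2 n) (pr2 p V A n)"
    proof (rule finsum_in[OF X2.abelian_group_BC _ L2(2,3)])
      show "lat (N2 n) (pr2 p V A n) \<subseteq> carrier (E2 n)" using L2(1) by blast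
      fix \<gamma> assume g: "\<gamma> \<in> indices l n"
      have "m2.bm (pure2 n (b \<otimes>\<^bsub>N2 n\<^esub> nmon n \<gamma>) (coef s \<gamma>)) = pure2 n (b \<otimes>\<^bsub>N2 n\<^esub> nmon n \<gamma>) (P k (coef s \<gamma>))"
        using m2.bm_pure[of "b \<otimes>\<^bsub>N2 n\<^esub> nmon n \<gamma>" "coef s \<gamma>"] b cM[OF s g] by simp
      then show "m2.bm (pure2 n (b \<otimes>\<^bsub>N2 n\<^esub> nmon n \<gamma>) (coef s \<gamma>)) \<in> lat (N2 n) (pr2 p V A n)"
        using L2(4)[where b = "b \<otimes>\<^bsub>N2 n\<^esub> nmon n \<gamma>", OF _ P[OF s g]] b by simp
    qed
    finally show "m2.bm (?i (pure1 n b s)) \<in> lat (N2 n) (pr2 p V A n)" .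
  qed
  ultimately show ?thesis by (auto simp: bounded_def)
qed

text \<open>Boundedness speaks about sections in L only, so an arbitrary section is first multiplied
  by a power of p. The identity follows from additivity of \<epsilon>_n and uniqueness of
  coefficients.\<close>

lemma coef_add_pow:
  assumes s: "s \<in> carrier M" and \<beta>: "\<beta> \<in> multi_indices l"
  shows "coef (add_pow M k s) \<beta> = add_pow M (k::nat) (coef s \<beta>)"
proof -
  have cM: "coef s \<gamma> \<in> carrier M" if "\<gamma> \<in> indices l n" for \<gamma> n by (rule coef_closed[OF s that])
  have ks: "add_pow M k s \<in> carrier M" using s by simp
  define d where "d = restrict (\<lambda>\<beta>. add_pow M k (coef s \<beta>)) (multi_indices l)"
  have "\<epsilon> n (u2 n (add_pow M k s)) = ex n d" for n
  proof -
    have pw: "abelian_group_hom (E1 n) (E1 n) (add_pow (E1 n) k)"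
      by (rule abelian_group_homI'[OF X1.abelian_group_BC X1.abelian_group_BC])
         (simp_all add: X1.BC.add.nat_pow_closed X1.BC.add.nat_pow_distrib)
    have "u2 n (add_pow M k s) = add_pow (E2 n) k (u2 n s)"
      unfolding u2_def by (rule abelian_group_hom.hom_add_pow[OF X2.pure_additive_r s]) simp
    then have "\<epsilon> n (u2 n (add_pow M k s)) = add_pow (E1 n) k (\<epsilon> n (u2 n s))"
      using abelian_group_hom.hom_add_pow[OF eps_additive u2_closed[OF s], of n k] by simp
    also have "\<dots> = (\<Oplus>\<^bsub>E1 n\<^esub>\<gamma>\<in>indices l n. add_pow (E1 n) k (pure1 n (mon n \<gamma>) (coef s \<gamma>)))"
      unfolding eps_u2[OF s] by (rule ex_hom[OF pw cM])
    also have "\<dots> = ex n d"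
      unfolding ex_def
    proof (rule X1.BC.finsum_cong'[OF refl])
      fix \<gamma> assume g: "\<gamma> \<in> indices l n"
      have "add_pow (E1 n) k (pure1 n (mon n \<gamma>) (coef s \<gamma>)) = pure1 n (mon n \<gamma>) (add_pow M k (coef s \<gamma>))"
        by (rule abelian_group_hom.hom_add_pow[OF X1.pure_additive_r cM[OF g], symmetric]) simp
      then show "add_pow (E1 n) k (pure1 n (mon n \<gamma>) (coef s \<gamma>)) = pure1 n (mon n \<gamma>) (d \<gamma>)"
        using indices_multi[OF g] by (simp add: d_def)
    qed (use cM indices_multi in \<open>auto simp: d_def\<close>)
    finally show ?thesis .
  qed
  moreover have "d \<in> multi_indices l \<rightarrow>\<^sub>E carrier M"
    using is_coef[OF s] by (auto simp: d_def is_coef_def PiE_iff)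
  ultimately have "is_coef (add_pow M k s) d" by (simp add: is_coef_def)
  then have "coef (add_pow M k s) = d" by (rule coef_unique[OF is_coef[OF ks]])
  then show ?thesis using \<beta> by (simp add: d_def)
qed

end

section \<open>Special stratifications and the radius of convergence\<close>

text \<open>The exponent is eventually below c n for every c > 0. With p^c the inverse square root
  of \<eta>, one square root of \<eta>^n cancels the growth and the other forces
  convergence.\<close>

lemma powr_sublinear_tendsto:
  fixes k :: "nat \<Rightarrow> int" and p :: real
  assumes p: "1 < p" and k: "(\<lambda>n. real_of_int (k n)) \<in> o(\<lambda>n. real n)" and \<eta>: "0 \<le> \<eta>" "\<eta> < 1"
  shows "(\<lambda>n. p powr real_of_int (k n + j) * \<eta> ^ n) \<longlonglongrightarrow> 0"
\<comment> \<open>The comparison constant involves 1 / sqrt \<eta>, so \<eta> = 0 is treated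
  apart.\<close>
proof (cases "\<eta> = 0")
  case True
  have "eventually (\<lambda>n. p powr real_of_int (k n + j) * \<eta> ^ n = 0) sequentially"
    using eventually_gt_at_top[of 0] by eventually_elim (simp add: True)
  then show ?thesis by (rule tendsto_eventually)
next
  case False
  define c where "c = log p (1 / sqrt \<eta>)"
  have sq: "0 < sqrt \<eta>" "sqrt \<eta> < 1" using \<eta> False by auto
  have c: "c > 0" "p powr c = 1 / sqrt \<eta>" using sq p by (simp_all add: c_def)
  have "eventually (\<lambda>n. norm (real_of_int (k n)) \<le> c * norm (real n)) sequentially"
    by (rule landau_o.smallD[OF k c(1)])
  then have "eventually (\<lambda>n. p powr real_of_int (k n + j) * \<eta> ^ n \<le> p powr j * sqrt \<eta> ^ n) sequentially"
  proof eventually_elim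
    case (elim n)
    have "p powr real_of_int (k n) \<le> p powr (c * real n)" using elim p by (intro powr_mono) auto
    also have "\<dots> = (1 / sqrt \<eta>) ^ n" using c(2) sq by (simp add: powr_powr[symmetric] powr_realpow)
    finally have "p powr real_of_int (k n) * \<eta> ^ n \<le> (1 / sqrt \<eta>) ^ n * \<eta> ^ n"
      using \<eta> by (intro mult_right_mono) auto
    also have "\<dots> = sqrt \<eta> ^ n"
      using \<eta>(1) by (simp add: power_mult_distrib[symmetric] real_div_sqrt)
    finally have "p powr j * (p powr real_of_int (k n) * \<eta> ^ n) \<le> p powr j * sqrt \<eta> ^ n"
      by (intro mult_left_mono) auto
    then show ?case by (simp add: powr_add mult_ac)
  qed
  moreover have "(\<lambda>n. p powr j * sqrt \<eta> ^ n) \<longlonglongrightarrow> 0"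
    using sq by (intro tendsto_mult_right_zero LIMSEQ_realpow_zero) auto
  ultimately show ?thesis
    by (rule tendsto_sandwich[OF _ _ tendsto_const, rotated]) (use \<eta> in simp)
qed

text \<open>The analytic part without geometry: C are the sections, I the multi-indices, S
  generators of the lattice L, and P j is multiplication by p^j. Of the stratification only
  \<open>bounded_imp\<close> and \<open>boundedI\<close> remain.\<close>

locale coef_growth =
  fixes C L S :: "'e set" and I :: "'i set" and deg :: "'i \<Rightarrow> nat" and coef :: "'e \<Rightarrow> 'i \<Rightarrow> 'e"
    and P :: "int \<Rightarrow> 'e \<Rightarrow> 'e" and bounded :: "nat \<Rightarrow> int \<Rightarrow> bool" and nm :: "'e \<Rightarrow> real" and p :: real
  assumes C: "C \<noteq> {}" and S: "finite S" "S \<subseteq> C" and finite_deg: "\<And>n. finite {\<beta>\<in>I. deg \<beta> \<le> n}"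
    and coef_closed: "\<And>s \<beta>. s \<in> C \<Longrightarrow> \<beta> \<in> I \<Longrightarrow> coef s \<beta> \<in> C"
    and P_P: "\<And>i j m. m \<in> C \<Longrightarrow> P i (P j m) = P (i + j) m"
    and P_L: "\<And>j m. 0 \<le> j \<Longrightarrow> m \<in> L \<Longrightarrow> P j m \<in> L"
    and absorb: "\<And>m. m \<in> C \<Longrightarrow> \<exists>j\<ge>0. P j m \<in> L"
    and coef_P: "\<And>j s \<beta>. 0 \<le> j \<Longrightarrow> s \<in> C \<Longrightarrow> \<beta> \<in> I \<Longrightarrow> coef (P j s) \<beta> = P j (coef s \<beta>)"
    and bounded_imp: "\<And>n k s \<beta>. bounded n k \<Longrightarrow> s \<in> L \<Longrightarrow> \<beta> \<in> I \<Longrightarrow> deg \<beta> \<le> n \<Longrightarrow> P k (coef s \<beta>) \<in> L"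
    and boundedI: "\<And>n k. (\<And>s \<beta>. s \<in> S \<Longrightarrow> \<beta> \<in> I \<Longrightarrow> deg \<beta> \<le> n \<Longrightarrow> P k (coef s \<beta>) \<in> L) \<Longrightarrow> bounded n k"
    and nm_nonneg: "\<And>m. m \<in> C \<Longrightarrow> 0 \<le> nm m"
    and nm_le: "\<And>m j. m \<in> C \<Longrightarrow> P j m \<in> L \<Longrightarrow> nm m \<le> p powr real_of_int j"
    and nm_less_imp: "\<And>m j. m \<in> C \<Longrightarrow> nm m < p powr real_of_int j \<Longrightarrow> P j m \<in> L"
    and p_gt_1: "1 < p"
begin

definition conv :: "real \<Rightarrow> 'e \<Rightarrow> bool" where
  "conv \<eta> s \<longleftrightarrow> (\<forall>\<delta>>0. \<exists>N. \<forall>\<beta>\<in>I. deg \<beta> \<ge> N \<longrightarrow> nm (coef s \<beta>) * \<eta> ^ deg \<beta> < \<delta>)"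

definition radius :: "'e \<Rightarrow> real" where
  "radius s = Sup {\<eta>. 0 \<le> \<eta> \<and> \<eta> < 1 \<and> conv \<eta> s}"

text \<open>If p^j s lies in L, then the norm of the coefficient at \<beta> is at most p to the
  power k(n) + j, with n the degree of \<beta> itself. The constant j does not harm
  convergence.\<close>

lemma bounded_conv:
  assumes k: "(\<lambda>n. real_of_int (k n)) \<in> o(\<lambda>n. real n)" and b: "\<And>n. bounded n (k n)"
    and s: "s \<in> C" and \<eta>: "0 \<le> \<eta>" "\<eta> < 1"
  shows "conv \<eta> s"
  unfolding conv_def
proof (intro allI impI)
  fix \<delta> :: real assume d: "\<delta> > 0"
  obtain j where j: "j \<ge> 0" "P j s \<in> L" using absorb[OF s] by blast
  have le: "nm (coef s \<beta>) \<le> p powr real_of_int (k (deg \<beta>) + j)" if \<beta>: "\<beta> \<in> I" for \<beta>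
  proof -
    have c: "coef s \<beta> \<in> C" by (rule coef_closed[OF s \<beta>])
    have "P j (coef s \<beta>) = coef (P j s) \<beta>"
      by (rule coef_P[OF j(1) s \<beta>, symmetric])
    then have "P (k (deg \<beta>)) (P j (coef s \<beta>)) \<in> L"
      using bounded_imp[OF b j(2) \<beta> order_refl] by simp
    then show ?thesis using c by (intro nm_le) (simp_all add: P_P)
  qed
  have "(\<lambda>n. p powr real_of_int (k n + j) * \<eta> ^ n) \<longlonglongrightarrow> 0"
    using p_gt_1 by (intro powr_sublinear_tendsto k \<eta>) simp
  then have "eventually (\<lambda>n. p powr real_of_int (k n + j) * \<eta> ^ n < \<delta>) sequentially"
    by (rule order_tendstoD(2)) (rule d)
  then obtain N where N: "\<And>n. n \<ge> N \<Longrightarrow> p powr real_of_int (k n + j) * \<eta> ^ n < \<delta>"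
    unfolding eventually_sequentially by blast
  show "\<exists>N. \<forall>\<beta>\<in>I. deg \<beta> \<ge> N \<longrightarrow> nm (coef s \<beta>) * \<eta> ^ deg \<beta> < \<delta>"
  proof (intro exI ballI impI)
    fix \<beta> assume \<beta>: "\<beta> \<in> I" "N \<le> deg \<beta>"
    have "nm (coef s \<beta>) * \<eta> ^ deg \<beta> \<le> p powr real_of_int (k (deg \<beta>) + j) * \<eta> ^ deg \<beta>"
      by (rule mult_right_mono[OF le[OF \<beta>(1)]]) (use \<eta> in simp)
    also have "\<dots> < \<delta>" by (rule N[OF \<beta>(2)])
    finally show "nm (coef s \<beta>) * \<eta> ^ deg \<beta> < \<delta>" .
  qed
qed

text \<open>In degree 0 the factor is 0^0 = 1, so the estimate starts at N = 1.\<close>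

lemma conv_0: "conv 0 s"
  unfolding conv_def by (intro allI impI exI[of _ 1] ballI) (simp add: power_0_left)

lemma conv_mono:
  assumes "conv \<eta>' s" and \<eta>: "0 \<le> \<eta>" "\<eta> \<le> \<eta>'" and s: "s \<in> C"
  shows "conv \<eta> s"
  unfolding conv_def
proof (intro allI impI)
  fix \<delta> :: real assume "\<delta> > 0"
  then obtain N where N: "\<And>\<beta>. \<beta> \<in> I \<Longrightarrow> deg \<beta> \<ge> N \<Longrightarrow> nm (coef s \<beta>) * \<eta>' ^ deg \<beta> < \<delta>"
    using assms(1) unfolding conv_def by blast
  show "\<exists>N. \<forall>\<beta>\<in>I. deg \<beta> \<ge> N \<longrightarrow> nm (coef s \<beta>) * \<eta> ^ deg \<beta> < \<delta>"
  proof (intro exI ballI impI)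
    fix \<beta> assume \<beta>: "\<beta> \<in> I" "N \<le> deg \<beta>"
    have "nm (coef s \<beta>) * \<eta> ^ deg \<beta> \<le> nm (coef s \<beta>) * \<eta>' ^ deg \<beta>"
      using \<eta> nm_nonneg[OF coef_closed[OF s \<beta>(1)]] by (intro mult_left_mono power_mono)
    then show "nm (coef s \<beta>) * \<eta> ^ deg \<beta> < \<delta>" using N[OF \<beta>] by (rule le_less_trans)
  qed
qed

lemma radius_le: "radius s \<le> 1"
  unfolding radius_def using conv_0[of s] by (intro cSup_least) (auto intro: exI[of _ 0])

lemma radius_nonneg: "0 \<le> radius s"
  unfolding radius_def using conv_0[of s] by (intro cSup_upper bdd_aboveI[of _ 1]) auto

text \<open>The supremum exceeds \<eta>, so some admissible radius is larger, and convergence passes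
  to smaller radii.\<close>

lemma conv_of_radius:
  assumes "radius s = 1" "s \<in> C" "0 \<le> \<eta>" "\<eta> < 1"
  shows "conv \<eta> s"
proof -
  have ne: "{\<eta>. 0 \<le> \<eta> \<and> \<eta> < 1 \<and> conv \<eta> s} \<noteq> {}" using conv_0[of s] by (auto intro: exI[of _ 0])
  have "bdd_above {\<eta>. 0 \<le> \<eta> \<and> \<eta> < 1 \<and> conv \<eta> s}" by (rule bdd_aboveI[of _ 1]) auto
  then obtain \<eta>' where "\<eta> < \<eta>'" "conv \<eta>' s"
    using assms(1,4) less_cSup_iff[OF ne, of \<eta>] by (auto simp: radius_def)
  then show ?thesis using assms by (intro conv_mono[of \<eta>' s \<eta>]) auto
qed

text \<open>Claimed for all large exponents, so that finitely many elements share a bound and the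
  bound may be enlarged later.\<close>

lemma absorb_finite:
  assumes "finite F" "F \<subseteq> C"
  shows "\<exists>j :: nat. \<forall>i\<ge>j. \<forall>m\<in>F. P (int i) m \<in> L"
  using assms
proof (induction F)
  case (insert m F)
  obtain j :: nat where j: "\<forall>i\<ge>j. \<forall>m\<in>F. P (int i) m \<in> L" using insert by auto
  have m: "m \<in> C" using insert by simp
  obtain j' where j': "j' \<ge> 0" "P j' m \<in> L" using absorb[OF m] by blast
  have "P (int i) m \<in> L" if "i \<ge> nat j'" for i
    using P_L[of "int i - j'" "P j' m"] j' that m by (simp add: P_P)
  then show ?case using j by (intro exI[of _ "max j (nat j')"]) auto
qed auto

text \<open>k n is the least natural exponent that suits all generators and all degrees up to n. Low
  degrees cost a constant exponent, high degrees about d n, and d > 0 is arbitrary.\<close>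

lemma conv_bounded:
  assumes conv: "\<And>s \<eta>. s \<in> C \<Longrightarrow> 0 \<le> \<eta> \<Longrightarrow> \<eta> < 1 \<Longrightarrow> conv \<eta> s"
  shows "\<exists>k :: nat \<Rightarrow> int. (\<lambda>n. real_of_int (k n)) \<in> o(\<lambda>n. real n) \<and> (\<forall>n. bounded n (k n))"
proof -
  have SM: "s \<in> C" if "s \<in> S" for s using that S(2) by blast
  define Q where "Q n j \<longleftrightarrow> (\<forall>s\<in>S. \<forall>\<beta>\<in>{\<beta>\<in>I. deg \<beta> \<le> n}. P (int j) (coef s \<beta>) \<in> L)" for n j :: nat
  define k where "k n = (LEAST j. Q n j)" for n
  have ex: "\<exists>j. \<forall>i\<ge>j. Q n i" for n
  proof -
    have "finite ((\<lambda>(s, \<beta>). coef s \<beta>) ` (S \<times> {\<beta>\<in>I. deg \<beta> \<le> n}))" using S(1) finite_deg by blast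
    moreover have "(\<lambda>(s, \<beta>). coef s \<beta>) ` (S \<times> {\<beta>\<in>I. deg \<beta> \<le> n}) \<subseteq> C" using SM coef_closed by auto
    ultimately have "\<exists>j :: nat. \<forall>i\<ge>j. \<forall>m\<in>(\<lambda>(s, \<beta>). coef s \<beta>) ` (S \<times> {\<beta>\<in>I. deg \<beta> \<le> n}). P (int i) m \<in> L"
      by (rule absorb_finite)
    then show ?thesis by (auto simp: Q_def)
  qed
  have Qk: "Q n (k n)" for n unfolding k_def using ex[of n] by (metis LeastI order_refl)
  have "bounded n (int (k n))" for n
    by (rule boundedI) (use Qk[of n] in \<open>auto simp: Q_def\<close>)
  moreover have "(\<lambda>n. real_of_int (int (k n))) \<in> o(\<lambda>n. real n)"
  proof (rule landau_o.smallI)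
    fix c :: real assume c: "c > 0"
    \<comment> \<open>Half of c; the other half absorbs the error of rounding d n up to an
      integer.\<close>
    define d where "d = c / 2"
    have d: "d > 0" using c by (simp add: d_def)
    have \<eta>: "0 \<le> p powr (- d)" "p powr (- d) < 1" using d p_gt_1 by (auto intro!: powr_less_one)
    \<comment> \<open>The threshold 1 suffices: it bounds the norm by p to the power d times the
      degree.\<close>
    have "\<forall>s\<in>S. \<exists>N. \<forall>\<beta>\<in>I. deg \<beta> \<ge> N \<longrightarrow> nm (coef s \<beta>) * (p powr (- d)) ^ deg \<beta> < 1"
      using conv[OF SM \<eta>] unfolding conv_def by (auto dest: spec[of _ 1])
    then obtain N where N: "\<And>s \<beta>. s \<in> S \<Longrightarrow> \<beta> \<in> I \<Longrightarrow> deg \<beta> \<ge> N s \<Longrightarrow>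
        nm (coef s \<beta>) * (p powr (- d)) ^ deg \<beta> < 1" by metis
    \<comment> \<open>The sum over the finite set S bounds every \<open>N s\<close>.\<close>
    define N' where "N' = sum N S"
    obtain J where J: "\<And>i. i \<ge> J \<Longrightarrow> Q N' i" using ex[of N'] by blast
    have "k n \<le> max J (nat \<lceil>d * n\<rceil>)" for n
      unfolding k_def
    proof (rule Least_le, unfold Q_def, intro ballI)
      fix s \<beta> assume s: "s \<in> S" and \<beta>: "\<beta> \<in> {\<beta>\<in>I. deg \<beta> \<le> n}"
      have bm: "\<beta> \<in> I" "deg \<beta> \<le> n" using \<beta> by auto
      have cM: "coef s \<beta> \<in> C" by (rule coef_closed[OF SM[OF s] bm(1)])
      let ?j = "max J (nat \<lceil>d * n\<rceil>)"
      show "P (int ?j) (coef s \<beta>) \<in> L"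
      proof (cases "deg \<beta> \<le> N'")
        case True
        then have "\<beta> \<in> {\<beta>\<in>I. deg \<beta> \<le> N'}" using bm by simp
        then show ?thesis using J[of ?j] s by (simp add: Q_def)
      next
        case False
        have "N s \<le> N'" unfolding N'_def using S(1) s by (intro member_le_sum) auto
        then have lt: "nm (coef s \<beta>) * (p powr (- d)) ^ deg \<beta> < 1" using False by (intro N s bm) simp
        have pw: "(p powr (- d)) ^ deg \<beta> = inverse (p powr (d * deg \<beta>))"
          using p_gt_1 by (simp add: powr_minus powr_powr powr_realpow[symmetric] power_inverse)
        have "nm (coef s \<beta>) < p powr (d * deg \<beta>)"
          using lt p_gt_1 unfolding pw by (simp add: field_simps)
        also have "\<dots> \<le> p powr real_of_int (int ?j)"
        proof (rule powr_mono)
          have "d * deg \<beta> \<le> d * n" using d bm by simp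
          also have "\<dots> \<le> real (nat \<lceil>d * n\<rceil>)" by linarith
          also have "\<dots> \<le> real_of_int (int ?j)" by simp
          finally show "d * deg \<beta> \<le> real_of_int (int ?j)" .
        qed (use p_gt_1 in simp)
        finally show ?thesis by (rule nm_less_imp[OF cM])
      qed
    qed
    then have kb: "real (k n) \<le> max J (nat \<lceil>d * n\<rceil>)" for n by (simp only: of_nat_le_iff)
    \<comment> \<open>From this n on, d n is at least J + 1, so the maximum is at most d n + 1,
      which is at most 2 d n = c n.\<close>
    have "eventually (\<lambda>n. real n \<ge> (real J + 1) / d) sequentially"
      by (rule filterlim_real_sequentially[unfolded filterlim_at_top, rule_format])
    then show "eventually (\<lambda>n. norm (real_of_int (int (k n))) \<le> c * norm (real n)) sequentially"
    proof eventually_elim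
      case (elim n)
      have e: "real J + 1 \<le> d * n" using elim d by (simp add: field_simps)
      have "real (max J (nat \<lceil>d * n\<rceil>)) \<le> d * n + 1"
        using e d by (auto simp: max_def)
      also have "\<dots> \<le> c * n" using e unfolding d_def by simp
      finally show ?case using kb[of n] by simp
    qed
  qed
  ultimately show ?thesis by (intro exI[of _ "\<lambda>n. int (k n)"]) blast
qed

text \<open>No radius exceeds 1, so an infimum equal to 1 forces every radius to be 1, and hence
  convergence of every section at every \<eta> < 1.\<close>

theorem bounded_iff_radius:
  "(\<exists>k :: nat \<Rightarrow> int. (\<lambda>n. real_of_int (k n)) \<in> o(\<lambda>n. real n) \<and> (\<forall>n. bounded n (k n))) \<longleftrightarrow>
    Inf (radius ` C) = 1"
proof
  assume "\<exists>k :: nat \<Rightarrow> int. (\<lambda>n. real_of_int (k n)) \<in> o(\<lambda>n. real n) \<and> (\<forall>n. bounded n (k n))"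
  then obtain k :: "nat \<Rightarrow> int" where k: "(\<lambda>n. real_of_int (k n)) \<in> o(\<lambda>n. real n)" "\<And>n. bounded n (k n)"
    by blast
  have "radius s = 1" if s: "s \<in> C" for s
  proof -
    have "{\<eta>. 0 \<le> \<eta> \<and> \<eta> < 1 \<and> conv \<eta> s} = {0..<1}" using bounded_conv[OF k s] by auto
    then show ?thesis by (simp add: radius_def)
  qed
  then have "radius ` C = {1}" using C by auto
  then show "Inf (radius ` C) = 1" by simp
next
  assume I: "Inf (radius ` C) = 1"
  have "radius s = 1" if s: "s \<in> C" for s
  proof (rule antisym[OF radius_le])
    have "bdd_below (radius ` C)" by (rule bdd_belowI[of _ 0]) (auto simp: radius_nonneg)
    then show "1 \<le> radius s" using cInf_lower[of "radius s" "radius ` C"] s I by auto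
  qed
  then show "\<exists>k :: nat \<Rightarrow> int. (\<lambda>n. real_of_int (k n)) \<in> o(\<lambda>n. real n) \<and> (\<forall>n. bounded n (k n))"
    by (intro conv_bounded conv_of_radius)
qed

end

theorem proposition6p8:
  fixes p :: nat
    and V :: "'v ring"
    and K :: "('v, 'k) module"
    and A :: "('v, 'a) module"
    and l :: nat
    and x :: "nat \<Rightarrow> 'a"
    and E :: "(('k, 'a) iso_ring, 'e) module"
    and \<epsilon> :: "nat \<Rightarrow> ('a, 'e) pull2 \<Rightarrow> ('a, 'e) pull2"
    and L :: "'e set"
  assumes "complete_mixed_dvr p V"
    and "fraction_field V K"
    and "affine_formal_scheme p V A"
    and "formally_smooth p V A"
    and "differential_basis p V A l x"
    and "stratification p V K A E \<epsilon>"
    and "is_lattice V K A E L"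
  shows "special p V K A E L \<epsilon> \<longleftrightarrow> radius_of_convergence p V K A l x E L \<epsilon> = 1"
proof -
  have alg_A: "algebra V A" and complete: "adically_complete A (p_ideal p A)"
    using assms(3) by (simp_all add: affine_formal_scheme_def)
  let ?M = "over_A V K A E"
  note st = assms(6)[unfolded stratification_def Let_def]
  interpret D: mixed_dvr p V K
    by (rule mixed_dvr.intro[OF assms(1,2)])
  have K_A: "alg_pair V K A"
    by (intro alg_pair.intro D.VK.algebra_axioms alg_A)
  have "module (AK V K A) E" using st by (simp only: isocoherent_def)
  then interpret N: iso_lattice p V K A E L
    by (intro iso_lattice.intro iso_module.intro iso_lattice_axioms.intro D.mixed_dvr_axioms K_A assms(7))
  have smooth: "smooth_diagonal p V A l x"
    by (intro smooth_diagonal.intro affine_diagonal.intro affine_diagonal_axioms.intro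
        smooth_diagonal_axioms.intro alg_A complete assms(5))
  have strat: "strat_diagonal p V A l x ?M \<epsilon>"
  proof (intro strat_diagonal.intro strat_diagonal_axioms.intro module_diagonal.intro smooth N.module_M)
    show "m = \<zero>\<^bsub>?M\<^esub>" if "0 < (k::nat)" "m \<in> carrier ?M" "add_pow ?M k m = \<zero>\<^bsub>?M\<^esub>" for k m
      by (rule N.torsion_free[OF that])
  qed (use st in \<open>simp_all only: p1_pull_def p2_pull_def\<close>)
  obtain S where S: "finite S" "S \<subseteq> L"
    and span: "\<And>m. m \<in> L \<Longrightarrow> \<exists>a\<in>S \<rightarrow> carrier A. m = (\<Oplus>\<^bsub>?M\<^esub>s\<in>S. a s \<odot>\<^bsub>?M\<^esub> s)"
    using N.lattice_generators by blast
  \<comment> \<open>Here P j becomes the action of the scalar p^j of K on E, and S a finite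
    generating set of L.\<close>
  interpret Y: lattice_strat p V A l x ?M \<epsilon> L S N.P
    by (intro lattice_strat.intro lattice_strat_axioms.intro strat N.submodule_L S span N.scale_additive
        D.pw_closed N.scale_smult N.P_P N.P_nat N.P_L N.absorb)
  have lat: "Y.lat (nb2 p V A n) (pr1 p V A n) = p1_lattice p V K A E L n"
    "Y.lat (nb2 p V A n) (pr2 p V A n) = p2_lattice p V K A E L n" for n
    by (simp_all only: Y.lat_def p1_lattice_def p2_lattice_def p1_map_def p2_map_def p1_pull_def p2_pull_def
        lattice_mod_def)
  have bounded: "Y.bounded n k \<longleftrightarrow>
      (\<forall>z\<in>p2_lattice p V K A E L n. p1_map p V A n ?M id (N.P k) (\<epsilon> n z) \<in> p1_lattice p V K A E L n) \<and>
      (\<forall>z\<in>p1_lattice p V K A E L n.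
        p2_map p V A n ?M id (N.P k) (inv_into (carrier (p2_pull p V A n ?M)) (\<epsilon> n) z) \<in> p2_lattice p V K A E L n)"
    for n k
    by (simp only: Y.bounded_def lat p2_pull_def)
  have special: "special p V K A E L \<epsilon> \<longleftrightarrow>
      (\<exists>k :: nat \<Rightarrow> int. (\<lambda>n. real_of_int (k n)) \<in> o(\<lambda>n. real n) \<and> (\<forall>n. Y.bounded n (k n)))"
    by (simp only: special_def Let_def bounded) (simp only: D.pw_def)
  \<comment> \<open>\<open>theta\<close> is a definite description; it agrees with
    \<open>Y.coef\<close> because the two describing predicates coincide.\<close>
  have is_coef: "is_theta p V K A l x E \<epsilon> s = Y.is_coef s" for s
    by (intro ext) (simp only: is_theta_def Let_def Y.is_coef_def Y.u2_def Y.ex_def indices_def Y.mon_def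
        p1_pull_def N.M_ops(1))
  have theta: "theta p V K A l x E \<epsilon> s = Y.coef s" for s
    by (simp only: theta_def Y.coef_def is_coef)
  interpret Z: coef_growth "carrier ?M" L S "multi_indices l" "mdeg l" Y.coef N.P Y.bounded N.nm "real p"
  proof
    show "carrier ?M \<noteq> {}" using N.M.zero_closed by blast
    show "finite S" "S \<subseteq> carrier ?M" using S N.L_closed by auto
    show "finite {\<beta> \<in> multi_indices l. mdeg l \<beta> \<le> n}" for n
      using finite_indices[of l n] by (simp only: indices_def)
    show cM: "Y.coef s \<beta> \<in> carrier ?M" if "s \<in> carrier ?M" "\<beta> \<in> multi_indices l" for s \<beta>
      using Y.coef_closed[OF that(1), of \<beta> "mdeg l \<beta>"] that(2) by (simp add: indices_def)
    \<comment> \<open>For j \<ge> 0 the scalar p^j is an integer, so the action is repeated addition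
      and \<open>Y.coef_add_pow\<close> applies.\<close>
    show "Y.coef (N.P j s) \<beta> = N.P j (Y.coef s \<beta>)"
      if j: "0 \<le> j" and s: "s \<in> carrier ?M" "\<beta> \<in> multi_indices l" for j s \<beta>
    proof -
      obtain n where n: "j = int n" by (rule nonneg_int_cases[OF j])
      show ?thesis
        unfolding n N.P_nat[OF s(1)] N.P_nat[OF cM[OF s]] by (rule Y.coef_add_pow[OF s])
    qed
    show "N.P k (Y.coef s \<beta>) \<in> L"
      if "Y.bounded n k" "s \<in> L" "\<beta> \<in> multi_indices l" "mdeg l \<beta> \<le> n" for n k s \<beta>
      by (rule Y.bounded_imp[OF that(1,2)]) (use that(3,4) in \<open>simp add: indices_def\<close>)
    show "Y.bounded n k"
      if "\<And>s \<beta>. s \<in> S \<Longrightarrow> \<beta> \<in> multi_indices l \<Longrightarrow> mdeg l \<beta> \<le> n \<Longrightarrow> N.P k (Y.coef s \<beta>) \<in> L" for n k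
      by (rule Y.boundedI) (rule that, simp_all only: indices_def mem_Collect_eq)
    show "1 < real p" using D.p_gt_1 by simp
  qed (fact N.P_P N.P_L N.absorb N.nm_nonneg N.nm_le N.nm_less_imp)+
  have "section_radius p V K A l x E L \<epsilon> = Z.radius"
    by (intro ext) (simp only: section_radius_def Z.radius_def eta_convergent_def Z.conv_def theta)
  then have "radius_of_convergence p V K A l x E L \<epsilon> = Inf (Z.radius ` carrier ?M)"
    by (simp only: radius_of_convergence_def N.M_ops(1))
  then show ?thesis
    using Z.bounded_iff_radius by (simp only: special)
qed

end
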